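(* Let $(\mathbb X,\mathbb T)$ be a tangent category, $\mathsf{DB}(\mathbb X,\mathbb T)$ its tangent category of display differential bundles and linear morphisms, and $\mathrm{Base},\mathrm{Tot}:\mathsf{DB}(\mathbb X,\mathbb T)\to(\mathbb X,\mathbb T)$ the strict tangent morphisms sending $\mathbf q:E\to M$ to $M$ and $E$, respectively. Let $\mathcal Q=(\mathcal q,\mathcal z,\mathcal s,\mathcal l):\mathrm{Tot}\to\mathrm{Base}$ be the pointwise display differential bundle of $[\mathsf{DB}(\mathbb X,\mathbb T)\mid\mathbb X,\mathbb T]$ whose components at $\mathbf q=(q,z_q,s_q,l_q)$ are $q,z_q,s_q,l_q$. Then $\mathcal Q$ is universal. Concretely, the induced strict tangent morphisms $$\Gamma_{\mathcal Q}:[\mathbb X',\mathbb T'\mid\mathsf{DB}(\mathbb X,\mathbb T)]\to\mathsf{DB}_{\mathsf{pt}}[\mathbb X',\mathbb T'\mid\mathbb X,\mathbb T],\qquad (H,\gamma)\mapsto\mathcal Q_{(H,\gamma)}=(\mathcal q_H,\mathcal z_H,\mathcal s_H,\mathcal l_H):\mathrm{Tot}\circ(H,\gamma)\to\mathrm{Base}\circ(H,\gamma),$$ natural in the tangent category $(\mathbb X',\mathbb T')$, make the contravariant functor on $\mathsf{TngCat}$ that sends $(\mathbb X',\mathbb T')$ to the tangent category $\mathsf{DB}_{\mathsf{pt}}[\mathbb X',\mathbb T'\mid\mathbb X,\mathbb T]$ into a representable functor, represented by $\mathsf{DB}(\mathbb X,\mathbb T)$. In particular, $\Gamma_{\mathcal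 Q}$ is invertible.
   Context: Composition $\circ$ is in the usual order; $F\varphi$, $\varphi_F$ denote whiskering. A tangent category $(\mathbb X,\mathbb T)$ is a category $\mathbb X$ with a functor $T:\mathbb X\to\mathbb X$ and natural transformations $p:T\Rightarrow\mathrm{id}$, $z:\mathrm{id}\Rightarrow T$, $s:T_2\Rightarrow T$, $l:T\Rightarrow T^2$, $c:T^2\Rightarrow T^2$, where $T_nA$ is the $n$-fold pullback of $p_A$ along itself (required to exist and be preserved by all $T^m$), such that: $(p_A,z_A,s_A)$ is a commutative monoid in $\mathbb X/A$; $Tp\circ l=z\circ p$, $l\circ z=Tz\circ z$, $l\circ s=Ts\circ\langle l\pi_1,l\pi_2\rangle$; $p_T\circ c=Tp$, $c\circ Tz=z_T$, $c\circ Ts=s_T\circ\langle c\,T\pi_1,c\,T\pi_2\rangle$; $Tl\circ l=l_T\circ l$, $c\circ l=l$, $c_T\circ Tc\circ l_T=Tl\circ c$; $c\circ c=\mathrm{id}$, $Tc\circ c_T\circ Tc=c_T\circ Tc\circ c_T$; and the square with top $Ts\circ\langle z_T\pi_1,l\pi_2\rangle:T_2A\to T^2A$, left $p\pi_1$, right $Tp$, bottom $z:A\to TA$ is a pullback. A lax tangent morphism $(F,\alpha):(\mathbb X',\mathbb T')\to(\mathbb X,\mathbb T)$ is a functor $F$ with $\alpha:FT'\Rightarrow TF$ such that $p_F\circ\alpha=Fp'$, $\alpha\circ Fz'=z_F$, $\alpha\circ Fs'=s_F\circ\langle\alpha F\pi_1,\alpha F\pi_2\rangle$, $l_F\circ\alpha=T\alpha\circ\alpha_{T'}\circ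 Fl'$, $c_F\circ T\alpha\circ\alpha_{T'}=T\alpha\circ\alpha_{T'}\circ Fc'$; strict if $\alpha$ is an identity; $(G,\beta)\circ(F,\alpha)=(GF,\beta_F\circ G\alpha)$. A tangent natural transformation $\varphi:(F,\alpha)\Rightarrow(G,\beta)$ satisfies $T\varphi\circ\alpha=\beta\circ\varphi_{T'}$. These form the 2-category $\mathsf{TngCat}$. The hom-category $[\mathbb X',\mathbb T'\mid\mathbb X,\mathbb T]$ of lax tangent morphisms $(\mathbb X',\mathbb T')\to(\mathbb X,\mathbb T)$ and tangent natural transformations is a tangent category with $\bar T(F,\alpha)=(TF,c_F\circ T\alpha)$, $\bar T\varphi=T\varphi$, $\bar p_{(F,\alpha)}=p_F$, etc. A tangent display map is a morphism $q:E\to M$ such that for all $n\ge0$ and $f:M'\to T^nM$ the pullback of $T^nq$ along $f$ exists and is preserved by all $T^m$. A display differential bundle $\mathbf q=(q,z_q,s_q,l_q):E\to M$ consists of a tangent display map $q:E\to M$ and $z_q:M\to E$, $s_q:E_2=E\times_ME\to E$, $l_q:E\to TE$ such that: $(q,z_q,s_q)$ is a commutative monoid in $\mathbb X/M$; $Tq\circ l_q=z_M\circ q$, $l_q\circ z_q=Tz_q\circ z_M$, $l_q\circ s_q=Ts_q\circ\langle l_q\pi_1,l_q\pi_2\rangle$; $p_E\circ l_q=z_q\circ q$, $l_q\circ z_q=z_E\circ z_q$, $l_q\circ s_q=s_E\circ\langle l_q\pi_1,l_q\pi_2\rangle$; $Tl_q\circ l_q=l_E\circ l_q$; and the square with top $\xi_q=Ts_q\circ\langle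 l_q\pi_1,z_E\pi_2\rangle:E_2\to TE$, left $q\pi_1:E_2\to M$, right $Tq:TE\to TM$, bottom $z_M$ is a pullback. A linear morphism $(f,g):\mathbf q\to\mathbf q'$ is a pair $f:M\to M'$, $g:E\to E'$ with $q'\circ g=f\circ q$ and $Tg\circ l_q=l_{q'}\circ g$. $\mathsf{DB}(\mathbb X,\mathbb T)$ is the tangent category of display differential bundles and linear morphisms, with tangent bundle functor $\mathbf q\mapsto(Tq,Tz_q,Ts_q,c_E\circ Tl_q)$, $(f,g)\mapsto(Tf,Tg)$, and structural transformations those of $(\mathbb X,\mathbb T)$. A pointwise tangent display map in $[\mathbb X',\mathbb T'\mid\mathbb X,\mathbb T]$ is a tangent display map $q$ of this tangent category for which each pullback of $q$ along any morphism of $[\mathbb X',\mathbb T'\mid\mathbb X,\mathbb T]$ is pointwise, that is, preserved by precomposition with every functor $F:\mathbb X''\to\mathbb X'$. A pointwise display differential bundle is a display differential bundle of $[\mathbb X',\mathbb T'\mid\mathbb X,\mathbb T]$ whose projection is a pointwise tangent display map. $\mathsf{DB}_{\mathsf{pt}}[\mathbb X',\mathbb T'\mid\mathbb X,\mathbb T]$ is the tangent category of pointwise display differential bundles and linear morphisms in $[\mathbb X',\mathbb T'\mid\mathbb X,\mathbb T]$, with tangent structure as for $\mathsf{DB}$.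
   Formalization: Pointwise tangent display maps are also required to have components that are tangent display maps of X (otherwise Γ can fail to be surjective); that DB(X,T) is a tangent category is an explicit hypothesis; X'' in "every functor" ranges over categories on an arbitrary fixed type. *)

theory Defs
  imports "HOL-Library.FuncSet"
begin

section \<open>Categories, functors, natural transformations, pullbacks\<close>

record ('o, 'a) cat =
  Ob :: "'o set"
  Arr :: "'a set"
  Dom :: "'a \<Rightarrow> 'o"
  Cod :: "'a \<Rightarrow> 'o"
  Ident :: "'o \<Rightarrow> 'a"
  Cmp :: "'a \<Rightarrow> 'a \<Rightarrow> 'a"

abbreviation cmp_syntax :: "'a \<Rightarrow> ('o, 'a, 'z) cat_scheme \<Rightarrow> 'a \<Rightarrow> 'a"
    ("(_ \<bullet>\<^bsub>_\<^esub> _)" [71, 0, 70] 70) where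
  "g \<bullet>\<^bsub>X\<^esub> f \<equiv> Cmp X g f"

definition hom :: "('o, 'a, 'z) cat_scheme \<Rightarrow> 'o \<Rightarrow> 'o \<Rightarrow> 'a set" where
  "hom X A B = {f \<in> Arr X. Dom X f = A \<and> Cod X f = B}"

definition category :: "('o, 'a, 'z) cat_scheme \<Rightarrow> bool" where
  "category X \<longleftrightarrow>
     (\<forall>f\<in>Arr X. Dom X f \<in> Ob X \<and> Cod X f \<in> Ob X) \<and>
     (\<forall>A\<in>Ob X. Ident X A \<in> hom X A A) \<and>
     (\<forall>f\<in>Arr X. \<forall>g\<in>Arr X. Cod X f = Dom X g \<longrightarrow>
        g \<bullet>\<^bsub>X\<^esub> f \<in> hom X (Dom X f) (Cod X g)) \<and>
     (\<forall>f\<in>Arr X. f \<bullet>\<^bsub>X\<^esub> Ident X (Dom X f) = f \<and> Ident X (Cod X f) \<bullet>\<^bsub>X\<^esub> f = f) \<and>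
     (\<forall>f\<in>Arr X. \<forall>g\<in>Arr X. \<forall>h\<in>Arr X. Cod X f = Dom X g \<and> Cod X g = Dom X h \<longrightarrow>
        h \<bullet>\<^bsub>X\<^esub> (g \<bullet>\<^bsub>X\<^esub> f) = (h \<bullet>\<^bsub>X\<^esub> g) \<bullet>\<^bsub>X\<^esub> f)"

definition functorial ::
  "('o, 'a, 'z) cat_scheme \<Rightarrow> ('o2, 'a2, 'z2) cat_scheme \<Rightarrow> ('o \<Rightarrow> 'o2) \<Rightarrow> ('a \<Rightarrow> 'a2) \<Rightarrow> bool" where
  "functorial X Y Fo Fa \<longleftrightarrow>
     (\<forall>A\<in>Ob X. Fo A \<in> Ob Y) \<and>
     (\<forall>f\<in>Arr X. Fa f \<in> hom Y (Fo (Dom X f)) (Fo (Cod X f))) \<and>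
     (\<forall>A\<in>Ob X. Fa (Ident X A) = Ident Y (Fo A)) \<and>
     (\<forall>f\<in>Arr X. \<forall>g\<in>Arr X. Cod X f = Dom X g \<longrightarrow> Fa (g \<bullet>\<^bsub>X\<^esub> f) = Fa g \<bullet>\<^bsub>Y\<^esub> Fa f)"

definition natural ::
  "('o, 'a, 'z) cat_scheme \<Rightarrow> ('o2, 'a2, 'z2) cat_scheme \<Rightarrow> ('o \<Rightarrow> 'o2) \<Rightarrow> ('a \<Rightarrow> 'a2) \<Rightarrow>
   ('o \<Rightarrow> 'o2) \<Rightarrow> ('a \<Rightarrow> 'a2) \<Rightarrow> ('o \<Rightarrow> 'a2) \<Rightarrow> bool" where
  "natural X Y Fo Fa Go Ga \<eta> \<longleftrightarrow>
     (\<forall>A\<in>Ob X. \<eta> A \<in> hom Y (Fo A) (Go A)) \<and>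
     (\<forall>f\<in>Arr X. \<eta> (Cod X f) \<bullet>\<^bsub>Y\<^esub> Fa f = Ga f \<bullet>\<^bsub>Y\<^esub> \<eta> (Dom X f))"

text \<open>\<open>is_pullback X f g a b\<close>: the cone \<open>(a, b)\<close>, with \<open>f a = g b\<close>, is a pullback of the cospan \<open>(f, g)\<close>.\<close>

definition is_pullback :: "('o, 'a, 'z) cat_scheme \<Rightarrow> 'a \<Rightarrow> 'a \<Rightarrow> 'a \<Rightarrow> 'a \<Rightarrow> bool" where
  "is_pullback X f g a b \<longleftrightarrow>
     f \<in> Arr X \<and> g \<in> Arr X \<and> Cod X f = Cod X g \<and>
     a \<in> Arr X \<and> b \<in> Arr X \<and> Dom X a = Dom X b \<and> Cod X a = Dom X f \<and> Cod X b = Dom X g \<and>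
     f \<bullet>\<^bsub>X\<^esub> a = g \<bullet>\<^bsub>X\<^esub> b \<and>
     (\<forall>W\<in>Ob X. \<forall>u\<in>hom X W (Dom X f). \<forall>v\<in>hom X W (Dom X g). f \<bullet>\<^bsub>X\<^esub> u = g \<bullet>\<^bsub>X\<^esub> v \<longrightarrow>
        (\<exists>!h. h \<in> hom X W (Dom X a) \<and> a \<bullet>\<^bsub>X\<^esub> h = u \<and> b \<bullet>\<^bsub>X\<^esub> h = v))"

text \<open>The morphism \<open>\<langle>u, v\<rangle>\<close> into the apex of a pullback with projections \<open>a, b\<close>.\<close>

definition pair_into :: "('o, 'a, 'z) cat_scheme \<Rightarrow> 'a \<Rightarrow> 'a \<Rightarrow> 'a \<Rightarrow> 'a \<Rightarrow> 'a" where
  "pair_into X a b u v =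
     (THE h. h \<in> hom X (Dom X u) (Dom X a) \<and> a \<bullet>\<^bsub>X\<^esub> h = u \<and> b \<bullet>\<^bsub>X\<^esub> h = v)"

text \<open>\<open>n\<close>-fold pullback of \<open>q\<close> along itself. The leg \<open>b\<close> to the base is part of the cone, so that
  the \<open>0\<close>-fold pullback is the base itself.\<close>

definition is_fold_pullback ::
  "('o, 'a, 'z) cat_scheme \<Rightarrow> nat \<Rightarrow> 'a \<Rightarrow> 'a \<Rightarrow> (nat \<Rightarrow> 'a) \<Rightarrow> bool" where
  "is_fold_pullback X n q b pr \<longleftrightarrow>
     q \<in> Arr X \<and> b \<in> Arr X \<and> Cod X b = Cod X q \<and>
     (\<forall>i<n. pr i \<in> hom X (Dom X b) (Dom X q) \<and> q \<bullet>\<^bsub>X\<^esub> pr i = b) \<and>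
     (\<forall>W\<in>Ob X. \<forall>w\<in>hom X W (Cod X q). \<forall>u. (\<forall>i<n. u i \<in> hom X W (Dom X q) \<and> q \<bullet>\<^bsub>X\<^esub> u i = w) \<longrightarrow>
        (\<exists>!h. h \<in> hom X W (Dom X b) \<and> b \<bullet>\<^bsub>X\<^esub> h = w \<and> (\<forall>i<n. pr i \<bullet>\<^bsub>X\<^esub> h = u i)))"

text \<open>\<open>(q, z, s)\<close> is a commutative monoid in the slice over the codomain of \<open>q\<close>, where the addition
  \<open>s\<close> is defined on the apex of the pullback \<open>(pi1, pi2)\<close> of \<open>q\<close> along itself. Associativity is
  required on every cone \<open>a, b, c\<close> over \<open>q\<close>; the projections of a threefold pullback are the generic
  such cone.\<close>

definition additive_bundle ::
  "('o, 'a, 'z) cat_scheme \<Rightarrow> 'a \<Rightarrow> 'a \<Rightarrow> 'a \<Rightarrow> 'a \<Rightarrow> 'a \<Rightarrow> bool" where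
  "additive_bundle X q pi1 pi2 z s \<longleftrightarrow>
     is_pullback X q q pi1 pi2 \<and>
     z \<in> hom X (Cod X q) (Dom X q) \<and> q \<bullet>\<^bsub>X\<^esub> z = Ident X (Cod X q) \<and>
     s \<in> hom X (Dom X pi1) (Dom X q) \<and> q \<bullet>\<^bsub>X\<^esub> s = q \<bullet>\<^bsub>X\<^esub> pi1 \<and>
     s \<bullet>\<^bsub>X\<^esub> pair_into X pi1 pi2 pi2 pi1 = s \<and>
     s \<bullet>\<^bsub>X\<^esub> pair_into X pi1 pi2 (Ident X (Dom X q)) (z \<bullet>\<^bsub>X\<^esub> q) = Ident X (Dom X q) \<and>
     (\<forall>W\<in>Ob X. \<forall>a\<in>hom X W (Dom X q). \<forall>b\<in>hom X W (Dom X q). \<forall>c\<in>hom X W (Dom X q).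
        q \<bullet>\<^bsub>X\<^esub> a = q \<bullet>\<^bsub>X\<^esub> b \<and> q \<bullet>\<^bsub>X\<^esub> b = q \<bullet>\<^bsub>X\<^esub> c \<longrightarrow>
        s \<bullet>\<^bsub>X\<^esub> pair_into X pi1 pi2 (s \<bullet>\<^bsub>X\<^esub> pair_into X pi1 pi2 a b) c =
        s \<bullet>\<^bsub>X\<^esub> pair_into X pi1 pi2 a (s \<bullet>\<^bsub>X\<^esub> pair_into X pi1 pi2 b c))"


section \<open>Tangent categories\<close>

text \<open>The domain of \<open>s\<close> is a chosen pullback: its projections \<open>\<pi>\<^sub>1, \<pi>\<^sub>2 : T\<^sub>2 A \<rightarrow> T A\<close> are part of
  the structure.\<close>

record ('o, 'a) tcat = "('o, 'a) cat" +
  To :: "'o \<Rightarrow> 'o"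
  Ta :: "'a \<Rightarrow> 'a"
  tp :: "'o \<Rightarrow> 'a"
  tpi1 :: "'o \<Rightarrow> 'a"
  tpi2 :: "'o \<Rightarrow> 'a"
  tz :: "'o \<Rightarrow> 'a"
  ts :: "'o \<Rightarrow> 'a"
  tl :: "'o \<Rightarrow> 'a"
  tc :: "'o \<Rightarrow> 'a"

definition T2o :: "('o, 'a, 'z) tcat_scheme \<Rightarrow> 'o \<Rightarrow> 'o" where
  "T2o X A = Dom X (tpi1 X A)"

definition T2a :: "('o, 'a, 'z) tcat_scheme \<Rightarrow> 'a \<Rightarrow> 'a" where
  "T2a X f = pair_into X (tpi1 X (Cod X f)) (tpi2 X (Cod X f))
               (Ta X f \<bullet>\<^bsub>X\<^esub> tpi1 X (Dom X f)) (Ta X f \<bullet>\<^bsub>X\<^esub> tpi2 X (Dom X f))"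

definition tangent_category :: "('o, 'a, 'z) tcat_scheme \<Rightarrow> bool" where
  "tangent_category X \<longleftrightarrow>
     category X \<and> functorial X X (To X) (Ta X) \<and>
     (\<forall>A\<in>Ob X. is_pullback X (tp X A) (tp X A) (tpi1 X A) (tpi2 X A)) \<and>
     (\<forall>A\<in>Ob X. \<forall>n.
        (\<exists>b pr. is_fold_pullback X n (tp X A) b pr) \<and>
        (\<forall>b pr m. is_fold_pullback X n (tp X A) b pr \<longrightarrow>
           is_fold_pullback X n ((Ta X ^^ m) (tp X A)) ((Ta X ^^ m) b) (\<lambda>i. (Ta X ^^ m) (pr i)))) \<and>
     natural X X (To X) (Ta X) (\<lambda>A. A) (\<lambda>f. f) (tp X) \<and>
     natural X X (\<lambda>A. A) (\<lambda>f. f) (To X) (Ta X) (tz X) \<and>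
     natural X X (T2o X) (T2a X) (To X) (Ta X) (ts X) \<and>
     natural X X (To X) (Ta X) (\<lambda>A. To X (To X A)) (\<lambda>f. Ta X (Ta X f)) (tl X) \<and>
     natural X X (\<lambda>A. To X (To X A)) (\<lambda>f. Ta X (Ta X f))
                 (\<lambda>A. To X (To X A)) (\<lambda>f. Ta X (Ta X f)) (tc X) \<and>
     (\<forall>A\<in>Ob X.
        additive_bundle X (tp X A) (tpi1 X A) (tpi2 X A) (tz X A) (ts X A) \<and>
        Ta X (tp X A) \<bullet>\<^bsub>X\<^esub> tl X A = tz X A \<bullet>\<^bsub>X\<^esub> tp X A \<and>
        tl X A \<bullet>\<^bsub>X\<^esub> tz X A = Ta X (tz X A) \<bullet>\<^bsub>X\<^esub> tz X A \<and>
        tl X A \<bullet>\<^bsub>X\<^esub> ts X A =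
          Ta X (ts X A) \<bullet>\<^bsub>X\<^esub> pair_into X (Ta X (tpi1 X A)) (Ta X (tpi2 X A))
                                (tl X A \<bullet>\<^bsub>X\<^esub> tpi1 X A) (tl X A \<bullet>\<^bsub>X\<^esub> tpi2 X A) \<and>
        tp X (To X A) \<bullet>\<^bsub>X\<^esub> tc X A = Ta X (tp X A) \<and>
        tc X A \<bullet>\<^bsub>X\<^esub> Ta X (tz X A) = tz X (To X A) \<and>
        tc X A \<bullet>\<^bsub>X\<^esub> Ta X (ts X A) =
          ts X (To X A) \<bullet>\<^bsub>X\<^esub> pair_into X (tpi1 X (To X A)) (tpi2 X (To X A))
                                (tc X A \<bullet>\<^bsub>X\<^esub> Ta X (tpi1 X A)) (tc X A \<bullet>\<^bsub>X\<^esub> Ta X (tpi2 X A)) \<and>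
        Ta X (tl X A) \<bullet>\<^bsub>X\<^esub> tl X A = tl X (To X A) \<bullet>\<^bsub>X\<^esub> tl X A \<and>
        tc X A \<bullet>\<^bsub>X\<^esub> tl X A = tl X A \<and>
        tc X (To X A) \<bullet>\<^bsub>X\<^esub> (Ta X (tc X A) \<bullet>\<^bsub>X\<^esub> tl X (To X A)) = Ta X (tl X A) \<bullet>\<^bsub>X\<^esub> tc X A \<and>
        tc X A \<bullet>\<^bsub>X\<^esub> tc X A = Ident X (To X (To X A)) \<and>
        Ta X (tc X A) \<bullet>\<^bsub>X\<^esub> (tc X (To X A) \<bullet>\<^bsub>X\<^esub> Ta X (tc X A)) =
          tc X (To X A) \<bullet>\<^bsub>X\<^esub> (Ta X (tc X A) \<bullet>\<^bsub>X\<^esub> tc X (To X A)) \<and>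
        is_pullback X (tz X A) (Ta X (tp X A)) (tp X A \<bullet>\<^bsub>X\<^esub> tpi1 X A)
          (Ta X (ts X A) \<bullet>\<^bsub>X\<^esub> pair_into X (Ta X (tpi1 X A)) (Ta X (tpi2 X A))
             (tz X (To X A) \<bullet>\<^bsub>X\<^esub> tpi1 X A) (tl X A \<bullet>\<^bsub>X\<^esub> tpi2 X A)))"


section \<open>The 2-category of tangent categories\<close>

text \<open>Functors and lax tangent morphisms are represented by functions that are \<open>undefined\<close> outside
  the source category, so that HOL equality is equality of functors and of lax tangent morphisms.\<close>

record ('o, 'a, 'o2, 'a2) func =
  fobj :: "'o \<Rightarrow> 'o2"
  farr :: "'a \<Rightarrow> 'a2"

record ('o, 'a, 'o2, 'a2) lmor = "('o, 'a, 'o2, 'a2) func" +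
  lstr :: "'o \<Rightarrow> 'a2"

record ('f, 'o, 'a) nt =
  nsrc :: "'f"
  ntgt :: "'f"
  ncmp :: "'o \<Rightarrow> 'a"

definition is_functor ::
  "('o, 'a, 'z) cat_scheme \<Rightarrow> ('o2, 'a2, 'z2) cat_scheme \<Rightarrow> ('o, 'a, 'o2, 'a2, 'z3) func_scheme \<Rightarrow> bool" where
  "is_functor X Y F \<longleftrightarrow> category X \<and> category Y \<and> functorial X Y (fobj F) (farr F) \<and>
     fobj F \<in> extensional (Ob X) \<and> farr F \<in> extensional (Arr X)"

definition fcomp ::
  "('o, 'a, 'z) cat_scheme \<Rightarrow> ('o2, 'a2, 'o3, 'a3, 'z2) func_scheme \<Rightarrow>
   ('o, 'a, 'o2, 'a2, 'z3) func_scheme \<Rightarrow> ('o, 'a, 'o3, 'a3) func" where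
  "fcomp X G F = \<lparr>fobj = (\<lambda>A\<in>Ob X. fobj G (fobj F A)), farr = (\<lambda>f\<in>Arr X. farr G (farr F f))\<rparr>"

definition is_nat_trans ::
  "('o, 'a, 'z) cat_scheme \<Rightarrow> ('o2, 'a2, 'z2) cat_scheme \<Rightarrow>
   (('o, 'a, 'o2, 'a2, 'z3) func_scheme, 'o, 'a2) nt \<Rightarrow> bool" where
  "is_nat_trans X Y \<phi> \<longleftrightarrow> is_functor X Y (nsrc \<phi>) \<and> is_functor X Y (ntgt \<phi>) \<and>
     natural X Y (fobj (nsrc \<phi>)) (farr (nsrc \<phi>)) (fobj (ntgt \<phi>)) (farr (ntgt \<phi>)) (ncmp \<phi>) \<and>
     ncmp \<phi> \<in> extensional (Ob X)"

definition nt_ident ::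
  "('o, 'a, 'z) cat_scheme \<Rightarrow> ('o2, 'a2, 'z2) cat_scheme \<Rightarrow> ('o, 'a, 'o2, 'a2, 'z3) func_scheme \<Rightarrow>
   (('o, 'a, 'o2, 'a2, 'z3) func_scheme, 'o, 'a2) nt" where
  "nt_ident X Y F = \<lparr>nsrc = F, ntgt = F, ncmp = (\<lambda>A\<in>Ob X. Ident Y (fobj F A))\<rparr>"

definition nt_comp ::
  "('o, 'a, 'z) cat_scheme \<Rightarrow> ('o2, 'a2, 'z2) cat_scheme \<Rightarrow>
   ('f, 'o, 'a2) nt \<Rightarrow> ('f, 'o, 'a2) nt \<Rightarrow> ('f, 'o, 'a2) nt" where
  "nt_comp X Y \<psi> \<phi> =
     \<lparr>nsrc = nsrc \<phi>, ntgt = ntgt \<psi>, ncmp = (\<lambda>A\<in>Ob X. ncmp \<psi> A \<bullet>\<^bsub>Y\<^esub> ncmp \<phi> A)\<rparr>"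

definition Fun ::
  "('o, 'a, 'z) cat_scheme \<Rightarrow> ('o2, 'a2, 'z2) cat_scheme \<Rightarrow>
   (('o, 'a, 'o2, 'a2) func, (('o, 'a, 'o2, 'a2) func, 'o, 'a2) nt) cat" where
  "Fun X Y = \<lparr>Ob = {F. is_functor X Y F}, Arr = {\<phi>. is_nat_trans X Y \<phi>}, Dom = nsrc, Cod = ntgt,
     Ident = nt_ident X Y, Cmp = nt_comp X Y\<rparr>"

definition lax_tangent_morphism ::
  "('o, 'a, 'z) tcat_scheme \<Rightarrow> ('o2, 'a2, 'z2) tcat_scheme \<Rightarrow> ('o, 'a, 'o2, 'a2) lmor \<Rightarrow> bool" where
  "lax_tangent_morphism X Y F \<longleftrightarrow>
     tangent_category X \<and> tangent_category Y \<and> is_functor X Y F \<and>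
     lstr F \<in> extensional (Ob X) \<and>
     natural X Y (\<lambda>A. fobj F (To X A)) (\<lambda>f. farr F (Ta X f))
                 (\<lambda>A. To Y (fobj F A)) (\<lambda>f. Ta Y (farr F f)) (lstr F) \<and>
     (\<forall>A\<in>Ob X.
        tp Y (fobj F A) \<bullet>\<^bsub>Y\<^esub> lstr F A = farr F (tp X A) \<and>
        lstr F A \<bullet>\<^bsub>Y\<^esub> farr F (tz X A) = tz Y (fobj F A) \<and>
        lstr F A \<bullet>\<^bsub>Y\<^esub> farr F (ts X A) =
          ts Y (fobj F A) \<bullet>\<^bsub>Y\<^esub> pair_into Y (tpi1 Y (fobj F A)) (tpi2 Y (fobj F A))
             (lstr F A \<bullet>\<^bsub>Y\<^esub> farr F (tpi1 X A)) (lstr F A \<bullet>\<^bsub>Y\<^esub> farr F (tpi2 X A)) \<and>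
        tl Y (fobj F A) \<bullet>\<^bsub>Y\<^esub> lstr F A =
          Ta Y (lstr F A) \<bullet>\<^bsub>Y\<^esub> (lstr F (To X A) \<bullet>\<^bsub>Y\<^esub> farr F (tl X A)) \<and>
        tc Y (fobj F A) \<bullet>\<^bsub>Y\<^esub> (Ta Y (lstr F A) \<bullet>\<^bsub>Y\<^esub> lstr F (To X A)) =
          Ta Y (lstr F A) \<bullet>\<^bsub>Y\<^esub> (lstr F (To X A) \<bullet>\<^bsub>Y\<^esub> farr F (tc X A)))"

definition strict_tangent_morphism ::
  "('o, 'a, 'z) tcat_scheme \<Rightarrow> ('o2, 'a2, 'z2) tcat_scheme \<Rightarrow> ('o, 'a, 'o2, 'a2) lmor \<Rightarrow> bool" where
  "strict_tangent_morphism X Y F \<longleftrightarrow> lax_tangent_morphism X Y F \<and>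
     (\<forall>A\<in>Ob X. lstr F A = Ident Y (fobj F (To X A)))"

definition tng_ident :: "('o, 'a, 'z) tcat_scheme \<Rightarrow> ('o, 'a, 'o, 'a) lmor" where
  "tng_ident X = \<lparr>fobj = (\<lambda>A\<in>Ob X. A), farr = (\<lambda>f\<in>Arr X. f), lstr = (\<lambda>A\<in>Ob X. Ident X (To X A))\<rparr>"

text \<open>\<open>tng_comp X Z G F\<close> is \<open>G \<circ> F\<close> for \<open>F\<close> starting at \<open>X\<close> and \<open>G\<close> ending at \<open>Z\<close>.\<close>

definition tng_comp ::
  "('o, 'a, 'z) tcat_scheme \<Rightarrow> ('o3, 'a3, 'z3) tcat_scheme \<Rightarrow>
   ('o2, 'a2, 'o3, 'a3) lmor \<Rightarrow> ('o, 'a, 'o2, 'a2) lmor \<Rightarrow> ('o, 'a, 'o3, 'a3) lmor" where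
  "tng_comp X Z G F =
     \<lparr>fobj = (\<lambda>A\<in>Ob X. fobj G (fobj F A)), farr = (\<lambda>f\<in>Arr X. farr G (farr F f)),
      lstr = (\<lambda>A\<in>Ob X. lstr G (fobj F A) \<bullet>\<^bsub>Z\<^esub> farr G (lstr F A))\<rparr>"

definition tng_invertible ::
  "('o, 'a, 'z) tcat_scheme \<Rightarrow> ('o2, 'a2, 'z2) tcat_scheme \<Rightarrow> ('o, 'a, 'o2, 'a2) lmor \<Rightarrow> bool" where
  "tng_invertible X Y F \<longleftrightarrow> lax_tangent_morphism X Y F \<and>
     (\<exists>G. lax_tangent_morphism Y X G \<and>
          tng_comp X X G F = tng_ident X \<and> tng_comp Y Y F G = tng_ident Y)"

definition tangent_nat_trans ::
  "('o, 'a, 'z) tcat_scheme \<Rightarrow> ('o2, 'a2, 'z2) tcat_scheme \<Rightarrow>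
   (('o, 'a, 'o2, 'a2) lmor, 'o, 'a2) nt \<Rightarrow> bool" where
  "tangent_nat_trans X Y \<phi> \<longleftrightarrow>
     lax_tangent_morphism X Y (nsrc \<phi>) \<and> lax_tangent_morphism X Y (ntgt \<phi>) \<and> is_nat_trans X Y \<phi> \<and>
     (\<forall>A\<in>Ob X. Ta Y (ncmp \<phi> A) \<bullet>\<^bsub>Y\<^esub> lstr (nsrc \<phi>) A = lstr (ntgt \<phi>) A \<bullet>\<^bsub>Y\<^esub> ncmp \<phi> (To X A))"

text \<open>For \<open>\<phi> : F \<Rightarrow> F' : X \<rightarrow> Y\<close> and \<open>\<psi> : G \<Rightarrow> G' : Y \<rightarrow> Z\<close>: the whiskerings \<open>\<psi>\<^sub>F\<close>
  (\<open>nt_whisker_right X Z \<psi> F\<close>) and \<open>G \<phi>\<close> (\<open>nt_whisker_left X Z G \<phi>\<close>), and the horizontal composite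
  \<open>\<psi>\<^sub>F\<^sub>' \<circ> G \<phi>\<close>.\<close>

definition nt_whisker_right ::
  "('o, 'a, 'z) tcat_scheme \<Rightarrow> ('o3, 'a3, 'z3) tcat_scheme \<Rightarrow>
   (('o2, 'a2, 'o3, 'a3) lmor, 'o2, 'a3) nt \<Rightarrow> ('o, 'a, 'o2, 'a2) lmor \<Rightarrow>
   (('o, 'a, 'o3, 'a3) lmor, 'o, 'a3) nt" where
  "nt_whisker_right X Z \<psi> F =
     \<lparr>nsrc = tng_comp X Z (nsrc \<psi>) F, ntgt = tng_comp X Z (ntgt \<psi>) F,
      ncmp = (\<lambda>A\<in>Ob X. ncmp \<psi> (fobj F A))\<rparr>"

definition nt_whisker_left ::
  "('o, 'a, 'z) tcat_scheme \<Rightarrow> ('o3, 'a3, 'z3) tcat_scheme \<Rightarrow>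
   ('o2, 'a2, 'o3, 'a3) lmor \<Rightarrow> (('o, 'a, 'o2, 'a2) lmor, 'o, 'a2) nt \<Rightarrow>
   (('o, 'a, 'o3, 'a3) lmor, 'o, 'a3) nt" where
  "nt_whisker_left X Z G \<phi> =
     \<lparr>nsrc = tng_comp X Z G (nsrc \<phi>), ntgt = tng_comp X Z G (ntgt \<phi>),
      ncmp = (\<lambda>A\<in>Ob X. farr G (ncmp \<phi> A))\<rparr>"

definition nt_hcomp ::
  "('o, 'a, 'z) tcat_scheme \<Rightarrow> ('o3, 'a3, 'z3) tcat_scheme \<Rightarrow>
   (('o2, 'a2, 'o3, 'a3) lmor, 'o2, 'a3) nt \<Rightarrow> (('o, 'a, 'o2, 'a2) lmor, 'o, 'a2) nt \<Rightarrow>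
   (('o, 'a, 'o3, 'a3) lmor, 'o, 'a3) nt" where
  "nt_hcomp X Z \<psi> \<phi> =
     nt_comp X Z (nt_whisker_right X Z \<psi> (ntgt \<phi>)) (nt_whisker_left X Z (nsrc \<psi>) \<phi>)"


section \<open>The tangent category of lax tangent morphisms\<close>

definition Tbar ::
  "('o, 'a, 'z) tcat_scheme \<Rightarrow> ('o2, 'a2, 'z2) tcat_scheme \<Rightarrow>
   ('o, 'a, 'o2, 'a2) lmor \<Rightarrow> ('o, 'a, 'o2, 'a2) lmor" where
  "Tbar X Y F =
     \<lparr>fobj = (\<lambda>A\<in>Ob X. To Y (fobj F A)), farr = (\<lambda>f\<in>Arr X. Ta Y (farr F f)),
      lstr = (\<lambda>A\<in>Ob X. tc Y (fobj F A) \<bullet>\<^bsub>Y\<^esub> Ta Y (lstr F A))\<rparr>"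

text \<open>The pullback \<open>T\<^sub>2 F\<close> of \<open>p\<^sub>F\<close> along itself; its structure is the unique one that makes both
  projections to \<open>Tbar X Y F\<close> tangent natural transformations.\<close>

definition T2bar ::
  "('o, 'a, 'z) tcat_scheme \<Rightarrow> ('o2, 'a2, 'z2) tcat_scheme \<Rightarrow>
   ('o, 'a, 'o2, 'a2) lmor \<Rightarrow> ('o, 'a, 'o2, 'a2) lmor" where
  "T2bar X Y F =
     \<lparr>fobj = (\<lambda>A\<in>Ob X. T2o Y (fobj F A)), farr = (\<lambda>f\<in>Arr X. T2a Y (farr F f)),
      lstr = (\<lambda>A\<in>Ob X. pair_into Y (Ta Y (tpi1 Y (fobj F A))) (Ta Y (tpi2 Y (fobj F A)))
         (lstr (Tbar X Y F) A \<bullet>\<^bsub>Y\<^esub> tpi1 Y (fobj F (To X A)))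
         (lstr (Tbar X Y F) A \<bullet>\<^bsub>Y\<^esub> tpi2 Y (fobj F (To X A))))\<rparr>"

definition Hom ::
  "('o, 'a, 'z) tcat_scheme \<Rightarrow> ('o2, 'a2, 'z2) tcat_scheme \<Rightarrow>
   (('o, 'a, 'o2, 'a2) lmor, (('o, 'a, 'o2, 'a2) lmor, 'o, 'a2) nt) tcat" where
  "Hom X Y =
     \<lparr>Ob = {F. lax_tangent_morphism X Y F}, Arr = {\<phi>. tangent_nat_trans X Y \<phi>},
      Dom = nsrc, Cod = ntgt, Ident = nt_ident X Y, Cmp = nt_comp X Y,
      To = Tbar X Y,
      Ta = (\<lambda>\<phi>. \<lparr>nsrc = Tbar X Y (nsrc \<phi>), ntgt = Tbar X Y (ntgt \<phi>),
                   ncmp = (\<lambda>A\<in>Ob X. Ta Y (ncmp \<phi> A))\<rparr>),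
      tp = (\<lambda>F. \<lparr>nsrc = Tbar X Y F, ntgt = F, ncmp = (\<lambda>A\<in>Ob X. tp Y (fobj F A))\<rparr>),
      tpi1 = (\<lambda>F. \<lparr>nsrc = T2bar X Y F, ntgt = Tbar X Y F, ncmp = (\<lambda>A\<in>Ob X. tpi1 Y (fobj F A))\<rparr>),
      tpi2 = (\<lambda>F. \<lparr>nsrc = T2bar X Y F, ntgt = Tbar X Y F, ncmp = (\<lambda>A\<in>Ob X. tpi2 Y (fobj F A))\<rparr>),
      tz = (\<lambda>F. \<lparr>nsrc = F, ntgt = Tbar X Y F, ncmp = (\<lambda>A\<in>Ob X. tz Y (fobj F A))\<rparr>),
      ts = (\<lambda>F. \<lparr>nsrc = T2bar X Y F, ntgt = Tbar X Y F, ncmp = (\<lambda>A\<in>Ob X. ts Y (fobj F A))\<rparr>),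
      tl = (\<lambda>F. \<lparr>nsrc = Tbar X Y F, ntgt = Tbar X Y (Tbar X Y F),
                  ncmp = (\<lambda>A\<in>Ob X. tl Y (fobj F A))\<rparr>),
      tc = (\<lambda>F. \<lparr>nsrc = Tbar X Y (Tbar X Y F), ntgt = Tbar X Y (Tbar X Y F),
                  ncmp = (\<lambda>A\<in>Ob X. tc Y (fobj F A))\<rparr>)\<rparr>"

text \<open>Precomposition with a lax tangent morphism \<open>K : X' \<rightarrow> X\<close> and with a tangent natural
  transformation \<open>\<kappa>\<close> between two such, as data of a strict tangent morphism \<open>Hom X Y \<rightarrow> Hom X' Y\<close>
  and of a tangent natural transformation: the action of \<open>[-|Y]\<close> on 1-cells and 2-cells.\<close>

definition hom_pre ::
  "('o1, 'a1, 'z1) tcat_scheme \<Rightarrow> ('o, 'a, 'z) tcat_scheme \<Rightarrow> ('o2, 'a2, 'z2) tcat_scheme \<Rightarrow>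
   ('o1, 'a1, 'o, 'a) lmor \<Rightarrow>
   (('o, 'a, 'o2, 'a2) lmor, (('o, 'a, 'o2, 'a2) lmor, 'o, 'a2) nt,
    ('o1, 'a1, 'o2, 'a2) lmor, (('o1, 'a1, 'o2, 'a2) lmor, 'o1, 'a2) nt) lmor" where
  "hom_pre X' X Y K =
     \<lparr>fobj = (\<lambda>H\<in>Ob (Hom X Y). tng_comp X' Y H K),
      farr = (\<lambda>\<theta>\<in>Arr (Hom X Y). nt_whisker_right X' Y \<theta> K),
      lstr = (\<lambda>H\<in>Ob (Hom X Y). Ident (Hom X' Y) (tng_comp X' Y (To (Hom X Y) H) K))\<rparr>"

definition hom_pre2 ::
  "('o1, 'a1, 'z1) tcat_scheme \<Rightarrow> ('o, 'a, 'z) tcat_scheme \<Rightarrow> ('o2, 'a2, 'z2) tcat_scheme \<Rightarrow>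
   (('o1, 'a1, 'o, 'a) lmor, 'o1, 'a) nt \<Rightarrow>
   ((('o, 'a, 'o2, 'a2) lmor, (('o, 'a, 'o2, 'a2) lmor, 'o, 'a2) nt,
     ('o1, 'a1, 'o2, 'a2) lmor, (('o1, 'a1, 'o2, 'a2) lmor, 'o1, 'a2) nt) lmor,
    ('o, 'a, 'o2, 'a2) lmor, (('o1, 'a1, 'o2, 'a2) lmor, 'o1, 'a2) nt) nt" where
  "hom_pre2 X' X Y \<kappa> =
     \<lparr>nsrc = hom_pre X' X Y (nsrc \<kappa>), ntgt = hom_pre X' X Y (ntgt \<kappa>),
      ncmp = (\<lambda>H\<in>Ob (Hom X Y). nt_whisker_left X' Y H \<kappa>)\<rparr>"


section \<open>Display differential bundles\<close>

definition tangent_display :: "('o, 'a, 'z) tcat_scheme \<Rightarrow> 'a \<Rightarrow> bool" where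
  "tangent_display X q \<longleftrightarrow> q \<in> Arr X \<and>
     (\<forall>n. \<forall>f\<in>Arr X. Cod X f = (To X ^^ n) (Cod X q) \<longrightarrow>
        (\<exists>a b. is_pullback X ((Ta X ^^ n) q) f a b) \<and>
        (\<forall>a b m. is_pullback X ((Ta X ^^ n) q) f a b \<longrightarrow>
           is_pullback X ((Ta X ^^ m) ((Ta X ^^ n) q)) ((Ta X ^^ m) f) ((Ta X ^^ m) a) ((Ta X ^^ m) b)))"

text \<open>The domain of the addition \<open>bs : E\<^sub>2 \<rightarrow> E\<close> is a pullback of the projection along itself; its
  projections \<open>bpi1, bpi2 : E\<^sub>2 \<rightarrow> E\<close> are recorded together with \<open>bs\<close>.\<close>

record 'a dbundle =
  bq :: 'a
  bpi1 :: 'a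
  bpi2 :: 'a
  bz :: 'a
  bs :: 'a
  bl :: 'a

abbreviation tot :: "('o, 'a, 'z) cat_scheme \<Rightarrow> 'a dbundle \<Rightarrow> 'o" where
  "tot X b \<equiv> Dom X (bq b)"

abbreviation base :: "('o, 'a, 'z) cat_scheme \<Rightarrow> 'a dbundle \<Rightarrow> 'o" where
  "base X b \<equiv> Cod X (bq b)"

definition diff_bundle :: "('o, 'a, 'z) tcat_scheme \<Rightarrow> 'a dbundle \<Rightarrow> bool" where
  "diff_bundle X b \<longleftrightarrow>
     tangent_display X (bq b) \<and>
     additive_bundle X (bq b) (bpi1 b) (bpi2 b) (bz b) (bs b) \<and>
     bl b \<in> hom X (tot X b) (To X (tot X b)) \<and>
     Ta X (bq b) \<bullet>\<^bsub>X\<^esub> bl b = tz X (base X b) \<bullet>\<^bsub>X\<^esub> bq b \<and>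
     bl b \<bullet>\<^bsub>X\<^esub> bz b = Ta X (bz b) \<bullet>\<^bsub>X\<^esub> tz X (base X b) \<and>
     bl b \<bullet>\<^bsub>X\<^esub> bs b =
       Ta X (bs b) \<bullet>\<^bsub>X\<^esub> pair_into X (Ta X (bpi1 b)) (Ta X (bpi2 b))
                              (bl b \<bullet>\<^bsub>X\<^esub> bpi1 b) (bl b \<bullet>\<^bsub>X\<^esub> bpi2 b) \<and>
     tp X (tot X b) \<bullet>\<^bsub>X\<^esub> bl b = bz b \<bullet>\<^bsub>X\<^esub> bq b \<and>
     bl b \<bullet>\<^bsub>X\<^esub> bz b = tz X (tot X b) \<bullet>\<^bsub>X\<^esub> bz b \<and>
     bl b \<bullet>\<^bsub>X\<^esub> bs b =
       ts X (tot X b) \<bullet>\<^bsub>X\<^esub> pair_into X (tpi1 X (tot X b)) (tpi2 X (tot X b))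
                              (bl b \<bullet>\<^bsub>X\<^esub> bpi1 b) (bl b \<bullet>\<^bsub>X\<^esub> bpi2 b) \<and>
     Ta X (bl b) \<bullet>\<^bsub>X\<^esub> bl b = tl X (tot X b) \<bullet>\<^bsub>X\<^esub> bl b \<and>
     is_pullback X (tz X (base X b)) (Ta X (bq b)) (bq b \<bullet>\<^bsub>X\<^esub> bpi1 b)
       (Ta X (bs b) \<bullet>\<^bsub>X\<^esub> pair_into X (Ta X (bpi1 b)) (Ta X (bpi2 b))
          (bl b \<bullet>\<^bsub>X\<^esub> bpi1 b) (tz X (tot X b) \<bullet>\<^bsub>X\<^esub> bpi2 b))"

record 'a linmor =
  msrc :: "'a dbundle"
  mtgt :: "'a dbundle"
  mbase :: 'a
  mtot :: 'a

definition linear_morphism :: "('o, 'a, 'z) tcat_scheme \<Rightarrow> 'a linmor \<Rightarrow> bool" where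
  "linear_morphism X \<phi> \<longleftrightarrow>
     diff_bundle X (msrc \<phi>) \<and> diff_bundle X (mtgt \<phi>) \<and>
     mbase \<phi> \<in> hom X (base X (msrc \<phi>)) (base X (mtgt \<phi>)) \<and>
     mtot \<phi> \<in> hom X (tot X (msrc \<phi>)) (tot X (mtgt \<phi>)) \<and>
     bq (mtgt \<phi>) \<bullet>\<^bsub>X\<^esub> mtot \<phi> = mbase \<phi> \<bullet>\<^bsub>X\<^esub> bq (msrc \<phi>) \<and>
     Ta X (mtot \<phi>) \<bullet>\<^bsub>X\<^esub> bl (msrc \<phi>) = bl (mtgt \<phi>) \<bullet>\<^bsub>X\<^esub> mtot \<phi>"

definition T_bundle :: "('o, 'a, 'z) tcat_scheme \<Rightarrow> 'a dbundle \<Rightarrow> 'a dbundle" where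
  "T_bundle X b =
     \<lparr>bq = Ta X (bq b), bpi1 = Ta X (bpi1 b), bpi2 = Ta X (bpi2 b),
      bz = Ta X (bz b), bs = Ta X (bs b), bl = tc X (tot X b) \<bullet>\<^bsub>X\<^esub> Ta X (bl b)\<rparr>"

text \<open>The pullback of \<open>p : T_bundle X b \<rightarrow> b\<close> along itself; its lift is the unique one that makes both
  projections to \<open>T_bundle X b\<close> linear.\<close>

definition T2_bundle :: "('o, 'a, 'z) tcat_scheme \<Rightarrow> 'a dbundle \<Rightarrow> 'a dbundle" where
  "T2_bundle X b =
     \<lparr>bq = T2a X (bq b), bpi1 = T2a X (bpi1 b), bpi2 = T2a X (bpi2 b),
      bz = T2a X (bz b), bs = T2a X (bs b),
      bl = pair_into X (Ta X (tpi1 X (tot X b))) (Ta X (tpi2 X (tot X b)))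
             (bl (T_bundle X b) \<bullet>\<^bsub>X\<^esub> tpi1 X (tot X b)) (bl (T_bundle X b) \<bullet>\<^bsub>X\<^esub> tpi2 X (tot X b))\<rparr>"

definition DB :: "('o, 'a, 'z) tcat_scheme \<Rightarrow> ('a dbundle, 'a linmor) tcat" where
  "DB X =
     \<lparr>Ob = {b. diff_bundle X b}, Arr = {\<phi>. linear_morphism X \<phi>}, Dom = msrc, Cod = mtgt,
      Ident = (\<lambda>b. \<lparr>msrc = b, mtgt = b, mbase = Ident X (base X b), mtot = Ident X (tot X b)\<rparr>),
      Cmp = (\<lambda>\<psi> \<phi>. \<lparr>msrc = msrc \<phi>, mtgt = mtgt \<psi>,
                     mbase = mbase \<psi> \<bullet>\<^bsub>X\<^esub> mbase \<phi>, mtot = mtot \<psi> \<bullet>\<^bsub>X\<^esub> mtot \<phi>\<rparr>),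
      To = T_bundle X,
      Ta = (\<lambda>\<phi>. \<lparr>msrc = T_bundle X (msrc \<phi>), mtgt = T_bundle X (mtgt \<phi>),
                   mbase = Ta X (mbase \<phi>), mtot = Ta X (mtot \<phi>)\<rparr>),
      tp = (\<lambda>b. \<lparr>msrc = T_bundle X b, mtgt = b, mbase = tp X (base X b), mtot = tp X (tot X b)\<rparr>),
      tpi1 = (\<lambda>b. \<lparr>msrc = T2_bundle X b, mtgt = T_bundle X b,
                    mbase = tpi1 X (base X b), mtot = tpi1 X (tot X b)\<rparr>),
      tpi2 = (\<lambda>b. \<lparr>msrc = T2_bundle X b, mtgt = T_bundle X b,
                    mbase = tpi2 X (base X b), mtot = tpi2 X (tot X b)\<rparr>),
      tz = (\<lambda>b. \<lparr>msrc = b, mtgt = T_bundle X b, mbase = tz X (base X b), mtot = tz X (tot X b)\<rparr>),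
      ts = (\<lambda>b. \<lparr>msrc = T2_bundle X b, mtgt = T_bundle X b,
                  mbase = ts X (base X b), mtot = ts X (tot X b)\<rparr>),
      tl = (\<lambda>b. \<lparr>msrc = T_bundle X b, mtgt = T_bundle X (T_bundle X b),
                  mbase = tl X (base X b), mtot = tl X (tot X b)\<rparr>),
      tc = (\<lambda>b. \<lparr>msrc = T_bundle X (T_bundle X b), mtgt = T_bundle X (T_bundle X b),
                  mbase = tc X (base X b), mtot = tc X (tot X b)\<rparr>)\<rparr>"


section \<open>Pointwise display differential bundles\<close>

definition underlying_pre ::
  "('o1, 'a1, 'z1) cat_scheme \<Rightarrow> (('o, 'a, 'o2, 'a2) lmor, 'o, 'a2) nt \<Rightarrow> ('o1, 'a1, 'o, 'a) func \<Rightarrow>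
   (('o1, 'a1, 'o2, 'a2) func, 'o1, 'a2) nt" where
  "underlying_pre X'' \<phi> F =
     \<lparr>nsrc = fcomp X'' (nsrc \<phi>) F, ntgt = fcomp X'' (ntgt \<phi>) F,
      ncmp = (\<lambda>A\<in>Ob X''. ncmp \<phi> (fobj F A))\<rparr>"

text \<open>A pullback square of \<open>Hom X' X\<close> is pointwise if precomposition with every functor \<open>F : X'' \<rightarrow> X'\<close>
  sends it to a pullback square of the functor category \<open>Fun X'' X\<close>. HOL cannot quantify over types
  inside a definition; the first argument \<open>U\<close> only names the types of the objects and arrows of the
  categories \<open>X''\<close>.\<close>

definition pointwise_pullback ::
  "('ou \<times> 'au) itself \<Rightarrow> ('o, 'a, 'z) tcat_scheme \<Rightarrow> ('o2, 'a2, 'z2) tcat_scheme \<Rightarrow>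
   (('o, 'a, 'o2, 'a2) lmor, 'o, 'a2) nt \<Rightarrow> (('o, 'a, 'o2, 'a2) lmor, 'o, 'a2) nt \<Rightarrow>
   (('o, 'a, 'o2, 'a2) lmor, 'o, 'a2) nt \<Rightarrow> (('o, 'a, 'o2, 'a2) lmor, 'o, 'a2) nt \<Rightarrow> bool" where
  "pointwise_pullback U X' X f g a b \<longleftrightarrow>
     is_pullback (Hom X' X) f g a b \<and>
     (\<forall>(X'' :: ('ou, 'au) cat) F. is_functor X'' X' F \<longrightarrow>
        is_pullback (Fun X'' X) (underlying_pre X'' f F) (underlying_pre X'' g F)
                                (underlying_pre X'' a F) (underlying_pre X'' b F))"

text \<open>The last clause, that the components are tangent display maps of \<open>X\<close>, does not follow from the
  other two: those only provide pullbacks along tangent natural transformations, and a morphism into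
  a component of the target need not be a component of one. Without it, the components of a pointwise
  display differential bundle need not be display differential bundles.\<close>

definition pointwise_display ::
  "('ou \<times> 'au) itself \<Rightarrow> ('o, 'a, 'z) tcat_scheme \<Rightarrow> ('o2, 'a2, 'z2) tcat_scheme \<Rightarrow>
   (('o, 'a, 'o2, 'a2) lmor, 'o, 'a2) nt \<Rightarrow> bool" where
  "pointwise_display U X' X q \<longleftrightarrow>
     tangent_display (Hom X' X) q \<and>
     (\<forall>f a b. is_pullback (Hom X' X) q f a b \<longrightarrow> pointwise_pullback U X' X q f a b) \<and>
     (\<forall>A\<in>Ob X'. tangent_display X (ncmp q A))"

text \<open>The full subcategory of \<open>DB (Hom X' X)\<close> on the pointwise display differential bundles, with the
  same tangent structure.\<close>

definition DBpt ::
  "('ou \<times> 'au) itself \<Rightarrow> ('o, 'a, 'z) tcat_scheme \<Rightarrow> ('o2, 'a2, 'z2) tcat_scheme \<Rightarrow>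
   ((('o, 'a, 'o2, 'a2) lmor, 'o, 'a2) nt dbundle, (('o, 'a, 'o2, 'a2) lmor, 'o, 'a2) nt linmor) tcat" where
  "DBpt U X' X = (DB (Hom X' X))
     \<lparr>Ob := {b. diff_bundle (Hom X' X) b \<and> pointwise_display U X' X (bq b)},
      Arr := {\<phi>. linear_morphism (Hom X' X) \<phi> \<and> pointwise_display U X' X (bq (msrc \<phi>)) \<and>
                  pointwise_display U X' X (bq (mtgt \<phi>))}\<rparr>"

text \<open>The contravariant functor \<open>X' \<mapsto> DBpt U X' X\<close> on 1-cells \<open>K : X'' \<rightarrow> X'\<close> and on 2-cells.\<close>

definition bundle_pre ::
  "('o1, 'a1, 'z1) tcat_scheme \<Rightarrow> ('o2, 'a2, 'z2) tcat_scheme \<Rightarrow>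
   (('o, 'a, 'o2, 'a2) lmor, 'o, 'a2) nt dbundle \<Rightarrow> ('o1, 'a1, 'o, 'a) lmor \<Rightarrow>
   (('o1, 'a1, 'o2, 'a2) lmor, 'o1, 'a2) nt dbundle" where
  "bundle_pre X'' X b K =
     \<lparr>bq = nt_whisker_right X'' X (bq b) K,
      bpi1 = nt_whisker_right X'' X (bpi1 b) K, bpi2 = nt_whisker_right X'' X (bpi2 b) K,
      bz = nt_whisker_right X'' X (bz b) K, bs = nt_whisker_right X'' X (bs b) K,
      bl = nt_whisker_right X'' X (bl b) K\<rparr>"

definition DBpt_pre ::
  "('ou \<times> 'au) itself \<Rightarrow> ('o1, 'a1, 'z1) tcat_scheme \<Rightarrow> ('o, 'a, 'z) tcat_scheme \<Rightarrow>
   ('o2, 'a2, 'z2) tcat_scheme \<Rightarrow> ('o1, 'a1, 'o, 'a) lmor \<Rightarrow>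
   ((('o, 'a, 'o2, 'a2) lmor, 'o, 'a2) nt dbundle, (('o, 'a, 'o2, 'a2) lmor, 'o, 'a2) nt linmor,
    (('o1, 'a1, 'o2, 'a2) lmor, 'o1, 'a2) nt dbundle,
    (('o1, 'a1, 'o2, 'a2) lmor, 'o1, 'a2) nt linmor) lmor" where
  "DBpt_pre U X'' X' X K =
     \<lparr>fobj = (\<lambda>b\<in>Ob (DBpt U X' X). bundle_pre X'' X b K),
      farr = (\<lambda>\<phi>\<in>Arr (DBpt U X' X).
        \<lparr>msrc = bundle_pre X'' X (msrc \<phi>) K, mtgt = bundle_pre X'' X (mtgt \<phi>) K,
         mbase = nt_whisker_right X'' X (mbase \<phi>) K, mtot = nt_whisker_right X'' X (mtot \<phi>) K\<rparr>),
      lstr = (\<lambda>b\<in>Ob (DBpt U X' X).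
        Ident (DBpt U X'' X) (bundle_pre X'' X (To (DBpt U X' X) b) K))\<rparr>"

definition DBpt_pre2 ::
  "('ou \<times> 'au) itself \<Rightarrow> ('o1, 'a1, 'z1) tcat_scheme \<Rightarrow> ('o, 'a, 'z) tcat_scheme \<Rightarrow>
   ('o2, 'a2, 'z2) tcat_scheme \<Rightarrow> (('o1, 'a1, 'o, 'a) lmor, 'o1, 'a) nt \<Rightarrow>
   (((('o, 'a, 'o2, 'a2) lmor, 'o, 'a2) nt dbundle, (('o, 'a, 'o2, 'a2) lmor, 'o, 'a2) nt linmor,
     (('o1, 'a1, 'o2, 'a2) lmor, 'o1, 'a2) nt dbundle,
     (('o1, 'a1, 'o2, 'a2) lmor, 'o1, 'a2) nt linmor) lmor,
    (('o, 'a, 'o2, 'a2) lmor, 'o, 'a2) nt dbundle,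
    (('o1, 'a1, 'o2, 'a2) lmor, 'o1, 'a2) nt linmor) nt" where
  "DBpt_pre2 U X'' X' X \<kappa> =
     \<lparr>nsrc = DBpt_pre U X'' X' X (nsrc \<kappa>), ntgt = DBpt_pre U X'' X' X (ntgt \<kappa>),
      ncmp = (\<lambda>b\<in>Ob (DBpt U X' X).
        \<lparr>msrc = bundle_pre X'' X b (nsrc \<kappa>), mtgt = bundle_pre X'' X b (ntgt \<kappa>),
         mbase = nt_whisker_left X'' X (base (Hom X' X) b) \<kappa>,
         mtot = nt_whisker_left X'' X (tot (Hom X' X) b) \<kappa>\<rparr>)\<rparr>"


section \<open>The universal bundle\<close>

definition Base :: "('o, 'a, 'z) tcat_scheme \<Rightarrow> ('a dbundle, 'a linmor, 'o, 'a) lmor" where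
  "Base X =
     \<lparr>fobj = (\<lambda>b\<in>Ob (DB X). base X b), farr = (\<lambda>\<phi>\<in>Arr (DB X). mbase \<phi>),
      lstr = (\<lambda>b\<in>Ob (DB X). Ident X (To X (base X b)))\<rparr>"

definition Tot :: "('o, 'a, 'z) tcat_scheme \<Rightarrow> ('a dbundle, 'a linmor, 'o, 'a) lmor" where
  "Tot X =
     \<lparr>fobj = (\<lambda>b\<in>Ob (DB X). tot X b), farr = (\<lambda>\<phi>\<in>Arr (DB X). mtot \<phi>),
      lstr = (\<lambda>b\<in>Ob (DB X). Ident X (To X (tot X b)))\<rparr>"

text \<open>The strict tangent morphism that sends a bundle to its recorded pullback \<open>E\<^sub>2\<close>; it is the domain of
  the addition of the universal bundle.\<close>

definition Tot2 :: "('o, 'a, 'z) tcat_scheme \<Rightarrow> ('a dbundle, 'a linmor, 'o, 'a) lmor" where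
  "Tot2 X =
     \<lparr>fobj = (\<lambda>b\<in>Ob (DB X). Dom X (bpi1 b)),
      farr = (\<lambda>\<phi>\<in>Arr (DB X). pair_into X (bpi1 (mtgt \<phi>)) (bpi2 (mtgt \<phi>))
                (mtot \<phi> \<bullet>\<^bsub>X\<^esub> bpi1 (msrc \<phi>)) (mtot \<phi> \<bullet>\<^bsub>X\<^esub> bpi2 (msrc \<phi>))),
      lstr = (\<lambda>b\<in>Ob (DB X). Ident X (To X (Dom X (bpi1 b))))\<rparr>"

definition univ_bundle ::
  "('o, 'a, 'z) tcat_scheme \<Rightarrow> (('a dbundle, 'a linmor, 'o, 'a) lmor, 'a dbundle, 'a) nt dbundle" where
  "univ_bundle X =
     \<lparr>bq = \<lparr>nsrc = Tot X, ntgt = Base X, ncmp = (\<lambda>b\<in>Ob (DB X). bq b)\<rparr>,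
      bpi1 = \<lparr>nsrc = Tot2 X, ntgt = Tot X, ncmp = (\<lambda>b\<in>Ob (DB X). bpi1 b)\<rparr>,
      bpi2 = \<lparr>nsrc = Tot2 X, ntgt = Tot X, ncmp = (\<lambda>b\<in>Ob (DB X). bpi2 b)\<rparr>,
      bz = \<lparr>nsrc = Base X, ntgt = Tot X, ncmp = (\<lambda>b\<in>Ob (DB X). bz b)\<rparr>,
      bs = \<lparr>nsrc = Tot2 X, ntgt = Tot X, ncmp = (\<lambda>b\<in>Ob (DB X). bs b)\<rparr>,
      bl = \<lparr>nsrc = Tot X, ntgt = Tbar (DB X) X (Tot X), ncmp = (\<lambda>b\<in>Ob (DB X). bl b)\<rparr>\<rparr>"

text \<open>A pointwise display differential bundle \<open>Q\<close> of \<open>Hom D X\<close> induces \<open>(H, \<gamma>) \<mapsto> Q\<^sub>H\<close> from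
  \<open>Hom X' D\<close> to \<open>DBpt U X' X\<close>; a tangent natural transformation \<open>\<theta>\<close> goes to the linear morphism
  whose components are \<open>base Q\<close> and \<open>tot Q\<close> whiskered with \<open>\<theta>\<close>.\<close>

definition Gam ::
  "('ou \<times> 'au) itself \<Rightarrow> ('o1, 'a1, 'z1) tcat_scheme \<Rightarrow> ('o, 'a, 'z) tcat_scheme \<Rightarrow>
   ('o2, 'a2, 'z2) tcat_scheme \<Rightarrow> (('o, 'a, 'o2, 'a2) lmor, 'o, 'a2) nt dbundle \<Rightarrow>
   (('o1, 'a1, 'o, 'a) lmor, (('o1, 'a1, 'o, 'a) lmor, 'o1, 'a) nt,
    (('o1, 'a1, 'o2, 'a2) lmor, 'o1, 'a2) nt dbundle,
    (('o1, 'a1, 'o2, 'a2) lmor, 'o1, 'a2) nt linmor) lmor" where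
  "Gam U X' D X Q =
     \<lparr>fobj = (\<lambda>H\<in>Ob (Hom X' D). bundle_pre X' X Q H),
      farr = (\<lambda>\<theta>\<in>Arr (Hom X' D).
        \<lparr>msrc = bundle_pre X' X Q (nsrc \<theta>), mtgt = bundle_pre X' X Q (ntgt \<theta>),
         mbase = nt_whisker_left X' X (base (Hom D X) Q) \<theta>,
         mtot = nt_whisker_left X' X (tot (Hom D X) Q) \<theta>\<rparr>),
      lstr = (\<lambda>H\<in>Ob (Hom X' D). Ident (DBpt U X' X) (bundle_pre X' X Q (To (Hom X' D) H)))\<rparr>"

abbreviation GamQ ::
  "('ou \<times> 'au) itself \<Rightarrow> ('o1, 'a1, 'z1) tcat_scheme \<Rightarrow> ('o, 'a, 'z) tcat_scheme \<Rightarrow>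
   (('o1, 'a1, 'a dbundle, 'a linmor) lmor, (('o1, 'a1, 'a dbundle, 'a linmor) lmor, 'o1, 'a linmor) nt,
    (('o1, 'a1, 'o, 'a) lmor, 'o1, 'a) nt dbundle,
    (('o1, 'a1, 'o, 'a) lmor, 'o1, 'a) nt linmor) lmor" where
  "GamQ U X' X \<equiv> Gam U X' (DB X) X (univ_bundle X)"

end

theory Submission
  imports Defs
begin

text \<open>Everything about tangent natural transformations can be read in components, and a pointwise
  display differential bundle over \<open>X1\<close> is, in components, a family of display differential bundles of
  \<open>X\<close> indexed by the objects of \<open>X1\<close>. The functor and the lax structure of its source and target turn
  this family into a lax tangent morphism \<open>X1 \<rightarrow> DB X\<close>: naturality of the projection and of the lift says
  that arrows of \<open>X1\<close> act by linear morphisms, and their compatibility with the lax structures says that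
  these structures are linear as well. This assignment is inverse to \<open>H \<mapsto> Q\<^sub>H\<close>.

  The first ingredient is that limits of lax tangent morphisms are computed in components. If the
  components of a cospan have limits that all powers of \<open>T\<close> preserve, the arrow part and the lax
  structure of the apex are forced by the legs, and the axioms hold because the legs, with their images
  under \<open>T\<close> and \<open>T T\<close>, are jointly monic (\<open>lax_by_cone\<close>, \<open>Hom_wide_ex\<close>). It follows that
  \<open>Hom X Y\<close> is a tangent category; the one axiom that is not immediate is the universality of the vertical
  lift, for which the image under \<open>T\<close> of the universal pair must be jointly monic
  (\<open>vertical_lift_Ta_monic\<close>). It also follows that a pointwise tangent display map is the same as a
  tangent natural transformation with tangent display components (\<open>pointwise_display_iff\<close>), and that
  the axioms of a pointwise display differential bundle are those of its components
  (\<open>DBpt_Ob_iff\<close>). The only equation that quantifies over arrows of \<open>Y\<close>, associativity, is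
  reduced to the generic triple, which is a cone of tangent natural transformations
  (\<open>Hom_additiveD\<close>).

  The second ingredient is that linear morphisms, which are only required to commute with projections
  and lifts, preserve zeros and sums (\<open>linear_zero\<close>, \<open>linear_sum\<close>), since the lift is monic. So
  the zeros and sums of all bundles form natural transformations, and the universal bundle is a
  pointwise display differential bundle.

  With these, \<open>\<Gamma>\<close> is bijective on objects and arrows and carries every structure map of
  \<open>Hom X1 (DB X)\<close> to the one of \<open>DBpt U X1 X\<close> (\<open>tcat_iso_Q\<close>). The rest is transport along this
  isomorphism: \<open>DBpt U X1 X\<close> is a tangent category because \<open>Hom X1 (DB X)\<close> is one, and
  precomposition of bundles is conjugate to precomposition of their classifying morphisms
  (\<open>DBpt_pre_eq\<close>, \<open>DBpt_pre2_eq\<close>), from which strictness, functoriality and naturality are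
  inherited.\<close>

section \<open>Categories and wide pullbacks\<close>

lemma hom_iff [simp]: "f \<in> hom X A B \<longleftrightarrow> f \<in> Arr X \<and> Dom X f = A \<and> Cod X f = B"
  by (simp add: hom_def)

text \<open>Apex \<open>L\<close> and legs \<open>e\<close> of a limit of the arrows \<open>f j\<close> with common codomain. Both the pullbacks
  of a cospan and the \<open>n\<close>-fold pullbacks, whose leg to the base is one more leg over the identity of
  the base, are of this form.\<close>

definition wide_pullback ::
  "('o, 'a, 'z) cat_scheme \<Rightarrow> 'i set \<Rightarrow> ('i \<Rightarrow> 'a) \<Rightarrow> 'o \<Rightarrow> ('i \<Rightarrow> 'a) \<Rightarrow> bool" where
  "wide_pullback X J f L e \<longleftrightarrow>
     (\<forall>j\<in>J. f j \<in> Arr X \<and> e j \<in> hom X L (Dom X (f j))) \<and>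
     (\<forall>j\<in>J. \<forall>k\<in>J. Cod X (f j) = Cod X (f k) \<and> f j \<bullet>\<^bsub>X\<^esub> e j = f k \<bullet>\<^bsub>X\<^esub> e k) \<and>
     (\<forall>W\<in>Ob X. \<forall>u. (\<forall>j\<in>J. u j \<in> hom X W (Dom X (f j))) \<longrightarrow>
        (\<forall>j\<in>J. \<forall>k\<in>J. f j \<bullet>\<^bsub>X\<^esub> u j = f k \<bullet>\<^bsub>X\<^esub> u k) \<longrightarrow>
        (\<exists>!h. h \<in> hom X W L \<and> (\<forall>j\<in>J. e j \<bullet>\<^bsub>X\<^esub> h = u j)))"

definition jointly_monic ::
  "('o, 'a, 'z) cat_scheme \<Rightarrow> 'i set \<Rightarrow> 'o \<Rightarrow> ('i \<Rightarrow> 'a) \<Rightarrow> bool" where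
  "jointly_monic X J L e \<longleftrightarrow>
     (\<forall>x\<in>Arr X. \<forall>y\<in>Arr X. Dom X x = Dom X y \<longrightarrow> Cod X x = L \<longrightarrow> Cod X y = L \<longrightarrow>
        (\<forall>j\<in>J. e j \<bullet>\<^bsub>X\<^esub> x = e j \<bullet>\<^bsub>X\<^esub> y) \<longrightarrow> x = y)"

lemma jointly_monicD:
  "\<lbrakk>jointly_monic X J L e; x \<in> Arr X; y \<in> Arr X; Dom X x = Dom X y; Cod X x = L; Cod X y = L;
    \<And>j. j \<in> J \<Longrightarrow> e j \<bullet>\<^bsub>X\<^esub> x = e j \<bullet>\<^bsub>X\<^esub> y\<rbrakk> \<Longrightarrow> x = y"
  unfolding jointly_monic_def by blast

lemma wide_pullbackD:
  assumes "wide_pullback X J f L e" "j \<in> J"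
  shows "f j \<in> Arr X" "e j \<in> Arr X" "Dom X (e j) = L" "Cod X (e j) = Dom X (f j)"
  using assms(1)[unfolded wide_pullback_def hom_iff, THEN conjunct1, rule_format, OF assms(2)] by auto

lemma wide_pullback_cone:
  assumes "wide_pullback X J f L e" "j \<in> J" "k \<in> J"
  shows "f j \<bullet>\<^bsub>X\<^esub> e j = f k \<bullet>\<^bsub>X\<^esub> e k" "Cod X (f j) = Cod X (f k)"
  using assms(1)[unfolded wide_pullback_def, THEN conjunct2, THEN conjunct1, rule_format, OF assms(2,3)]
  by auto

lemma wide_pullback_ex1:
  assumes "wide_pullback X J f L e" "W \<in> Ob X"
    and "\<And>j. j \<in> J \<Longrightarrow> u j \<in> Arr X \<and> Dom X (u j) = W \<and> Cod X (u j) = Dom X (f j)"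
    and "\<And>j k. j \<in> J \<Longrightarrow> k \<in> J \<Longrightarrow> f j \<bullet>\<^bsub>X\<^esub> u j = f k \<bullet>\<^bsub>X\<^esub> u k"
  shows "\<exists>!h. h \<in> hom X W L \<and> (\<forall>j\<in>J. e j \<bullet>\<^bsub>X\<^esub> h = u j)"
proof -
  have u: "\<forall>j\<in>J. u j \<in> hom X W (Dom X (f j))" using assms(3) by simp
  have c: "\<forall>j\<in>J. \<forall>k\<in>J. f j \<bullet>\<^bsub>X\<^esub> u j = f k \<bullet>\<^bsub>X\<^esub> u k" by (intro ballI assms(4))
  show ?thesis
    using assms(1)[unfolded wide_pullback_def, THEN conjunct2, THEN conjunct2, THEN bspec, OF assms(2),
      THEN spec, THEN mp, OF u, THEN mp, OF c] .
qed

lemma wide_pullback_lift: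
  assumes "wide_pullback X J f L e" "W \<in> Ob X"
    "\<And>j. j \<in> J \<Longrightarrow> u j \<in> Arr X \<and> Dom X (u j) = W \<and> Cod X (u j) = Dom X (f j)"
    "\<And>j k. j \<in> J \<Longrightarrow> k \<in> J \<Longrightarrow> f j \<bullet>\<^bsub>X\<^esub> u j = f k \<bullet>\<^bsub>X\<^esub> u k"
  shows "\<exists>h. h \<in> Arr X \<and> Dom X h = W \<and> Cod X h = L \<and> (\<forall>j\<in>J. e j \<bullet>\<^bsub>X\<^esub> h = u j)"
  using wide_pullback_ex1[OF assms] by auto

lemma wide_pullbackI:
  assumes "\<And>j. j \<in> J \<Longrightarrow> f j \<in> Arr X"
    and "\<And>j. j \<in> J \<Longrightarrow> e j \<in> Arr X \<and> Dom X (e j) = L \<and> Cod X (e j) = Dom X (f j)"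
    and "\<And>j k. j \<in> J \<Longrightarrow> k \<in> J \<Longrightarrow> Cod X (f j) = Cod X (f k) \<and> f j \<bullet>\<^bsub>X\<^esub> e j = f k \<bullet>\<^bsub>X\<^esub> e k"
    and "jointly_monic X J L e"
    and "\<And>W u. \<lbrakk>W \<in> Ob X; \<And>j. j \<in> J \<Longrightarrow> u j \<in> Arr X \<and> Dom X (u j) = W \<and> Cod X (u j) = Dom X (f j);
      \<And>j k. j \<in> J \<Longrightarrow> k \<in> J \<Longrightarrow> f j \<bullet>\<^bsub>X\<^esub> u j = f k \<bullet>\<^bsub>X\<^esub> u k\<rbrakk> \<Longrightarrow>
      \<exists>h. h \<in> hom X W L \<and> (\<forall>j\<in>J. e j \<bullet>\<^bsub>X\<^esub> h = u j)"
  shows "wide_pullback X J f L e"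
proof -
  have "\<exists>!h. h \<in> hom X W L \<and> (\<forall>j\<in>J. e j \<bullet>\<^bsub>X\<^esub> h = u j)"
    if "W \<in> Ob X" "\<forall>j\<in>J. u j \<in> hom X W (Dom X (f j))"
      "\<forall>j\<in>J. \<forall>k\<in>J. f j \<bullet>\<^bsub>X\<^esub> u j = f k \<bullet>\<^bsub>X\<^esub> u k" for W u
  proof -
    have "\<exists>h. h \<in> hom X W L \<and> (\<forall>j\<in>J. e j \<bullet>\<^bsub>X\<^esub> h = u j)"
      by (rule assms(5)) (use that(1,2) in auto, use that(3) in blast)
    then show ?thesis
      using jointly_monicD[OF assms(4)] by (metis hom_iff)
  qed
  moreover have "\<forall>j\<in>J. f j \<in> Arr X \<and> e j \<in> hom X L (Dom X (f j))" using assms(1,2) by simp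
  moreover have "\<forall>j\<in>J. \<forall>k\<in>J. Cod X (f j) = Cod X (f k) \<and> f j \<bullet>\<^bsub>X\<^esub> e j = f k \<bullet>\<^bsub>X\<^esub> e k"
    by (intro ballI assms(3))
  ultimately show ?thesis unfolding wide_pullback_def by blast
qed

lemma wide_pullback_eq_on:
  assumes w: "wide_pullback X J f L e" and f: "\<And>j. j \<in> J \<Longrightarrow> f' j = f j" and e: "\<And>j. j \<in> J \<Longrightarrow> e' j = e j"
  shows "wide_pullback X J f' L e'"
  unfolding wide_pullback_def
proof (intro conjI ballI allI impI)
  fix W u assume W: "W \<in> Ob X" and u: "\<forall>j\<in>J. u j \<in> hom X W (Dom X (f' j))"
    "\<forall>j\<in>J. \<forall>k\<in>J. f' j \<bullet>\<^bsub>X\<^esub> u j = f' k \<bullet>\<^bsub>X\<^esub> u k"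
  have "\<exists>!h. h \<in> hom X W L \<and> (\<forall>j\<in>J. e j \<bullet>\<^bsub>X\<^esub> h = u j)"
  proof (rule wide_pullback_ex1[OF w W])
    show "f j \<bullet>\<^bsub>X\<^esub> u j = f k \<bullet>\<^bsub>X\<^esub> u k" if "j \<in> J" "k \<in> J" for j k
      using u(2) f[OF that(1)] f[OF that(2)] that by metis
  qed (use u(1) f in auto)
  moreover have "(\<forall>j\<in>J. e' j \<bullet>\<^bsub>X\<^esub> h = u j) \<longleftrightarrow> (\<forall>j\<in>J. e j \<bullet>\<^bsub>X\<^esub> h = u j)" for h
    using e by metis
  ultimately show "\<exists>!h. h \<in> hom X W L \<and> (\<forall>j\<in>J. e' j \<bullet>\<^bsub>X\<^esub> h = u j)" by simp
next
  fix j assume j: "j \<in> J"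
  show "f' j \<in> Arr X" "e' j \<in> hom X L (Dom X (f' j))"
    unfolding f[OF j] e[OF j] using wide_pullbackD[OF w j] by auto
  fix k assume k: "k \<in> J"
  show "Cod X (f' j) = Cod X (f' k)" "f' j \<bullet>\<^bsub>X\<^esub> e' j = f' k \<bullet>\<^bsub>X\<^esub> e' k"
    unfolding f[OF j] e[OF j] f[OF k] e[OF k] using wide_pullback_cone[OF w j k] by auto
qed

text \<open>Index \<open>n\<close> of \<open>fold_legs n\<close> carries the leg to the base.\<close>

abbreviation two_legs :: "'a \<Rightarrow> 'a \<Rightarrow> nat \<Rightarrow> 'a" where
  "two_legs f g \<equiv> (\<lambda>j. if j = 0 then f else g)"

abbreviation fold_legs :: "nat \<Rightarrow> 'a \<Rightarrow> (nat \<Rightarrow> 'a) \<Rightarrow> nat \<Rightarrow> 'a" where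
  "fold_legs n b pr \<equiv> (\<lambda>j. if j = n then b else pr j)"

lemma additive_bundleD:
  assumes "additive_bundle C q pi1 pi2 z s"
  shows "is_pullback C q q pi1 pi2" "z \<in> Arr C" "Dom C z = Cod C q" "Cod C z = Dom C q"
    "q \<bullet>\<^bsub>C\<^esub> z = Ident C (Cod C q)" "s \<in> Arr C" "Dom C s = Dom C pi1" "Cod C s = Dom C q"
    "q \<bullet>\<^bsub>C\<^esub> s = q \<bullet>\<^bsub>C\<^esub> pi1"
    "s \<bullet>\<^bsub>C\<^esub> pair_into C pi1 pi2 pi2 pi1 = s"
    "s \<bullet>\<^bsub>C\<^esub> pair_into C pi1 pi2 (Ident C (Dom C q)) (z \<bullet>\<^bsub>C\<^esub> q) = Ident C (Dom C q)"
  using assms unfolding additive_bundle_def hom_iff by blast+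

lemma additive_bundle_assoc:
  assumes "additive_bundle C q pi1 pi2 z s" "W \<in> Ob C"
    "a \<in> hom C W (Dom C q)" "b \<in> hom C W (Dom C q)" "c \<in> hom C W (Dom C q)"
    "q \<bullet>\<^bsub>C\<^esub> a = q \<bullet>\<^bsub>C\<^esub> b" "q \<bullet>\<^bsub>C\<^esub> b = q \<bullet>\<^bsub>C\<^esub> c"
  shows "s \<bullet>\<^bsub>C\<^esub> pair_into C pi1 pi2 (s \<bullet>\<^bsub>C\<^esub> pair_into C pi1 pi2 a b) c =
      s \<bullet>\<^bsub>C\<^esub> pair_into C pi1 pi2 a (s \<bullet>\<^bsub>C\<^esub> pair_into C pi1 pi2 b c)"
  using assms(1)[unfolded additive_bundle_def, THEN conjunct2, THEN conjunct2, THEN conjunct2, THEN conjunct2,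
    THEN conjunct2, THEN conjunct2, THEN conjunct2, THEN bspec, OF assms(2), THEN bspec, OF assms(3),
    THEN bspec, OF assms(4), THEN bspec, OF assms(5), THEN mp, OF conjI, OF assms(6,7)] .

locale category_on =
  fixes X :: "('o, 'a, 'z) cat_scheme"
  assumes category_X: "category X"
begin

lemma Dom_Ob [simp]: "f \<in> Arr X \<Longrightarrow> Dom X f \<in> Ob X"
  and Cod_Ob [simp]: "f \<in> Arr X \<Longrightarrow> Cod X f \<in> Ob X"
  and Ident_Arr [simp]: "A \<in> Ob X \<Longrightarrow> Ident X A \<in> Arr X"
  and Dom_Ident [simp]: "A \<in> Ob X \<Longrightarrow> Dom X (Ident X A) = A"
  and Cod_Ident [simp]: "A \<in> Ob X \<Longrightarrow> Cod X (Ident X A) = A"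
  and Cmp_Arr [simp]: "\<lbrakk>f \<in> Arr X; g \<in> Arr X; Cod X f = Dom X g\<rbrakk> \<Longrightarrow> g \<bullet>\<^bsub>X\<^esub> f \<in> Arr X"
  and Dom_Cmp [simp]: "\<lbrakk>f \<in> Arr X; g \<in> Arr X; Cod X f = Dom X g\<rbrakk> \<Longrightarrow> Dom X (g \<bullet>\<^bsub>X\<^esub> f) = Dom X f"
  and Cod_Cmp [simp]: "\<lbrakk>f \<in> Arr X; g \<in> Arr X; Cod X f = Dom X g\<rbrakk> \<Longrightarrow> Cod X (g \<bullet>\<^bsub>X\<^esub> f) = Cod X g"
  and Cmp_Ident_right [simp]: "\<lbrakk>f \<in> Arr X; Dom X f = A\<rbrakk> \<Longrightarrow> f \<bullet>\<^bsub>X\<^esub> Ident X A = f"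
  and Cmp_Ident_left [simp]: "\<lbrakk>f \<in> Arr X; Cod X f = A\<rbrakk> \<Longrightarrow> Ident X A \<bullet>\<^bsub>X\<^esub> f = f"
  and Cmp_assoc [simp]: "\<lbrakk>f \<in> Arr X; g \<in> Arr X; h \<in> Arr X; Cod X f = Dom X g; Cod X g = Dom X h\<rbrakk> \<Longrightarrow>
    (h \<bullet>\<^bsub>X\<^esub> g) \<bullet>\<^bsub>X\<^esub> f = h \<bullet>\<^bsub>X\<^esub> (g \<bullet>\<^bsub>X\<^esub> f)"
  using category_X unfolding category_def by (auto simp: hom_iff)

text \<open>An equation between composites, continued by a further arrow on the right; this keeps
  composites bracketed to the right.\<close>

lemma Cmp_eq_extend:
  assumes "g \<bullet>\<^bsub>X\<^esub> f = k" "f \<in> Arr X" "g \<in> Arr X" "Cod X f = Dom X g" "x \<in> Arr X" "Cod X x = Dom X f"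
  shows "g \<bullet>\<^bsub>X\<^esub> (f \<bullet>\<^bsub>X\<^esub> x) = k \<bullet>\<^bsub>X\<^esub> x"
  using assms by (metis Cmp_assoc)

lemma Cmp_eq_extend3:
  assumes "h \<bullet>\<^bsub>X\<^esub> (g \<bullet>\<^bsub>X\<^esub> f) = k" "f \<in> Arr X" "g \<in> Arr X" "h \<in> Arr X" "Cod X f = Dom X g" "Cod X g = Dom X h"
    "x \<in> Arr X" "Cod X x = Dom X f"
  shows "h \<bullet>\<^bsub>X\<^esub> (g \<bullet>\<^bsub>X\<^esub> (f \<bullet>\<^bsub>X\<^esub> x)) = k \<bullet>\<^bsub>X\<^esub> x"
  using assms(2-) by (simp flip: assms(1))

lemma jointly_monic_wide: "wide_pullback X J f L e \<Longrightarrow> jointly_monic X J L e"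
  unfolding jointly_monic_def
proof (intro ballI impI)
  fix x y assume w: "wide_pullback X J f L e" and xy: "x \<in> Arr X" "y \<in> Arr X" "Dom X x = Dom X y"
    "Cod X x = L" "Cod X y = L" "\<forall>j\<in>J. e j \<bullet>\<^bsub>X\<^esub> x = e j \<bullet>\<^bsub>X\<^esub> y"
  note d = wide_pullbackD[OF w] and c = wide_pullback_cone[OF w]
  have "\<exists>!h. h \<in> hom X (Dom X x) L \<and> (\<forall>j\<in>J. e j \<bullet>\<^bsub>X\<^esub> h = e j \<bullet>\<^bsub>X\<^esub> x)"
  proof (rule wide_pullback_ex1[OF w])
    fix j k assume jk: "j \<in> J" "k \<in> J"
    show "f j \<bullet>\<^bsub>X\<^esub> (e j \<bullet>\<^bsub>X\<^esub> x) = f k \<bullet>\<^bsub>X\<^esub> (e k \<bullet>\<^bsub>X\<^esub> x)"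
      using xy d jk c(1) c(2) by (metis Cmp_assoc)
  qed (use xy d in auto)
  then show "x = y" using xy by auto
qed

lemma wide_pullback_iso:
  assumes w: "wide_pullback X J f L e" and k: "k \<in> hom X L' L" "k' \<in> hom X L L'"
    "k \<bullet>\<^bsub>X\<^esub> k' = Ident X L" "k' \<bullet>\<^bsub>X\<^esub> k = Ident X L'"
    and e': "\<And>j. j \<in> J \<Longrightarrow> e' j = e j \<bullet>\<^bsub>X\<^esub> k"
  shows "wide_pullback X J f L' e'"
proof (rule wide_pullbackI)
  note d = wide_pullbackD[OF w] and c = wide_pullback_cone[OF w]
  show "f j \<in> Arr X" if "j \<in> J" for j using d that by auto
  show "e' j \<in> Arr X \<and> Dom X (e' j) = L' \<and> Cod X (e' j) = Dom X (f j)" if "j \<in> J" for j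
    using d k e' that by auto
  show "Cod X (f j) = Cod X (f i) \<and> f j \<bullet>\<^bsub>X\<^esub> e' j = f i \<bullet>\<^bsub>X\<^esub> e' i" if "j \<in> J" "i \<in> J" for j i
    using d[OF that(1)] d[OF that(2)] k e' that c by (metis Cmp_assoc hom_iff)
  show "jointly_monic X J L' e'"
    unfolding jointly_monic_def
  proof (intro ballI impI)
    fix x y assume xy: "x \<in> Arr X" "y \<in> Arr X" "Dom X x = Dom X y" "Cod X x = L'" "Cod X y = L'"
      "\<forall>j\<in>J. e' j \<bullet>\<^bsub>X\<^esub> x = e' j \<bullet>\<^bsub>X\<^esub> y"
    have "k \<bullet>\<^bsub>X\<^esub> x = k \<bullet>\<^bsub>X\<^esub> y"
    proof (rule jointly_monicD[OF jointly_monic_wide[OF w]])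
      show "e j \<bullet>\<^bsub>X\<^esub> (k \<bullet>\<^bsub>X\<^esub> x) = e j \<bullet>\<^bsub>X\<^esub> (k \<bullet>\<^bsub>X\<^esub> y)" if "j \<in> J" for j
        using d k e' xy that by (metis Cmp_assoc hom_iff)
    qed (use xy k in auto)
    then have "k' \<bullet>\<^bsub>X\<^esub> (k \<bullet>\<^bsub>X\<^esub> x) = k' \<bullet>\<^bsub>X\<^esub> (k \<bullet>\<^bsub>X\<^esub> y)" by simp
    then show "x = y" using k xy by (simp add: Cmp_eq_extend[OF k(4)])
  qed
  fix W u assume W: "W \<in> Ob X" and u: "\<And>j. j \<in> J \<Longrightarrow> u j \<in> Arr X \<and> Dom X (u j) = W \<and> Cod X (u j) = Dom X (f j)"
     "\<And>j k. j \<in> J \<Longrightarrow> k \<in> J \<Longrightarrow> f j \<bullet>\<^bsub>X\<^esub> u j = f k \<bullet>\<^bsub>X\<^esub> u k"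
  obtain h where h: "h \<in> Arr X" "Dom X h = W" "Cod X h = L" "\<And>j. j \<in> J \<Longrightarrow> e j \<bullet>\<^bsub>X\<^esub> h = u j"
    using wide_pullback_lift[OF w W u] by blast
  show "\<exists>h. h \<in> hom X W L' \<and> (\<forall>j\<in>J. e' j \<bullet>\<^bsub>X\<^esub> h = u j)"
    by (rule exI[of _ "k' \<bullet>\<^bsub>X\<^esub> h"])
      (use h k e' d in \<open>auto simp: Cmp_eq_extend[OF k(3)]\<close>)
qed

lemma wide_pullback_unique:
  assumes w: "wide_pullback X J f L e" and w': "wide_pullback X J f L' e'" and L: "L \<in> Ob X" "L' \<in> Ob X"
  obtains k k' where "k \<in> hom X L' L" "k' \<in> hom X L L'" "k \<bullet>\<^bsub>X\<^esub> k' = Ident X L" "k' \<bullet>\<^bsub>X\<^esub> k = Ident X L'"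
    "\<And>j. j \<in> J \<Longrightarrow> e' j = e j \<bullet>\<^bsub>X\<^esub> k"
proof -
  note d = wide_pullbackD[OF w] wide_pullbackD[OF w'] and c = wide_pullback_cone(1)[OF w] wide_pullback_cone(1)[OF w']
  obtain k where k: "k \<in> Arr X" "Dom X k = L'" "Cod X k = L" "\<And>j. j \<in> J \<Longrightarrow> e j \<bullet>\<^bsub>X\<^esub> k = e' j"
    using wide_pullback_lift[OF w L(2), of e'] d c by metis
  obtain k' where k': "k' \<in> Arr X" "Dom X k' = L" "Cod X k' = L'" "\<And>j. j \<in> J \<Longrightarrow> e' j \<bullet>\<^bsub>X\<^esub> k' = e j"
    using wide_pullback_lift[OF w' L(1), of e] d c by metis
  have "k \<bullet>\<^bsub>X\<^esub> k' = Ident X L"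
    by (rule jointly_monicD[OF jointly_monic_wide[OF w]])
      (use k k' L d in \<open>auto simp: Cmp_eq_extend[OF k(4)]\<close>)
  moreover have "k' \<bullet>\<^bsub>X\<^esub> k = Ident X L'"
    by (rule jointly_monicD[OF jointly_monic_wide[OF w']])
      (use k k' L d in \<open>auto simp: Cmp_eq_extend[OF k'(4)]\<close>)
  ultimately show ?thesis using k k' by (intro that[of k k']) auto
qed

subsection \<open>Pullbacks of a cospan\<close>

lemma is_pullbackD:
  assumes "is_pullback X f g a b"
  shows "f \<in> Arr X" "g \<in> Arr X" "Cod X f = Cod X g" "a \<in> Arr X" "b \<in> Arr X" "Dom X a = Dom X b"
    "Cod X a = Dom X f" "Cod X b = Dom X g" "f \<bullet>\<^bsub>X\<^esub> a = g \<bullet>\<^bsub>X\<^esub> b"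
  using assms unfolding is_pullback_def by auto

lemma is_pullback_ex1:
  assumes "is_pullback X f g a b" "W \<in> Ob X" "u \<in> hom X W (Dom X f)" "v \<in> hom X W (Dom X g)"
    "f \<bullet>\<^bsub>X\<^esub> u = g \<bullet>\<^bsub>X\<^esub> v"
  shows "\<exists>!h. h \<in> hom X W (Dom X a) \<and> a \<bullet>\<^bsub>X\<^esub> h = u \<and> b \<bullet>\<^bsub>X\<^esub> h = v"
proof -
  have "\<forall>W\<in>Ob X. \<forall>u\<in>hom X W (Dom X f). \<forall>v\<in>hom X W (Dom X g). f \<bullet>\<^bsub>X\<^esub> u = g \<bullet>\<^bsub>X\<^esub> v \<longrightarrow>
        (\<exists>!h. h \<in> hom X W (Dom X a) \<and> a \<bullet>\<^bsub>X\<^esub> h = u \<and> b \<bullet>\<^bsub>X\<^esub> h = v)"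
    using assms(1) unfolding is_pullback_def by blast
  from this[THEN bspec, OF assms(2), THEN bspec, OF assms(3), THEN bspec, OF assms(4), THEN mp, OF assms(5)]
  show ?thesis .
qed

lemma is_pullback_iff_wide:
  "is_pullback X f g a b \<longleftrightarrow> wide_pullback X {..<2} (two_legs f g) (Dom X a) (two_legs a b)"
proof -
  have two: "{..<2::nat} = {0, 1}" by auto
  have all2: "(\<forall>j\<in>{..<2::nat}. P j) \<longleftrightarrow> P 0 \<and> P 1" for P unfolding two by simp
  show ?thesis
  proof
    assume p: "is_pullback X f g a b"
    note d = is_pullbackD[OF p]
    show "wide_pullback X {..<2} (two_legs f g) (Dom X a) (two_legs a b)"
      unfolding wide_pullback_def all2
    proof (intro conjI ballI allI impI)
      fix W and u :: "nat \<Rightarrow> 'a"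
      assume W: "W \<in> Ob X" and u: "u 0 \<in> hom X W (Dom X (two_legs f g 0)) \<and> u 1 \<in> hom X W (Dom X (two_legs f g 1))"
        and e: "(two_legs f g 0 \<bullet>\<^bsub>X\<^esub> u 0 = two_legs f g 0 \<bullet>\<^bsub>X\<^esub> u 0 \<and>
          two_legs f g 0 \<bullet>\<^bsub>X\<^esub> u 0 = two_legs f g 1 \<bullet>\<^bsub>X\<^esub> u 1) \<and>
          two_legs f g 1 \<bullet>\<^bsub>X\<^esub> u 1 = two_legs f g 0 \<bullet>\<^bsub>X\<^esub> u 0 \<and>
          two_legs f g 1 \<bullet>\<^bsub>X\<^esub> u 1 = two_legs f g 1 \<bullet>\<^bsub>X\<^esub> u 1"
      show "\<exists>!h. h \<in> hom X W (Dom X a) \<and> two_legs a b 0 \<bullet>\<^bsub>X\<^esub> h = u 0 \<and> two_legs a b 1 \<bullet>\<^bsub>X\<^esub> h = u 1"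
        using is_pullback_ex1[OF p W, of "u 0" "u 1"] u e[THEN conjunct1, THEN conjunct2] by simp
    qed (use d in auto)
  next
    assume w: "wide_pullback X {..<2} (two_legs f g) (Dom X a) (two_legs a b)"
    note d = wide_pullbackD[OF w, of 0] wide_pullbackD[OF w, of 1] wide_pullback_cone[OF w, of 0 1]
    show "is_pullback X f g a b"
      unfolding is_pullback_def
    proof (intro conjI ballI allI impI)
      fix W u v assume W: "W \<in> Ob X" and u: "u \<in> hom X W (Dom X f)" "v \<in> hom X W (Dom X g)" "f \<bullet>\<^bsub>X\<^esub> u = g \<bullet>\<^bsub>X\<^esub> v"
      have "\<exists>!h. h \<in> hom X W (Dom X a) \<and> (\<forall>j\<in>{..<2}. two_legs a b j \<bullet>\<^bsub>X\<^esub> h = two_legs u v j)"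
        by (rule wide_pullback_ex1[OF w W]) (use u in auto)
      then show "\<exists>!h. h \<in> hom X W (Dom X a) \<and> a \<bullet>\<^bsub>X\<^esub> h = u \<and> b \<bullet>\<^bsub>X\<^esub> h = v"
        unfolding all2 by simp
    qed (use d in auto)
  qed
qed

lemma is_pullback_sym:
  assumes p: "is_pullback X f g a b"
  shows "is_pullback X g f b a"
  unfolding is_pullback_def
proof (intro conjI ballI allI impI)
  note d = is_pullbackD[OF p]
  fix W u v assume "W \<in> Ob X" "u \<in> hom X W (Dom X g)" "v \<in> hom X W (Dom X f)" "g \<bullet>\<^bsub>X\<^esub> u = f \<bullet>\<^bsub>X\<^esub> v"
  then have "\<exists>!h. h \<in> hom X W (Dom X a) \<and> a \<bullet>\<^bsub>X\<^esub> h = v \<and> b \<bullet>\<^bsub>X\<^esub> h = u"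
    by (intro is_pullback_ex1[OF p]) auto
  then show "\<exists>!h. h \<in> hom X W (Dom X b) \<and> b \<bullet>\<^bsub>X\<^esub> h = u \<and> a \<bullet>\<^bsub>X\<^esub> h = v"
    using d(6) by (simp add: conj_commute)
qed (use is_pullbackD[OF p] in auto)

lemma is_pullback_lift:
  assumes "is_pullback X f g a b" "u \<in> Arr X" "v \<in> Arr X" "Dom X u = Dom X v"
    "Cod X u = Dom X f" "Cod X v = Dom X g" "f \<bullet>\<^bsub>X\<^esub> u = g \<bullet>\<^bsub>X\<^esub> v"
  shows "pair_into X a b u v \<in> Arr X" "Dom X (pair_into X a b u v) = Dom X u"
    "Cod X (pair_into X a b u v) = Dom X a"
    "a \<bullet>\<^bsub>X\<^esub> pair_into X a b u v = u" "b \<bullet>\<^bsub>X\<^esub> pair_into X a b u v = v"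
proof -
  have "\<exists>!h. h \<in> hom X (Dom X u) (Dom X a) \<and> a \<bullet>\<^bsub>X\<^esub> h = u \<and> b \<bullet>\<^bsub>X\<^esub> h = v"
    by (rule is_pullback_ex1[OF assms(1)]) (use assms in auto)
  from theI'[OF this]
  show "pair_into X a b u v \<in> Arr X" "Dom X (pair_into X a b u v) = Dom X u"
    "Cod X (pair_into X a b u v) = Dom X a"
    "a \<bullet>\<^bsub>X\<^esub> pair_into X a b u v = u" "b \<bullet>\<^bsub>X\<^esub> pair_into X a b u v = v"
    unfolding pair_into_def by auto
qed

lemma is_pullback_monic:
  assumes "is_pullback X f g a b" "x \<in> Arr X" "y \<in> Arr X" "Dom X x = Dom X y"
    "Cod X x = Dom X a" "Cod X y = Dom X a" "a \<bullet>\<^bsub>X\<^esub> x = a \<bullet>\<^bsub>X\<^esub> y" "b \<bullet>\<^bsub>X\<^esub> x = b \<bullet>\<^bsub>X\<^esub> y"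
  shows "x = y"
  by (rule jointly_monicD[OF jointly_monic_wide[OF assms(1)[unfolded is_pullback_iff_wide]]])
    (use assms in auto)

lemma pair_into_eqI:
  assumes "is_pullback X f g a b" "h \<in> Arr X" "Cod X h = Dom X a" "a \<bullet>\<^bsub>X\<^esub> h = u" "b \<bullet>\<^bsub>X\<^esub> h = v"
  shows "pair_into X a b u v = h"
proof -
  note d = is_pullbackD[OF assms(1)]
  have e: "f \<bullet>\<^bsub>X\<^esub> u = g \<bullet>\<^bsub>X\<^esub> v"
    unfolding assms(4)[symmetric] assms(5)[symmetric]
    using d assms(2,3) by (simp flip: Cmp_assoc)
  have u: "u \<in> Arr X" "v \<in> Arr X" "Dom X u = Dom X h" "Dom X v = Dom X h"
    "Cod X u = Dom X f" "Cod X v = Dom X g"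
    unfolding assms(4)[symmetric] assms(5)[symmetric] using d assms(2,3) by auto
  note l = is_pullback_lift[OF assms(1) u(1,2) _ u(5,6) e]
  show ?thesis
    by (rule is_pullback_monic[OF assms(1)]) (use l u assms(2-) d in simp_all)
qed

lemma pair_into_Cmp:
  assumes "is_pullback X f g a b" "u \<in> Arr X" "v \<in> Arr X" "Dom X u = Dom X v"
    "Cod X u = Dom X f" "Cod X v = Dom X g" "f \<bullet>\<^bsub>X\<^esub> u = g \<bullet>\<^bsub>X\<^esub> v" "k \<in> Arr X" "Cod X k = Dom X u"
  shows "pair_into X a b u v \<bullet>\<^bsub>X\<^esub> k = pair_into X a b (u \<bullet>\<^bsub>X\<^esub> k) (v \<bullet>\<^bsub>X\<^esub> k)"
proof -
  note d = is_pullbackD[OF assms(1)] and p = is_pullback_lift[OF assms(1-7)]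
  show ?thesis
    by (rule pair_into_eqI[OF assms(1), symmetric])
      (use d p assms(2-) in \<open>auto simp: Cmp_eq_extend[OF p(4)] Cmp_eq_extend[OF p(5)]\<close>)
qed

subsection \<open>Pullbacks of an arrow along itself\<close>

lemma is_fold_pullback_ex1:
  assumes "is_fold_pullback X n q b pr" "W \<in> Ob X" "w \<in> hom X W (Cod X q)"
    "\<forall>i<n. u i \<in> hom X W (Dom X q) \<and> q \<bullet>\<^bsub>X\<^esub> u i = w"
  shows "\<exists>!h. h \<in> hom X W (Dom X b) \<and> b \<bullet>\<^bsub>X\<^esub> h = w \<and> (\<forall>i<n. pr i \<bullet>\<^bsub>X\<^esub> h = u i)"
  using assms(1)[unfolded is_fold_pullback_def, THEN conjunct2, THEN conjunct2, THEN conjunct2, THEN conjunct2,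
    THEN bspec, OF assms(2), THEN bspec, OF assms(3), THEN spec, THEN mp, OF assms(4)] .

lemma is_fold_pullback_iff_wide:
  assumes "q \<in> Arr X"
  shows "is_fold_pullback X n q b pr \<longleftrightarrow>
    wide_pullback X {..n} (fold_legs n (Ident X (Cod X q)) (\<lambda>_. q)) (Dom X b) (fold_legs n b pr)"
    (is "?L = ?R")
proof -
  let ?f = "fold_legs n (Ident X (Cod X q)) (\<lambda>_. q)" and ?e = "fold_legs n b pr"
  have J: "j \<le> n \<longleftrightarrow> j < n \<or> j = n" for j by auto
  have ball: "(\<forall>j\<in>{..n}. P j) \<longleftrightarrow> (\<forall>j<n. P j) \<and> P n" for P :: "nat \<Rightarrow> bool"
    by (auto simp: J)
  show ?thesis
  proof
    assume L: ?L
    show ?R unfolding wide_pullback_def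
    proof (intro conjI ballI allI impI)
      fix W u assume W: "W \<in> Ob X" and u: "\<forall>j\<in>{..n}. u j \<in> hom X W (Dom X (?f j))"
        "\<forall>j\<in>{..n}. \<forall>k\<in>{..n}. ?f j \<bullet>\<^bsub>X\<^esub> u j = ?f k \<bullet>\<^bsub>X\<^esub> u k"
      have un: "u n \<in> hom X W (Cod X q)" using u(1) assms by auto
      have "u i \<in> hom X W (Dom X q) \<and> q \<bullet>\<^bsub>X\<^esub> u i = u n" if "i < n" for i
        using u(1) u(2)[rule_format, of i n] assms un that by auto
      then have "\<exists>!h. h \<in> hom X W (Dom X b) \<and> b \<bullet>\<^bsub>X\<^esub> h = u n \<and> (\<forall>i<n. pr i \<bullet>\<^bsub>X\<^esub> h = u i)"
        by (intro is_fold_pullback_ex1[OF L W un]) simp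
      moreover have "(\<forall>j\<in>{..n}. ?e j \<bullet>\<^bsub>X\<^esub> h = u j) \<longleftrightarrow> b \<bullet>\<^bsub>X\<^esub> h = u n \<and> (\<forall>i<n. pr i \<bullet>\<^bsub>X\<^esub> h = u i)" for h
        unfolding ball by auto
      ultimately show "\<exists>!h. h \<in> hom X W (Dom X b) \<and> (\<forall>j\<in>{..n}. ?e j \<bullet>\<^bsub>X\<^esub> h = u j)" by simp
    qed (use L assms in \<open>auto simp: is_fold_pullback_def J split: if_splits\<close>)
  next
    assume R: ?R
    have e: "?e j \<in> hom X (Dom X b) (Dom X (?f j))" "?f j \<bullet>\<^bsub>X\<^esub> ?e j = ?f n \<bullet>\<^bsub>X\<^esub> ?e n" if "j \<le> n" for j
      using wide_pullbackD[OF R, of j] wide_pullback_cone(1)[OF R, of j n] that by auto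
    have b: "b \<in> Arr X" "Cod X b = Cod X q" using e(1)[of n] assms by auto
    show ?L unfolding is_fold_pullback_def
    proof (intro conjI ballI allI impI)
      fix i assume "i < n" then show "pr i \<in> hom X (Dom X b) (Dom X q)" "q \<bullet>\<^bsub>X\<^esub> pr i = b"
        using e[of i] b assms by auto
    next
      fix W w u assume W: "W \<in> Ob X" and w: "w \<in> hom X W (Cod X q)"
        and u: "\<forall>i<n. u i \<in> hom X W (Dom X q) \<and> q \<bullet>\<^bsub>X\<^esub> u i = w"
      let ?u = "fold_legs n w u"
      have "\<exists>!h. h \<in> hom X W (Dom X b) \<and> (\<forall>j\<in>{..n}. ?e j \<bullet>\<^bsub>X\<^esub> h = ?u j)"
        by (rule wide_pullback_ex1[OF R W]) (use u w assms in \<open>auto simp: J split: if_splits\<close>)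
      moreover have "(\<forall>j\<in>{..n}. ?e j \<bullet>\<^bsub>X\<^esub> h = ?u j) \<longleftrightarrow> b \<bullet>\<^bsub>X\<^esub> h = w \<and> (\<forall>i<n. pr i \<bullet>\<^bsub>X\<^esub> h = u i)" for h
        unfolding ball by auto
      ultimately show "\<exists>!h. h \<in> hom X W (Dom X b) \<and> b \<bullet>\<^bsub>X\<^esub> h = w \<and> (\<forall>i<n. pr i \<bullet>\<^bsub>X\<^esub> h = u i)" by simp
    qed (use assms b in auto)
  qed
qed

lemma is_pullback_iff_fold:
  assumes "q \<in> Arr X"
  shows "is_pullback X q q a b \<longleftrightarrow> a \<in> Arr X \<and> Cod X a = Dom X q \<and> is_fold_pullback X 2 q (q \<bullet>\<^bsub>X\<^esub> a) (two_legs a b)"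
proof -
  have all2: "(\<forall>i<2. P i) \<longleftrightarrow> P 0 \<and> P 1" for P :: "nat \<Rightarrow> bool"
    using less_2_cases_iff by auto
  have "is_fold_pullback X 2 q (q \<bullet>\<^bsub>X\<^esub> a) (two_legs a b)" if p: "is_pullback X q q a b"
    unfolding is_fold_pullback_def all2
  proof (intro conjI ballI allI impI)
    note d = is_pullbackD[OF p]
    fix W w and u :: "nat \<Rightarrow> 'a"
    assume W: "W \<in> Ob X" "w \<in> hom X W (Cod X q)"
      "(u 0 \<in> hom X W (Dom X q) \<and> q \<bullet>\<^bsub>X\<^esub> u 0 = w) \<and> (u 1 \<in> hom X W (Dom X q) \<and> q \<bullet>\<^bsub>X\<^esub> u 1 = w)"
    then have "\<exists>!h. h \<in> hom X W (Dom X a) \<and> a \<bullet>\<^bsub>X\<^esub> h = u 0 \<and> b \<bullet>\<^bsub>X\<^esub> h = u 1"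
      by (intro is_pullback_ex1[OF p]) auto
    moreover have "(h \<in> hom X W (Dom X (q \<bullet>\<^bsub>X\<^esub> a)) \<and> (q \<bullet>\<^bsub>X\<^esub> a) \<bullet>\<^bsub>X\<^esub> h = w \<and> a \<bullet>\<^bsub>X\<^esub> h = u 0 \<and> b \<bullet>\<^bsub>X\<^esub> h = u 1)
      \<longleftrightarrow> h \<in> hom X W (Dom X a) \<and> a \<bullet>\<^bsub>X\<^esub> h = u 0 \<and> b \<bullet>\<^bsub>X\<^esub> h = u 1" for h
    proof -
      have "(q \<bullet>\<^bsub>X\<^esub> a) \<bullet>\<^bsub>X\<^esub> h = w" if "h \<in> hom X W (Dom X a)" "a \<bullet>\<^bsub>X\<^esub> h = u 0"
        using d(1,4,7) that W by simp
      moreover have "Dom X (q \<bullet>\<^bsub>X\<^esub> a) = Dom X a" using d(1,4,7) by simp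
      ultimately show ?thesis by metis
    qed
    ultimately show "\<exists>!h. h \<in> hom X W (Dom X (q \<bullet>\<^bsub>X\<^esub> a)) \<and> (q \<bullet>\<^bsub>X\<^esub> a) \<bullet>\<^bsub>X\<^esub> h = w \<and>
      two_legs a b 0 \<bullet>\<^bsub>X\<^esub> h = u 0 \<and> two_legs a b 1 \<bullet>\<^bsub>X\<^esub> h = u 1" by simp
  qed (use is_pullbackD[OF p] in simp_all)
  moreover have "is_pullback X q q a b"
    if a: "a \<in> Arr X" "Cod X a = Dom X q" and p: "is_fold_pullback X 2 q (q \<bullet>\<^bsub>X\<^esub> a) (two_legs a b)"
    unfolding is_pullback_def
  proof (intro conjI ballI allI impI)
    fix W u v assume W: "W \<in> Ob X" "u \<in> hom X W (Dom X q)" "v \<in> hom X W (Dom X q)" "q \<bullet>\<^bsub>X\<^esub> u = q \<bullet>\<^bsub>X\<^esub> v"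
    have qa: "Dom X (q \<bullet>\<^bsub>X\<^esub> a) = Dom X a" using a assms by simp
    have w: "q \<bullet>\<^bsub>X\<^esub> u \<in> hom X W (Cod X q)" using W assms by simp
    have uv: "\<forall>i<2. two_legs u v i \<in> hom X W (Dom X q) \<and> q \<bullet>\<^bsub>X\<^esub> two_legs u v i = q \<bullet>\<^bsub>X\<^esub> u"
      using W unfolding all2 by simp
    have "\<exists>!h. h \<in> hom X W (Dom X (q \<bullet>\<^bsub>X\<^esub> a)) \<and> (q \<bullet>\<^bsub>X\<^esub> a) \<bullet>\<^bsub>X\<^esub> h = q \<bullet>\<^bsub>X\<^esub> u \<and>
      (\<forall>i<2. two_legs a b i \<bullet>\<^bsub>X\<^esub> h = two_legs u v i)"
      by (rule is_fold_pullback_ex1[OF p W(1) w uv])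
    moreover have "(h \<in> hom X W (Dom X (q \<bullet>\<^bsub>X\<^esub> a)) \<and> (q \<bullet>\<^bsub>X\<^esub> a) \<bullet>\<^bsub>X\<^esub> h = q \<bullet>\<^bsub>X\<^esub> u \<and>
      (\<forall>i<2. two_legs a b i \<bullet>\<^bsub>X\<^esub> h = two_legs u v i)) \<longleftrightarrow> h \<in> hom X W (Dom X a) \<and> a \<bullet>\<^bsub>X\<^esub> h = u \<and> b \<bullet>\<^bsub>X\<^esub> h = v" for h
    proof -
      have "(q \<bullet>\<^bsub>X\<^esub> a) \<bullet>\<^bsub>X\<^esub> h = q \<bullet>\<^bsub>X\<^esub> u" if "h \<in> hom X W (Dom X a)" "a \<bullet>\<^bsub>X\<^esub> h = u"
        unfolding that(2)[symmetric] using a assms that(1) by simp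
      then show ?thesis unfolding all2 qa by auto
    qed
    ultimately show "\<exists>!h. h \<in> hom X W (Dom X a) \<and> a \<bullet>\<^bsub>X\<^esub> h = u \<and> b \<bullet>\<^bsub>X\<^esub> h = v" by simp
  qed (use p a assms in \<open>auto simp: is_fold_pullback_def all2\<close>)
  ultimately show ?thesis using is_pullbackD[of q q a b] by metis
qed

end

section \<open>Tangent categories\<close>

text \<open>The cospan family \<open>f\<close> has a limit, and all powers of the tangent functor preserve its limits.
  This is what the axioms provide for the \<open>n\<close>-fold pullbacks of \<open>p\<close> and what a tangent display map
  provides for its pullbacks.\<close>

definition T_stable :: "('o, 'a, 'z) tcat_scheme \<Rightarrow> 'i set \<Rightarrow> ('i \<Rightarrow> 'a) \<Rightarrow> bool" where
  "T_stable X J f \<longleftrightarrow> (\<exists>L e. wide_pullback X J f L e) \<and>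
     (\<forall>L e m. wide_pullback X J f L e \<longrightarrow>
        wide_pullback X J (\<lambda>j. (Ta X ^^ m) (f j)) ((To X ^^ m) L) (\<lambda>j. (Ta X ^^ m) (e j)))"

lemma T_stableD:
  assumes "T_stable X J f" "wide_pullback X J f L e"
  shows "wide_pullback X J (\<lambda>j. (Ta X ^^ m) (f j)) ((To X ^^ m) L) (\<lambda>j. (Ta X ^^ m) (e j))"
    "wide_pullback X J (\<lambda>j. Ta X (f j)) (To X L) (\<lambda>j. Ta X (e j))"
    "wide_pullback X J (\<lambda>j. Ta X (Ta X (f j))) (To X (To X L)) (\<lambda>j. Ta X (Ta X (e j)))"
proof -
  have "wide_pullback X J (\<lambda>j. (Ta X ^^ m) (f j)) ((To X ^^ m) L) (\<lambda>j. (Ta X ^^ m) (e j))" for m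
    using assms unfolding T_stable_def by blast
  from this[of m] this[of 1] this[of 2]
  show "wide_pullback X J (\<lambda>j. (Ta X ^^ m) (f j)) ((To X ^^ m) L) (\<lambda>j. (Ta X ^^ m) (e j))"
    "wide_pullback X J (\<lambda>j. Ta X (f j)) (To X L) (\<lambda>j. Ta X (e j))"
    "wide_pullback X J (\<lambda>j. Ta X (Ta X (f j))) (To X (To X L)) (\<lambda>j. Ta X (Ta X (e j)))"
    by (simp_all add: eval_nat_numeral)
qed

lemma funcpow_legs: "(F ^^ m) (if c then a else b) = (if c then (F ^^ m) a else (F ^^ m) b)"
  by simp

locale tangent_on =
  fixes X :: "('o, 'a) tcat"
  assumes tangent_X: "tangent_category X"
begin

lemma tangent_unfolded:
  shows "category X" and "functorial X X (To X) (Ta X)"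
    and "A \<in> Ob X \<Longrightarrow> is_pullback X (tp X A) (tp X A) (tpi1 X A) (tpi2 X A)"
    and "A \<in> Ob X \<Longrightarrow> \<exists>b pr. is_fold_pullback X n (tp X A) b pr"
    and "A \<in> Ob X \<Longrightarrow> is_fold_pullback X n (tp X A) b pr \<Longrightarrow>
           is_fold_pullback X n ((Ta X ^^ m) (tp X A)) ((Ta X ^^ m) b) (\<lambda>i. (Ta X ^^ m) (pr i))"
    and "natural X X (To X) (Ta X) (\<lambda>A. A) (\<lambda>f. f) (tp X)"
    and "natural X X (\<lambda>A. A) (\<lambda>f. f) (To X) (Ta X) (tz X)"
    and "natural X X (T2o X) (T2a X) (To X) (Ta X) (ts X)"
    and "natural X X (To X) (Ta X) (\<lambda>A. To X (To X A)) (\<lambda>f. Ta X (Ta X f)) (tl X)"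
    and "natural X X (\<lambda>A. To X (To X A)) (\<lambda>f. Ta X (Ta X f))
                 (\<lambda>A. To X (To X A)) (\<lambda>f. Ta X (Ta X f)) (tc X)"
  using tangent_X unfolding tangent_category_def by blast+

lemma tangent_equations:
  assumes "A \<in> Ob X"
  shows "additive_bundle X (tp X A) (tpi1 X A) (tpi2 X A) (tz X A) (ts X A)"
    and "Ta X (tp X A) \<bullet>\<^bsub>X\<^esub> tl X A = tz X A \<bullet>\<^bsub>X\<^esub> tp X A"
    and "tl X A \<bullet>\<^bsub>X\<^esub> tz X A = Ta X (tz X A) \<bullet>\<^bsub>X\<^esub> tz X A"
    and "tl X A \<bullet>\<^bsub>X\<^esub> ts X A =
          Ta X (ts X A) \<bullet>\<^bsub>X\<^esub> pair_into X (Ta X (tpi1 X A)) (Ta X (tpi2 X A))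
                                (tl X A \<bullet>\<^bsub>X\<^esub> tpi1 X A) (tl X A \<bullet>\<^bsub>X\<^esub> tpi2 X A)"
    and "tp X (To X A) \<bullet>\<^bsub>X\<^esub> tc X A = Ta X (tp X A)"
    and "tc X A \<bullet>\<^bsub>X\<^esub> Ta X (tz X A) = tz X (To X A)"
    and "tc X A \<bullet>\<^bsub>X\<^esub> Ta X (ts X A) =
          ts X (To X A) \<bullet>\<^bsub>X\<^esub> pair_into X (tpi1 X (To X A)) (tpi2 X (To X A))
                                (tc X A \<bullet>\<^bsub>X\<^esub> Ta X (tpi1 X A)) (tc X A \<bullet>\<^bsub>X\<^esub> Ta X (tpi2 X A))"
    and "Ta X (tl X A) \<bullet>\<^bsub>X\<^esub> tl X A = tl X (To X A) \<bullet>\<^bsub>X\<^esub> tl X A"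
    and "tc X A \<bullet>\<^bsub>X\<^esub> tl X A = tl X A"
    and "tc X (To X A) \<bullet>\<^bsub>X\<^esub> (Ta X (tc X A) \<bullet>\<^bsub>X\<^esub> tl X (To X A)) = Ta X (tl X A) \<bullet>\<^bsub>X\<^esub> tc X A"
    and "tc X A \<bullet>\<^bsub>X\<^esub> tc X A = Ident X (To X (To X A))"
    and "Ta X (tc X A) \<bullet>\<^bsub>X\<^esub> (tc X (To X A) \<bullet>\<^bsub>X\<^esub> Ta X (tc X A)) =
          tc X (To X A) \<bullet>\<^bsub>X\<^esub> (Ta X (tc X A) \<bullet>\<^bsub>X\<^esub> tc X (To X A))"
    and "is_pullback X (tz X A) (Ta X (tp X A)) (tp X A \<bullet>\<^bsub>X\<^esub> tpi1 X A)
          (Ta X (ts X A) \<bullet>\<^bsub>X\<^esub> pair_into X (Ta X (tpi1 X A)) (Ta X (tpi2 X A))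
             (tz X (To X A) \<bullet>\<^bsub>X\<^esub> tpi1 X A) (tl X A \<bullet>\<^bsub>X\<^esub> tpi2 X A))"
  using tangent_X assms unfolding tangent_category_def by blast+

end

sublocale tangent_on \<subseteq> category_on X
  using tangent_unfolded(1) by unfold_locales

context tangent_on
begin

lemma To_Ob [simp]: "A \<in> Ob X \<Longrightarrow> To X A \<in> Ob X"
  and Ta_Arr [simp]: "f \<in> Arr X \<Longrightarrow> Ta X f \<in> Arr X"
  and Dom_Ta [simp]: "f \<in> Arr X \<Longrightarrow> Dom X (Ta X f) = To X (Dom X f)"
  and Cod_Ta [simp]: "f \<in> Arr X \<Longrightarrow> Cod X (Ta X f) = To X (Cod X f)"
  and Ta_Ident [simp]: "A \<in> Ob X \<Longrightarrow> Ta X (Ident X A) = Ident X (To X A)"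
  and Ta_Cmp [simp]: "\<lbrakk>f \<in> Arr X; g \<in> Arr X; Cod X f = Dom X g\<rbrakk> \<Longrightarrow>
    Ta X (g \<bullet>\<^bsub>X\<^esub> f) = Ta X g \<bullet>\<^bsub>X\<^esub> Ta X f"
  using tangent_unfolded(2) unfolding functorial_def by auto

lemma Ta_eq:
  "\<lbrakk>g \<bullet>\<^bsub>X\<^esub> f = k; f \<in> Arr X; g \<in> Arr X; Cod X f = Dom X g\<rbrakk> \<Longrightarrow> Ta X g \<bullet>\<^bsub>X\<^esub> Ta X f = Ta X k"
  using Ta_Cmp by metis

lemma T2o_Ob [simp]: "A \<in> Ob X \<Longrightarrow> T2o X A \<in> Ob X"
  and Dom_tpi1: "Dom X (tpi1 X A) = T2o X A"
  using tangent_unfolded(3)[of A] by (auto simp: T2o_def is_pullbackD)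

lemma structure_Arr [simp]:
  assumes "A \<in> Ob X"
  shows "tp X A \<in> Arr X" "Dom X (tp X A) = To X A" "Cod X (tp X A) = A"
    "tz X A \<in> Arr X" "Dom X (tz X A) = A" "Cod X (tz X A) = To X A"
    "ts X A \<in> Arr X" "Dom X (ts X A) = T2o X A" "Cod X (ts X A) = To X A"
    "tl X A \<in> Arr X" "Dom X (tl X A) = To X A" "Cod X (tl X A) = To X (To X A)"
    "tc X A \<in> Arr X" "Dom X (tc X A) = To X (To X A)" "Cod X (tc X A) = To X (To X A)"
    "tpi1 X A \<in> Arr X" "Dom X (tpi1 X A) = T2o X A" "Cod X (tpi1 X A) = To X A"
    "tpi2 X A \<in> Arr X" "Dom X (tpi2 X A) = T2o X A" "Cod X (tpi2 X A) = To X A"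
proof -
  show 1: "tp X A \<in> Arr X" "Dom X (tp X A) = To X A" "Cod X (tp X A) = A"
    using tangent_unfolded(6) assms unfolding natural_def by auto
  show "tz X A \<in> Arr X" "Dom X (tz X A) = A" "Cod X (tz X A) = To X A"
    using tangent_unfolded(7) assms unfolding natural_def by auto
  show "ts X A \<in> Arr X" "Dom X (ts X A) = T2o X A" "Cod X (ts X A) = To X A"
    using tangent_unfolded(8) assms unfolding natural_def by auto
  show "tl X A \<in> Arr X" "Dom X (tl X A) = To X A" "Cod X (tl X A) = To X (To X A)"
    using tangent_unfolded(9) assms unfolding natural_def by auto
  show "tc X A \<in> Arr X" "Dom X (tc X A) = To X (To X A)" "Cod X (tc X A) = To X (To X A)"
    using tangent_unfolded(10) assms unfolding natural_def by auto
  show "tpi1 X A \<in> Arr X" "Dom X (tpi1 X A) = T2o X A" "Cod X (tpi1 X A) = To X A"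
    "tpi2 X A \<in> Arr X" "Dom X (tpi2 X A) = T2o X A" "Cod X (tpi2 X A) = To X A"
    using is_pullbackD[OF tangent_unfolded(3)[OF assms]] 1 by (auto simp: T2o_def)
qed

lemma tp_nat: "\<lbrakk>f \<in> Arr X; Cod X f = B\<rbrakk> \<Longrightarrow> tp X B \<bullet>\<^bsub>X\<^esub> Ta X f = f \<bullet>\<^bsub>X\<^esub> tp X (Dom X f)"
  and tz_nat: "\<lbrakk>f \<in> Arr X; Cod X f = B\<rbrakk> \<Longrightarrow> tz X B \<bullet>\<^bsub>X\<^esub> f = Ta X f \<bullet>\<^bsub>X\<^esub> tz X (Dom X f)"
  and tl_nat: "\<lbrakk>f \<in> Arr X; Cod X f = B\<rbrakk> \<Longrightarrow> tl X B \<bullet>\<^bsub>X\<^esub> Ta X f = Ta X (Ta X f) \<bullet>\<^bsub>X\<^esub> tl X (Dom X f)"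
  and tc_nat: "\<lbrakk>f \<in> Arr X; Cod X f = B\<rbrakk> \<Longrightarrow>
    tc X B \<bullet>\<^bsub>X\<^esub> Ta X (Ta X f) = Ta X (Ta X f) \<bullet>\<^bsub>X\<^esub> tc X (Dom X f)"
  and ts_nat: "\<lbrakk>f \<in> Arr X; Cod X f = B\<rbrakk> \<Longrightarrow> ts X B \<bullet>\<^bsub>X\<^esub> T2a X f = Ta X f \<bullet>\<^bsub>X\<^esub> ts X (Dom X f)"
  using tangent_unfolded(6-10) unfolding natural_def by blast+

lemmas tpi_pullback = tangent_unfolded(3)

lemma Ta_pow [simp]:
  assumes "f \<in> Arr X"
  shows "(Ta X ^^ m) f \<in> Arr X" "Dom X ((Ta X ^^ m) f) = (To X ^^ m) (Dom X f)"
    "Cod X ((Ta X ^^ m) f) = (To X ^^ m) (Cod X f)"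
  by (induction m) (use assms in auto)

lemma To_pow [simp]: "A \<in> Ob X \<Longrightarrow> (To X ^^ m) A \<in> Ob X"
  by (induction m) auto

lemma Ta_pow_Ident [simp]: "A \<in> Ob X \<Longrightarrow> (Ta X ^^ m) (Ident X A) = Ident X ((To X ^^ m) A)"
  by (induction m) auto

lemma Ta_pow_Cmp: "\<lbrakk>f \<in> Arr X; g \<in> Arr X; Cod X f = Dom X g\<rbrakk> \<Longrightarrow>
    (Ta X ^^ m) (g \<bullet>\<^bsub>X\<^esub> f) = (Ta X ^^ m) g \<bullet>\<^bsub>X\<^esub> (Ta X ^^ m) f"
  by (induction m) auto

lemma T_stable_fold:
  assumes A: "A \<in> Ob X"
  shows "T_stable X {..n} (fold_legs n (Ident X A) (\<lambda>_. tp X A))"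
  unfolding T_stable_def
proof (intro conjI allI impI)
  let ?f = "fold_legs n (Ident X A) (\<lambda>_. tp X A)"
  obtain b pr where "is_fold_pullback X n (tp X A) b pr" using tangent_unfolded(4) A by blast
  then show "\<exists>L e. wide_pullback X {..n} ?f L e"
    using is_fold_pullback_iff_wide[of "tp X A" n b pr] A unfolding structure_Arr(3)[OF A] by auto
  fix L e m assume w: "wide_pullback X {..n} ?f L e"
  have w': "wide_pullback X {..n} ?f L (fold_legs n (e n) e)"
    by (rule wide_pullback_eq_on[OF w]) auto
  have L: "Dom X (e n) = L" and en: "e n \<in> Arr X" using wide_pullbackD[OF w, of n] by auto
  have "is_fold_pullback X n (tp X A) (e n) e"
    using is_fold_pullback_iff_wide[of "tp X A" n "e n" e] A w' L unfolding structure_Arr(3)[OF A] by auto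
  from tangent_unfolded(5)[OF A this, of m]
  have "wide_pullback X {..n} (fold_legs n (Ident X ((To X ^^ m) A)) (\<lambda>_. (Ta X ^^ m) (tp X A)))
    ((To X ^^ m) L) (fold_legs n ((Ta X ^^ m) (e n)) (\<lambda>i. (Ta X ^^ m) (e i)))"
    using is_fold_pullback_iff_wide[of "(Ta X ^^ m) (tp X A)"] A L en
    unfolding Ta_pow(3)[OF structure_Arr(1)[OF A]] structure_Arr(3)[OF A] by auto
  then show "wide_pullback X {..n} (\<lambda>j. (Ta X ^^ m) (?f j)) ((To X ^^ m) L) (\<lambda>j. (Ta X ^^ m) (e j))"
    by (rule wide_pullback_eq_on) (use A in auto)
qed

lemma tpi_pullback_pow:
  assumes A: "A \<in> Ob X"
  shows "is_pullback X ((Ta X ^^ m) (tp X A)) ((Ta X ^^ m) (tp X A))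
    ((Ta X ^^ m) (tpi1 X A)) ((Ta X ^^ m) (tpi2 X A))"
proof -
  have "is_fold_pullback X 2 (tp X A) (tp X A \<bullet>\<^bsub>X\<^esub> tpi1 X A) (two_legs (tpi1 X A) (tpi2 X A))"
    using tpi_pullback[OF A] is_pullback_iff_fold[of "tp X A"] A by auto
  from tangent_unfolded(5)[OF A this, of m]
  show ?thesis
    using is_pullback_iff_fold[of "(Ta X ^^ m) (tp X A)"] A by (simp add: Ta_pow_Cmp funcpow_legs)
qed

lemma tpi_pullback_Ta:
  assumes "A \<in> Ob X"
  shows "is_pullback X (Ta X (tp X A)) (Ta X (tp X A)) (Ta X (tpi1 X A)) (Ta X (tpi2 X A))"
    "is_pullback X (Ta X (Ta X (tp X A))) (Ta X (Ta X (tp X A)))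
       (Ta X (Ta X (tpi1 X A))) (Ta X (Ta X (tpi2 X A)))"
  using tpi_pullback_pow[OF assms, of 1] tpi_pullback_pow[OF assms, of 2]
  by (simp_all add: eval_nat_numeral)

lemma tp_tpi: "A \<in> Ob X \<Longrightarrow> tp X A \<bullet>\<^bsub>X\<^esub> tpi1 X A = tp X A \<bullet>\<^bsub>X\<^esub> tpi2 X A"
  using is_pullbackD(9)[OF tpi_pullback] .

subsection \<open>The functor of pairs of tangent vectors\<close>

lemma T2a_wf:
  assumes "f \<in> Arr X"
  shows "tp X (Cod X f) \<bullet>\<^bsub>X\<^esub> (Ta X f \<bullet>\<^bsub>X\<^esub> tpi1 X (Dom X f)) = tp X (Cod X f) \<bullet>\<^bsub>X\<^esub> (Ta X f \<bullet>\<^bsub>X\<^esub> tpi2 X (Dom X f))"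
  using assms by (simp add: tp_nat[THEN Cmp_eq_extend] tp_tpi)

lemma T2a_Arr [simp]:
  assumes "f \<in> Arr X"
  shows "T2a X f \<in> Arr X" "Dom X (T2a X f) = T2o X (Dom X f)" "Cod X (T2a X f) = T2o X (Cod X f)"
  using is_pullback_lift[OF tpi_pullback[of "Cod X f"] _ _ _ _ _ T2a_wf[OF assms]] assms
  unfolding T2a_def by simp_all

lemma tpi_nat:
  assumes "f \<in> Arr X" "Cod X f = B"
  shows "tpi1 X B \<bullet>\<^bsub>X\<^esub> T2a X f = Ta X f \<bullet>\<^bsub>X\<^esub> tpi1 X (Dom X f)"
    "tpi2 X B \<bullet>\<^bsub>X\<^esub> T2a X f = Ta X f \<bullet>\<^bsub>X\<^esub> tpi2 X (Dom X f)"
  using is_pullback_lift[OF tpi_pullback[of "Cod X f"] _ _ _ _ _ T2a_wf[OF assms(1)]] assms(1)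
  unfolding T2a_def assms(2)[symmetric] by simp_all

lemma tpi_monic:
  assumes "x \<in> Arr X" "y \<in> Arr X" "Dom X x = Dom X y" "Cod X x = T2o X A" "Cod X y = T2o X A" "A \<in> Ob X"
    "tpi1 X A \<bullet>\<^bsub>X\<^esub> x = tpi1 X A \<bullet>\<^bsub>X\<^esub> y" "tpi2 X A \<bullet>\<^bsub>X\<^esub> x = tpi2 X A \<bullet>\<^bsub>X\<^esub> y"
  shows "x = y"
  by (rule is_pullback_monic[OF tpi_pullback]) (use assms in auto)

lemma tpi_Ta_monic:
  assumes "x \<in> Arr X" "y \<in> Arr X" "Dom X x = Dom X y" "Cod X x = To X (T2o X A)" "Cod X y = To X (T2o X A)"
    "A \<in> Ob X" "Ta X (tpi1 X A) \<bullet>\<^bsub>X\<^esub> x = Ta X (tpi1 X A) \<bullet>\<^bsub>X\<^esub> y"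
    "Ta X (tpi2 X A) \<bullet>\<^bsub>X\<^esub> x = Ta X (tpi2 X A) \<bullet>\<^bsub>X\<^esub> y"
  shows "x = y"
  by (rule is_pullback_monic[OF tpi_pullback_Ta(1)[of A]]) (use assms in auto)

lemma T2a_Ident [simp]: "A \<in> Ob X \<Longrightarrow> T2a X (Ident X A) = Ident X (T2o X A)"
  by (rule tpi_monic[of _ _ A]) (auto simp: tpi_nat)

lemma T2a_Cmp [simp]:
  "\<lbrakk>f \<in> Arr X; g \<in> Arr X; Cod X f = Dom X g\<rbrakk> \<Longrightarrow> T2a X (g \<bullet>\<^bsub>X\<^esub> f) = T2a X g \<bullet>\<^bsub>X\<^esub> T2a X f"
  by (rule tpi_monic[of _ _ "Cod X g"]) (auto simp: tpi_nat tpi_nat[THEN Cmp_eq_extend])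

subsection \<open>Consequences of the axioms\<close>

lemma tc_tc: "\<lbrakk>x \<in> Arr X; Cod X x = To X (To X A); A \<in> Ob X\<rbrakk> \<Longrightarrow> tc X A \<bullet>\<^bsub>X\<^esub> (tc X A \<bullet>\<^bsub>X\<^esub> x) = x"
  using Cmp_eq_extend[OF tangent_equations(11)[of A]] by simp

lemma Ta_tc_tc: "\<lbrakk>x \<in> Arr X; Cod X x = To X (To X (To X A)); A \<in> Ob X\<rbrakk> \<Longrightarrow>
  Ta X (tc X A) \<bullet>\<^bsub>X\<^esub> (Ta X (tc X A) \<bullet>\<^bsub>X\<^esub> x) = x"
  using Cmp_eq_extend[OF Ta_eq[OF tangent_equations(11)[of A]], of x] by simp

text \<open>The tuple of the axiom on sums is any arrow with its projections.\<close>

lemma tc_ts: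
  assumes "A \<in> Ob X" "k \<in> Arr X" "Cod X k = T2o X (To X A)"
    "tpi1 X (To X A) \<bullet>\<^bsub>X\<^esub> k = tc X A \<bullet>\<^bsub>X\<^esub> Ta X (tpi1 X A)"
    "tpi2 X (To X A) \<bullet>\<^bsub>X\<^esub> k = tc X A \<bullet>\<^bsub>X\<^esub> Ta X (tpi2 X A)"
  shows "tc X A \<bullet>\<^bsub>X\<^esub> Ta X (ts X A) = ts X (To X A) \<bullet>\<^bsub>X\<^esub> k"
  using pair_into_eqI[OF tpi_pullback[of "To X A"] assms(2) _ assms(4,5)] assms
    tangent_equations(7)[OF assms(1)] by simp

lemma Ta_tp_tc: "A \<in> Ob X \<Longrightarrow> Ta X (tp X A) \<bullet>\<^bsub>X\<^esub> tc X A = tp X (To X A)"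
  using Cmp_eq_extend[OF tangent_equations(5)[of A], of "tc X A"] tangent_equations(11)[of A] by simp

lemma tl_tc: "A \<in> Ob X \<Longrightarrow>
  tl X (To X A) \<bullet>\<^bsub>X\<^esub> tc X A = Ta X (tc X A) \<bullet>\<^bsub>X\<^esub> (tc X (To X A) \<bullet>\<^bsub>X\<^esub> Ta X (tl X A))"
proof -
  assume A: "A \<in> Ob X"
  have "Ta X (tc X A) \<bullet>\<^bsub>X\<^esub> (tc X (To X A) \<bullet>\<^bsub>X\<^esub> (Ta X (tl X A) \<bullet>\<^bsub>X\<^esub> (tc X A \<bullet>\<^bsub>X\<^esub> tc X A))) =
     tl X (To X A) \<bullet>\<^bsub>X\<^esub> tc X A"
    using A by (simp add: tangent_equations(10)[of A, symmetric, THEN Cmp_eq_extend] tc_tc Ta_tc_tc del: Cmp_Ident_right)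
  then show ?thesis using A tangent_equations(11)[of A] by simp
qed

text \<open>The interchange \<open>T T\<^sub>2 A \<rightarrow> T\<^sub>2 T A\<close> of a tangent vector of a pair with a pair of tangent vectors.\<close>

definition T2_flip :: "'o \<Rightarrow> 'a" where
  "T2_flip A = pair_into X (tpi1 X (To X A)) (tpi2 X (To X A))
     (tc X A \<bullet>\<^bsub>X\<^esub> Ta X (tpi1 X A)) (tc X A \<bullet>\<^bsub>X\<^esub> Ta X (tpi2 X A))"

lemma T2_flip:
  assumes "A \<in> Ob X"
  shows "T2_flip A \<in> Arr X" "Dom X (T2_flip A) = To X (T2o X A)" "Cod X (T2_flip A) = T2o X (To X A)"
    "tpi1 X (To X A) \<bullet>\<^bsub>X\<^esub> T2_flip A = tc X A \<bullet>\<^bsub>X\<^esub> Ta X (tpi1 X A)"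
    "tpi2 X (To X A) \<bullet>\<^bsub>X\<^esub> T2_flip A = tc X A \<bullet>\<^bsub>X\<^esub> Ta X (tpi2 X A)"
    "tc X A \<bullet>\<^bsub>X\<^esub> Ta X (ts X A) = ts X (To X A) \<bullet>\<^bsub>X\<^esub> T2_flip A"
proof -
  have e: "tp X (To X A) \<bullet>\<^bsub>X\<^esub> (tc X A \<bullet>\<^bsub>X\<^esub> Ta X (tpi1 X A)) = tp X (To X A) \<bullet>\<^bsub>X\<^esub> (tc X A \<bullet>\<^bsub>X\<^esub> Ta X (tpi2 X A))"
    using assms is_pullbackD(9)[OF tpi_pullback_Ta(1)[OF assms]]
    by (simp add: tangent_equations(5)[THEN Cmp_eq_extend])
  note l = is_pullback_lift[OF tpi_pullback[of "To X A"] _ _ _ _ _ e]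
  show "T2_flip A \<in> Arr X" "Dom X (T2_flip A) = To X (T2o X A)" "Cod X (T2_flip A) = T2o X (To X A)"
    "tpi1 X (To X A) \<bullet>\<^bsub>X\<^esub> T2_flip A = tc X A \<bullet>\<^bsub>X\<^esub> Ta X (tpi1 X A)"
    "tpi2 X (To X A) \<bullet>\<^bsub>X\<^esub> T2_flip A = tc X A \<bullet>\<^bsub>X\<^esub> Ta X (tpi2 X A)"
    using l assms unfolding T2_flip_def by simp_all
  then show "tc X A \<bullet>\<^bsub>X\<^esub> Ta X (ts X A) = ts X (To X A) \<bullet>\<^bsub>X\<^esub> T2_flip A"
    using assms by (intro tc_ts) auto
qed

definition lift_pair :: "'o \<Rightarrow> 'a" where
  "lift_pair A = pair_into X (Ta X (tpi1 X A)) (Ta X (tpi2 X A))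
             (tz X (To X A) \<bullet>\<^bsub>X\<^esub> tpi1 X A) (tl X A \<bullet>\<^bsub>X\<^esub> tpi2 X A)"

lemma lift_pair:
  assumes "A \<in> Ob X"
  shows "lift_pair A \<in> Arr X" "Dom X (lift_pair A) = T2o X A" "Cod X (lift_pair A) = To X (T2o X A)"
    "Ta X (tpi1 X A) \<bullet>\<^bsub>X\<^esub> lift_pair A = tz X (To X A) \<bullet>\<^bsub>X\<^esub> tpi1 X A"
    "Ta X (tpi2 X A) \<bullet>\<^bsub>X\<^esub> lift_pair A = tl X A \<bullet>\<^bsub>X\<^esub> tpi2 X A"
proof -
  have n: "Ta X (tp X A) \<bullet>\<^bsub>X\<^esub> tz X (To X A) = tz X A \<bullet>\<^bsub>X\<^esub> tp X A"
    using tz_nat[of "tp X A" A] assms by simp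
  have "Ta X (tp X A) \<bullet>\<^bsub>X\<^esub> (tz X (To X A) \<bullet>\<^bsub>X\<^esub> tpi1 X A) = Ta X (tp X A) \<bullet>\<^bsub>X\<^esub> (tl X A \<bullet>\<^bsub>X\<^esub> tpi2 X A)"
    using assms by (simp add: tangent_equations(2)[THEN Cmp_eq_extend] Cmp_eq_extend[OF n] tp_tpi)
  note l = is_pullback_lift[OF tpi_pullback_Ta(1)[of A] _ _ _ _ _ this]
  show "lift_pair A \<in> Arr X" "Dom X (lift_pair A) = T2o X A" "Cod X (lift_pair A) = To X (T2o X A)"
    "Ta X (tpi1 X A) \<bullet>\<^bsub>X\<^esub> lift_pair A = tz X (To X A) \<bullet>\<^bsub>X\<^esub> tpi1 X A"
    "Ta X (tpi2 X A) \<bullet>\<^bsub>X\<^esub> lift_pair A = tl X A \<bullet>\<^bsub>X\<^esub> tpi2 X A"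
    using l assms unfolding lift_pair_def by simp_all
qed

text \<open>The flip \<open>c\<close> carries the image under \<open>T\<close> of the pair of arrows that expresses the
  universality of the vertical lift at \<open>A\<close> to the pair at \<open>T A\<close>. Since \<open>c\<close> is invertible and the pair
  at \<open>T A\<close> has a universal property, the image under \<open>T\<close> is jointly monic, although the axioms do not
  ask \<open>T\<close> to preserve this pullback.\<close>

lemma vertical_lift_Ta_monic:
  assumes A: "A \<in> Ob X" and x: "x \<in> Arr X" "y \<in> Arr X" "Dom X x = Dom X y" "Cod X x = To X (T2o X A)"
    "Cod X y = To X (T2o X A)"
    and e1: "Ta X (tp X A \<bullet>\<^bsub>X\<^esub> tpi1 X A) \<bullet>\<^bsub>X\<^esub> x = Ta X (tp X A \<bullet>\<^bsub>X\<^esub> tpi1 X A) \<bullet>\<^bsub>X\<^esub> y"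
    and e2: "Ta X (Ta X (ts X A) \<bullet>\<^bsub>X\<^esub> lift_pair A) \<bullet>\<^bsub>X\<^esub> x = Ta X (Ta X (ts X A) \<bullet>\<^bsub>X\<^esub> lift_pair A) \<bullet>\<^bsub>X\<^esub> y"
  shows "x = y"
proof -
  let ?B = "To X A"
  let ?xi = "Ta X (ts X ?B) \<bullet>\<^bsub>X\<^esub> lift_pair ?B"
  note [simp] = T2_flip(1-3)[OF A] lift_pair(1-3)[OF A] lift_pair(1-3)[of ?B]
  \<comment> \<open>checked after each projection, by naturality of \<open>z\<close>, respectively by \<open>l c = T c c T l\<close>\<close>
  have pre: "lift_pair ?B \<bullet>\<^bsub>X\<^esub> T2_flip A =
     Ta X (T2_flip A) \<bullet>\<^bsub>X\<^esub> (tc X (T2o X A) \<bullet>\<^bsub>X\<^esub> Ta X (lift_pair A))"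
  proof (rule tpi_Ta_monic[of _ _ ?B])
    note f = Ta_eq[OF T2_flip(4)[OF A]] Ta_eq[OF T2_flip(5)[OF A]]
    note g = Ta_eq[OF lift_pair(4)[OF A]] Ta_eq[OF lift_pair(5)[OF A]]
    show "Ta X (tpi1 X ?B) \<bullet>\<^bsub>X\<^esub> (lift_pair ?B \<bullet>\<^bsub>X\<^esub> T2_flip A) =
      Ta X (tpi1 X ?B) \<bullet>\<^bsub>X\<^esub> (Ta X (T2_flip A) \<bullet>\<^bsub>X\<^esub> (tc X (T2o X A) \<bullet>\<^bsub>X\<^esub> Ta X (lift_pair A)))"
      (is "?l = ?r")
    proof -
      have "?l = tz X (To X ?B) \<bullet>\<^bsub>X\<^esub> (tc X A \<bullet>\<^bsub>X\<^esub> Ta X (tpi1 X A))"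
        using A by (simp add: lift_pair(4)[THEN Cmp_eq_extend] T2_flip(4))
      also have "\<dots> = Ta X (tc X A) \<bullet>\<^bsub>X\<^esub> (tz X (To X ?B) \<bullet>\<^bsub>X\<^esub> Ta X (tpi1 X A))"
        using A by (simp add: tz_nat[THEN Cmp_eq_extend, of "tc X A"])
      also have "\<dots> = Ta X (tc X A) \<bullet>\<^bsub>X\<^esub> (tc X ?B \<bullet>\<^bsub>X\<^esub> (Ta X (tz X ?B) \<bullet>\<^bsub>X\<^esub> Ta X (tpi1 X A)))"
        using A by (simp add: tangent_equations(6)[of ?B, THEN Cmp_eq_extend])
      also have "\<dots> = Ta X (tc X A) \<bullet>\<^bsub>X\<^esub> (tc X ?B \<bullet>\<^bsub>X\<^esub> (Ta X (Ta X (tpi1 X A)) \<bullet>\<^bsub>X\<^esub> Ta X (lift_pair A)))"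
        using A g(1) by simp
      also have "\<dots> = ?r"
        using A by (simp add: f(1)[THEN Cmp_eq_extend] tc_nat[THEN Cmp_eq_extend])
      finally show ?thesis .
    qed
    show "Ta X (tpi2 X ?B) \<bullet>\<^bsub>X\<^esub> (lift_pair ?B \<bullet>\<^bsub>X\<^esub> T2_flip A) =
      Ta X (tpi2 X ?B) \<bullet>\<^bsub>X\<^esub> (Ta X (T2_flip A) \<bullet>\<^bsub>X\<^esub> (tc X (T2o X A) \<bullet>\<^bsub>X\<^esub> Ta X (lift_pair A)))"
      (is "?l = ?r")
    proof -
      have "?l = tl X ?B \<bullet>\<^bsub>X\<^esub> (tc X A \<bullet>\<^bsub>X\<^esub> Ta X (tpi2 X A))"
        using A by (simp add: lift_pair(5)[THEN Cmp_eq_extend] T2_flip(5))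
      also have "\<dots> = Ta X (tc X A) \<bullet>\<^bsub>X\<^esub> (tc X ?B \<bullet>\<^bsub>X\<^esub> (Ta X (tl X A) \<bullet>\<^bsub>X\<^esub> Ta X (tpi2 X A)))"
        using A by (simp add: tl_tc[THEN Cmp_eq_extend])
      also have "\<dots> = Ta X (tc X A) \<bullet>\<^bsub>X\<^esub> (tc X ?B \<bullet>\<^bsub>X\<^esub> (Ta X (Ta X (tpi2 X A)) \<bullet>\<^bsub>X\<^esub> Ta X (lift_pair A)))"
        using A g(2) by simp
      also have "\<dots> = ?r"
        using A by (simp add: f(2)[THEN Cmp_eq_extend] tc_nat[THEN Cmp_eq_extend])
      finally show ?thesis .
    qed
  qed (use A in auto)
  have xi: "?xi \<bullet>\<^bsub>X\<^esub> T2_flip A =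
     Ta X (tc X A) \<bullet>\<^bsub>X\<^esub> (tc X ?B \<bullet>\<^bsub>X\<^esub> Ta X (Ta X (ts X A) \<bullet>\<^bsub>X\<^esub> lift_pair A))"
    using A
    by (simp add: pre tc_nat[THEN Cmp_eq_extend] Cmp_eq_extend[OF Ta_eq[OF T2_flip(6)[OF A, symmetric]]])
  have "T2_flip A \<bullet>\<^bsub>X\<^esub> x = T2_flip A \<bullet>\<^bsub>X\<^esub> y"
  proof (rule is_pullback_monic[OF tangent_equations(13)[of ?B, folded lift_pair_def]])
    have p: "(tp X ?B \<bullet>\<^bsub>X\<^esub> tpi1 X ?B) \<bullet>\<^bsub>X\<^esub> (T2_flip A \<bullet>\<^bsub>X\<^esub> w) = Ta X (tp X A \<bullet>\<^bsub>X\<^esub> tpi1 X A) \<bullet>\<^bsub>X\<^esub> w"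
      if "w \<in> Arr X" "Cod X w = To X (T2o X A)" for w
      using A that by (simp add: T2_flip(4)[THEN Cmp_eq_extend] tangent_equations(5)[THEN Cmp_eq_extend])
    show "(tp X ?B \<bullet>\<^bsub>X\<^esub> tpi1 X ?B) \<bullet>\<^bsub>X\<^esub> (T2_flip A \<bullet>\<^bsub>X\<^esub> x) = (tp X ?B \<bullet>\<^bsub>X\<^esub> tpi1 X ?B) \<bullet>\<^bsub>X\<^esub> (T2_flip A \<bullet>\<^bsub>X\<^esub> y)"
      using p[of x] p[of y] x e1 by simp
    have q: "?xi \<bullet>\<^bsub>X\<^esub> (T2_flip A \<bullet>\<^bsub>X\<^esub> w) =
       Ta X (tc X A) \<bullet>\<^bsub>X\<^esub> (tc X ?B \<bullet>\<^bsub>X\<^esub> (Ta X (Ta X (ts X A) \<bullet>\<^bsub>X\<^esub> lift_pair A) \<bullet>\<^bsub>X\<^esub> w))"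
      if "w \<in> Arr X" "Cod X w = To X (T2o X A)" for w
      using Cmp_eq_extend[OF xi, of w] A that by simp
    show "?xi \<bullet>\<^bsub>X\<^esub> (T2_flip A \<bullet>\<^bsub>X\<^esub> x) = ?xi \<bullet>\<^bsub>X\<^esub> (T2_flip A \<bullet>\<^bsub>X\<^esub> y)"
      using q[of x] q[of y] x e2 by simp
  qed (use A x in auto)
  then have "tpi1 X ?B \<bullet>\<^bsub>X\<^esub> (T2_flip A \<bullet>\<^bsub>X\<^esub> x) = tpi1 X ?B \<bullet>\<^bsub>X\<^esub> (T2_flip A \<bullet>\<^bsub>X\<^esub> y)"
    "tpi2 X ?B \<bullet>\<^bsub>X\<^esub> (T2_flip A \<bullet>\<^bsub>X\<^esub> x) = tpi2 X ?B \<bullet>\<^bsub>X\<^esub> (T2_flip A \<bullet>\<^bsub>X\<^esub> y)" by simp_all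
  then have "tc X A \<bullet>\<^bsub>X\<^esub> (Ta X (tpi1 X A) \<bullet>\<^bsub>X\<^esub> x) = tc X A \<bullet>\<^bsub>X\<^esub> (Ta X (tpi1 X A) \<bullet>\<^bsub>X\<^esub> y)"
    "tc X A \<bullet>\<^bsub>X\<^esub> (Ta X (tpi2 X A) \<bullet>\<^bsub>X\<^esub> x) = tc X A \<bullet>\<^bsub>X\<^esub> (Ta X (tpi2 X A) \<bullet>\<^bsub>X\<^esub> y)"
    using A x by (simp_all add: T2_flip(4,5)[THEN Cmp_eq_extend])
  then have "tc X A \<bullet>\<^bsub>X\<^esub> (tc X A \<bullet>\<^bsub>X\<^esub> (Ta X (tpi1 X A) \<bullet>\<^bsub>X\<^esub> x)) = tc X A \<bullet>\<^bsub>X\<^esub> (tc X A \<bullet>\<^bsub>X\<^esub> (Ta X (tpi1 X A) \<bullet>\<^bsub>X\<^esub> y))"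
    "tc X A \<bullet>\<^bsub>X\<^esub> (tc X A \<bullet>\<^bsub>X\<^esub> (Ta X (tpi2 X A) \<bullet>\<^bsub>X\<^esub> x)) = tc X A \<bullet>\<^bsub>X\<^esub> (tc X A \<bullet>\<^bsub>X\<^esub> (Ta X (tpi2 X A) \<bullet>\<^bsub>X\<^esub> y))"
    by simp_all
  then have "Ta X (tpi1 X A) \<bullet>\<^bsub>X\<^esub> x = Ta X (tpi1 X A) \<bullet>\<^bsub>X\<^esub> y"
    "Ta X (tpi2 X A) \<bullet>\<^bsub>X\<^esub> x = Ta X (tpi2 X A) \<bullet>\<^bsub>X\<^esub> y"
    using A x by (simp_all add: tc_tc)
  then show ?thesis by (rule tpi_Ta_monic[OF x A])
qed

end

section \<open>Lax tangent morphisms\<close>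

lemma lmor_ext:
  assumes "fobj F \<in> extensional S" "fobj G \<in> extensional S" "farr F \<in> extensional T" "farr G \<in> extensional T"
    "lstr F \<in> extensional S" "lstr G \<in> extensional S"
    and "\<And>A. A \<in> S \<Longrightarrow> fobj F A = fobj G A" "\<And>f. f \<in> T \<Longrightarrow> farr F f = farr G f" "\<And>A. A \<in> S \<Longrightarrow> lstr F A = lstr G A"
  shows "F = (G :: ('o, 'a, 'o2, 'a2) lmor)"
  using assms by (cases F; cases G) (auto intro!: extensionalityI)

lemma nt_ext:
  assumes "nsrc \<phi> = nsrc \<psi>" "ntgt \<phi> = ntgt \<psi>" "ncmp \<phi> \<in> extensional S" "ncmp \<psi> \<in> extensional S"
    "\<And>A. A \<in> S \<Longrightarrow> ncmp \<phi> A = ncmp \<psi> A"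
  shows "\<phi> = (\<psi> :: ('f, 'o, 'a) nt)"
  using assms by (cases \<phi>; cases \<psi>) (auto intro!: extensionalityI)

locale tangent_pair = X: tangent_on X + Y: tangent_on Y
  for X :: "('o, 'a) tcat" and Y :: "('o2, 'a2) tcat"
begin

lemma lax_typing [simp]:
  assumes "lax_tangent_morphism X Y F"
  shows "A \<in> Ob X \<Longrightarrow> fobj F A \<in> Ob Y"
    "f \<in> Arr X \<Longrightarrow> farr F f \<in> Arr Y"
    "f \<in> Arr X \<Longrightarrow> Dom Y (farr F f) = fobj F (Dom X f)"
    "f \<in> Arr X \<Longrightarrow> Cod Y (farr F f) = fobj F (Cod X f)"
    "A \<in> Ob X \<Longrightarrow> farr F (Ident X A) = Ident Y (fobj F A)"
    "\<lbrakk>f \<in> Arr X; g \<in> Arr X; Cod X f = Dom X g\<rbrakk> \<Longrightarrow> farr F (g \<bullet>\<^bsub>X\<^esub> f) = farr F g \<bullet>\<^bsub>Y\<^esub> farr F f"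
    "A \<in> Ob X \<Longrightarrow> lstr F A \<in> Arr Y"
    "A \<in> Ob X \<Longrightarrow> Dom Y (lstr F A) = fobj F (To X A)"
    "A \<in> Ob X \<Longrightarrow> Cod Y (lstr F A) = To Y (fobj F A)"
proof -
  have "functorial X Y (fobj F) (farr F)"
    and "natural X Y (\<lambda>A. fobj F (To X A)) (\<lambda>f. farr F (Ta X f))
                 (\<lambda>A. To Y (fobj F A)) (\<lambda>f. Ta Y (farr F f)) (lstr F)"
    using assms unfolding lax_tangent_morphism_def is_functor_def by blast+
  then show "A \<in> Ob X \<Longrightarrow> fobj F A \<in> Ob Y"
    "f \<in> Arr X \<Longrightarrow> farr F f \<in> Arr Y"
    "f \<in> Arr X \<Longrightarrow> Dom Y (farr F f) = fobj F (Dom X f)"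
    "f \<in> Arr X \<Longrightarrow> Cod Y (farr F f) = fobj F (Cod X f)"
    "A \<in> Ob X \<Longrightarrow> farr F (Ident X A) = Ident Y (fobj F A)"
    "\<lbrakk>f \<in> Arr X; g \<in> Arr X; Cod X f = Dom X g\<rbrakk> \<Longrightarrow> farr F (g \<bullet>\<^bsub>X\<^esub> f) = farr F g \<bullet>\<^bsub>Y\<^esub> farr F f"
    "A \<in> Ob X \<Longrightarrow> lstr F A \<in> Arr Y"
    "A \<in> Ob X \<Longrightarrow> Dom Y (lstr F A) = fobj F (To X A)"
    "A \<in> Ob X \<Longrightarrow> Cod Y (lstr F A) = To Y (fobj F A)"
    unfolding functorial_def natural_def by auto
qed

lemma lax_extensional:
  assumes "lax_tangent_morphism X Y F"
  shows "fobj F \<in> extensional (Ob X)" "farr F \<in> extensional (Arr X)" "lstr F \<in> extensional (Ob X)"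
  using assms unfolding lax_tangent_morphism_def is_functor_def by blast+

lemma farr_eq:
  "\<lbrakk>g \<bullet>\<^bsub>X\<^esub> f = k; lax_tangent_morphism X Y F; f \<in> Arr X; g \<in> Arr X; Cod X f = Dom X g\<rbrakk> \<Longrightarrow>
    farr F g \<bullet>\<^bsub>Y\<^esub> farr F f = farr F k"
  using lax_typing(6) by metis

lemma lstr_nat:
  "\<lbrakk>lax_tangent_morphism X Y F; f \<in> Arr X; Cod X f = B\<rbrakk> \<Longrightarrow>
     lstr F B \<bullet>\<^bsub>Y\<^esub> farr F (Ta X f) = Ta Y (farr F f) \<bullet>\<^bsub>Y\<^esub> lstr F (Dom X f)"
  unfolding lax_tangent_morphism_def natural_def by blast

lemma lax_equations:
  assumes "lax_tangent_morphism X Y F" "A \<in> Ob X"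
  shows "tp Y (fobj F A) \<bullet>\<^bsub>Y\<^esub> lstr F A = farr F (tp X A)"
    "lstr F A \<bullet>\<^bsub>Y\<^esub> farr F (tz X A) = tz Y (fobj F A)"
    "lstr F A \<bullet>\<^bsub>Y\<^esub> farr F (ts X A) =
          ts Y (fobj F A) \<bullet>\<^bsub>Y\<^esub> pair_into Y (tpi1 Y (fobj F A)) (tpi2 Y (fobj F A))
             (lstr F A \<bullet>\<^bsub>Y\<^esub> farr F (tpi1 X A)) (lstr F A \<bullet>\<^bsub>Y\<^esub> farr F (tpi2 X A))"
    "tl Y (fobj F A) \<bullet>\<^bsub>Y\<^esub> lstr F A =
          Ta Y (lstr F A) \<bullet>\<^bsub>Y\<^esub> (lstr F (To X A) \<bullet>\<^bsub>Y\<^esub> farr F (tl X A))"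
    "tc Y (fobj F A) \<bullet>\<^bsub>Y\<^esub> (Ta Y (lstr F A) \<bullet>\<^bsub>Y\<^esub> lstr F (To X A)) =
          Ta Y (lstr F A) \<bullet>\<^bsub>Y\<^esub> (lstr F (To X A) \<bullet>\<^bsub>Y\<^esub> farr F (tc X A))"
  using assms unfolding lax_tangent_morphism_def by blast+

text \<open>The arrow \<open>F T\<^sub>2 A \<rightarrow> T\<^sub>2 F A\<close> through which a lax structure acts on pairs.\<close>

lemma lax_pair_ex:
  assumes "A \<in> Ob X" "fobj F A \<in> Ob Y"
    and l: "lstr F A \<in> Arr Y" "Dom Y (lstr F A) = fobj F (To X A)" "Cod Y (lstr F A) = To Y (fobj F A)"
    and F: "\<And>f. f \<in> Arr X \<Longrightarrow> farr F f \<in> Arr Y \<and> Dom Y (farr F f) = fobj F (Dom X f) \<and> Cod Y (farr F f) = fobj F (Cod X f)"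
    and c: "\<And>f g. \<lbrakk>f \<in> Arr X; g \<in> Arr X; Cod X f = Dom X g\<rbrakk> \<Longrightarrow> farr F (g \<bullet>\<^bsub>X\<^esub> f) = farr F g \<bullet>\<^bsub>Y\<^esub> farr F f"
    and p: "tp Y (fobj F A) \<bullet>\<^bsub>Y\<^esub> lstr F A = farr F (tp X A)"
  shows "\<exists>k. k \<in> Arr Y \<and> Dom Y k = fobj F (T2o X A) \<and> Cod Y k = T2o Y (fobj F A) \<and>
    tpi1 Y (fobj F A) \<bullet>\<^bsub>Y\<^esub> k = lstr F A \<bullet>\<^bsub>Y\<^esub> farr F (tpi1 X A) \<and>
    tpi2 Y (fobj F A) \<bullet>\<^bsub>Y\<^esub> k = lstr F A \<bullet>\<^bsub>Y\<^esub> farr F (tpi2 X A) \<and>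
    pair_into Y (tpi1 Y (fobj F A)) (tpi2 Y (fobj F A))
             (lstr F A \<bullet>\<^bsub>Y\<^esub> farr F (tpi1 X A)) (lstr F A \<bullet>\<^bsub>Y\<^esub> farr F (tpi2 X A)) = k"
proof -
  have "tp Y (fobj F A) \<bullet>\<^bsub>Y\<^esub> (lstr F A \<bullet>\<^bsub>Y\<^esub> farr F (tpi1 X A)) = tp Y (fobj F A) \<bullet>\<^bsub>Y\<^esub> (lstr F A \<bullet>\<^bsub>Y\<^esub> farr F (tpi2 X A))"
    using assms(1,2) l F by (simp add: p[THEN Y.Cmp_eq_extend] X.tp_tpi flip: c)
  from Y.is_pullback_lift[OF Y.tpi_pullback[OF assms(2)] _ _ _ _ _ this] show ?thesis
    using assms(1,2) l F by simp
qed

lemma lax_ts: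
  assumes "lax_tangent_morphism X Y F" "A \<in> Ob X"
  obtains k where "k \<in> Arr Y" "Dom Y k = fobj F (T2o X A)" "Cod Y k = T2o Y (fobj F A)"
    "tpi1 Y (fobj F A) \<bullet>\<^bsub>Y\<^esub> k = lstr F A \<bullet>\<^bsub>Y\<^esub> farr F (tpi1 X A)"
    "tpi2 Y (fobj F A) \<bullet>\<^bsub>Y\<^esub> k = lstr F A \<bullet>\<^bsub>Y\<^esub> farr F (tpi2 X A)"
    "lstr F A \<bullet>\<^bsub>Y\<^esub> farr F (ts X A) = ts Y (fobj F A) \<bullet>\<^bsub>Y\<^esub> k"
  using lax_pair_ex[of A F] lax_equations(1,3)[OF assms] assms by auto

text \<open>The sum law is asked for an arbitrary arrow with the projections of the tuple, so that it can be
  checked after composition with jointly monic arrows.\<close>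

lemma lax_tangent_morphismI:
  assumes ext: "fobj F \<in> extensional (Ob X)" "farr F \<in> extensional (Arr X)" "lstr F \<in> extensional (Ob X)"
    and ob: "\<And>A. A \<in> Ob X \<Longrightarrow> fobj F A \<in> Ob Y"
    and ar: "\<And>f. f \<in> Arr X \<Longrightarrow> farr F f \<in> Arr Y \<and> Dom Y (farr F f) = fobj F (Dom X f) \<and> Cod Y (farr F f) = fobj F (Cod X f)"
    and id: "\<And>A. A \<in> Ob X \<Longrightarrow> farr F (Ident X A) = Ident Y (fobj F A)"
    and cmp: "\<And>f g. \<lbrakk>f \<in> Arr X; g \<in> Arr X; Cod X f = Dom X g\<rbrakk> \<Longrightarrow> farr F (g \<bullet>\<^bsub>X\<^esub> f) = farr F g \<bullet>\<^bsub>Y\<^esub> farr F f"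
    and l: "\<And>A. A \<in> Ob X \<Longrightarrow> lstr F A \<in> Arr Y \<and> Dom Y (lstr F A) = fobj F (To X A) \<and> Cod Y (lstr F A) = To Y (fobj F A)"
    and nat: "\<And>f. f \<in> Arr X \<Longrightarrow> lstr F (Cod X f) \<bullet>\<^bsub>Y\<^esub> farr F (Ta X f) = Ta Y (farr F f) \<bullet>\<^bsub>Y\<^esub> lstr F (Dom X f)"
    and p: "\<And>A. A \<in> Ob X \<Longrightarrow> tp Y (fobj F A) \<bullet>\<^bsub>Y\<^esub> lstr F A = farr F (tp X A)"
    and z: "\<And>A. A \<in> Ob X \<Longrightarrow> lstr F A \<bullet>\<^bsub>Y\<^esub> farr F (tz X A) = tz Y (fobj F A)"
    and s: "\<And>A k. \<lbrakk>A \<in> Ob X; k \<in> Arr Y; Dom Y k = fobj F (T2o X A); Cod Y k = T2o Y (fobj F A);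
       tpi1 Y (fobj F A) \<bullet>\<^bsub>Y\<^esub> k = lstr F A \<bullet>\<^bsub>Y\<^esub> farr F (tpi1 X A);
       tpi2 Y (fobj F A) \<bullet>\<^bsub>Y\<^esub> k = lstr F A \<bullet>\<^bsub>Y\<^esub> farr F (tpi2 X A)\<rbrakk> \<Longrightarrow>
       lstr F A \<bullet>\<^bsub>Y\<^esub> farr F (ts X A) = ts Y (fobj F A) \<bullet>\<^bsub>Y\<^esub> k"
    and ll: "\<And>A. A \<in> Ob X \<Longrightarrow> tl Y (fobj F A) \<bullet>\<^bsub>Y\<^esub> lstr F A =
          Ta Y (lstr F A) \<bullet>\<^bsub>Y\<^esub> (lstr F (To X A) \<bullet>\<^bsub>Y\<^esub> farr F (tl X A))"
    and cc: "\<And>A. A \<in> Ob X \<Longrightarrow> tc Y (fobj F A) \<bullet>\<^bsub>Y\<^esub> (Ta Y (lstr F A) \<bullet>\<^bsub>Y\<^esub> lstr F (To X A)) =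
          Ta Y (lstr F A) \<bullet>\<^bsub>Y\<^esub> (lstr F (To X A) \<bullet>\<^bsub>Y\<^esub> farr F (tc X A))"
  shows "lax_tangent_morphism X Y F"
proof -
  have "lstr F A \<bullet>\<^bsub>Y\<^esub> farr F (ts X A) =
          ts Y (fobj F A) \<bullet>\<^bsub>Y\<^esub> pair_into Y (tpi1 Y (fobj F A)) (tpi2 Y (fobj F A))
             (lstr F A \<bullet>\<^bsub>Y\<^esub> farr F (tpi1 X A)) (lstr F A \<bullet>\<^bsub>Y\<^esub> farr F (tpi2 X A))" if A: "A \<in> Ob X" for A
  proof -
    have lA: "lstr F A \<in> Arr Y" "Dom Y (lstr F A) = fobj F (To X A)" "Cod Y (lstr F A) = To Y (fobj F A)"
      using l[OF A] by blast+
    obtain k where k: "k \<in> Arr Y" "Dom Y k = fobj F (T2o X A)" "Cod Y k = T2o Y (fobj F A)"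
      "tpi1 Y (fobj F A) \<bullet>\<^bsub>Y\<^esub> k = lstr F A \<bullet>\<^bsub>Y\<^esub> farr F (tpi1 X A)"
      "tpi2 Y (fobj F A) \<bullet>\<^bsub>Y\<^esub> k = lstr F A \<bullet>\<^bsub>Y\<^esub> farr F (tpi2 X A)"
      and eq: "pair_into Y (tpi1 Y (fobj F A)) (tpi2 Y (fobj F A))
             (lstr F A \<bullet>\<^bsub>Y\<^esub> farr F (tpi1 X A)) (lstr F A \<bullet>\<^bsub>Y\<^esub> farr F (tpi2 X A)) = k"
      using lax_pair_ex[OF A ob[OF A] lA ar cmp p[OF A]] by blast
    show ?thesis unfolding eq by (rule s[OF A k])
  qed
  moreover have "functorial X Y (fobj F) (farr F)"
    unfolding functorial_def using ob ar id cmp by auto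
  moreover have "natural X Y (\<lambda>A. fobj F (To X A)) (\<lambda>f. farr F (Ta X f))
                 (\<lambda>A. To Y (fobj F A)) (\<lambda>f. Ta Y (farr F f)) (lstr F)"
    unfolding natural_def using l nat by auto
  ultimately show ?thesis
    unfolding lax_tangent_morphism_def is_functor_def
    using ext p z ll cc X.tangent_X Y.tangent_X X.category_X Y.category_X by auto
qed

lemma lmor_eqI:
  assumes "lax_tangent_morphism X Y F" "lax_tangent_morphism X Y G"
    and "\<And>A. A \<in> Ob X \<Longrightarrow> fobj F A = fobj G A" "\<And>f. f \<in> Arr X \<Longrightarrow> farr F f = farr G f"
    "\<And>A. A \<in> Ob X \<Longrightarrow> lstr F A = lstr G A"
  shows "F = G"
  using lax_extensional[OF assms(1)] lax_extensional[OF assms(2)] assms(3-)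
  by (cases F; cases G) (auto intro!: extensionalityI)

text \<open>The axioms of a lax structure are equations between arrows into \<open>P A\<close>, \<open>T P A\<close> and \<open>T T P A\<close>. They
  hold as soon as \<open>P\<close> has jointly monic legs into lax tangent morphisms that respect the given
  structures, provided that the legs stay jointly monic under \<open>T\<close> and \<open>T T\<close>. Every limit of lax
  tangent morphisms below obtains its structure in this way.\<close>

lemma lax_by_cone:
  fixes P :: "('o, 'a, 'o2, 'a2) lmor"
  assumes F: "\<And>j. j \<in> J \<Longrightarrow> lax_tangent_morphism X Y (F j)"
    and ext: "fobj P \<in> extensional (Ob X)" "farr P \<in> extensional (Arr X)" "lstr P \<in> extensional (Ob X)"
    and ob [simp]: "\<And>A. A \<in> Ob X \<Longrightarrow> fobj P A \<in> Ob Y"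
    and ar [simp]: "\<And>f. f \<in> Arr X \<Longrightarrow> farr P f \<in> Arr Y" "\<And>f. f \<in> Arr X \<Longrightarrow> Dom Y (farr P f) = fobj P (Dom X f)"
      "\<And>f. f \<in> Arr X \<Longrightarrow> Cod Y (farr P f) = fobj P (Cod X f)"
    and l [simp]: "\<And>A. A \<in> Ob X \<Longrightarrow> lstr P A \<in> Arr Y" "\<And>A. A \<in> Ob X \<Longrightarrow> Dom Y (lstr P A) = fobj P (To X A)"
      "\<And>A. A \<in> Ob X \<Longrightarrow> Cod Y (lstr P A) = To Y (fobj P A)"
    and e: "\<And>j A. \<lbrakk>j \<in> J; A \<in> Ob X\<rbrakk> \<Longrightarrow> e j A \<in> Arr Y \<and> Dom Y (e j A) = fobj P A \<and> Cod Y (e j A) = fobj (F j) A"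
    and nat: "\<And>j f. \<lbrakk>j \<in> J; f \<in> Arr X\<rbrakk> \<Longrightarrow> e j (Cod X f) \<bullet>\<^bsub>Y\<^esub> farr P f = farr (F j) f \<bullet>\<^bsub>Y\<^esub> e j (Dom X f)"
    and tan: "\<And>j A. \<lbrakk>j \<in> J; A \<in> Ob X\<rbrakk> \<Longrightarrow> Ta Y (e j A) \<bullet>\<^bsub>Y\<^esub> lstr P A = lstr (F j) A \<bullet>\<^bsub>Y\<^esub> e j (To X A)"
    and jm: "\<And>A. A \<in> Ob X \<Longrightarrow> jointly_monic Y J (fobj P A) (\<lambda>j. e j A)"
      "\<And>A. A \<in> Ob X \<Longrightarrow> jointly_monic Y J (To Y (fobj P A)) (\<lambda>j. Ta Y (e j A))"
      "\<And>A. A \<in> Ob X \<Longrightarrow> jointly_monic Y J (To Y (To Y (fobj P A))) (\<lambda>j. Ta Y (Ta Y (e j A)))"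
  shows "lax_tangent_morphism X Y P"
proof -
  have e' [simp]: "e j A \<in> Arr Y" "Dom Y (e j A) = fobj P A" "Cod Y (e j A) = fobj (F j) A"
    if "j \<in> J" "A \<in> Ob X" for j A using e that by auto
  have nat': "e j B \<bullet>\<^bsub>Y\<^esub> farr P f = farr (F j) f \<bullet>\<^bsub>Y\<^esub> e j A"
    if "j \<in> J" "f \<in> Arr X" "Dom X f = A" "Cod X f = B" for j f A B using nat that by auto
  note ne = nat' nat'[THEN Y.Cmp_eq_extend] and te = tan tan[THEN Y.Cmp_eq_extend]
    and tte = tan[THEN Y.Ta_eq] tan[THEN Y.Ta_eq, THEN Y.Cmp_eq_extend]
  have id: "farr P (Ident X A) = Ident Y (fobj P A)" if A: "A \<in> Ob X" for A
    by (rule jointly_monicD[OF jm(1)[OF A]]) (use A F in \<open>simp_all add: ne\<close>)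
  have cmp: "farr P (g \<bullet>\<^bsub>X\<^esub> f) = farr P g \<bullet>\<^bsub>Y\<^esub> farr P f"
    if f: "f \<in> Arr X" "g \<in> Arr X" "Cod X f = Dom X g" for f g
    by (rule jointly_monicD[OF jm(1)[of "Cod X g"]]) (use f F in \<open>simp_all add: ne\<close>)
  have p: "tp Y (fobj P A) \<bullet>\<^bsub>Y\<^esub> lstr P A = farr P (tp X A)" if A: "A \<in> Ob X" for A
  proof (rule jointly_monicD[OF jm(1)[OF A]])
    fix j assume j: "j \<in> J"
    note [simp] = j F[OF j] e'(1-3)[OF j]
    have "e j A \<bullet>\<^bsub>Y\<^esub> (tp Y (fobj P A) \<bullet>\<^bsub>Y\<^esub> lstr P A) = tp Y (fobj (F j) A) \<bullet>\<^bsub>Y\<^esub> (Ta Y (e j A) \<bullet>\<^bsub>Y\<^esub> lstr P A)"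
      using A by (simp add: Y.tp_nat[THEN Y.Cmp_eq_extend])
    also have "\<dots> = e j A \<bullet>\<^bsub>Y\<^esub> farr P (tp X A)"
      using A by (simp add: te ne lax_equations(1) lax_equations(1)[THEN Y.Cmp_eq_extend])
    finally show "e j A \<bullet>\<^bsub>Y\<^esub> (tp Y (fobj P A) \<bullet>\<^bsub>Y\<^esub> lstr P A) = e j A \<bullet>\<^bsub>Y\<^esub> farr P (tp X A)" .
  qed (use A in simp_all)
  show ?thesis
  proof (rule lax_tangent_morphismI)
    fix f assume f: "f \<in> Arr X"
    show "lstr P (Cod X f) \<bullet>\<^bsub>Y\<^esub> farr P (Ta X f) = Ta Y (farr P f) \<bullet>\<^bsub>Y\<^esub> lstr P (Dom X f)"
    proof (rule jointly_monicD[OF jm(2)[of "Cod X f"]])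
      fix j assume j: "j \<in> J"
      note [simp] = j F[OF j] e'(1-3)[OF j]
      show "Ta Y (e j (Cod X f)) \<bullet>\<^bsub>Y\<^esub> (lstr P (Cod X f) \<bullet>\<^bsub>Y\<^esub> farr P (Ta X f)) =
        Ta Y (e j (Cod X f)) \<bullet>\<^bsub>Y\<^esub> (Ta Y (farr P f) \<bullet>\<^bsub>Y\<^esub> lstr P (Dom X f))"
        using f by (simp add: te ne lstr_nat[THEN Y.Cmp_eq_extend] nat[THEN Y.Ta_eq, THEN Y.Cmp_eq_extend])
    qed (use f in simp_all)
  next
    fix A assume A: "A \<in> Ob X"
    show "lstr P A \<bullet>\<^bsub>Y\<^esub> farr P (tz X A) = tz Y (fobj P A)"
    proof (rule jointly_monicD[OF jm(2)[OF A]])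
      fix j assume j: "j \<in> J"
      note [simp] = j F[OF j] e'(1-3)[OF j]
      have "Ta Y (e j A) \<bullet>\<^bsub>Y\<^esub> (lstr P A \<bullet>\<^bsub>Y\<^esub> farr P (tz X A)) = tz Y (fobj (F j) A) \<bullet>\<^bsub>Y\<^esub> e j A"
        using A by (simp add: te ne lax_equations(2)[THEN Y.Cmp_eq_extend])
      then show "Ta Y (e j A) \<bullet>\<^bsub>Y\<^esub> (lstr P A \<bullet>\<^bsub>Y\<^esub> farr P (tz X A)) = Ta Y (e j A) \<bullet>\<^bsub>Y\<^esub> tz Y (fobj P A)"
        using A by (simp add: Y.tz_nat)
    qed (use A in simp_all)
    show "tl Y (fobj P A) \<bullet>\<^bsub>Y\<^esub> lstr P A =
          Ta Y (lstr P A) \<bullet>\<^bsub>Y\<^esub> (lstr P (To X A) \<bullet>\<^bsub>Y\<^esub> farr P (tl X A))"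
    proof (rule jointly_monicD[OF jm(3)[OF A]])
      fix j assume j: "j \<in> J"
      note [simp] = j F[OF j] e'(1-3)[OF j]
      have "Ta Y (Ta Y (e j A)) \<bullet>\<^bsub>Y\<^esub> (tl Y (fobj P A) \<bullet>\<^bsub>Y\<^esub> lstr P A) =
         tl Y (fobj (F j) A) \<bullet>\<^bsub>Y\<^esub> (Ta Y (e j A) \<bullet>\<^bsub>Y\<^esub> lstr P A)"
        using A by (simp add: Y.tl_nat[THEN Y.Cmp_eq_extend])
      also have "\<dots> = Ta Y (Ta Y (e j A)) \<bullet>\<^bsub>Y\<^esub> (Ta Y (lstr P A) \<bullet>\<^bsub>Y\<^esub> (lstr P (To X A) \<bullet>\<^bsub>Y\<^esub> farr P (tl X A)))"
        using A by (simp add: te ne tte lax_equations(4)[THEN Y.Cmp_eq_extend])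
      finally show "Ta Y (Ta Y (e j A)) \<bullet>\<^bsub>Y\<^esub> (tl Y (fobj P A) \<bullet>\<^bsub>Y\<^esub> lstr P A) =
        Ta Y (Ta Y (e j A)) \<bullet>\<^bsub>Y\<^esub> (Ta Y (lstr P A) \<bullet>\<^bsub>Y\<^esub> (lstr P (To X A) \<bullet>\<^bsub>Y\<^esub> farr P (tl X A)))" .
    qed (use A in simp_all)
    show "tc Y (fobj P A) \<bullet>\<^bsub>Y\<^esub> (Ta Y (lstr P A) \<bullet>\<^bsub>Y\<^esub> lstr P (To X A)) =
          Ta Y (lstr P A) \<bullet>\<^bsub>Y\<^esub> (lstr P (To X A) \<bullet>\<^bsub>Y\<^esub> farr P (tc X A))"
    proof (rule jointly_monicD[OF jm(3)[OF A]])
      fix j assume j: "j \<in> J"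
      note [simp] = j F[OF j] e'(1-3)[OF j]
      have "Ta Y (Ta Y (e j A)) \<bullet>\<^bsub>Y\<^esub> (tc Y (fobj P A) \<bullet>\<^bsub>Y\<^esub> (Ta Y (lstr P A) \<bullet>\<^bsub>Y\<^esub> lstr P (To X A))) =
         tc Y (fobj (F j) A) \<bullet>\<^bsub>Y\<^esub> (Ta Y (Ta Y (e j A)) \<bullet>\<^bsub>Y\<^esub> (Ta Y (lstr P A) \<bullet>\<^bsub>Y\<^esub> lstr P (To X A)))"
        using A by (simp add: Y.tc_nat[THEN Y.Cmp_eq_extend])
      also have "\<dots> = Ta Y (Ta Y (e j A)) \<bullet>\<^bsub>Y\<^esub> (Ta Y (lstr P A) \<bullet>\<^bsub>Y\<^esub> (lstr P (To X A) \<bullet>\<^bsub>Y\<^esub> farr P (tc X A)))"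
        using A by (simp add: te ne tte lax_equations(5)[THEN Y.Cmp_eq_extend3])
      finally show "Ta Y (Ta Y (e j A)) \<bullet>\<^bsub>Y\<^esub> (tc Y (fobj P A) \<bullet>\<^bsub>Y\<^esub> (Ta Y (lstr P A) \<bullet>\<^bsub>Y\<^esub> lstr P (To X A))) =
        Ta Y (Ta Y (e j A)) \<bullet>\<^bsub>Y\<^esub> (Ta Y (lstr P A) \<bullet>\<^bsub>Y\<^esub> (lstr P (To X A) \<bullet>\<^bsub>Y\<^esub> farr P (tc X A)))" .
    qed (use A in simp_all)
    fix k assume k [simp]: "k \<in> Arr Y" "Dom Y k = fobj P (T2o X A)" "Cod Y k = T2o Y (fobj P A)"
      and kp: "tpi1 Y (fobj P A) \<bullet>\<^bsub>Y\<^esub> k = lstr P A \<bullet>\<^bsub>Y\<^esub> farr P (tpi1 X A)"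
        "tpi2 Y (fobj P A) \<bullet>\<^bsub>Y\<^esub> k = lstr P A \<bullet>\<^bsub>Y\<^esub> farr P (tpi2 X A)"
    show "lstr P A \<bullet>\<^bsub>Y\<^esub> farr P (ts X A) = ts Y (fobj P A) \<bullet>\<^bsub>Y\<^esub> k"
    proof (rule jointly_monicD[OF jm(2)[OF A]])
      fix j assume j: "j \<in> J"
      note [simp] = j F[OF j] e'(1-3)[OF j]
      obtain h where h [simp]: "h \<in> Arr Y" "Dom Y h = fobj (F j) (T2o X A)" "Cod Y h = T2o Y (fobj (F j) A)"
        and hp: "tpi1 Y (fobj (F j) A) \<bullet>\<^bsub>Y\<^esub> h = lstr (F j) A \<bullet>\<^bsub>Y\<^esub> farr (F j) (tpi1 X A)"
          "tpi2 Y (fobj (F j) A) \<bullet>\<^bsub>Y\<^esub> h = lstr (F j) A \<bullet>\<^bsub>Y\<^esub> farr (F j) (tpi2 X A)"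
          "lstr (F j) A \<bullet>\<^bsub>Y\<^esub> farr (F j) (ts X A) = ts Y (fobj (F j) A) \<bullet>\<^bsub>Y\<^esub> h"
        by (rule lax_ts[OF F[OF j] A])
      have eq: "h \<bullet>\<^bsub>Y\<^esub> e j (T2o X A) = T2a Y (e j A) \<bullet>\<^bsub>Y\<^esub> k"
        by (rule Y.tpi_monic[of _ _ "fobj (F j) A"])
          (use A in \<open>simp_all add: Y.tpi_nat[THEN Y.Cmp_eq_extend] hp(1,2)[THEN Y.Cmp_eq_extend] kp te ne\<close>)
      have "Ta Y (e j A) \<bullet>\<^bsub>Y\<^esub> (lstr P A \<bullet>\<^bsub>Y\<^esub> farr P (ts X A)) =
         ts Y (fobj (F j) A) \<bullet>\<^bsub>Y\<^esub> (h \<bullet>\<^bsub>Y\<^esub> e j (T2o X A))"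
        using A by (simp add: te ne hp(3)[THEN Y.Cmp_eq_extend])
      also have "\<dots> = Ta Y (e j A) \<bullet>\<^bsub>Y\<^esub> (ts Y (fobj P A) \<bullet>\<^bsub>Y\<^esub> k)"
        unfolding eq using A by (simp add: Y.ts_nat[THEN Y.Cmp_eq_extend])
      finally show "Ta Y (e j A) \<bullet>\<^bsub>Y\<^esub> (lstr P A \<bullet>\<^bsub>Y\<^esub> farr P (ts X A)) =
        Ta Y (e j A) \<bullet>\<^bsub>Y\<^esub> (ts Y (fobj P A) \<bullet>\<^bsub>Y\<^esub> k)" .
    qed (use A in simp_all)
  qed (use ext id cmp p in simp_all)
qed

subsection \<open>Strict tangent morphisms\<close>

text \<open>With identities as lax structure, each axiom asks that one structure map is preserved. In the sum
  law the tuple is then an identity, because the chosen projections are preserved as well.\<close>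

lemma strict_tangent_morphismI:
  assumes ext: "fobj F \<in> extensional (Ob X)" "farr F \<in> extensional (Arr X)" "lstr F \<in> extensional (Ob X)"
    and ob [simp]: "\<And>A. A \<in> Ob X \<Longrightarrow> fobj F A \<in> Ob Y"
    and ar: "\<And>f. f \<in> Arr X \<Longrightarrow> farr F f \<in> Arr Y \<and> Dom Y (farr F f) = fobj F (Dom X f) \<and> Cod Y (farr F f) = fobj F (Cod X f)"
    and id: "\<And>A. A \<in> Ob X \<Longrightarrow> farr F (Ident X A) = Ident Y (fobj F A)"
    and cmp: "\<And>f g. \<lbrakk>f \<in> Arr X; g \<in> Arr X; Cod X f = Dom X g\<rbrakk> \<Longrightarrow> farr F (g \<bullet>\<^bsub>X\<^esub> f) = farr F g \<bullet>\<^bsub>Y\<^esub> farr F f"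
    and l [simp]: "\<And>A. A \<in> Ob X \<Longrightarrow> lstr F A = Ident Y (fobj F (To X A))"
    and To [simp]: "\<And>A. A \<in> Ob X \<Longrightarrow> fobj F (To X A) = To Y (fobj F A)"
    and Ta [simp]: "\<And>f. f \<in> Arr X \<Longrightarrow> farr F (Ta X f) = Ta Y (farr F f)"
    and str [simp]: "\<And>A. A \<in> Ob X \<Longrightarrow> farr F (tp X A) = tp Y (fobj F A)"
      "\<And>A. A \<in> Ob X \<Longrightarrow> farr F (tpi1 X A) = tpi1 Y (fobj F A)"
      "\<And>A. A \<in> Ob X \<Longrightarrow> farr F (tpi2 X A) = tpi2 Y (fobj F A)"
      "\<And>A. A \<in> Ob X \<Longrightarrow> farr F (tz X A) = tz Y (fobj F A)"
      "\<And>A. A \<in> Ob X \<Longrightarrow> farr F (ts X A) = ts Y (fobj F A)"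
      "\<And>A. A \<in> Ob X \<Longrightarrow> farr F (tl X A) = tl Y (fobj F A)"
      "\<And>A. A \<in> Ob X \<Longrightarrow> farr F (tc X A) = tc Y (fobj F A)"
  shows "strict_tangent_morphism X Y F"
proof -
  have [simp]: "farr F f \<in> Arr Y" "Dom Y (farr F f) = fobj F (Dom X f)" "Cod Y (farr F f) = fobj F (Cod X f)"
    if "f \<in> Arr X" for f using ar[OF that] by auto
  have [simp]: "fobj F (T2o X A) = T2o Y (fobj F A)" if "A \<in> Ob X" for A
    using ar[of "tpi1 X A"] that by simp
  have "lax_tangent_morphism X Y F"
  proof (rule lax_tangent_morphismI)
    fix A k assume A: "A \<in> Ob X" and k: "k \<in> Arr Y" "Dom Y k = fobj F (T2o X A)" "Cod Y k = T2o Y (fobj F A)"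
       "tpi1 Y (fobj F A) \<bullet>\<^bsub>Y\<^esub> k = lstr F A \<bullet>\<^bsub>Y\<^esub> farr F (tpi1 X A)"
       "tpi2 Y (fobj F A) \<bullet>\<^bsub>Y\<^esub> k = lstr F A \<bullet>\<^bsub>Y\<^esub> farr F (tpi2 X A)"
    have "k = Ident Y (T2o Y (fobj F A))"
      by (rule Y.tpi_monic[of _ _ "fobj F A"]) (use A k in simp_all)
    then show "lstr F A \<bullet>\<^bsub>Y\<^esub> farr F (ts X A) = ts Y (fobj F A) \<bullet>\<^bsub>Y\<^esub> k" using A by simp
  qed (use ext id cmp ar in simp_all)
  then show ?thesis unfolding strict_tangent_morphism_def by simp
qed

subsection \<open>Tangent natural transformations\<close>

lemma tnt_typing [simp]:
  assumes "tangent_nat_trans X Y \<phi>"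
  shows "lax_tangent_morphism X Y (nsrc \<phi>)" "lax_tangent_morphism X Y (ntgt \<phi>)"
    "A \<in> Ob X \<Longrightarrow> ncmp \<phi> A \<in> Arr Y"
    "A \<in> Ob X \<Longrightarrow> Dom Y (ncmp \<phi> A) = fobj (nsrc \<phi>) A"
    "A \<in> Ob X \<Longrightarrow> Cod Y (ncmp \<phi> A) = fobj (ntgt \<phi>) A"
  using assms unfolding tangent_nat_trans_def is_nat_trans_def natural_def by auto

lemma tnt_extensional: "tangent_nat_trans X Y \<phi> \<Longrightarrow> ncmp \<phi> \<in> extensional (Ob X)"
  unfolding tangent_nat_trans_def is_nat_trans_def by blast

lemma tnt_nat: "\<lbrakk>tangent_nat_trans X Y \<phi>; f \<in> Arr X; Cod X f = B\<rbrakk> \<Longrightarrow>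
    ncmp \<phi> B \<bullet>\<^bsub>Y\<^esub> farr (nsrc \<phi>) f = farr (ntgt \<phi>) f \<bullet>\<^bsub>Y\<^esub> ncmp \<phi> (Dom X f)"
  unfolding tangent_nat_trans_def is_nat_trans_def natural_def by blast

lemma tnt_tan: "\<lbrakk>tangent_nat_trans X Y \<phi>; A \<in> Ob X\<rbrakk> \<Longrightarrow>
    Ta Y (ncmp \<phi> A) \<bullet>\<^bsub>Y\<^esub> lstr (nsrc \<phi>) A = lstr (ntgt \<phi>) A \<bullet>\<^bsub>Y\<^esub> ncmp \<phi> (To X A)"
  unfolding tangent_nat_trans_def by blast

lemma tangent_nat_transI:
  assumes "lax_tangent_morphism X Y (nsrc \<phi>)" "lax_tangent_morphism X Y (ntgt \<phi>)"
    and "ncmp \<phi> \<in> extensional (Ob X)"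
    and "\<And>A. A \<in> Ob X \<Longrightarrow> ncmp \<phi> A \<in> Arr Y \<and> Dom Y (ncmp \<phi> A) = fobj (nsrc \<phi>) A \<and> Cod Y (ncmp \<phi> A) = fobj (ntgt \<phi>) A"
    and "\<And>f. f \<in> Arr X \<Longrightarrow> ncmp \<phi> (Cod X f) \<bullet>\<^bsub>Y\<^esub> farr (nsrc \<phi>) f = farr (ntgt \<phi>) f \<bullet>\<^bsub>Y\<^esub> ncmp \<phi> (Dom X f)"
    and "\<And>A. A \<in> Ob X \<Longrightarrow> Ta Y (ncmp \<phi> A) \<bullet>\<^bsub>Y\<^esub> lstr (nsrc \<phi>) A = lstr (ntgt \<phi>) A \<bullet>\<^bsub>Y\<^esub> ncmp \<phi> (To X A)"
  shows "tangent_nat_trans X Y \<phi>"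
  using assms unfolding tangent_nat_trans_def is_nat_trans_def natural_def lax_tangent_morphism_def
  by auto

lemmas nt_eqI = nt_ext[where S = "Ob X"]

end

section \<open>Composition and whiskering\<close>

locale tangent_triple = XY: tangent_pair X Y + YZ: tangent_pair Y Z
  for X :: "('o, 'a) tcat" and Y :: "('o2, 'a2) tcat" and Z :: "('o3, 'a3) tcat"

sublocale tangent_triple \<subseteq> XZ: tangent_pair X Z by unfold_locales

lemma lax_tangent_pair: "lax_tangent_morphism X Y F \<Longrightarrow> tangent_pair X Y"
  by (simp add: lax_tangent_morphism_def tangent_pair_def tangent_on_def)

lemma tng_comp_simps [simp]:
  "A \<in> Ob X \<Longrightarrow> fobj (tng_comp X Z G F) A = fobj G (fobj F A)"
  "f \<in> Arr X \<Longrightarrow> farr (tng_comp X Z G F) f = farr G (farr F f)"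
  "A \<in> Ob X \<Longrightarrow> lstr (tng_comp X Z G F) A = lstr G (fobj F A) \<bullet>\<^bsub>Z\<^esub> farr G (lstr F A)"
  by (simp_all add: tng_comp_def)

lemma tng_comp_extensional [simp]:
  "fobj (tng_comp X Z G F) \<in> extensional (Ob X)" "farr (tng_comp X Z G F) \<in> extensional (Arr X)"
  "lstr (tng_comp X Z G F) \<in> extensional (Ob X)"
  by (simp_all add: tng_comp_def)

lemma whisker_simps [simp]:
  "nsrc (nt_whisker_right X Z \<psi> F) = tng_comp X Z (nsrc \<psi>) F"
  "ntgt (nt_whisker_right X Z \<psi> F) = tng_comp X Z (ntgt \<psi>) F"
  "A \<in> Ob X \<Longrightarrow> ncmp (nt_whisker_right X Z \<psi> F) A = ncmp \<psi> (fobj F A)"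
  "ncmp (nt_whisker_right X Z \<psi> F) \<in> extensional (Ob X)"
  "nsrc (nt_whisker_left X Z G \<phi>) = tng_comp X Z G (nsrc \<phi>)"
  "ntgt (nt_whisker_left X Z G \<phi>) = tng_comp X Z G (ntgt \<phi>)"
  "A \<in> Ob X \<Longrightarrow> ncmp (nt_whisker_left X Z G \<phi>) A = farr G (ncmp \<phi> A)"
  "ncmp (nt_whisker_left X Z G \<phi>) \<in> extensional (Ob X)"
  by (simp_all add: nt_whisker_right_def nt_whisker_left_def)

context tangent_triple
begin

lemma lax_comp:
  assumes F [simp]: "lax_tangent_morphism X Y F" and G [simp]: "lax_tangent_morphism Y Z G"
  shows "lax_tangent_morphism X Z (tng_comp X Z G F)"
proof (rule XZ.lax_tangent_morphismI)
  fix f assume f: "f \<in> Arr X"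
  show "lstr (tng_comp X Z G F) (Cod X f) \<bullet>\<^bsub>Z\<^esub> farr (tng_comp X Z G F) (Ta X f) =
    Ta Z (farr (tng_comp X Z G F) f) \<bullet>\<^bsub>Z\<^esub> lstr (tng_comp X Z G F) (Dom X f)"
    using f YZ.farr_eq[OF XY.lstr_nat[OF F f refl] G]
    by (simp add: YZ.lstr_nat[THEN YZ.Y.Cmp_eq_extend])
next
  fix A assume A: "A \<in> Ob X"
  show "tp Z (fobj (tng_comp X Z G F) A) \<bullet>\<^bsub>Z\<^esub> lstr (tng_comp X Z G F) A = farr (tng_comp X Z G F) (tp X A)"
    using A by (simp add: YZ.lax_equations(1)[THEN YZ.Y.Cmp_eq_extend] YZ.farr_eq[OF XY.lax_equations(1)])
  show "lstr (tng_comp X Z G F) A \<bullet>\<^bsub>Z\<^esub> farr (tng_comp X Z G F) (tz X A) = tz Z (fobj (tng_comp X Z G F) A)"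
    using A by (simp add: YZ.lax_equations(2) YZ.farr_eq[OF XY.lax_equations(2)])
  have l: "farr G (tl Y (fobj F A)) \<bullet>\<^bsub>Z\<^esub> farr G (lstr F A) =
     farr G (Ta Y (lstr F A)) \<bullet>\<^bsub>Z\<^esub> (farr G (lstr F (To X A)) \<bullet>\<^bsub>Z\<^esub> farr G (farr F (tl X A)))"
    using A by (simp add: YZ.farr_eq[OF XY.lax_equations(4)])
  show "tl Z (fobj (tng_comp X Z G F) A) \<bullet>\<^bsub>Z\<^esub> lstr (tng_comp X Z G F) A =
      Ta Z (lstr (tng_comp X Z G F) A) \<bullet>\<^bsub>Z\<^esub>
      (lstr (tng_comp X Z G F) (To X A) \<bullet>\<^bsub>Z\<^esub> farr (tng_comp X Z G F) (tl X A))"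
    using A by (simp add: YZ.lax_equations(4)[THEN YZ.Y.Cmp_eq_extend] l YZ.lstr_nat[THEN YZ.Y.Cmp_eq_extend])
  have c: "farr G (tc Y (fobj F A)) \<bullet>\<^bsub>Z\<^esub> (farr G (Ta Y (lstr F A)) \<bullet>\<^bsub>Z\<^esub> farr G (lstr F (To X A))) =
     farr G (Ta Y (lstr F A)) \<bullet>\<^bsub>Z\<^esub> (farr G (lstr F (To X A)) \<bullet>\<^bsub>Z\<^esub> farr G (farr F (tc X A)))"
    using A arg_cong[OF XY.lax_equations(5)[OF F A], of "farr G"] by simp
  have n: "Ta Z (farr G (lstr F A)) \<bullet>\<^bsub>Z\<^esub> (lstr G (fobj F (To X A)) \<bullet>\<^bsub>Z\<^esub> x) =
      lstr G (To Y (fobj F A)) \<bullet>\<^bsub>Z\<^esub> (farr G (Ta Y (lstr F A)) \<bullet>\<^bsub>Z\<^esub> x)"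
    if "x \<in> Arr Z" "Cod Z x = fobj G (To Y (fobj F (To X A)))" for x
    using A that YZ.lstr_nat[OF G, of "lstr F A", OF _ refl, THEN YZ.Y.Cmp_eq_extend, of x] by simp
  show "tc Z (fobj (tng_comp X Z G F) A) \<bullet>\<^bsub>Z\<^esub>
      (Ta Z (lstr (tng_comp X Z G F) A) \<bullet>\<^bsub>Z\<^esub> lstr (tng_comp X Z G F) (To X A)) =
      Ta Z (lstr (tng_comp X Z G F) A) \<bullet>\<^bsub>Z\<^esub>
      (lstr (tng_comp X Z G F) (To X A) \<bullet>\<^bsub>Z\<^esub> farr (tng_comp X Z G F) (tc X A))"
    using A by (simp add: n YZ.lax_equations(5)[THEN YZ.Y.Cmp_eq_extend3] c)
  fix k assume k: "k \<in> Arr Z" "Dom Z k = fobj (tng_comp X Z G F) (T2o X A)"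
       "Cod Z k = T2o Z (fobj (tng_comp X Z G F) A)"
     and kp: "tpi1 Z (fobj (tng_comp X Z G F) A) \<bullet>\<^bsub>Z\<^esub> k = lstr (tng_comp X Z G F) A \<bullet>\<^bsub>Z\<^esub> farr (tng_comp X Z G F) (tpi1 X A)"
       "tpi2 Z (fobj (tng_comp X Z G F) A) \<bullet>\<^bsub>Z\<^esub> k = lstr (tng_comp X Z G F) A \<bullet>\<^bsub>Z\<^esub> farr (tng_comp X Z G F) (tpi2 X A)"
  obtain h where h [simp]: "h \<in> Arr Y" "Dom Y h = fobj F (T2o X A)" "Cod Y h = T2o Y (fobj F A)"
    and hp: "tpi1 Y (fobj F A) \<bullet>\<^bsub>Y\<^esub> h = lstr F A \<bullet>\<^bsub>Y\<^esub> farr F (tpi1 X A)"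
    "tpi2 Y (fobj F A) \<bullet>\<^bsub>Y\<^esub> h = lstr F A \<bullet>\<^bsub>Y\<^esub> farr F (tpi2 X A)"
    "lstr F A \<bullet>\<^bsub>Y\<^esub> farr F (ts X A) = ts Y (fobj F A) \<bullet>\<^bsub>Y\<^esub> h" by (rule XY.lax_ts[OF F A])
  have FA: "fobj F A \<in> Ob Y" using A by simp
  obtain i where i [simp]: "i \<in> Arr Z" "Dom Z i = fobj G (T2o Y (fobj F A))" "Cod Z i = T2o Z (fobj G (fobj F A))"
    and ip: "tpi1 Z (fobj G (fobj F A)) \<bullet>\<^bsub>Z\<^esub> i = lstr G (fobj F A) \<bullet>\<^bsub>Z\<^esub> farr G (tpi1 Y (fobj F A))"
    "tpi2 Z (fobj G (fobj F A)) \<bullet>\<^bsub>Z\<^esub> i = lstr G (fobj F A) \<bullet>\<^bsub>Z\<^esub> farr G (tpi2 Y (fobj F A))"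
    "lstr G (fobj F A) \<bullet>\<^bsub>Z\<^esub> farr G (ts Y (fobj F A)) = ts Z (fobj G (fobj F A)) \<bullet>\<^bsub>Z\<^esub> i"
    by (rule YZ.lax_ts[OF G FA])
  have "k = i \<bullet>\<^bsub>Z\<^esub> farr G h"
    by (rule YZ.Y.tpi_monic[of _ _ "fobj G (fobj F A)"])
      (use A k kp in \<open>simp_all add: ip[THEN YZ.Y.Cmp_eq_extend] YZ.farr_eq[OF hp(1)] YZ.farr_eq[OF hp(2)]\<close>)
  then show "lstr (tng_comp X Z G F) A \<bullet>\<^bsub>Z\<^esub> farr (tng_comp X Z G F) (ts X A) =
    ts Z (fobj (tng_comp X Z G F) A) \<bullet>\<^bsub>Z\<^esub> k"
    using A by (simp add: YZ.farr_eq[OF hp(3)] ip(3)[THEN YZ.Y.Cmp_eq_extend])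
qed simp_all

lemma tnt_whisker_right:
  assumes [simp]: "tangent_nat_trans Y Z \<psi>" "lax_tangent_morphism X Y F"
  shows "tangent_nat_trans X Z (nt_whisker_right X Z \<psi> F)"
proof (rule XZ.tangent_nat_transI)
  fix A assume A: "A \<in> Ob X"
  have n: "farr (ntgt \<psi>) (lstr F A) \<bullet>\<^bsub>Z\<^esub> ncmp \<psi> (fobj F (To X A)) = ncmp \<psi> (To Y (fobj F A)) \<bullet>\<^bsub>Z\<^esub> farr (nsrc \<psi>) (lstr F A)"
    using A YZ.tnt_nat[of \<psi> "lstr F A"] by simp
  show "Ta Z (ncmp (nt_whisker_right X Z \<psi> F) A) \<bullet>\<^bsub>Z\<^esub> lstr (nsrc (nt_whisker_right X Z \<psi> F)) A =
     lstr (ntgt (nt_whisker_right X Z \<psi> F)) A \<bullet>\<^bsub>Z\<^esub> ncmp (nt_whisker_right X Z \<psi> F) (To X A)"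
    using A by (simp add: n YZ.tnt_tan[THEN YZ.Y.Cmp_eq_extend])
qed (simp_all add: lax_comp YZ.tnt_nat)

lemma tnt_whisker_left:
  assumes [simp]: "tangent_nat_trans X Y \<phi>" "lax_tangent_morphism Y Z G"
  shows "tangent_nat_trans X Z (nt_whisker_left X Z G \<phi>)"
proof (rule XZ.tangent_nat_transI)
  fix A assume A: "A \<in> Ob X"
  have n: "Ta Z (farr G (ncmp \<phi> A)) \<bullet>\<^bsub>Z\<^esub> (lstr G (fobj (nsrc \<phi>) A) \<bullet>\<^bsub>Z\<^esub> x) =
      lstr G (fobj (ntgt \<phi>) A) \<bullet>\<^bsub>Z\<^esub> (farr G (Ta Y (ncmp \<phi> A)) \<bullet>\<^bsub>Z\<^esub> x)"
    if "x \<in> Arr Z" "Cod Z x = fobj G (To Y (fobj (nsrc \<phi>) A))" for x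
    using A that YZ.lstr_nat[OF assms(2), of "ncmp \<phi> A", OF _ refl, THEN YZ.Y.Cmp_eq_extend, of x] by simp
  show "Ta Z (ncmp (nt_whisker_left X Z G \<phi>) A) \<bullet>\<^bsub>Z\<^esub> lstr (nsrc (nt_whisker_left X Z G \<phi>)) A =
     lstr (ntgt (nt_whisker_left X Z G \<phi>)) A \<bullet>\<^bsub>Z\<^esub> ncmp (nt_whisker_left X Z G \<phi>) (To X A)"
    using A by (simp add: n YZ.farr_eq[OF XY.tnt_tan])
next
  fix f assume f: "f \<in> Arr X"
  show "ncmp (nt_whisker_left X Z G \<phi>) (Cod X f) \<bullet>\<^bsub>Z\<^esub> farr (nsrc (nt_whisker_left X Z G \<phi>)) f =
         farr (ntgt (nt_whisker_left X Z G \<phi>)) f \<bullet>\<^bsub>Z\<^esub> ncmp (nt_whisker_left X Z G \<phi>) (Dom X f)"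
    using f YZ.farr_eq[OF XY.tnt_nat[OF assms(1) f refl]] by simp
qed (simp_all add: lax_comp)

end

lemma tng_comp_assoc:
  fixes W :: "('o0, 'a0) tcat" and X :: "('o1, 'a1) tcat" and Y :: "('o2, 'a2) tcat" and Z :: "('o3, 'a3) tcat"
  assumes "lax_tangent_morphism W X F" "lax_tangent_morphism X Y G" "lax_tangent_morphism Y Z H"
  shows "tng_comp W Z H (tng_comp W Y G F) = tng_comp W Z (tng_comp X Z H G) F"
proof -
  interpret F: tangent_pair W X by (rule lax_tangent_pair[OF assms(1)])
  interpret G: tangent_pair X Y by (rule lax_tangent_pair[OF assms(2)])
  interpret H: tangent_pair Y Z by (rule lax_tangent_pair[OF assms(3)])
  show ?thesis using assms by (auto simp: tng_comp_def fun_eq_iff restrict_def)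
qed

lemma whisker_right_comp:
  fixes W :: "('o0, 'a0) tcat" and X :: "('o1, 'a1) tcat" and Y :: "('o2, 'a2) tcat" and Z :: "('o3, 'a3) tcat"
  assumes "lax_tangent_morphism W X F" "lax_tangent_morphism X Y G" "tangent_nat_trans Y Z \<psi>"
  shows "nt_whisker_right W Z (nt_whisker_right X Z \<psi> G) F = nt_whisker_right W Z \<psi> (tng_comp W Y G F)"
proof -
  interpret F: tangent_pair W X by (rule lax_tangent_pair[OF assms(1)])
  have l: "lax_tangent_morphism Y Z (nsrc \<psi>)" "lax_tangent_morphism Y Z (ntgt \<psi>)"
    using assms(3) unfolding tangent_nat_trans_def by blast+
  show ?thesis using assms tng_comp_assoc[OF assms(1,2) l(1)] tng_comp_assoc[OF assms(1,2) l(2)]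
    by (auto simp: nt_whisker_right_def fun_eq_iff restrict_def)
qed

lemma strict_ident:
  fixes X :: "('o, 'a) tcat"
  assumes "tangent_category X"
  shows "strict_tangent_morphism X X (tng_ident X)"
proof -
  from assms interpret X: tangent_on X by unfold_locales
  interpret tangent_pair X X by unfold_locales
  show ?thesis by (rule strict_tangent_morphismI) (simp_all add: tng_ident_def)
qed

lemma strict_lax: "strict_tangent_morphism X Y F \<Longrightarrow> lax_tangent_morphism X Y F"
  unfolding strict_tangent_morphism_def by blast

lemmas lax_ident = strict_ident[THEN strict_lax]

lemma tng_comp_ident_right:
  fixes X :: "('o1, 'a1) tcat" and Y :: "('o2, 'a2) tcat"
  assumes "lax_tangent_morphism X Y F"
  shows "tng_comp X Y F (tng_ident X) = F"
proof -
  interpret tangent_pair X Y by (rule lax_tangent_pair[OF assms])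
  interpret tangent_triple X X Y by unfold_locales
  show ?thesis
    by (rule lmor_eqI[OF lax_comp[OF lax_ident[OF X.tangent_X] assms] assms])
      (use assms in \<open>simp_all add: tng_ident_def\<close>)
qed

section \<open>The tangent category of lax tangent morphisms\<close>

lemma Tbar_simps [simp]:
  "A \<in> Ob X \<Longrightarrow> fobj (Tbar X Y F) A = To Y (fobj F A)"
  "f \<in> Arr X \<Longrightarrow> farr (Tbar X Y F) f = Ta Y (farr F f)"
  "A \<in> Ob X \<Longrightarrow> lstr (Tbar X Y F) A = tc Y (fobj F A) \<bullet>\<^bsub>Y\<^esub> Ta Y (lstr F A)"
  "fobj (Tbar X Y F) \<in> extensional (Ob X)" "farr (Tbar X Y F) \<in> extensional (Arr X)"
  "lstr (Tbar X Y F) \<in> extensional (Ob X)"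
  by (simp_all add: Tbar_def)

lemma T2bar_simps [simp]:
  "A \<in> Ob X \<Longrightarrow> fobj (T2bar X Y F) A = T2o Y (fobj F A)"
  "f \<in> Arr X \<Longrightarrow> farr (T2bar X Y F) f = T2a Y (farr F f)"
  "fobj (T2bar X Y F) \<in> extensional (Ob X)" "farr (T2bar X Y F) \<in> extensional (Arr X)"
  "lstr (T2bar X Y F) \<in> extensional (Ob X)"
  by (simp_all add: T2bar_def)

context tangent_pair
begin

lemma jointly_monic_pair:
  "is_pullback Y f g a b \<Longrightarrow> Dom Y a = L \<Longrightarrow> jointly_monic Y {..<2} L (\<lambda>j. two_legs a b j)"
  using Y.jointly_monic_wide Y.is_pullback_iff_wide by blast

text \<open>The structure \<open>c T\<alpha>\<close> inherits each axiom from \<open>\<alpha>\<close>, once \<open>c\<close> is moved past the structure map: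
  past \<open>p\<close>, \<open>z\<close> and \<open>s\<close> by the axioms that exchange the two tangent directions, past \<open>l\<close> by the hexagon
  with the lift, past \<open>c\<close> by the braid relation.\<close>

lemma lax_Tbar [simp]:
  assumes F [simp]: "lax_tangent_morphism X Y F"
  shows "lax_tangent_morphism X Y (Tbar X Y F)"
proof (rule lax_tangent_morphismI)
  fix f assume f: "f \<in> Arr X"
  show "lstr (Tbar X Y F) (Cod X f) \<bullet>\<^bsub>Y\<^esub> farr (Tbar X Y F) (Ta X f) =
    Ta Y (farr (Tbar X Y F) f) \<bullet>\<^bsub>Y\<^esub> lstr (Tbar X Y F) (Dom X f)"
    using f Y.Ta_eq[OF lstr_nat[OF F f refl]] by (simp add: Y.tc_nat[THEN Y.Cmp_eq_extend])
next
  fix A assume A: "A \<in> Ob X"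
  let ?A = "fobj F A" and ?B = "fobj F (To X A)"
  note [simp] = A
  show "tp Y (fobj (Tbar X Y F) A) \<bullet>\<^bsub>Y\<^esub> lstr (Tbar X Y F) A = farr (Tbar X Y F) (tp X A)"
    by (simp add: Y.tangent_equations(5)[THEN Y.Cmp_eq_extend] lax_equations(1)[THEN Y.Ta_eq])
  show "lstr (Tbar X Y F) A \<bullet>\<^bsub>Y\<^esub> farr (Tbar X Y F) (tz X A) = tz Y (fobj (Tbar X Y F) A)"
    by (simp add: lax_equations(2)[THEN Y.Ta_eq] Y.tangent_equations(6))
  have rev: "Ta Y (Ta Y (lstr F A)) \<bullet>\<^bsub>Y\<^esub> (tc Y ?B \<bullet>\<^bsub>Y\<^esub> x) =
      tc Y (To Y ?A) \<bullet>\<^bsub>Y\<^esub> (Ta Y (Ta Y (lstr F A)) \<bullet>\<^bsub>Y\<^esub> x)"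
    if "x \<in> Arr Y" "Cod Y x = To Y (To Y ?B)" for x
    using that by (simp add: Y.tc_nat[THEN Y.Cmp_eq_extend])
  have l: "Ta Y (tl Y ?A) \<bullet>\<^bsub>Y\<^esub> Ta Y (lstr F A) =
     Ta Y (Ta Y (lstr F A)) \<bullet>\<^bsub>Y\<^esub> (Ta Y (lstr F (To X A)) \<bullet>\<^bsub>Y\<^esub> Ta Y (farr F (tl X A)))"
    by (simp add: lax_equations(4)[THEN Y.Ta_eq])
  show "tl Y (fobj (Tbar X Y F) A) \<bullet>\<^bsub>Y\<^esub> lstr (Tbar X Y F) A =
     Ta Y (lstr (Tbar X Y F) A) \<bullet>\<^bsub>Y\<^esub> (lstr (Tbar X Y F) (To X A) \<bullet>\<^bsub>Y\<^esub> farr (Tbar X Y F) (tl X A))"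
    by (simp add: Y.tl_tc[THEN Y.Cmp_eq_extend] l rev)
  have c: "Ta Y (tc Y ?A) \<bullet>\<^bsub>Y\<^esub> (Ta Y (Ta Y (lstr F A)) \<bullet>\<^bsub>Y\<^esub> Ta Y (lstr F (To X A))) =
     Ta Y (Ta Y (lstr F A)) \<bullet>\<^bsub>Y\<^esub> (Ta Y (lstr F (To X A)) \<bullet>\<^bsub>Y\<^esub> Ta Y (farr F (tc X A)))"
    using arg_cong[OF lax_equations(5)[OF F A], of "Ta Y"] by simp
  show "tc Y (fobj (Tbar X Y F) A) \<bullet>\<^bsub>Y\<^esub> (Ta Y (lstr (Tbar X Y F) A) \<bullet>\<^bsub>Y\<^esub> lstr (Tbar X Y F) (To X A)) =
     Ta Y (lstr (Tbar X Y F) A) \<bullet>\<^bsub>Y\<^esub> (lstr (Tbar X Y F) (To X A) \<bullet>\<^bsub>Y\<^esub> farr (Tbar X Y F) (tc X A))"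
    by (simp add: rev Y.tangent_equations(12)[symmetric, THEN Y.Cmp_eq_extend3] c)
  fix k assume k: "k \<in> Arr Y" "Dom Y k = fobj (Tbar X Y F) (T2o X A)" "Cod Y k = T2o Y (fobj (Tbar X Y F) A)"
     and kp: "tpi1 Y (fobj (Tbar X Y F) A) \<bullet>\<^bsub>Y\<^esub> k = lstr (Tbar X Y F) A \<bullet>\<^bsub>Y\<^esub> farr (Tbar X Y F) (tpi1 X A)"
       "tpi2 Y (fobj (Tbar X Y F) A) \<bullet>\<^bsub>Y\<^esub> k = lstr (Tbar X Y F) A \<bullet>\<^bsub>Y\<^esub> farr (Tbar X Y F) (tpi2 X A)"
  obtain h where h [simp]: "h \<in> Arr Y" "Dom Y h = fobj F (T2o X A)" "Cod Y h = T2o Y (fobj F A)"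
    and hp: "tpi1 Y (fobj F A) \<bullet>\<^bsub>Y\<^esub> h = lstr F A \<bullet>\<^bsub>Y\<^esub> farr F (tpi1 X A)"
    "tpi2 Y (fobj F A) \<bullet>\<^bsub>Y\<^esub> h = lstr F A \<bullet>\<^bsub>Y\<^esub> farr F (tpi2 X A)"
    "lstr F A \<bullet>\<^bsub>Y\<^esub> farr F (ts X A) = ts Y (fobj F A) \<bullet>\<^bsub>Y\<^esub> h" by (rule lax_ts[OF F A])
  note fl = Y.T2_flip[of ?A]
  have "k = Y.T2_flip ?A \<bullet>\<^bsub>Y\<^esub> Ta Y h"
    by (rule Y.tpi_monic[of _ _ "To Y ?A"])
      (use k kp fl(1-3) in \<open>simp_all add: fl(4,5)[THEN Y.Cmp_eq_extend] hp(1,2)[THEN Y.Ta_eq]\<close>)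
  then show "lstr (Tbar X Y F) A \<bullet>\<^bsub>Y\<^esub> farr (Tbar X Y F) (ts X A) = ts Y (fobj (Tbar X Y F) A) \<bullet>\<^bsub>Y\<^esub> k"
    using fl(1-3) by (simp add: hp(3)[THEN Y.Ta_eq] fl(6)[THEN Y.Cmp_eq_extend])
qed simp_all

lemma T2bar_lstr:
  assumes F [simp]: "lax_tangent_morphism X Y F" and A [simp]: "A \<in> Ob X"
  shows "lstr (T2bar X Y F) A \<in> Arr Y" "Dom Y (lstr (T2bar X Y F) A) = T2o Y (fobj F (To X A))"
    "Cod Y (lstr (T2bar X Y F) A) = To Y (T2o Y (fobj F A))"
    "Ta Y (tpi1 Y (fobj F A)) \<bullet>\<^bsub>Y\<^esub> lstr (T2bar X Y F) A = lstr (Tbar X Y F) A \<bullet>\<^bsub>Y\<^esub> tpi1 Y (fobj F (To X A))"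
    "Ta Y (tpi2 Y (fobj F A)) \<bullet>\<^bsub>Y\<^esub> lstr (T2bar X Y F) A = lstr (Tbar X Y F) A \<bullet>\<^bsub>Y\<^esub> tpi2 Y (fobj F (To X A))"
proof -
  have "Ta Y (tp Y (fobj F A)) \<bullet>\<^bsub>Y\<^esub> (lstr (Tbar X Y F) A \<bullet>\<^bsub>Y\<^esub> tpi1 Y (fobj F (To X A))) =
     Ta Y (tp Y (fobj F A)) \<bullet>\<^bsub>Y\<^esub> (lstr (Tbar X Y F) A \<bullet>\<^bsub>Y\<^esub> tpi2 Y (fobj F (To X A)))"
    by (simp add: Y.Ta_tp_tc[THEN Y.Cmp_eq_extend] Y.tp_nat[THEN Y.Cmp_eq_extend] Y.tp_tpi)
  from Y.is_pullback_lift[OF Y.tpi_pullback_Ta(1)[of "fobj F A"] _ _ _ _ _ this]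
  show "lstr (T2bar X Y F) A \<in> Arr Y" "Dom Y (lstr (T2bar X Y F) A) = T2o Y (fobj F (To X A))"
    "Cod Y (lstr (T2bar X Y F) A) = To Y (T2o Y (fobj F A))"
    "Ta Y (tpi1 Y (fobj F A)) \<bullet>\<^bsub>Y\<^esub> lstr (T2bar X Y F) A = lstr (Tbar X Y F) A \<bullet>\<^bsub>Y\<^esub> tpi1 Y (fobj F (To X A))"
    "Ta Y (tpi2 Y (fobj F A)) \<bullet>\<^bsub>Y\<^esub> lstr (T2bar X Y F) A = lstr (Tbar X Y F) A \<bullet>\<^bsub>Y\<^esub> tpi2 Y (fobj F (To X A))"
    by (simp_all add: T2bar_def)
qed

text \<open>The projections to \<open>Tbar X Y F\<close> stay jointly monic under \<open>T\<close> and \<open>T T\<close>.\<close>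

lemma lax_T2bar [simp]:
  assumes F [simp]: "lax_tangent_morphism X Y F"
  shows "lax_tangent_morphism X Y (T2bar X Y F)"
proof (rule lax_by_cone[where J = "{..<2::nat}" and F = "\<lambda>_. Tbar X Y F" and
      e = "\<lambda>j A. two_legs (tpi1 Y (fobj F A)) (tpi2 Y (fobj F A)) j"])
  fix A assume A: "A \<in> Ob X"
  show "jointly_monic Y {..<2::nat} (fobj (T2bar X Y F) A) (\<lambda>j. two_legs (tpi1 Y (fobj F A)) (tpi2 Y (fobj F A)) j)"
    by (rule jointly_monic_pair[OF Y.tpi_pullback]) (use A in simp_all)
  show "jointly_monic Y {..<2::nat} (To Y (fobj (T2bar X Y F) A))
    (\<lambda>j. Ta Y (two_legs (tpi1 Y (fobj F A)) (tpi2 Y (fobj F A)) j))"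
    unfolding if_distrib by (rule jointly_monic_pair[OF Y.tpi_pullback_Ta(1)[of "fobj F A"]]) (use A in simp_all)
  show "jointly_monic Y {..<2::nat} (To Y (To Y (fobj (T2bar X Y F) A)))
    (\<lambda>j. Ta Y (Ta Y (two_legs (tpi1 Y (fobj F A)) (tpi2 Y (fobj F A)) j)))"
    unfolding if_distrib by (rule jointly_monic_pair[OF Y.tpi_pullback_Ta(2)[of "fobj F A"]]) (use A in simp_all)
qed (simp_all add: T2bar_lstr Y.tpi_nat)

abbreviation "H \<equiv> Hom X Y"

lemma Hom_simps [simp]:
  "Ob H = {F. lax_tangent_morphism X Y F}" "Arr H = {\<phi>. tangent_nat_trans X Y \<phi>}"
  "Dom H = nsrc" "Cod H = ntgt" "To H = Tbar X Y"
  by (simp_all add: Hom_def)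

lemma Hom_Cmp_simps [simp]:
  "nsrc (g \<bullet>\<^bsub>H\<^esub> f) = nsrc f" "ntgt (g \<bullet>\<^bsub>H\<^esub> f) = ntgt g"
  "A \<in> Ob X \<Longrightarrow> ncmp (g \<bullet>\<^bsub>H\<^esub> f) A = ncmp g A \<bullet>\<^bsub>Y\<^esub> ncmp f A"
  "nsrc (Ident H F) = F" "ntgt (Ident H F) = F" "A \<in> Ob X \<Longrightarrow> ncmp (Ident H F) A = Ident Y (fobj F A)"
  by (simp_all add: Hom_def nt_comp_def nt_ident_def)

lemma Hom_structure_simps [simp]:
  "nsrc (Ta H \<phi>) = Tbar X Y (nsrc \<phi>)" "ntgt (Ta H \<phi>) = Tbar X Y (ntgt \<phi>)"
  "A \<in> Ob X \<Longrightarrow> ncmp (Ta H \<phi>) A = Ta Y (ncmp \<phi> A)"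
  "nsrc (tp H F) = Tbar X Y F" "ntgt (tp H F) = F" "A \<in> Ob X \<Longrightarrow> ncmp (tp H F) A = tp Y (fobj F A)"
  "nsrc (tpi1 H F) = T2bar X Y F" "ntgt (tpi1 H F) = Tbar X Y F"
  "A \<in> Ob X \<Longrightarrow> ncmp (tpi1 H F) A = tpi1 Y (fobj F A)"
  "nsrc (tpi2 H F) = T2bar X Y F" "ntgt (tpi2 H F) = Tbar X Y F"
  "A \<in> Ob X \<Longrightarrow> ncmp (tpi2 H F) A = tpi2 Y (fobj F A)"
  "nsrc (tz H F) = F" "ntgt (tz H F) = Tbar X Y F" "A \<in> Ob X \<Longrightarrow> ncmp (tz H F) A = tz Y (fobj F A)"
  "nsrc (ts H F) = T2bar X Y F" "ntgt (ts H F) = Tbar X Y F" "A \<in> Ob X \<Longrightarrow> ncmp (ts H F) A = ts Y (fobj F A)"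
  "nsrc (tl H F) = Tbar X Y F" "ntgt (tl H F) = Tbar X Y (Tbar X Y F)"
  "A \<in> Ob X \<Longrightarrow> ncmp (tl H F) A = tl Y (fobj F A)"
  "nsrc (tc H F) = Tbar X Y (Tbar X Y F)" "ntgt (tc H F) = Tbar X Y (Tbar X Y F)"
  "A \<in> Ob X \<Longrightarrow> ncmp (tc H F) A = tc Y (fobj F A)"
  "T2o H F = T2bar X Y F"
  by (simp_all add: Hom_def T2o_def)

lemma Hom_extensional [simp]:
  "ncmp (g \<bullet>\<^bsub>H\<^esub> f) \<in> extensional (Ob X)" "ncmp (Ident H F) \<in> extensional (Ob X)"
  "ncmp (Ta H \<phi>) \<in> extensional (Ob X)" "ncmp (tp H F) \<in> extensional (Ob X)"
  "ncmp (tpi1 H F) \<in> extensional (Ob X)" "ncmp (tpi2 H F) \<in> extensional (Ob X)"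
  "ncmp (tz H F) \<in> extensional (Ob X)" "ncmp (ts H F) \<in> extensional (Ob X)"
  "ncmp (tl H F) \<in> extensional (Ob X)" "ncmp (tc H F) \<in> extensional (Ob X)"
  by (simp_all add: Hom_def nt_comp_def nt_ident_def)

lemma tnt_Ident [simp]:
  assumes [simp]: "lax_tangent_morphism X Y F" shows "tangent_nat_trans X Y (Ident H F)"
  by (rule tangent_nat_transI) simp_all

lemma tnt_Cmp [simp]:
  assumes g [simp]: "tangent_nat_trans X Y g" and f [simp]: "tangent_nat_trans X Y f" and e: "ntgt f = nsrc g"
  shows "tangent_nat_trans X Y (g \<bullet>\<^bsub>H\<^esub> f)"
proof (rule tangent_nat_transI)
  fix A assume A: "A \<in> Ob X"
  show "Ta Y (ncmp (g \<bullet>\<^bsub>H\<^esub> f) A) \<bullet>\<^bsub>Y\<^esub> lstr (nsrc (g \<bullet>\<^bsub>H\<^esub> f)) A =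
    lstr (ntgt (g \<bullet>\<^bsub>H\<^esub> f)) A \<bullet>\<^bsub>Y\<^esub> ncmp (g \<bullet>\<^bsub>H\<^esub> f) (To X A)"
    using A tnt_typing(3-5)[OF f] tnt_tan[OF f] lax_typing[OF tnt_typing(1)[OF g]]
    by (simp add: e tnt_tan[OF g, THEN Y.Cmp_eq_extend])
next
  fix h assume h: "h \<in> Arr X"
  show "ncmp (g \<bullet>\<^bsub>H\<^esub> f) (Cod X h) \<bullet>\<^bsub>Y\<^esub> farr (nsrc (g \<bullet>\<^bsub>H\<^esub> f)) h =
         farr (ntgt (g \<bullet>\<^bsub>H\<^esub> f)) h \<bullet>\<^bsub>Y\<^esub> ncmp (g \<bullet>\<^bsub>H\<^esub> f) (Dom X h)"
    using h tnt_nat[OF f h refl] by (simp add: e tnt_nat[OF g, THEN Y.Cmp_eq_extend])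
qed (simp_all add: e)

lemma tnt_Ta [simp]:
  assumes f [simp]: "tangent_nat_trans X Y f"
  shows "tangent_nat_trans X Y (Ta H f)"
proof (rule tangent_nat_transI)
  fix A assume A: "A \<in> Ob X"
  show "Ta Y (ncmp (Ta H f) A) \<bullet>\<^bsub>Y\<^esub> lstr (nsrc (Ta H f)) A = lstr (ntgt (Ta H f)) A \<bullet>\<^bsub>Y\<^esub> ncmp (Ta H f) (To X A)"
    using A Y.tc_nat[of "ncmp f A" "fobj (ntgt f) A", THEN Y.Cmp_eq_extend, of "Ta Y (lstr (nsrc f) A)"]
    by (simp add: tnt_tan[OF f, THEN Y.Ta_eq])
next
  fix h assume h: "h \<in> Arr X"
  show "ncmp (Ta H f) (Cod X h) \<bullet>\<^bsub>Y\<^esub> farr (nsrc (Ta H f)) h = farr (ntgt (Ta H f)) h \<bullet>\<^bsub>Y\<^esub> ncmp (Ta H f) (Dom X h)"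
    using h by (simp add: tnt_nat[OF f, THEN Y.Ta_eq])
qed simp_all

lemma tnt_structure [simp]:
  assumes F [simp]: "lax_tangent_morphism X Y F"
  shows "tangent_nat_trans X Y (tp H F)" "tangent_nat_trans X Y (tpi1 H F)" "tangent_nat_trans X Y (tpi2 H F)"
    "tangent_nat_trans X Y (tz H F)" "tangent_nat_trans X Y (ts H F)" "tangent_nat_trans X Y (tl H F)"
    "tangent_nat_trans X Y (tc H F)"
proof -
  show "tangent_nat_trans X Y (tp H F)"
    by (rule tangent_nat_transI) (simp_all add: Y.tp_nat Y.Ta_tp_tc[THEN Y.Cmp_eq_extend])
  show "tangent_nat_trans X Y (tpi1 H F)" "tangent_nat_trans X Y (tpi2 H F)"
    by (rule tangent_nat_transI; simp add: Y.tpi_nat T2bar_lstr[simplified] del: Tbar_simps(3))+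
  show "tangent_nat_trans X Y (tz H F)"
  proof (rule tangent_nat_transI)
    fix A assume A [simp]: "A \<in> Ob X"
    have c: "tc Y (fobj F A) \<bullet>\<^bsub>Y\<^esub> tz Y (To Y (fobj F A)) = Ta Y (tz Y (fobj F A))"
      unfolding Y.tangent_equations(6)[OF lax_typing(1)[OF F A], symmetric] by (simp add: Y.tc_tc)
    have "Ta Y (lstr F A) \<bullet>\<^bsub>Y\<^esub> tz Y (fobj F (To X A)) = tz Y (To Y (fobj F A)) \<bullet>\<^bsub>Y\<^esub> lstr F A"
      by (simp add: Y.tz_nat)
    then show "Ta Y (ncmp (tz H F) A) \<bullet>\<^bsub>Y\<^esub> lstr (nsrc (tz H F)) A = lstr (ntgt (tz H F)) A \<bullet>\<^bsub>Y\<^esub> ncmp (tz H F) (To X A)"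
      by (simp add: c[THEN Y.Cmp_eq_extend])
  qed (simp_all add: Y.tz_nat)
  show "tangent_nat_trans X Y (ts H F)"
  proof (rule tangent_nat_transI)
    fix A assume A [simp]: "A \<in> Ob X"
    let ?A = "fobj F A"
    note fl = Y.T2_flip[of ?A] and l = T2bar_lstr[OF F A]
    have eq: "Y.T2_flip ?A \<bullet>\<^bsub>Y\<^esub> lstr (T2bar X Y F) A = T2a Y (lstr F A)"
      by (rule Y.tpi_monic[of _ _ "To Y ?A"])
        (use fl(1-3) l in \<open>simp_all add: fl(4,5)[THEN Y.Cmp_eq_extend] Y.tpi_nat Y.tc_tc\<close>)
    have "tc Y ?A \<bullet>\<^bsub>Y\<^esub> (tc Y ?A \<bullet>\<^bsub>Y\<^esub> (Ta Y (ts Y ?A) \<bullet>\<^bsub>Y\<^esub> lstr (T2bar X Y F) A)) =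
       tc Y ?A \<bullet>\<^bsub>Y\<^esub> (ts Y (To Y ?A) \<bullet>\<^bsub>Y\<^esub> T2a Y (lstr F A))"
      using fl(1-3) l(1-3) by (simp add: fl(6)[THEN Y.Cmp_eq_extend] eq)
    then show "Ta Y (ncmp (ts H F) A) \<bullet>\<^bsub>Y\<^esub> lstr (nsrc (ts H F)) A = lstr (ntgt (ts H F)) A \<bullet>\<^bsub>Y\<^esub> ncmp (ts H F) (To X A)"
      using l(1-3) by (simp add: Y.ts_nat Y.tc_tc)
  qed (simp_all add: Y.ts_nat)
  show "tangent_nat_trans X Y (tl H F)"
  proof (rule tangent_nat_transI)
    fix A assume A [simp]: "A \<in> Ob X"
    show "Ta Y (ncmp (tl H F) A) \<bullet>\<^bsub>Y\<^esub> lstr (nsrc (tl H F)) A = lstr (ntgt (tl H F)) A \<bullet>\<^bsub>Y\<^esub> ncmp (tl H F) (To X A)"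
      using Y.tl_nat[of "lstr F A" "To Y (fobj F A)"]
      by (simp flip: Y.tl_nat add: Y.tangent_equations(10)[symmetric, THEN Y.Cmp_eq_extend])
  qed (simp_all add: Y.tl_nat)
  show "tangent_nat_trans X Y (tc H F)"
  proof (rule tangent_nat_transI)
    fix A assume A [simp]: "A \<in> Ob X"
    have rev: "Ta Y (Ta Y (lstr F A)) \<bullet>\<^bsub>Y\<^esub> tc Y (fobj F (To X A)) = tc Y (To Y (fobj F A)) \<bullet>\<^bsub>Y\<^esub> Ta Y (Ta Y (lstr F A))"
      by (simp add: Y.tc_nat)
    show "Ta Y (ncmp (tc H F) A) \<bullet>\<^bsub>Y\<^esub> lstr (nsrc (tc H F)) A = lstr (ntgt (tc H F)) A \<bullet>\<^bsub>Y\<^esub> ncmp (tc H F) (To X A)"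
      by (simp add: rev Y.tangent_equations(12)[THEN Y.Cmp_eq_extend3])
  qed (simp_all add: Y.tc_nat)
qed

lemma tnt_eqI:
  assumes "tangent_nat_trans X Y \<phi>" "tangent_nat_trans X Y \<psi>" "nsrc \<phi> = nsrc \<psi>" "ntgt \<phi> = ntgt \<psi>"
    "\<And>A. A \<in> Ob X \<Longrightarrow> ncmp \<phi> A = ncmp \<psi> A"
  shows "\<phi> = \<psi>"
  using assms by (intro nt_eqI) (simp_all add: tnt_extensional)

lemma category_Hom: "category H"
  unfolding category_def
proof (intro conjI ballI impI)
  fix f assume "f \<in> Arr H"
  then show "f \<bullet>\<^bsub>H\<^esub> Ident H (Dom H f) = f" "Ident H (Cod H f) \<bullet>\<^bsub>H\<^esub> f = f"
    by (auto intro!: tnt_eqI)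
next
  fix f g h assume "f \<in> Arr H" "g \<in> Arr H" "h \<in> Arr H" "Cod H f = Dom H g \<and> Cod H g = Dom H h"
  then have t [simp]: "tangent_nat_trans X Y f" "tangent_nat_trans X Y g" "tangent_nat_trans X Y h"
    and e: "ntgt f = nsrc g" "ntgt g = nsrc h" by simp_all
  show "h \<bullet>\<^bsub>H\<^esub> (g \<bullet>\<^bsub>H\<^esub> f) = (h \<bullet>\<^bsub>H\<^esub> g) \<bullet>\<^bsub>H\<^esub> f"
    by (rule tnt_eqI) (simp_all add: e)
qed (auto simp del: Hom_simps(5))

end

sublocale tangent_pair \<subseteq> H: category_on "Hom X Y"
  using category_Hom by unfold_locales

context tangent_pair
begin

lemma Hom_pow [simp]:
  "nsrc ((Ta H ^^ m) \<phi>) = (Tbar X Y ^^ m) (nsrc \<phi>)" "ntgt ((Ta H ^^ m) \<phi>) = (Tbar X Y ^^ m) (ntgt \<phi>)"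
  "A \<in> Ob X \<Longrightarrow> ncmp ((Ta H ^^ m) \<phi>) A = (Ta Y ^^ m) (ncmp \<phi> A)"
  "A \<in> Ob X \<Longrightarrow> fobj ((Tbar X Y ^^ m) F) A = (To Y ^^ m) (fobj F A)"
  "tangent_nat_trans X Y \<phi> \<Longrightarrow> tangent_nat_trans X Y ((Ta H ^^ m) \<phi>)"
  "lax_tangent_morphism X Y F \<Longrightarrow> lax_tangent_morphism X Y ((Tbar X Y ^^ m) F)"
  by (induction m) simp_all

subsection \<open>Componentwise limits\<close>

text \<open>The components of an arrow into \<open>P\<close> exist one by one. They are natural because the components of
  the legs are jointly monic, and tangent because the images of these components under \<open>T\<close> are.\<close>

lemma Hom_wideI:
  assumes \<phi> [simp]: "\<And>j. j \<in> J \<Longrightarrow> tangent_nat_trans X Y (\<phi> j)" "\<And>j. j \<in> J \<Longrightarrow> ntgt (\<phi> j) = G"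
    and e [simp]: "\<And>j. j \<in> J \<Longrightarrow> tangent_nat_trans X Y (e j)" "\<And>j. j \<in> J \<Longrightarrow> nsrc (e j) = P"
      "\<And>j. j \<in> J \<Longrightarrow> ntgt (e j) = nsrc (\<phi> j)"
    and P [simp]: "lax_tangent_morphism X Y P"
    and w: "\<And>A. A \<in> Ob X \<Longrightarrow> wide_pullback Y J (\<lambda>j. ncmp (\<phi> j) A) (fobj P A) (\<lambda>j. ncmp (e j) A)"
    and jm: "\<And>A. A \<in> Ob X \<Longrightarrow> jointly_monic Y J (To Y (fobj P A)) (\<lambda>j. Ta Y (ncmp (e j) A))"
  shows "wide_pullback H J \<phi> P e"
proof (rule wide_pullbackI)
  have [simp]: "ncmp (e j) A \<in> Arr Y" "Dom Y (ncmp (e j) A) = fobj P A" "Cod Y (ncmp (e j) A) = fobj (nsrc (\<phi> j)) A"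
    if "j \<in> J" "A \<in> Ob X" for j A
    using tnt_typing(3-5)[OF e(1)[OF that(1)] that(2)] e(2,3)[OF that(1)] by auto
  have [simp]: "lax_tangent_morphism X Y (nsrc (\<phi> j))" if "j \<in> J" for j
    by (rule tnt_typing(1)[OF \<phi>(1)[OF that]])
  show "\<phi> j \<in> Arr H" if "j \<in> J" for j using that by simp
  show "e j \<in> Arr H \<and> Dom H (e j) = P \<and> Cod H (e j) = Dom H (\<phi> j)" if "j \<in> J" for j
    using that by simp
  show "Cod H (\<phi> j) = Cod H (\<phi> k) \<and> \<phi> j \<bullet>\<^bsub>H\<^esub> e j = \<phi> k \<bullet>\<^bsub>H\<^esub> e k" if "j \<in> J" "k \<in> J" for j k
  proof
    show "\<phi> j \<bullet>\<^bsub>H\<^esub> e j = \<phi> k \<bullet>\<^bsub>H\<^esub> e k"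
      by (rule tnt_eqI) (use that wide_pullback_cone(1)[OF w, of _ j k] in simp_all)
  qed (use that in simp)
  note jm0 = jointly_monicD[OF Y.jointly_monic_wide[OF w]]
  show "jointly_monic H J P e"
    unfolding jointly_monic_def
  proof (intro ballI impI)
    fix x y assume xy: "x \<in> Arr H" "y \<in> Arr H" "Dom H x = Dom H y" "Cod H x = P" "Cod H y = P"
      and eq: "\<forall>j\<in>J. e j \<bullet>\<^bsub>H\<^esub> x = e j \<bullet>\<^bsub>H\<^esub> y"
    show "x = y"
    proof (rule tnt_eqI)
      fix A assume A: "A \<in> Ob X"
      show "ncmp x A = ncmp y A"
      proof (rule jm0[OF A])
        fix j assume "j \<in> J"
        with eq have "ncmp (e j \<bullet>\<^bsub>H\<^esub> x) A = ncmp (e j \<bullet>\<^bsub>H\<^esub> y) A" by simp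
        then show "ncmp (e j) A \<bullet>\<^bsub>Y\<^esub> ncmp x A = ncmp (e j) A \<bullet>\<^bsub>Y\<^esub> ncmp y A" using A by simp
      qed (use xy A in simp_all)
    qed (use xy in simp_all)
  qed
  fix W u assume W: "W \<in> Ob H" and u: "\<And>j. j \<in> J \<Longrightarrow> u j \<in> Arr H \<and> Dom H (u j) = W \<and> Cod H (u j) = Dom H (\<phi> j)"
    and eq: "\<And>j k. j \<in> J \<Longrightarrow> k \<in> J \<Longrightarrow> \<phi> j \<bullet>\<^bsub>H\<^esub> u j = \<phi> k \<bullet>\<^bsub>H\<^esub> u k"
  have W' [simp]: "lax_tangent_morphism X Y W" using W by simp
  have u' [simp]: "tangent_nat_trans X Y (u j)" "nsrc (u j) = W" "ntgt (u j) = nsrc (\<phi> j)" if "j \<in> J" for j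
    using u[OF that] by auto
  have uc [simp]: "ncmp (u j) A \<in> Arr Y" "Dom Y (ncmp (u j) A) = fobj W A" "Cod Y (ncmp (u j) A) = fobj (nsrc (\<phi> j)) A"
    if "j \<in> J" "A \<in> Ob X" for j A
    using tnt_typing(3-5)[OF u'(1)[OF that(1)] that(2)] u'(2,3)[OF that(1)] by auto
  have "\<exists>h. h \<in> Arr Y \<and> Dom Y h = fobj W A \<and> Cod Y h = fobj P A \<and> (\<forall>j\<in>J. ncmp (e j) A \<bullet>\<^bsub>Y\<^esub> h = ncmp (u j) A)"
    if A: "A \<in> Ob X" for A
  proof (rule wide_pullback_lift[OF w[OF A]])
    fix j k assume jk: "j \<in> J" "k \<in> J"
    have "ncmp (\<phi> j \<bullet>\<^bsub>H\<^esub> u j) A = ncmp (\<phi> k \<bullet>\<^bsub>H\<^esub> u k) A" using eq[OF jk] by simp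
    then show "ncmp (\<phi> j) A \<bullet>\<^bsub>Y\<^esub> ncmp (u j) A = ncmp (\<phi> k) A \<bullet>\<^bsub>Y\<^esub> ncmp (u k) A"
      using A by simp
  qed (use A in simp_all)
  then obtain h where h: "\<forall>A\<in>Ob X. h A \<in> Arr Y \<and> Dom Y (h A) = fobj W A \<and> Cod Y (h A) = fobj P A \<and>
      (\<forall>j\<in>J. ncmp (e j) A \<bullet>\<^bsub>Y\<^esub> h A = ncmp (u j) A)" by metis
  have hc [simp]: "h A \<in> Arr Y" "Dom Y (h A) = fobj W A" "Cod Y (h A) = fobj P A" if "A \<in> Ob X" for A
    using h that by auto
  have he: "ncmp (e j) A \<bullet>\<^bsub>Y\<^esub> h A = ncmp (u j) A" if "j \<in> J" "A \<in> Ob X" for j A using h that by blast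
  let ?h = "\<lparr>nsrc = W, ntgt = P, ncmp = restrict h (Ob X)\<rparr>"
  have t: "tangent_nat_trans X Y ?h"
  proof (rule tangent_nat_transI)
    fix f assume f: "f \<in> Arr X"
    have "h (Cod X f) \<bullet>\<^bsub>Y\<^esub> farr W f = farr P f \<bullet>\<^bsub>Y\<^esub> h (Dom X f)"
    proof (rule jm0[of "Cod X f"])
      fix j assume j: "j \<in> J"
      note n = tnt_nat[OF u'(1)[OF j] f refl] tnt_nat[OF e(1)[OF j] f refl]
      show "ncmp (e j) (Cod X f) \<bullet>\<^bsub>Y\<^esub> (h (Cod X f) \<bullet>\<^bsub>Y\<^esub> farr W f) = ncmp (e j) (Cod X f) \<bullet>\<^bsub>Y\<^esub> (farr P f \<bullet>\<^bsub>Y\<^esub> h (Dom X f))"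
        using j f n by (simp add: he he[THEN Y.Cmp_eq_extend] n(2)[simplified e[OF j], THEN Y.Cmp_eq_extend])
    qed (use f in simp_all)
    then show "ncmp ?h (Cod X f) \<bullet>\<^bsub>Y\<^esub> farr (nsrc ?h) f = farr (ntgt ?h) f \<bullet>\<^bsub>Y\<^esub> ncmp ?h (Dom X f)"
      using f by simp
  next
    fix A assume A: "A \<in> Ob X"
    have "Ta Y (h A) \<bullet>\<^bsub>Y\<^esub> lstr W A = lstr P A \<bullet>\<^bsub>Y\<^esub> h (To X A)"
    proof (rule jointly_monicD[OF jm[OF A]])
      fix j assume j: "j \<in> J"
      note n = tnt_tan[OF u'(1)[OF j] A] tnt_tan[OF e(1)[OF j] A]
      show "Ta Y (ncmp (e j) A) \<bullet>\<^bsub>Y\<^esub> (Ta Y (h A) \<bullet>\<^bsub>Y\<^esub> lstr W A) = Ta Y (ncmp (e j) A) \<bullet>\<^bsub>Y\<^esub> (lstr P A \<bullet>\<^bsub>Y\<^esub> h (To X A))"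
        using j A n by (simp add: he he[THEN Y.Ta_eq, THEN Y.Cmp_eq_extend] n(2)[simplified e[OF j], THEN Y.Cmp_eq_extend])
    qed (use A in simp_all)
    then show "Ta Y (ncmp ?h A) \<bullet>\<^bsub>Y\<^esub> lstr (nsrc ?h) A = lstr (ntgt ?h) A \<bullet>\<^bsub>Y\<^esub> ncmp ?h (To X A)"
      using A by simp
  qed simp_all
  have "e j \<bullet>\<^bsub>H\<^esub> ?h = u j" if "j \<in> J" for j
    by (rule tnt_eqI) (use that t in \<open>simp_all add: he\<close>)
  then show "\<exists>h. h \<in> hom H W P \<and> (\<forall>j\<in>J. e j \<bullet>\<^bsub>H\<^esub> h = u j)"
    using t by (intro exI[of _ ?h]) simp
qed

text \<open>The apex is built from limits chosen at each object: its arrow part and its lax structure are the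
  induced arrows, and the axioms hold by \<open>lax_by_cone\<close>.\<close>

lemma Hom_wide_ex:
  assumes \<phi> [simp]: "\<And>j. j \<in> J \<Longrightarrow> tangent_nat_trans X Y (\<phi> j)" and tgt [simp]: "\<And>j. j \<in> J \<Longrightarrow> ntgt (\<phi> j) = G"
    and J: "J \<noteq> {}" and st: "\<And>A. A \<in> Ob X \<Longrightarrow> T_stable Y J (\<lambda>j. ncmp (\<phi> j) A)"
  shows "\<exists>P e. wide_pullback H J \<phi> P e \<and> lax_tangent_morphism X Y P \<and>
     (\<forall>A\<in>Ob X. wide_pullback Y J (\<lambda>j. ncmp (\<phi> j) A) (fobj P A) (\<lambda>j. ncmp (e j) A))"
proof -
  have G [simp]: "lax_tangent_morphism X Y G" using J \<phi> tgt tnt_typing(2) by (metis ex_in_conv)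
  have F [simp]: "lax_tangent_morphism X Y (nsrc (\<phi> j))" if "j \<in> J" for j
    by (rule tnt_typing(1)[OF \<phi>[OF that]])
  have "\<exists>L e. wide_pullback Y J (\<lambda>j. ncmp (\<phi> j) A) L e" if "A \<in> Ob X" for A
    using st[OF that] unfolding T_stable_def by blast
  then obtain L e where w: "\<And>A. A \<in> Ob X \<Longrightarrow> wide_pullback Y J (\<lambda>j. ncmp (\<phi> j) A) (L A) (e A)"
    by metis
  note wT = T_stableD[OF st w]
  have e [simp]: "e A j \<in> Arr Y" "Dom Y (e A j) = L A" "Cod Y (e A j) = fobj (nsrc (\<phi> j)) A"
    if "j \<in> J" "A \<in> Ob X" for A j
    using wide_pullbackD[OF w[OF that(2)] that(1)] that by auto
  have L [simp]: "L A \<in> Ob Y" if "A \<in> Ob X" for A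
    using J e(1,2) that by (metis Y.Dom_Ob ex_in_conv)
  have cone: "ncmp (\<phi> j) A \<bullet>\<^bsub>Y\<^esub> e A j = ncmp (\<phi> k) A \<bullet>\<^bsub>Y\<^esub> e A k" if "j \<in> J" "k \<in> J" "A \<in> Ob X" for j k A
    by (rule wide_pullback_cone(1)[OF w[OF that(3)] that(1,2)])
  have "\<exists>h. h \<in> Arr Y \<and> Dom Y h = L (Dom X f) \<and> Cod Y h = L (Cod X f) \<and>
    (\<forall>j\<in>J. e (Cod X f) j \<bullet>\<^bsub>Y\<^esub> h = farr (nsrc (\<phi> j)) f \<bullet>\<^bsub>Y\<^esub> e (Dom X f) j)" if f: "f \<in> Arr X" for f
  proof (rule wide_pullback_lift[OF w])
    fix j k assume jk: "j \<in> J" "k \<in> J"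
    have n: "ncmp (\<phi> j) (Cod X f) \<bullet>\<^bsub>Y\<^esub> (farr (nsrc (\<phi> j)) f \<bullet>\<^bsub>Y\<^esub> e (Dom X f) j) =
        farr G f \<bullet>\<^bsub>Y\<^esub> (ncmp (\<phi> j) (Dom X f) \<bullet>\<^bsub>Y\<^esub> e (Dom X f) j)" if "j \<in> J" for j
      using that f by (simp add: tnt_nat[OF \<phi>[OF that], THEN Y.Cmp_eq_extend])
    show "ncmp (\<phi> j) (Cod X f) \<bullet>\<^bsub>Y\<^esub> (farr (nsrc (\<phi> j)) f \<bullet>\<^bsub>Y\<^esub> e (Dom X f) j) =
      ncmp (\<phi> k) (Cod X f) \<bullet>\<^bsub>Y\<^esub> (farr (nsrc (\<phi> k)) f \<bullet>\<^bsub>Y\<^esub> e (Dom X f) k)"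
      unfolding n[OF jk(1)] n[OF jk(2)] using cone[OF jk, of "Dom X f"] f by simp
  qed (use f in simp_all)
  \<comment> \<open>the arrow part of the apex\<close>
  then obtain pa where pa: "\<forall>f\<in>Arr X. pa f \<in> Arr Y \<and> Dom Y (pa f) = L (Dom X f) \<and> Cod Y (pa f) = L (Cod X f) \<and>
    (\<forall>j\<in>J. e (Cod X f) j \<bullet>\<^bsub>Y\<^esub> pa f = farr (nsrc (\<phi> j)) f \<bullet>\<^bsub>Y\<^esub> e (Dom X f) j)" by metis
  have "\<exists>h. h \<in> Arr Y \<and> Dom Y h = L (To X A) \<and> Cod Y h = To Y (L A) \<and>
    (\<forall>j\<in>J. Ta Y (e A j) \<bullet>\<^bsub>Y\<^esub> h = lstr (nsrc (\<phi> j)) A \<bullet>\<^bsub>Y\<^esub> e (To X A) j)" if A: "A \<in> Ob X" for A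
  proof (rule wide_pullback_lift[OF wT(2)[OF A A]])
    fix j k assume jk: "j \<in> J" "k \<in> J"
    have n: "Ta Y (ncmp (\<phi> j) A) \<bullet>\<^bsub>Y\<^esub> (lstr (nsrc (\<phi> j)) A \<bullet>\<^bsub>Y\<^esub> e (To X A) j) =
        lstr G A \<bullet>\<^bsub>Y\<^esub> (ncmp (\<phi> j) (To X A) \<bullet>\<^bsub>Y\<^esub> e (To X A) j)" if "j \<in> J" for j
      using that A by (simp add: tnt_tan[OF \<phi>[OF that], THEN Y.Cmp_eq_extend])
    show "Ta Y (ncmp (\<phi> j) A) \<bullet>\<^bsub>Y\<^esub> (lstr (nsrc (\<phi> j)) A \<bullet>\<^bsub>Y\<^esub> e (To X A) j) =
      Ta Y (ncmp (\<phi> k) A) \<bullet>\<^bsub>Y\<^esub> (lstr (nsrc (\<phi> k)) A \<bullet>\<^bsub>Y\<^esub> e (To X A) k)"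
      unfolding n[OF jk(1)] n[OF jk(2)] using cone[OF jk, of "To X A"] A by simp
  qed (use A in simp_all)
  \<comment> \<open>the lax structure of the apex, which exists because \<open>T\<close> preserves the limit at \<open>A\<close>\<close>
  then obtain pl where pl: "\<forall>A\<in>Ob X. pl A \<in> Arr Y \<and> Dom Y (pl A) = L (To X A) \<and> Cod Y (pl A) = To Y (L A) \<and>
    (\<forall>j\<in>J. Ta Y (e A j) \<bullet>\<^bsub>Y\<^esub> pl A = lstr (nsrc (\<phi> j)) A \<bullet>\<^bsub>Y\<^esub> e (To X A) j)" by metis
  let ?P = "\<lparr>fobj = restrict L (Ob X), farr = restrict pa (Arr X), lstr = restrict pl (Ob X)\<rparr>"
  let ?e = "\<lambda>j. \<lparr>nsrc = ?P, ntgt = nsrc (\<phi> j), ncmp = \<lambda>A\<in>Ob X. e A j\<rparr>"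
  have P: "lax_tangent_morphism X Y ?P"
  proof (rule lax_by_cone[where J = J and F = "\<lambda>j. nsrc (\<phi> j)" and e = "\<lambda>j A. e A j"])
    fix A assume A: "A \<in> Ob X"
    show "jointly_monic Y J (fobj ?P A) (e A)" "jointly_monic Y J (To Y (fobj ?P A)) (\<lambda>j. Ta Y (e A j))"
      "jointly_monic Y J (To Y (To Y (fobj ?P A))) (\<lambda>j. Ta Y (Ta Y (e A j)))"
      using Y.jointly_monic_wide[OF w[OF A]] Y.jointly_monic_wide[OF wT(2)[OF A A]]
        Y.jointly_monic_wide[OF wT(3)[OF A A]] A by simp_all
  qed (use pa pl in simp_all)
  have te: "tangent_nat_trans X Y (?e j)" if "j \<in> J" for j
    by (rule tangent_nat_transI) (use that P pa pl in simp_all)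
  have w': "wide_pullback Y J (\<lambda>j. ncmp (\<phi> j) A) (fobj ?P A) (\<lambda>j. ncmp (?e j) A)" if "A \<in> Ob X" for A
    using w[OF that] that by simp
  have "wide_pullback H J \<phi> ?P ?e"
  proof (rule Hom_wideI[where G = G])
    fix A assume A: "A \<in> Ob X"
    show "jointly_monic Y J (To Y (fobj ?P A)) (\<lambda>j. Ta Y (ncmp (?e j) A))"
      using Y.jointly_monic_wide[OF wT(2)[OF A A]] A by simp
  qed (use te P w' in simp_all)
  then show ?thesis using P w' by (intro exI[of _ ?P] exI[of _ ?e] conjI) blast+
qed

text \<open>Every limit cone is isomorphic to the one that was just constructed, and the components of an
  isomorphism are isomorphisms.\<close>

lemma Hom_wideD:
  assumes w: "wide_pullback H J \<phi> P e"
    and J: "J \<noteq> {}" and st: "\<And>A. A \<in> Ob X \<Longrightarrow> T_stable Y J (\<lambda>j. ncmp (\<phi> j) A)" and A: "A \<in> Ob X"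
  shows "wide_pullback Y J (\<lambda>j. ncmp (\<phi> j) A) (fobj P A) (\<lambda>j. ncmp (e j) A)"
proof -
  obtain j0 where j0: "j0 \<in> J" using J by blast
  have \<phi>: "tangent_nat_trans X Y (\<phi> j)" "ntgt (\<phi> j) = ntgt (\<phi> j0)" if "j \<in> J" for j
    using wide_pullbackD(1)[OF w that] wide_pullback_cone(2)[OF w that j0] by auto
  obtain P' e' where w': "wide_pullback H J \<phi> P' e'" and P': "lax_tangent_morphism X Y P'"
    and c: "\<forall>A\<in>Ob X. wide_pullback Y J (\<lambda>j. ncmp (\<phi> j) A) (fobj P' A) (\<lambda>j. ncmp (e' j) A)"
    using Hom_wide_ex[OF \<phi> J st] by blast
  have P: "lax_tangent_morphism X Y P" using wide_pullbackD[OF w j0] by auto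
  obtain k k' where k: "k \<in> hom H P P'" "k' \<in> hom H P' P" "k \<bullet>\<^bsub>H\<^esub> k' = Ident H P'" "k' \<bullet>\<^bsub>H\<^esub> k = Ident H P"
    "\<And>j. j \<in> J \<Longrightarrow> e j = e' j \<bullet>\<^bsub>H\<^esub> k"
    using H.wide_pullback_unique[OF w' w] P P' by auto
  show ?thesis
  proof (rule Y.wide_pullback_iso[OF c[THEN bspec, OF A]])
    show "ncmp k A \<in> hom Y (fobj P A) (fobj P' A)" "ncmp k' A \<in> hom Y (fobj P' A) (fobj P A)"
      using k(1,2) A by auto
    show "ncmp k A \<bullet>\<^bsub>Y\<^esub> ncmp k' A = Ident Y (fobj P' A)" "ncmp k' A \<bullet>\<^bsub>Y\<^esub> ncmp k A = Ident Y (fobj P A)"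
      using arg_cong[OF k(3), of "\<lambda>x. ncmp x A"] arg_cong[OF k(4), of "\<lambda>x. ncmp x A"] A by simp_all
    show "ncmp (e j) A = ncmp (e' j) A \<bullet>\<^bsub>Y\<^esub> ncmp k A" if "j \<in> J" for j using k(5)[OF that] A by simp
  qed
qed

lemma Hom_T_stable:
  assumes \<phi>: "\<And>j. j \<in> J \<Longrightarrow> tangent_nat_trans X Y (\<phi> j)" "\<And>j. j \<in> J \<Longrightarrow> ntgt (\<phi> j) = G"
    and J: "J \<noteq> {}" and st: "\<And>A. A \<in> Ob X \<Longrightarrow> T_stable Y J (\<lambda>j. ncmp (\<phi> j) A)"
  shows "T_stable H J \<phi>"
  unfolding T_stable_def
proof (intro conjI allI impI)
  show "\<exists>P e. wide_pullback H J \<phi> P e" using Hom_wide_ex[OF \<phi> J st] by blast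
  fix P e m assume w: "wide_pullback H J \<phi> P e"
  note e = wide_pullbackD[OF w, simplified]
  have P: "lax_tangent_morphism X Y P" using J e(2,3) tnt_typing(1) by (metis ex_in_conv)
  show "wide_pullback H J (\<lambda>j. (Ta H ^^ m) (\<phi> j)) ((To H ^^ m) P) (\<lambda>j. (Ta H ^^ m) (e j))"
  proof (rule Hom_wideI[where G = "(Tbar X Y ^^ m) G"])
    fix A assume A: "A \<in> Ob X"
    note c = T_stableD(1)[OF st[OF A] Hom_wideD[OF w J st A]]
    show "wide_pullback Y J (\<lambda>j. ncmp ((Ta H ^^ m) (\<phi> j)) A) (fobj ((To H ^^ m) P) A) (\<lambda>j. ncmp ((Ta H ^^ m) (e j)) A)"
      using c[of m] A by simp
    show "jointly_monic Y J (To Y (fobj ((To H ^^ m) P) A)) (\<lambda>j. Ta Y (ncmp ((Ta H ^^ m) (e j)) A))"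
      using Y.jointly_monic_wide[OF c[of "Suc m"]] A by simp
  qed (use \<phi> e P in simp_all)
qed

subsection \<open>Pullbacks and pairings in components\<close>

lemma Hom_pullbackI:
  assumes [simp]: "tangent_nat_trans X Y f" "tangent_nat_trans X Y g" "ntgt f = ntgt g"
    "tangent_nat_trans X Y a" "tangent_nat_trans X Y b" "nsrc a = nsrc b" "ntgt a = nsrc f" "ntgt b = nsrc g"
    and p: "\<And>A. A \<in> Ob X \<Longrightarrow> is_pullback Y (ncmp f A) (ncmp g A) (ncmp a A) (ncmp b A)"
    and jm: "\<And>A. A \<in> Ob X \<Longrightarrow> jointly_monic Y {..<2::nat} (To Y (fobj (nsrc a) A))
       (\<lambda>j. two_legs (Ta Y (ncmp a A)) (Ta Y (ncmp b A)) j)"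
  shows "is_pullback H f g a b"
  unfolding H.is_pullback_iff_wide
proof (rule Hom_wideI[where G = "ntgt g"])
  fix A assume A: "A \<in> Ob X"
  have "Dom Y (ncmp a A) = fobj (Dom H a) A"
    using tnt_typing(4)[OF assms(4) A] by simp
  then show "wide_pullback Y {..<2::nat} (\<lambda>j. ncmp (two_legs f g j) A) (fobj (Dom H a) A) (\<lambda>j. ncmp (two_legs a b j) A)"
    using p[OF A] unfolding Y.is_pullback_iff_wide if_distrib[of "\<lambda>x. ncmp x A"] by simp
  show "jointly_monic Y {..<2::nat} (To Y (fobj (Dom H a) A)) (\<lambda>j. Ta Y (ncmp (two_legs a b j) A))"
    using jm[OF A] by (simp add: if_distrib[of "\<lambda>x. ncmp x A"] if_distrib[of "Ta Y"])
qed (auto split: if_splits)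

lemma Hom_pullbackD:
  assumes p: "is_pullback H f g a b"
    and st: "\<And>A. A \<in> Ob X \<Longrightarrow> T_stable Y {..<2::nat} (two_legs (ncmp f A) (ncmp g A))" and A: "A \<in> Ob X"
  shows "is_pullback Y (ncmp f A) (ncmp g A) (ncmp a A) (ncmp b A)"
proof -
  have "0 \<in> {..<2::nat}" by simp
  then have J: "{..<2::nat} \<noteq> {}" by blast
  have "wide_pullback Y {..<2::nat} (\<lambda>j. ncmp (two_legs f g j) A) (fobj (Dom H a) A) (\<lambda>j. ncmp (two_legs a b j) A)"
    by (rule Hom_wideD[OF p[unfolded H.is_pullback_iff_wide] J _ A])
      (use st in \<open>simp add: if_distrib[of "\<lambda>x. ncmp x _"]\<close>)
  moreover have "Dom Y (ncmp a A) = fobj (Dom H a) A"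
    using H.is_pullbackD(4)[OF p] A by simp
  ultimately show ?thesis
    unfolding Y.is_pullback_iff_wide if_distrib[of "\<lambda>x. ncmp x A"] by simp
qed

text \<open>The components of the pairing have the projections that characterise the pairing of the components.\<close>

lemma Hom_pair_into:
  assumes p: "is_pullback H f g a b"
    and pA: "\<And>A. A \<in> Ob X \<Longrightarrow> is_pullback Y (ncmp f A) (ncmp g A) (ncmp a A) (ncmp b A)"
    and u: "tangent_nat_trans X Y u" "tangent_nat_trans X Y v" "nsrc u = nsrc v" "ntgt u = nsrc f" "ntgt v = nsrc g"
    and e: "\<And>A. A \<in> Ob X \<Longrightarrow> ncmp f A \<bullet>\<^bsub>Y\<^esub> ncmp u A = ncmp g A \<bullet>\<^bsub>Y\<^esub> ncmp v A"
  shows "tangent_nat_trans X Y (pair_into H a b u v)" "nsrc (pair_into H a b u v) = nsrc u"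
    "ntgt (pair_into H a b u v) = nsrc a"
    "A \<in> Ob X \<Longrightarrow> ncmp (pair_into H a b u v) A = pair_into Y (ncmp a A) (ncmp b A) (ncmp u A) (ncmp v A)"
    "a \<bullet>\<^bsub>H\<^esub> pair_into H a b u v = u" "b \<bullet>\<^bsub>H\<^esub> pair_into H a b u v = v"
proof -
  note d = H.is_pullbackD[OF p, simplified]
  have "f \<bullet>\<^bsub>H\<^esub> u = g \<bullet>\<^bsub>H\<^esub> v"
    by (rule tnt_eqI) (use d u e in simp_all)
  note l = H.is_pullback_lift[OF p _ _ _ _ _ this, simplified, OF u]
  show t: "tangent_nat_trans X Y (pair_into H a b u v)" "nsrc (pair_into H a b u v) = nsrc u"
    "ntgt (pair_into H a b u v) = nsrc a" and "a \<bullet>\<^bsub>H\<^esub> pair_into H a b u v = u" "b \<bullet>\<^bsub>H\<^esub> pair_into H a b u v = v"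
    using l u(3) by auto
  assume A: "A \<in> Ob X"
  show "ncmp (pair_into H a b u v) A = pair_into Y (ncmp a A) (ncmp b A) (ncmp u A) (ncmp v A)"
  proof (rule Y.pair_into_eqI[OF pA[OF A], symmetric])
    show "ncmp (pair_into H a b u v) A \<in> Arr Y" "Cod Y (ncmp (pair_into H a b u v) A) = Dom Y (ncmp a A)"
      using t A d tnt_typing(4,5) by auto
    show "ncmp a A \<bullet>\<^bsub>Y\<^esub> ncmp (pair_into H a b u v) A = ncmp u A"
      using arg_cong[OF l(4), of "\<lambda>x. ncmp x A"] A by simp
    show "ncmp b A \<bullet>\<^bsub>Y\<^esub> ncmp (pair_into H a b u v) A = ncmp v A"
      using arg_cong[OF l(5), of "\<lambda>x. ncmp x A"] A by simp
  qed
qed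

lemma Hom_additive:
  assumes p: "is_pullback H q q a b" and z: "tangent_nat_trans X Y z" "nsrc z = ntgt q" "ntgt z = nsrc q"
    and s: "tangent_nat_trans X Y s" "nsrc s = nsrc a" "ntgt s = nsrc q"
    and ad: "\<And>A. A \<in> Ob X \<Longrightarrow>
      additive_bundle Y (ncmp q A) (ncmp a A) (ncmp b A) (ncmp z A) (ncmp s A)"
  shows "additive_bundle H q a b z s"
proof -
  note d = H.is_pullbackD[OF p, simplified]
  note adD = additive_bundleD[OF ad]
  have adp: "is_pullback Y (ncmp q A) (ncmp q A) (ncmp a A) (ncmp b A)" if "A \<in> Ob X" for A
    by (rule adD(1)[OF that])
  note pr = Hom_pair_into[OF p adp]
  note [simp] = d(1,4,5,6,7,8) z s
  have [simp]: "lax_tangent_morphism X Y (nsrc q)" "lax_tangent_morphism X Y (ntgt q)"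
    using tnt_typing[OF d(1)] by auto
  have ty [simp]: "ncmp q A \<in> Arr Y" "Dom Y (ncmp q A) = fobj (nsrc q) A" "Cod Y (ncmp q A) = fobj (ntgt q) A"
    "ncmp a A \<in> Arr Y" "Dom Y (ncmp a A) = fobj (nsrc b) A" "Cod Y (ncmp a A) = fobj (nsrc q) A"
    "ncmp b A \<in> Arr Y" "Dom Y (ncmp b A) = fobj (nsrc b) A" "Cod Y (ncmp b A) = fobj (nsrc q) A" if "A \<in> Ob X" for A
    using that tnt_typing(3-5)[OF d(1)] tnt_typing(3-5)[OF d(4)] tnt_typing(3-5)[OF d(5)] d by auto
  have qa: "ncmp q A \<bullet>\<^bsub>Y\<^esub> ncmp a A = ncmp q A \<bullet>\<^bsub>Y\<^esub> ncmp b A" if "A \<in> Ob X" for A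
    using Y.is_pullbackD(9)[OF adD(1)[OF that]] .
  have qz: "ncmp q A \<bullet>\<^bsub>Y\<^esub> ncmp z A = Ident Y (fobj (ntgt q) A)" if "A \<in> Ob X" for A
    using adD(5)[OF that] that by simp
  have qs: "ncmp q A \<bullet>\<^bsub>Y\<^esub> ncmp s A = ncmp q A \<bullet>\<^bsub>Y\<^esub> ncmp a A" if "A \<in> Ob X" for A
    using adD(9)[OF that] .
  have ztyp [simp]: "ncmp z A \<in> Arr Y" "Dom Y (ncmp z A) = fobj (ntgt q) A" "Cod Y (ncmp z A) = fobj (nsrc q) A"
     "ncmp s A \<in> Arr Y" "Dom Y (ncmp s A) = fobj (nsrc b) A" "Cod Y (ncmp s A) = fobj (nsrc q) A"
     if "A \<in> Ob X" for A
    using that tnt_typing(3-5)[OF z(1)] tnt_typing(3-5)[OF s(1)] z s by auto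
  note p1 = pr[of b a, OF _ _ _ _ _ _ qa[symmetric], simplified]
  have e2: "ncmp q A \<bullet>\<^bsub>Y\<^esub> ncmp (Ident H (nsrc q)) A = ncmp q A \<bullet>\<^bsub>Y\<^esub> ncmp (z \<bullet>\<^bsub>H\<^esub> q) A" if "A \<in> Ob X" for A
    using that by (simp add: qz[THEN Y.Cmp_eq_extend])
  note p2 = pr[of "Ident H (nsrc q)" "z \<bullet>\<^bsub>H\<^esub> q", OF _ _ _ _ _ _ e2, simplified]
  show ?thesis
    unfolding additive_bundle_def
  proof (intro conjI ballI impI)
    show "q \<bullet>\<^bsub>H\<^esub> z = Ident H (Cod H q)" by (rule tnt_eqI) (simp_all add: qz)
    show "q \<bullet>\<^bsub>H\<^esub> s = q \<bullet>\<^bsub>H\<^esub> a" by (rule tnt_eqI) (simp_all add: qs)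
    show "s \<bullet>\<^bsub>H\<^esub> pair_into H a b b a = s"
      by (rule tnt_eqI) (use p1 adD(10) in simp_all)
    show "s \<bullet>\<^bsub>H\<^esub> pair_into H a b (Ident H (Dom H q)) (z \<bullet>\<^bsub>H\<^esub> q) = Ident H (Dom H q)"
      by (rule tnt_eqI) (use p2 adD(11) in simp_all)
    fix W u v w
    assume W: "W \<in> Ob H" "u \<in> hom H W (Dom H q)" "v \<in> hom H W (Dom H q)" "w \<in> hom H W (Dom H q)"
      and e: "q \<bullet>\<^bsub>H\<^esub> u = q \<bullet>\<^bsub>H\<^esub> v \<and> q \<bullet>\<^bsub>H\<^esub> v = q \<bullet>\<^bsub>H\<^esub> w"
    have W' [simp]: "lax_tangent_morphism X Y W" using W by simp
    have t [simp]: "tangent_nat_trans X Y u" "nsrc u = W" "ntgt u = nsrc q" "tangent_nat_trans X Y v" "nsrc v = W" "ntgt v = nsrc q"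
      "tangent_nat_trans X Y w" "nsrc w = W" "ntgt w = nsrc q" using W by simp_all
    have c [simp]: "ncmp u A \<in> Arr Y" "Dom Y (ncmp u A) = fobj W A" "Cod Y (ncmp u A) = fobj (nsrc q) A"
      "ncmp v A \<in> Arr Y" "Dom Y (ncmp v A) = fobj W A" "Cod Y (ncmp v A) = fobj (nsrc q) A"
      "ncmp w A \<in> Arr Y" "Dom Y (ncmp w A) = fobj W A" "Cod Y (ncmp w A) = fobj (nsrc q) A" if "A \<in> Ob X" for A
      using that tnt_typing(3-5)[OF t(1)] tnt_typing(3-5)[OF t(4)] tnt_typing(3-5)[OF t(7)] t by auto
    have eu: "ncmp q A \<bullet>\<^bsub>Y\<^esub> ncmp u A = ncmp q A \<bullet>\<^bsub>Y\<^esub> ncmp v A" if "A \<in> Ob X" for A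
      using arg_cong[OF conjunct1[OF e], of "\<lambda>x. ncmp x A"] that by simp
    have ev: "ncmp q A \<bullet>\<^bsub>Y\<^esub> ncmp v A = ncmp q A \<bullet>\<^bsub>Y\<^esub> ncmp w A" if "A \<in> Ob X" for A
      using arg_cong[OF conjunct2[OF e], of "\<lambda>x. ncmp x A"] that by simp
    let ?uv = "pair_into H a b u v" and ?vw = "pair_into H a b v w"
    have uv [simp]: "tangent_nat_trans X Y ?uv" "nsrc ?uv = W" "ntgt ?uv = nsrc b"
      and uvc: "\<And>A. A \<in> Ob X \<Longrightarrow> ncmp ?uv A = pair_into Y (ncmp a A) (ncmp b A) (ncmp u A) (ncmp v A)"
      and uvp: "a \<bullet>\<^bsub>H\<^esub> ?uv = u"
      using pr[of u v, OF _ _ _ _ _ _ eu] by simp_all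
    have vw [simp]: "tangent_nat_trans X Y ?vw" "nsrc ?vw = W" "ntgt ?vw = nsrc b"
      and vwc: "\<And>A. A \<in> Ob X \<Longrightarrow> ncmp ?vw A = pair_into Y (ncmp a A) (ncmp b A) (ncmp v A) (ncmp w A)"
      and vwp: "a \<bullet>\<^bsub>H\<^esub> ?vw = v"
      using pr[of v w, OF _ _ _ _ _ _ ev] by simp_all
    have uvt [simp]: "ncmp ?uv A \<in> Arr Y" "Dom Y (ncmp ?uv A) = fobj W A" "Cod Y (ncmp ?uv A) = fobj (nsrc b) A"
      "ncmp ?vw A \<in> Arr Y" "Dom Y (ncmp ?vw A) = fobj W A" "Cod Y (ncmp ?vw A) = fobj (nsrc b) A" if "A \<in> Ob X" for A
      using that tnt_typing(3-5)[OF uv(1)] tnt_typing(3-5)[OF vw(1)] uv vw by auto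
    have auv: "ncmp a A \<bullet>\<^bsub>Y\<^esub> ncmp ?uv A = ncmp u A" "ncmp a A \<bullet>\<^bsub>Y\<^esub> ncmp ?vw A = ncmp v A" if "A \<in> Ob X" for A
      using arg_cong[OF uvp, of "\<lambda>x. ncmp x A"] arg_cong[OF vwp, of "\<lambda>x. ncmp x A"] that by simp_all
    have e3: "ncmp q A \<bullet>\<^bsub>Y\<^esub> ncmp (s \<bullet>\<^bsub>H\<^esub> ?uv) A = ncmp q A \<bullet>\<^bsub>Y\<^esub> ncmp w A" if "A \<in> Ob X" for A
      using that by (simp add: qs[THEN Y.Cmp_eq_extend] auv eu ev)
    have e4: "ncmp q A \<bullet>\<^bsub>Y\<^esub> ncmp u A = ncmp q A \<bullet>\<^bsub>Y\<^esub> ncmp (s \<bullet>\<^bsub>H\<^esub> ?vw) A" if "A \<in> Ob X" for A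
      using that by (simp add: qs[THEN Y.Cmp_eq_extend] auv eu)
    note p3 = pr[of "s \<bullet>\<^bsub>H\<^esub> ?uv" w, OF _ _ _ _ _ _ e3, simplified]
    note p4 = pr[of u "s \<bullet>\<^bsub>H\<^esub> ?vw", OF _ _ _ _ _ _ e4, simplified]
    show "s \<bullet>\<^bsub>H\<^esub> pair_into H a b (s \<bullet>\<^bsub>H\<^esub> pair_into H a b u v) w =
        s \<bullet>\<^bsub>H\<^esub> pair_into H a b u (s \<bullet>\<^bsub>H\<^esub> pair_into H a b v w)"
    proof (rule tnt_eqI)
      fix A assume A: "A \<in> Ob X"
      have "ncmp s A \<bullet>\<^bsub>Y\<^esub> pair_into Y (ncmp a A) (ncmp b A) (ncmp s A \<bullet>\<^bsub>Y\<^esub> pair_into Y (ncmp a A) (ncmp b A) (ncmp u A) (ncmp v A)) (ncmp w A) =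
         ncmp s A \<bullet>\<^bsub>Y\<^esub> pair_into Y (ncmp a A) (ncmp b A) (ncmp u A) (ncmp s A \<bullet>\<^bsub>Y\<^esub> pair_into Y (ncmp a A) (ncmp b A) (ncmp v A) (ncmp w A))"
        by (rule additive_bundle_assoc[OF ad[OF A], of "fobj W A"]) (use A eu ev in simp_all)
      then show "ncmp (s \<bullet>\<^bsub>H\<^esub> pair_into H a b (s \<bullet>\<^bsub>H\<^esub> ?uv) w) A = ncmp (s \<bullet>\<^bsub>H\<^esub> pair_into H a b u (s \<bullet>\<^bsub>H\<^esub> ?vw)) A"
        using A p3(4) p4(4) by (simp add: uvc vwc)
    qed (use p3 p4 in simp_all)
  qed (use p in simp_all)
qed

subsection \<open>The axioms of a tangent category\<close>

lemma Hom_tpi_pullback: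
  assumes F [simp]: "lax_tangent_morphism X Y F"
  shows "is_pullback H (tp H F) (tp H F) (tpi1 H F) (tpi2 H F)"
    "is_pullback H (Ta H (tp H F)) (Ta H (tp H F)) (Ta H (tpi1 H F)) (Ta H (tpi2 H F))"
proof -
  show "is_pullback H (tp H F) (tp H F) (tpi1 H F) (tpi2 H F)"
  proof (rule Hom_pullbackI)
    fix A assume A: "A \<in> Ob X"
    show "jointly_monic Y {..<2::nat} (To Y (fobj (nsrc (tpi1 H F)) A))
       (\<lambda>j. two_legs (Ta Y (ncmp (tpi1 H F) A)) (Ta Y (ncmp (tpi2 H F) A)) j)"
      using jointly_monic_pair[OF Y.tpi_pullback_Ta(1)[of "fobj F A"]] A by (simp cong: if_cong)
  qed (simp_all add: Y.tpi_pullback)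
  show "is_pullback H (Ta H (tp H F)) (Ta H (tp H F)) (Ta H (tpi1 H F)) (Ta H (tpi2 H F))"
  proof (rule Hom_pullbackI)
    fix A assume A: "A \<in> Ob X"
    show "jointly_monic Y {..<2::nat} (To Y (fobj (nsrc (Ta H (tpi1 H F))) A))
       (\<lambda>j. two_legs (Ta Y (ncmp (Ta H (tpi1 H F)) A)) (Ta Y (ncmp (Ta H (tpi2 H F)) A)) j)"
      using jointly_monic_pair[OF Y.tpi_pullback_Ta(2)[of "fobj F A"]] A by (simp cong: if_cong)
  qed (simp_all add: Y.tpi_pullback_Ta)
qed

lemma Hom_T2a [simp]:
  assumes f [simp]: "tangent_nat_trans X Y f"
  shows "tangent_nat_trans X Y (T2a H f)" "nsrc (T2a H f) = T2bar X Y (nsrc f)" "ntgt (T2a H f) = T2bar X Y (ntgt f)"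
    "A \<in> Ob X \<Longrightarrow> ncmp (T2a H f) A = T2a Y (ncmp f A)"
proof -
  have e: "ncmp (tp H (ntgt f)) A \<bullet>\<^bsub>Y\<^esub> ncmp (Ta H f \<bullet>\<^bsub>H\<^esub> tpi1 H (nsrc f)) A =
     ncmp (tp H (ntgt f)) A \<bullet>\<^bsub>Y\<^esub> ncmp (Ta H f \<bullet>\<^bsub>H\<^esub> tpi2 H (nsrc f)) A" if "A \<in> Ob X" for A
    using Y.T2a_wf[of "ncmp f A"] that by simp
  note p = Hom_pair_into[OF Hom_tpi_pullback(1)[of "ntgt f"] _ _ _ _ _ _ e, simplified]
  show "tangent_nat_trans X Y (T2a H f)" "nsrc (T2a H f) = T2bar X Y (nsrc f)" "ntgt (T2a H f) = T2bar X Y (ntgt f)"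
    "A \<in> Ob X \<Longrightarrow> ncmp (T2a H f) A = T2a Y (ncmp f A)"
    using p by (simp_all add: T2a_def Y.tpi_pullback)
qed

text \<open>Equations hold because they hold in components, and the pullbacks of the axioms are pullbacks in
  components. For the one that expresses the universality of the vertical lift, tangency of the induced
  arrow rests on \<open>vertical_lift_Ta_monic\<close>.\<close>

theorem tangent_category_Hom: "tangent_category H"
  unfolding tangent_category_def
proof (intro conjI ballI allI impI)
  show "functorial H H (To H) (Ta H)"
    unfolding functorial_def by (auto intro!: tnt_eqI)
  show "natural H H (To H) (Ta H) (\<lambda>A. A) (\<lambda>f. f) (tp H)"
    unfolding natural_def by (auto intro!: tnt_eqI simp: Y.tp_nat)
  show "natural H H (\<lambda>A. A) (\<lambda>f. f) (To H) (Ta H) (tz H)"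
    unfolding natural_def by (auto intro!: tnt_eqI simp: Y.tz_nat)
  show "natural H H (T2o H) (T2a H) (To H) (Ta H) (ts H)"
    unfolding natural_def by (auto intro!: tnt_eqI simp: Y.ts_nat)
  show "natural H H (To H) (Ta H) (\<lambda>A. To H (To H A)) (\<lambda>f. Ta H (Ta H f)) (tl H)"
    unfolding natural_def by (auto intro!: tnt_eqI simp: Y.tl_nat)
  show "natural H H (\<lambda>A. To H (To H A)) (\<lambda>f. Ta H (Ta H f)) (\<lambda>A. To H (To H A)) (\<lambda>f. Ta H (Ta H f)) (tc H)"
    unfolding natural_def by (auto intro!: tnt_eqI simp: Y.tc_nat)
next
  fix F assume "F \<in> Ob H"
  then have F [simp]: "lax_tangent_morphism X Y F" by simp
  show "is_pullback H (tp H F) (tp H F) (tpi1 H F) (tpi2 H F)" by (rule Hom_tpi_pullback(1)[OF F])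
  have st: "T_stable H {..n} (fold_legs n (Ident H F) (\<lambda>_. tp H F))" for n
  proof (rule Hom_T_stable[where G = F])
    fix A assume A: "A \<in> Ob X"
    show "T_stable Y {..n} (\<lambda>j. ncmp (fold_legs n (Ident H F) (\<lambda>_. tp H F) j) A)"
      using Y.T_stable_fold[of "fobj F A" n] A by (simp add: if_distrib[of "\<lambda>x. ncmp x A"] cong: if_cong)
  qed (auto simp: atMost_def)
  have cod: "Cod H (tp H F) = F" by simp
  show "\<exists>b pr. is_fold_pullback H n (tp H F) b pr" for n
  proof -
    obtain L e where w: "wide_pullback H {..n} (fold_legs n (Ident H F) (\<lambda>_. tp H F)) L e"
      using st[of n] unfolding T_stable_def by blast
    have "wide_pullback H {..n} (fold_legs n (Ident H F) (\<lambda>_. tp H F)) L (fold_legs n (e n) e)"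
      by (rule wide_pullback_eq_on[OF w]) auto
    moreover have "Dom H (e n) = L" using wide_pullbackD(3)[OF w, of n] by simp
    ultimately have "is_fold_pullback H n (tp H F) (e n) e"
      using H.is_fold_pullback_iff_wide[of "tp H F" n "e n" e] unfolding cod by simp
    then show ?thesis by blast
  qed
  fix n b pr m assume fp: "is_fold_pullback H n (tp H F) b pr"
  have b: "b \<in> Arr H" using fp unfolding is_fold_pullback_def by blast
  have "wide_pullback H {..n} (fold_legs n (Ident H F) (\<lambda>_. tp H F)) (Dom H b) (fold_legs n b pr)"
    using fp H.is_fold_pullback_iff_wide[of "tp H F" n b pr] unfolding cod by simp
  note w = T_stableD(1)[OF st this, of m]
  have idm: "(Ta H ^^ m) (Ident H F) = Ident H ((Tbar X Y ^^ m) F)"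
    by (rule tnt_eqI) simp_all
  have L: "(To H ^^ m) (Dom H b) = Dom H ((Ta H ^^ m) b)" by simp
  have "wide_pullback H {..n} (fold_legs n (Ident H (Cod H ((Ta H ^^ m) (tp H F)))) (\<lambda>_. (Ta H ^^ m) (tp H F)))
    (Dom H ((Ta H ^^ m) b)) (fold_legs n ((Ta H ^^ m) b) (\<lambda>i. (Ta H ^^ m) (pr i)))"
    using idm by (intro wide_pullback_eq_on[OF w[unfolded L]]) auto
  then show "is_fold_pullback H n ((Ta H ^^ m) (tp H F)) ((Ta H ^^ m) b) (\<lambda>i. (Ta H ^^ m) (pr i))"
    using H.is_fold_pullback_iff_wide[of "(Ta H ^^ m) (tp H F)"] by simp
next
  show "category H" by (rule category_Hom)
next
  fix F assume "F \<in> Ob H"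
  then have F [simp]: "lax_tangent_morphism X Y F" by simp
  show "additive_bundle H (tp H F) (tpi1 H F) (tpi2 H F) (tz H F) (ts H F)"
    by (rule Hom_additive[OF Hom_tpi_pullback(1)[OF F]]) (simp_all add: Y.tangent_equations(1))
  show "Ta H (tp H F) \<bullet>\<^bsub>H\<^esub> tl H F = tz H F \<bullet>\<^bsub>H\<^esub> tp H F"
    by (rule tnt_eqI) (simp_all add: Y.tangent_equations(2))
  show "tl H F \<bullet>\<^bsub>H\<^esub> tz H F = Ta H (tz H F) \<bullet>\<^bsub>H\<^esub> tz H F"
    by (rule tnt_eqI) (simp_all add: Y.tangent_equations(3))
  show "tp H (To H F) \<bullet>\<^bsub>H\<^esub> tc H F = Ta H (tp H F)"
    by (rule tnt_eqI) (simp_all add: Y.tangent_equations(5))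
  show "tc H F \<bullet>\<^bsub>H\<^esub> Ta H (tz H F) = tz H (To H F)"
    by (rule tnt_eqI) (simp_all add: Y.tangent_equations(6))
  show "Ta H (tl H F) \<bullet>\<^bsub>H\<^esub> tl H F = tl H (To H F) \<bullet>\<^bsub>H\<^esub> tl H F"
    by (rule tnt_eqI) (simp_all add: Y.tangent_equations(8))
  show "tc H F \<bullet>\<^bsub>H\<^esub> tl H F = tl H F"
    by (rule tnt_eqI) (simp_all add: Y.tangent_equations(9))
  show "tc H (To H F) \<bullet>\<^bsub>H\<^esub> (Ta H (tc H F) \<bullet>\<^bsub>H\<^esub> tl H (To H F)) = Ta H (tl H F) \<bullet>\<^bsub>H\<^esub> tc H F"
    by (rule tnt_eqI) (simp_all add: Y.tangent_equations(10))
  show "tc H F \<bullet>\<^bsub>H\<^esub> tc H F = Ident H (To H (To H F))"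
    by (rule tnt_eqI) (simp_all add: Y.tangent_equations(11))
  show "Ta H (tc H F) \<bullet>\<^bsub>H\<^esub> (tc H (To H F) \<bullet>\<^bsub>H\<^esub> Ta H (tc H F)) =
          tc H (To H F) \<bullet>\<^bsub>H\<^esub> (Ta H (tc H F) \<bullet>\<^bsub>H\<^esub> tc H (To H F))"
    by (rule tnt_eqI) (simp_all add: Y.tangent_equations(12))
  have pT: "is_pullback Y (ncmp (Ta H (tp H F)) A) (ncmp (Ta H (tp H F)) A) (ncmp (Ta H (tpi1 H F)) A) (ncmp (Ta H (tpi2 H F)) A)"
    and p: "is_pullback Y (ncmp (tp H G) A) (ncmp (tp H G) A) (ncmp (tpi1 H G) A) (ncmp (tpi2 H G) A)"
    if "A \<in> Ob X" "lax_tangent_morphism X Y G" for A G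
    using that by (simp_all add: Y.tpi_pullback_Ta Y.tpi_pullback)
  have e1: "ncmp (Ta H (tp H F)) A \<bullet>\<^bsub>Y\<^esub> ncmp (tl H F \<bullet>\<^bsub>H\<^esub> tpi1 H F) A =
      ncmp (Ta H (tp H F)) A \<bullet>\<^bsub>Y\<^esub> ncmp (tl H F \<bullet>\<^bsub>H\<^esub> tpi2 H F) A" if "A \<in> Ob X" for A
    using that by (simp add: Y.tangent_equations(2)[THEN Y.Cmp_eq_extend] Y.tp_tpi)
  note p1 = Hom_pair_into[OF Hom_tpi_pullback(2)[OF F] pT[OF _ F] _ _ _ _ _ e1, simplified]
  show "tl H F \<bullet>\<^bsub>H\<^esub> ts H F =
          Ta H (ts H F) \<bullet>\<^bsub>H\<^esub> pair_into H (Ta H (tpi1 H F)) (Ta H (tpi2 H F))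
                                (tl H F \<bullet>\<^bsub>H\<^esub> tpi1 H F) (tl H F \<bullet>\<^bsub>H\<^esub> tpi2 H F)"
    by (rule tnt_eqI) (use p1 in \<open>simp_all add: Y.tangent_equations(4)\<close>)
  have e2: "ncmp (tp H (Tbar X Y F)) A \<bullet>\<^bsub>Y\<^esub> ncmp (tc H F \<bullet>\<^bsub>H\<^esub> Ta H (tpi1 H F)) A =
      ncmp (tp H (Tbar X Y F)) A \<bullet>\<^bsub>Y\<^esub> ncmp (tc H F \<bullet>\<^bsub>H\<^esub> Ta H (tpi2 H F)) A" if "A \<in> Ob X" for A
    using that Y.is_pullbackD(9)[OF Y.tpi_pullback_Ta(1)[of "fobj F A"]]
    by (simp add: Y.tangent_equations(5)[THEN Y.Cmp_eq_extend])
  note p2 = Hom_pair_into[OF Hom_tpi_pullback(1)[OF lax_Tbar[OF F]] p[OF _ lax_Tbar[OF F]] _ _ _ _ _ e2, simplified]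
  show "tc H F \<bullet>\<^bsub>H\<^esub> Ta H (ts H F) =
          ts H (To H F) \<bullet>\<^bsub>H\<^esub> pair_into H (tpi1 H (To H F)) (tpi2 H (To H F))
                                (tc H F \<bullet>\<^bsub>H\<^esub> Ta H (tpi1 H F)) (tc H F \<bullet>\<^bsub>H\<^esub> Ta H (tpi2 H F))"
    by (rule tnt_eqI) (use p2 in \<open>simp_all add: Y.tangent_equations(7)\<close>)
  have e3: "ncmp (Ta H (tp H F)) A \<bullet>\<^bsub>Y\<^esub> ncmp (tz H (Tbar X Y F) \<bullet>\<^bsub>H\<^esub> tpi1 H F) A =
      ncmp (Ta H (tp H F)) A \<bullet>\<^bsub>Y\<^esub> ncmp (tl H F \<bullet>\<^bsub>H\<^esub> tpi2 H F) A" if A: "A \<in> Ob X" for A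
  proof -
    have "Ta Y (tp Y (fobj F A)) \<bullet>\<^bsub>Y\<^esub> (Ta Y (tpi1 Y (fobj F A)) \<bullet>\<^bsub>Y\<^esub> Y.lift_pair (fobj F A)) =
       Ta Y (tp Y (fobj F A)) \<bullet>\<^bsub>Y\<^esub> (Ta Y (tpi2 Y (fobj F A)) \<bullet>\<^bsub>Y\<^esub> Y.lift_pair (fobj F A))"
      using A Y.lift_pair(1-3)[of "fobj F A"]
      by (simp add: Y.is_pullbackD(9)[OF Y.tpi_pullback_Ta(1), THEN Y.Cmp_eq_extend])
    then show ?thesis using A by (simp add: Y.lift_pair)
  qed
  note p3 = Hom_pair_into[OF Hom_tpi_pullback(2)[OF F] pT[OF _ F] _ _ _ _ _ e3, simplified]
  show "is_pullback H (tz H F) (Ta H (tp H F)) (tp H F \<bullet>\<^bsub>H\<^esub> tpi1 H F)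
          (Ta H (ts H F) \<bullet>\<^bsub>H\<^esub> pair_into H (Ta H (tpi1 H F)) (Ta H (tpi2 H F))
             (tz H (To H F) \<bullet>\<^bsub>H\<^esub> tpi1 H F) (tl H F \<bullet>\<^bsub>H\<^esub> tpi2 H F))"
  proof (rule Hom_pullbackI)
    let ?l = "pair_into H (Ta H (tpi1 H F)) (Ta H (tpi2 H F)) (tz H (To H F) \<bullet>\<^bsub>H\<^esub> tpi1 H F) (tl H F \<bullet>\<^bsub>H\<^esub> tpi2 H F)"
    fix A assume A: "A \<in> Ob X"
    have l: "ncmp ?l A = Y.lift_pair (fobj F A)"
      using p3(4)[OF A] A by (simp add: Y.lift_pair_def)
    show "is_pullback Y (ncmp (tz H F) A) (ncmp (Ta H (tp H F)) A) (ncmp (tp H F \<bullet>\<^bsub>H\<^esub> tpi1 H F) A) (ncmp (Ta H (ts H F) \<bullet>\<^bsub>H\<^esub> ?l) A)"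
      using A Y.tangent_equations(13)[of "fobj F A"] l by (simp add: Y.lift_pair_def)
    show "jointly_monic Y {..<2::nat} (To Y (fobj (nsrc (tp H F \<bullet>\<^bsub>H\<^esub> tpi1 H F)) A))
       (\<lambda>j. two_legs (Ta Y (ncmp (tp H F \<bullet>\<^bsub>H\<^esub> tpi1 H F) A)) (Ta Y (ncmp (Ta H (ts H F) \<bullet>\<^bsub>H\<^esub> ?l) A)) j)"
      unfolding jointly_monic_def
    proof (intro ballI impI)
      fix x y assume xy: "x \<in> Arr Y" "y \<in> Arr Y" "Dom Y x = Dom Y y"
        "Cod Y x = To Y (fobj (nsrc (tp H F \<bullet>\<^bsub>H\<^esub> tpi1 H F)) A)" "Cod Y y = To Y (fobj (nsrc (tp H F \<bullet>\<^bsub>H\<^esub> tpi1 H F)) A)"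
        and e: "\<forall>j\<in>{..<2::nat}. two_legs (Ta Y (ncmp (tp H F \<bullet>\<^bsub>H\<^esub> tpi1 H F) A)) (Ta Y (ncmp (Ta H (ts H F) \<bullet>\<^bsub>H\<^esub> ?l) A)) j \<bullet>\<^bsub>Y\<^esub> x =
          two_legs (Ta Y (ncmp (tp H F \<bullet>\<^bsub>H\<^esub> tpi1 H F) A)) (Ta Y (ncmp (Ta H (ts H F) \<bullet>\<^bsub>H\<^esub> ?l) A)) j \<bullet>\<^bsub>Y\<^esub> y"
      show "x = y"
        by (rule Y.vertical_lift_Ta_monic[of "fobj F A"])
          (use xy A e[THEN bspec, of 0] e[THEN bspec, of 1] l in simp_all)
    qed
  qed (use p3 in simp_all)
qed

end

sublocale tangent_pair \<subseteq> H: tangent_on "Hom X Y"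
  using tangent_category_Hom by unfold_locales

section \<open>Display differential bundles of lax tangent morphisms\<close>

context tangent_on
begin

lemma tangent_display_T_stable:
  assumes q: "tangent_display X q" and f: "f \<in> Arr X" "Cod X f = (To X ^^ n) (Cod X q)"
  shows "T_stable X {..<2::nat} (two_legs ((Ta X ^^ n) q) f)"
  unfolding T_stable_def
proof (intro conjI allI impI)
  let ?q = "(Ta X ^^ n) q"
  have d: "(\<exists>a b. is_pullback X ?q f a b)"
      "\<And>a b m. is_pullback X ?q f a b \<Longrightarrow> is_pullback X ((Ta X ^^ m) ?q) ((Ta X ^^ m) f) ((Ta X ^^ m) a) ((Ta X ^^ m) b)"
    using q f unfolding tangent_display_def by blast+
  show "\<exists>L e. wide_pullback X {..<2::nat} (two_legs ?q f) L e"
    using d(1) is_pullback_iff_wide by blast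
  fix L e m assume w: "wide_pullback X {..<2::nat} (two_legs ?q f) L e"
  have w': "wide_pullback X {..<2::nat} (two_legs ?q f) L (two_legs (e 0) (e 1))"
    by (rule wide_pullback_eq_on[OF w]) (auto simp: less_2_cases_iff)
  have L: "Dom X (e 0) = L" "e 0 \<in> Arr X" using wide_pullbackD[OF w, of 0] by auto
  have p: "is_pullback X ?q f (e 0) (e 1)" unfolding is_pullback_iff_wide using w' L by simp
  have D: "Dom X ((Ta X ^^ m) (e 0)) = (To X ^^ m) L" using L by simp
  show "wide_pullback X {..<2::nat} (\<lambda>j. (Ta X ^^ m) (two_legs ?q f j)) ((To X ^^ m) L) (\<lambda>j. (Ta X ^^ m) (e j))"
    by (rule wide_pullback_eq_on[OF d(2)[OF p, of m, unfolded is_pullback_iff_wide D]]) (auto simp: less_2_cases_iff)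
qed

lemma tangent_displayI:
  assumes q: "q \<in> Arr X"
    and st: "\<And>n f. f \<in> Arr X \<Longrightarrow> Cod X f = (To X ^^ n) (Cod X q) \<Longrightarrow> T_stable X {..<2::nat} (two_legs ((Ta X ^^ n) q) f)"
  shows "tangent_display X q"
  unfolding tangent_display_def
proof (intro conjI allI ballI impI)
  show "q \<in> Arr X" by (rule q)
  fix n f assume f: "f \<in> Arr X" "Cod X f = (To X ^^ n) (Cod X q)"
  let ?q = "(Ta X ^^ n) q"
  obtain L e where w: "wide_pullback X {..<2::nat} (two_legs ?q f) L e"
    using st[OF f] unfolding T_stable_def by blast
  have w': "wide_pullback X {..<2::nat} (two_legs ?q f) L (two_legs (e 0) (e 1))"
    by (rule wide_pullback_eq_on[OF w]) (auto simp: less_2_cases_iff)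
  have L: "Dom X (e 0) = L" using wide_pullbackD[OF w, of 0] by auto
  show "\<exists>a b. is_pullback X ?q f a b"
    using w' L is_pullback_iff_wide by blast
  fix a b m assume p: "is_pullback X ?q f a b"
  have D: "Dom X ((Ta X ^^ m) a) = (To X ^^ m) (Dom X a)" using is_pullbackD(4)[OF p] by simp
  show "is_pullback X ((Ta X ^^ m) ?q) ((Ta X ^^ m) f) ((Ta X ^^ m) a) ((Ta X ^^ m) b)"
    unfolding is_pullback_iff_wide D
    by (rule wide_pullback_eq_on[OF T_stableD(1)[OF st[OF f] p[unfolded is_pullback_iff_wide], of m]]) auto
qed

lemma T_stable_pullback:
  assumes st: "T_stable X {..<2::nat} (two_legs f g)" and p: "is_pullback X f g a b"
  shows "is_pullback X (Ta X f) (Ta X g) (Ta X a) (Ta X b)"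
    "is_pullback X (Ta X (Ta X f)) (Ta X (Ta X g)) (Ta X (Ta X a)) (Ta X (Ta X b))"
proof -
  note w = p[unfolded is_pullback_iff_wide]
  have D: "Dom X (Ta X a) = To X (Dom X a)" "Dom X (Ta X (Ta X a)) = To X (To X (Dom X a))"
    using is_pullbackD(4)[OF p] by simp_all
  show "is_pullback X (Ta X f) (Ta X g) (Ta X a) (Ta X b)" unfolding is_pullback_iff_wide D
    by (rule wide_pullback_eq_on[OF T_stableD(2)[OF st w]]) auto
  show "is_pullback X (Ta X (Ta X f)) (Ta X (Ta X g)) (Ta X (Ta X a)) (Ta X (Ta X b))"
    unfolding is_pullback_iff_wide D
    by (rule wide_pullback_eq_on[OF T_stableD(3)[OF st w]]) auto
qed

lemma tangent_display_pullback:
  assumes "tangent_display X q" "is_pullback X q q a b"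
  shows "is_pullback X (Ta X q) (Ta X q) (Ta X a) (Ta X b)"
    "is_pullback X (Ta X (Ta X q)) (Ta X (Ta X q)) (Ta X (Ta X a)) (Ta X (Ta X b))"
  by (rule T_stable_pullback[OF _ assms(2)],
    use tangent_display_T_stable[OF assms(1), of q 0] is_pullbackD(1)[OF assms(2)] in \<open>simp cong: if_cong\<close>)+

end

subsection \<open>Pointwise display maps\<close>

context tangent_pair
begin

text \<open>Arrows induced in components are natural because the projections are jointly monic, and
  precomposition with \<open>F\<close> only reindexes the components.\<close>

lemma Fun_pullbackI:
  fixes C :: "('c, 'd) cat" and F :: "('c, 'd, 'o, 'a) func"
  assumes F: "is_functor C X F"
    and t: "tangent_nat_trans X Y f" "tangent_nat_trans X Y g" "ntgt f = ntgt g"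
    "tangent_nat_trans X Y a" "tangent_nat_trans X Y b" "nsrc a = nsrc b" "ntgt a = nsrc f" "ntgt b = nsrc g"
    and p: "\<And>A. A \<in> Ob X \<Longrightarrow> is_pullback Y (ncmp f A) (ncmp g A) (ncmp a A) (ncmp b A)"
  shows "is_pullback (Fun C Y) (underlying_pre C f F) (underlying_pre C g F)
                               (underlying_pre C a F) (underlying_pre C b F)"
proof -
  have C: "category C" "functorial C X (fobj F) (farr F)"
    using F unfolding is_functor_def by blast+
  interpret C: category_on C using C(1) by unfold_locales
  have [simp]: "A \<in> Ob C \<Longrightarrow> fobj F A \<in> Ob X" "h \<in> Arr C \<Longrightarrow> farr F h \<in> Arr X"
    "h \<in> Arr C \<Longrightarrow> Dom X (farr F h) = fobj F (Dom C h)" "h \<in> Arr C \<Longrightarrow> Cod X (farr F h) = fobj F (Cod C h)"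
    "A \<in> Ob C \<Longrightarrow> farr F (Ident C A) = Ident X (fobj F A)"
    "\<lbrakk>h \<in> Arr C; k \<in> Arr C; Cod C h = Dom C k\<rbrakk> \<Longrightarrow> farr F (k \<bullet>\<^bsub>C\<^esub> h) = farr F k \<bullet>\<^bsub>X\<^esub> farr F h" for A h k
    using C(2) unfolding functorial_def by auto
  have fc: "is_functor C Y (fcomp C G F)" if "lax_tangent_morphism X Y G" for G
    unfolding is_functor_def functorial_def using C(1) Y.category_X that by (simp add: fcomp_def)
  have nt: "is_nat_trans C Y (underlying_pre C \<phi> F)" if "tangent_nat_trans X Y \<phi>" for \<phi>
    unfolding is_nat_trans_def natural_def using fc that tnt_nat[OF that]
    by (simp add: underlying_pre_def) (simp add: fcomp_def)
  have S: "nsrc (underlying_pre C \<phi> F) = fcomp C (nsrc \<phi>) F" "ntgt (underlying_pre C \<phi> F) = fcomp C (ntgt \<phi>) F"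
    for \<phi> by (simp_all add: underlying_pre_def)
  have N [simp]: "ncmp (underlying_pre C \<phi> F) A = ncmp \<phi> (fobj F A)" if "A \<in> Ob C" for \<phi> A
    using that by (simp add: underlying_pre_def)
  have E: "ncmp (underlying_pre C \<phi> F) \<in> extensional (Ob C)" for \<phi> by (simp add: underlying_pre_def)
  have Fsel: "Arr (Fun C Y) = {\<phi>. is_nat_trans C Y \<phi>}" "Ob (Fun C Y) = {G. is_functor C Y G}" "Dom (Fun C Y) = nsrc"
    "Cod (Fun C Y) = ntgt" "Cmp (Fun C Y) = nt_comp C Y" by (simp_all add: Fun_def)
  have cmp [simp]: "nsrc (nt_comp C Y \<psi> \<phi>) = nsrc \<phi>" "ntgt (nt_comp C Y \<psi> \<phi>) = ntgt \<psi>"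
    "ncmp (nt_comp C Y \<psi> \<phi>) \<in> extensional (Ob C)"
    "A \<in> Ob C \<Longrightarrow> ncmp (nt_comp C Y \<psi> \<phi>) A = ncmp \<psi> A \<bullet>\<^bsub>Y\<^esub> ncmp \<phi> A"
    for \<psi> \<phi> :: "(('c, 'd, 'o2, 'a2) func, 'c, 'a2) nt" and A
    by (simp_all add: nt_comp_def)
  have eqI: "\<phi> = \<psi>" if "nsrc \<phi> = nsrc \<psi>" "ntgt \<phi> = ntgt \<psi>" "ncmp \<phi> \<in> extensional (Ob C)" "ncmp \<psi> \<in> extensional (Ob C)"
    "\<And>A. A \<in> Ob C \<Longrightarrow> ncmp \<phi> A = ncmp \<psi> A" for \<phi> \<psi> :: "(('c, 'd, 'o2, 'a2) func, 'c, 'a2) nt"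
    using that by (cases \<phi>; cases \<psi>) (auto intro!: extensionalityI)
  have pd: "ncmp f A \<bullet>\<^bsub>Y\<^esub> ncmp a A = ncmp g A \<bullet>\<^bsub>Y\<^esub> ncmp b A" if "A \<in> Ob X" for A
    using Y.is_pullbackD(9)[OF p[OF that]] .
  show ?thesis
    unfolding is_pullback_def
  proof (intro conjI ballI impI)
    show "underlying_pre C f F \<bullet>\<^bsub>Fun C Y\<^esub> underlying_pre C a F = underlying_pre C g F \<bullet>\<^bsub>Fun C Y\<^esub> underlying_pre C b F"
      unfolding Fsel by (rule eqI) (use t pd in \<open>simp_all add: S\<close>)
    fix W u v assume W: "W \<in> Ob (Fun C Y)" and u: "u \<in> hom (Fun C Y) W (Dom (Fun C Y) (underlying_pre C f F))"
      and v: "v \<in> hom (Fun C Y) W (Dom (Fun C Y) (underlying_pre C g F))"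
      and e: "underlying_pre C f F \<bullet>\<^bsub>Fun C Y\<^esub> u = underlying_pre C g F \<bullet>\<^bsub>Fun C Y\<^esub> v"
    have W': "is_functor C Y W" using W Fsel by simp
    then have WF [simp]: "A \<in> Ob C \<Longrightarrow> fobj W A \<in> Ob Y" "h \<in> Arr C \<Longrightarrow> farr W h \<in> Arr Y"
      "h \<in> Arr C \<Longrightarrow> Dom Y (farr W h) = fobj W (Dom C h)" "h \<in> Arr C \<Longrightarrow> Cod Y (farr W h) = fobj W (Cod C h)" for A h
      unfolding is_functor_def functorial_def by auto
    have uv: "is_nat_trans C Y u" "nsrc u = W" "ntgt u = fcomp C (nsrc f) F"
       "is_nat_trans C Y v" "nsrc v = W" "ntgt v = fcomp C (nsrc g) F"
      using u v by (simp_all add: Fsel S)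
    have ext: "ncmp u \<in> extensional (Ob C)" "ncmp v \<in> extensional (Ob C)" using uv unfolding is_nat_trans_def by auto
    have c [simp]: "ncmp u A \<in> Arr Y" "Dom Y (ncmp u A) = fobj W A" "Cod Y (ncmp u A) = fobj (nsrc f) (fobj F A)"
      "ncmp v A \<in> Arr Y" "Dom Y (ncmp v A) = fobj W A" "Cod Y (ncmp v A) = fobj (nsrc g) (fobj F A)" if "A \<in> Ob C" for A
      using uv that unfolding is_nat_trans_def natural_def by (auto simp: fcomp_def)
    have n: "ncmp u (Cod C h) \<bullet>\<^bsub>Y\<^esub> farr W h = farr (nsrc f) (farr F h) \<bullet>\<^bsub>Y\<^esub> ncmp u (Dom C h)"
      "ncmp v (Cod C h) \<bullet>\<^bsub>Y\<^esub> farr W h = farr (nsrc g) (farr F h) \<bullet>\<^bsub>Y\<^esub> ncmp v (Dom C h)" if "h \<in> Arr C" for h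
      using uv that unfolding is_nat_trans_def natural_def by (auto simp: fcomp_def)
    have eA: "ncmp f (fobj F A) \<bullet>\<^bsub>Y\<^esub> ncmp u A = ncmp g (fobj F A) \<bullet>\<^bsub>Y\<^esub> ncmp v A" if "A \<in> Ob C" for A
      using arg_cong[OF e[unfolded Fsel], of "\<lambda>x. ncmp x A"] that by simp
    define h where "h A = pair_into Y (ncmp a (fobj F A)) (ncmp b (fobj F A)) (ncmp u A) (ncmp v A)" for A
    have h [simp]: "h A \<in> Arr Y" "Dom Y (h A) = fobj W A" "Cod Y (h A) = fobj (nsrc b) (fobj F A)"
      and ha: "ncmp a (fobj F A) \<bullet>\<^bsub>Y\<^esub> h A = ncmp u A" and hb: "ncmp b (fobj F A) \<bullet>\<^bsub>Y\<^esub> h A = ncmp v A" if "A \<in> Ob C" for A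
      using Y.is_pullback_lift[OF p[of "fobj F A"] c(1)[OF that] c(4)[OF that] _ _ _ eA[OF that]] that t
      unfolding h_def by simp_all
    note na = tnt_nat[OF t(4)] and nb = tnt_nat[OF t(5)]
    let ?h = "\<lparr>nsrc = W, ntgt = fcomp C (nsrc b) F, ncmp = restrict h (Ob C)\<rparr>"
    have hnat: "h (Cod C k) \<bullet>\<^bsub>Y\<^esub> farr W k = farr (nsrc b) (farr F k) \<bullet>\<^bsub>Y\<^esub> h (Dom C k)" if k: "k \<in> Arr C" for k
    proof (rule Y.is_pullback_monic[OF p[of "fobj F (Cod C k)"]])
      have "ncmp a (fobj F (Cod C k)) \<bullet>\<^bsub>Y\<^esub> farr (nsrc b) (farr F k) = farr (nsrc f) (farr F k) \<bullet>\<^bsub>Y\<^esub> ncmp a (fobj F (Dom C k))"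
        using na[of "farr F k"] k t by simp
      then show "ncmp a (fobj F (Cod C k)) \<bullet>\<^bsub>Y\<^esub> (h (Cod C k) \<bullet>\<^bsub>Y\<^esub> farr W k) =
        ncmp a (fobj F (Cod C k)) \<bullet>\<^bsub>Y\<^esub> (farr (nsrc b) (farr F k) \<bullet>\<^bsub>Y\<^esub> h (Dom C k))"
        using k t tnt_typing(3-5)[OF t(4)] by (simp add: ha[THEN Y.Cmp_eq_extend] ha n Y.Cmp_eq_extend)
      have "ncmp b (fobj F (Cod C k)) \<bullet>\<^bsub>Y\<^esub> farr (nsrc b) (farr F k) = farr (nsrc g) (farr F k) \<bullet>\<^bsub>Y\<^esub> ncmp b (fobj F (Dom C k))"
        using nb[of "farr F k"] k t by simp
      then show "ncmp b (fobj F (Cod C k)) \<bullet>\<^bsub>Y\<^esub> (h (Cod C k) \<bullet>\<^bsub>Y\<^esub> farr W k) =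
        ncmp b (fobj F (Cod C k)) \<bullet>\<^bsub>Y\<^esub> (farr (nsrc b) (farr F k) \<bullet>\<^bsub>Y\<^esub> h (Dom C k))"
        using k t tnt_typing(3-5)[OF t(5)] by (simp add: hb[THEN Y.Cmp_eq_extend] hb n Y.Cmp_eq_extend)
    qed (use k t in simp_all)
    have h1: "is_nat_trans C Y ?h"
      unfolding is_nat_trans_def natural_def using W' fc t(5) hnat by (simp, simp add: fcomp_def)
    have h2: "nt_comp C Y (underlying_pre C a F) ?h = u" "nt_comp C Y (underlying_pre C b F) ?h = v"
      by (rule eqI; use uv ext t in \<open>simp_all add: S ha hb\<close>)+
    have h3: "k = ?h" if k: "is_nat_trans C Y k" "nsrc k = W" "ntgt k = fcomp C (nsrc b) F"
      "nt_comp C Y (underlying_pre C a F) k = u" "nt_comp C Y (underlying_pre C b F) k = v" for k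
    proof (rule eqI)
      show "ncmp k \<in> extensional (Ob C)" using k(1) unfolding is_nat_trans_def by blast
      fix A assume A: "A \<in> Ob C"
      have kA: "ncmp k A \<in> Arr Y" "Dom Y (ncmp k A) = fobj W A" "Cod Y (ncmp k A) = fobj (nsrc b) (fobj F A)"
        using k A unfolding is_nat_trans_def natural_def by (auto simp: fcomp_def)
      have "ncmp k A = h A"
      proof (rule Y.is_pullback_monic[OF p[of "fobj F A"]])
        show "ncmp a (fobj F A) \<bullet>\<^bsub>Y\<^esub> ncmp k A = ncmp a (fobj F A) \<bullet>\<^bsub>Y\<^esub> h A"
          using arg_cong[OF k(4), of "\<lambda>x. ncmp x A"] A by (simp add: ha)
        show "ncmp b (fobj F A) \<bullet>\<^bsub>Y\<^esub> ncmp k A = ncmp b (fobj F A) \<bullet>\<^bsub>Y\<^esub> h A"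
          using arg_cong[OF k(5), of "\<lambda>x. ncmp x A"] A by (simp add: hb)
      qed (use A kA t in simp_all)
      then show "ncmp k A = ncmp ?h A" using A by simp
    qed (use k in simp_all)
    show "\<exists>!h. h \<in> hom (Fun C Y) W (Dom (Fun C Y) (underlying_pre C a F)) \<and>
      underlying_pre C a F \<bullet>\<^bsub>Fun C Y\<^esub> h = u \<and> underlying_pre C b F \<bullet>\<^bsub>Fun C Y\<^esub> h = v"
    proof (rule ex1I[of _ ?h])
      show "?h \<in> hom (Fun C Y) W (Dom (Fun C Y) (underlying_pre C a F)) \<and>
        underlying_pre C a F \<bullet>\<^bsub>Fun C Y\<^esub> ?h = u \<and> underlying_pre C b F \<bullet>\<^bsub>Fun C Y\<^esub> ?h = v"
        using h1 h2 t(6) by (simp add: Fsel S)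
      fix k assume k: "k \<in> hom (Fun C Y) W (Dom (Fun C Y) (underlying_pre C a F)) \<and>
        underlying_pre C a F \<bullet>\<^bsub>Fun C Y\<^esub> k = u \<and> underlying_pre C b F \<bullet>\<^bsub>Fun C Y\<^esub> k = v"
      show "k = ?h"
        by (rule h3) (use k t(6) in \<open>simp_all add: Fsel S\<close>)
    qed
  qed (use nt t in \<open>simp_all add: Fsel S\<close>)
qed

lemma Hom_display_T_stable:
  assumes q: "tangent_nat_trans X Y q" "\<And>A. A \<in> Ob X \<Longrightarrow> tangent_display Y (ncmp q A)"
    and f: "tangent_nat_trans X Y f" "ntgt f = (Tbar X Y ^^ n) (ntgt q)" and A: "A \<in> Ob X"
  shows "T_stable Y {..<2::nat} (two_legs (ncmp ((Ta H ^^ n) q) A) (ncmp f A))"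
  using Y.tangent_display_T_stable[OF q(2)[OF A], of "ncmp f A" n] q(1) f A by (simp cong: if_cong)

lemma Hom_displayI:
  assumes q: "tangent_nat_trans X Y q" "\<And>A. A \<in> Ob X \<Longrightarrow> tangent_display Y (ncmp q A)"
  shows "tangent_display H q"
proof (rule H.tangent_displayI)
  fix n f assume f: "f \<in> Arr H" "Cod H f = (To H ^^ n) (Cod H q)"
  show "T_stable H {..<2::nat} (two_legs ((Ta H ^^ n) q) f)"
  proof (rule Hom_T_stable[where G = "ntgt f"])
    show "{..<2::nat} \<noteq> {}" by (simp add: lessThan_empty_iff)
    fix A assume A: "A \<in> Ob X"
    show "T_stable Y {..<2::nat} (\<lambda>j. ncmp (two_legs ((Ta H ^^ n) q) f j) A)"
      using Hom_display_T_stable[OF q _ _ A, of f n] f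
      unfolding if_distrib[of "\<lambda>x. ncmp x A"] by simp
  qed (use q f in auto)
qed (use q in simp)

lemma Hom_display_pullbackD:
  assumes q: "tangent_nat_trans X Y q" "\<And>A. A \<in> Ob X \<Longrightarrow> tangent_display Y (ncmp q A)"
    and p: "is_pullback H ((Ta H ^^ n) q) f a b" and A: "A \<in> Ob X"
  shows "is_pullback Y (ncmp ((Ta H ^^ n) q) A) (ncmp f A) (ncmp a A) (ncmp b A)"
  by (rule Hom_pullbackD[OF p Hom_display_T_stable[OF q] A])
    (use H.is_pullbackD[OF p] q in simp_all)

text \<open>If the components of \<open>q\<close> are tangent display maps, all pullbacks along \<open>q\<close> and its images under \<open>T\<close>
  exist and are computed in components, so precomposition with any functor preserves them.\<close>

lemma pointwise_display_iff:
  fixes U :: "('ou \<times> 'au) itself"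
  shows "pointwise_display U X Y q \<longleftrightarrow>
     tangent_nat_trans X Y q \<and> (\<forall>A\<in>Ob X. tangent_display Y (ncmp q A))"
proof
  assume "pointwise_display U X Y q"
  then show "tangent_nat_trans X Y q \<and> (\<forall>A\<in>Ob X. tangent_display Y (ncmp q A))"
    unfolding pointwise_display_def tangent_display_def[of H] by simp
next
  assume q: "tangent_nat_trans X Y q \<and> (\<forall>A\<in>Ob X. tangent_display Y (ncmp q A))"
  then have q': "tangent_nat_trans X Y q" "\<And>A. A \<in> Ob X \<Longrightarrow> tangent_display Y (ncmp q A)" by auto
  have "pointwise_pullback U X Y q f a b" if p: "is_pullback H q f a b" for f a b
    unfolding pointwise_pullback_def
  proof (intro conjI allI impI)
    show "is_pullback H q f a b" by (rule p)
    fix C :: "('ou, 'au) cat" and F :: "('ou, 'au, 'o, 'a) func"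
    assume F: "is_functor C X F"
    show "is_pullback (Fun C Y) (underlying_pre C q F) (underlying_pre C f F) (underlying_pre C a F) (underlying_pre C b F)"
      by (rule Fun_pullbackI[OF F])
        (use H.is_pullbackD[OF p] Hom_display_pullbackD[OF q', of 0] p in simp_all)
  qed
  then show "pointwise_display U X Y q"
    unfolding pointwise_display_def using Hom_displayI[OF q'] q' by blast
qed

end

lemma diff_bundleD:
  assumes "diff_bundle X b"
  shows "tangent_display X (bq b)" "additive_bundle X (bq b) (bpi1 b) (bpi2 b) (bz b) (bs b)"
    "bl b \<in> Arr X" "Dom X (bl b) = tot X b" "Cod X (bl b) = To X (tot X b)"
    "Ta X (bq b) \<bullet>\<^bsub>X\<^esub> bl b = tz X (base X b) \<bullet>\<^bsub>X\<^esub> bq b"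
    "bl b \<bullet>\<^bsub>X\<^esub> bz b = Ta X (bz b) \<bullet>\<^bsub>X\<^esub> tz X (base X b)"
    "bl b \<bullet>\<^bsub>X\<^esub> bs b =
       Ta X (bs b) \<bullet>\<^bsub>X\<^esub> pair_into X (Ta X (bpi1 b)) (Ta X (bpi2 b))
                              (bl b \<bullet>\<^bsub>X\<^esub> bpi1 b) (bl b \<bullet>\<^bsub>X\<^esub> bpi2 b)"
    "tp X (tot X b) \<bullet>\<^bsub>X\<^esub> bl b = bz b \<bullet>\<^bsub>X\<^esub> bq b"
    "bl b \<bullet>\<^bsub>X\<^esub> bz b = tz X (tot X b) \<bullet>\<^bsub>X\<^esub> bz b"
    "bl b \<bullet>\<^bsub>X\<^esub> bs b =
       ts X (tot X b) \<bullet>\<^bsub>X\<^esub> pair_into X (tpi1 X (tot X b)) (tpi2 X (tot X b))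
                              (bl b \<bullet>\<^bsub>X\<^esub> bpi1 b) (bl b \<bullet>\<^bsub>X\<^esub> bpi2 b)"
    "Ta X (bl b) \<bullet>\<^bsub>X\<^esub> bl b = tl X (tot X b) \<bullet>\<^bsub>X\<^esub> bl b"
    "is_pullback X (tz X (base X b)) (Ta X (bq b)) (bq b \<bullet>\<^bsub>X\<^esub> bpi1 b)
       (Ta X (bs b) \<bullet>\<^bsub>X\<^esub> pair_into X (Ta X (bpi1 b)) (Ta X (bpi2 b))
          (bl b \<bullet>\<^bsub>X\<^esub> bpi1 b) (tz X (tot X b) \<bullet>\<^bsub>X\<^esub> bpi2 b))"
  using assms unfolding diff_bundle_def hom_iff by blast+

text \<open>The tuples that occur in the axioms of a differential bundle are well defined.\<close>

lemma (in tangent_on) bundle_pairs_wf: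
  assumes p: "is_pullback X q q a b" and l [simp]: "l \<in> Arr X" "Dom X l = Dom X q" "Cod X l = To X (Dom X q)"
    and z: "z \<in> Arr X" "Dom X z = Cod X q" "Cod X z = Dom X q"
    and e: "Ta X q \<bullet>\<^bsub>X\<^esub> l = tz X (Cod X q) \<bullet>\<^bsub>X\<^esub> q" "tp X (Dom X q) \<bullet>\<^bsub>X\<^esub> l = z \<bullet>\<^bsub>X\<^esub> q"
  shows "Ta X q \<bullet>\<^bsub>X\<^esub> (l \<bullet>\<^bsub>X\<^esub> a) = Ta X q \<bullet>\<^bsub>X\<^esub> (l \<bullet>\<^bsub>X\<^esub> b)"
    "tp X (Dom X q) \<bullet>\<^bsub>X\<^esub> (l \<bullet>\<^bsub>X\<^esub> a) = tp X (Dom X q) \<bullet>\<^bsub>X\<^esub> (l \<bullet>\<^bsub>X\<^esub> b)"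
    "Ta X q \<bullet>\<^bsub>X\<^esub> (l \<bullet>\<^bsub>X\<^esub> a) = Ta X q \<bullet>\<^bsub>X\<^esub> (tz X (Dom X q) \<bullet>\<^bsub>X\<^esub> b)"
proof -
  note d [simp] = is_pullbackD(1,4-8)[OF p] and c = is_pullbackD(9)[OF p]
  have n: "Ta X q \<bullet>\<^bsub>X\<^esub> tz X (Dom X q) = tz X (Cod X q) \<bullet>\<^bsub>X\<^esub> q" using tz_nat[of q] by simp
  show "Ta X q \<bullet>\<^bsub>X\<^esub> (l \<bullet>\<^bsub>X\<^esub> a) = Ta X q \<bullet>\<^bsub>X\<^esub> (l \<bullet>\<^bsub>X\<^esub> b)"
    "tp X (Dom X q) \<bullet>\<^bsub>X\<^esub> (l \<bullet>\<^bsub>X\<^esub> a) = tp X (Dom X q) \<bullet>\<^bsub>X\<^esub> (l \<bullet>\<^bsub>X\<^esub> b)"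
    "Ta X q \<bullet>\<^bsub>X\<^esub> (l \<bullet>\<^bsub>X\<^esub> a) = Ta X q \<bullet>\<^bsub>X\<^esub> (tz X (Dom X q) \<bullet>\<^bsub>X\<^esub> b)"
    using z by (simp_all add: e[THEN Cmp_eq_extend] n[THEN Cmp_eq_extend] c)
qed

definition bundle_at :: "('f, 'o, 'a) nt dbundle \<Rightarrow> 'o \<Rightarrow> 'a dbundle" where
  "bundle_at b A = \<lparr>bq = ncmp (bq b) A, bpi1 = ncmp (bpi1 b) A, bpi2 = ncmp (bpi2 b) A,
     bz = ncmp (bz b) A, bs = ncmp (bs b) A, bl = ncmp (bl b) A\<rparr>"

lemma bundle_at_simps [simp]:
  "bq (bundle_at b A) = ncmp (bq b) A" "bpi1 (bundle_at b A) = ncmp (bpi1 b) A"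
  "bpi2 (bundle_at b A) = ncmp (bpi2 b) A" "bz (bundle_at b A) = ncmp (bz b) A"
  "bs (bundle_at b A) = ncmp (bs b) A" "bl (bundle_at b A) = ncmp (bl b) A"
  by (simp_all add: bundle_at_def)

context tangent_pair
begin

text \<open>The part of the axioms that components do not see: which lax tangent morphisms the structure maps
  connect.\<close>

definition bundle_typed :: "(('o, 'a, 'o2, 'a2) lmor, 'o, 'a2) nt dbundle \<Rightarrow> bool" where
  "bundle_typed b \<longleftrightarrow>
     tangent_nat_trans X Y (bq b) \<and> tangent_nat_trans X Y (bpi1 b) \<and> tangent_nat_trans X Y (bpi2 b) \<and>
     tangent_nat_trans X Y (bz b) \<and> tangent_nat_trans X Y (bs b) \<and> tangent_nat_trans X Y (bl b) \<and>
     nsrc (bpi1 b) = nsrc (bpi2 b) \<and> ntgt (bpi1 b) = nsrc (bq b) \<and> ntgt (bpi2 b) = nsrc (bq b) \<and>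
     nsrc (bz b) = ntgt (bq b) \<and> ntgt (bz b) = nsrc (bq b) \<and>
     nsrc (bs b) = nsrc (bpi2 b) \<and> ntgt (bs b) = nsrc (bq b) \<and>
     nsrc (bl b) = nsrc (bq b) \<and> ntgt (bl b) = Tbar X Y (nsrc (bq b))"

lemma tnt_eq_iff:
  assumes "tangent_nat_trans X Y \<phi>" "tangent_nat_trans X Y \<psi>" "nsrc \<phi> = nsrc \<psi>" "ntgt \<phi> = ntgt \<psi>"
  shows "\<phi> = \<psi> \<longleftrightarrow> (\<forall>A\<in>Ob X. ncmp \<phi> A = ncmp \<psi> A)"
  using tnt_eqI[OF assms] by auto

text \<open>Associativity at a component concerns arrows into that component, which need not come from
  tangent natural transformations. It follows from associativity for the generic triple: the iterated
  pullback of the projection, which exists among the tangent natural transformations and is computed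
  in components.\<close>

lemma Hom_additiveD:
  assumes ad: "additive_bundle H q a b z s" and disp: "\<And>A. A \<in> Ob X \<Longrightarrow> tangent_display Y (ncmp q A)"
    and A: "A \<in> Ob X"
  shows "additive_bundle Y (ncmp q A) (ncmp a A) (ncmp b A) (ncmp z A) (ncmp s A)"
proof -
  note D = additive_bundleD[OF ad]
  note p = D(1)
  note d = H.is_pullbackD[OF p, simplified]
  have pA: "is_pullback Y (ncmp q A) (ncmp q A) (ncmp a A) (ncmp b A)" if "A \<in> Ob X" for A
    using Hom_display_pullbackD[OF d(1) disp, of 0] p that by simp
  note pr = Hom_pair_into[OF p pA]
  note [simp] = d(1,4,5,6,7,8)
  have z [simp]: "tangent_nat_trans X Y z" "nsrc z = ntgt q" "ntgt z = nsrc q"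
    and s [simp]: "tangent_nat_trans X Y s" "nsrc s = nsrc b" "ntgt s = nsrc q" using D by simp_all
  have [simp]: "lax_tangent_morphism X Y (nsrc q)" "lax_tangent_morphism X Y (ntgt q)"
    using tnt_typing[OF d(1)] by auto
  have ty [simp]: "ncmp q A \<in> Arr Y" "Dom Y (ncmp q A) = fobj (nsrc q) A" "Cod Y (ncmp q A) = fobj (ntgt q) A"
    "ncmp a A \<in> Arr Y" "Dom Y (ncmp a A) = fobj (nsrc b) A" "Cod Y (ncmp a A) = fobj (nsrc q) A"
    "ncmp b A \<in> Arr Y" "Dom Y (ncmp b A) = fobj (nsrc b) A" "Cod Y (ncmp b A) = fobj (nsrc q) A"
    "ncmp z A \<in> Arr Y" "Dom Y (ncmp z A) = fobj (ntgt q) A" "Cod Y (ncmp z A) = fobj (nsrc q) A"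
    "ncmp s A \<in> Arr Y" "Dom Y (ncmp s A) = fobj (nsrc b) A" "Cod Y (ncmp s A) = fobj (nsrc q) A" if "A \<in> Ob X" for A
    using that by simp_all
  have at: "ncmp \<phi> A = ncmp \<psi> A" if "\<phi> = \<psi>" for \<phi> \<psi> :: "(('o, 'a, 'o2, 'a2) lmor, 'o, 'a2) nt" using that by simp
  have qa: "ncmp q A \<bullet>\<^bsub>Y\<^esub> ncmp a A = ncmp q A \<bullet>\<^bsub>Y\<^esub> ncmp b A" if "A \<in> Ob X" for A
    using Y.is_pullbackD(9)[OF pA[OF that]] .
  have qz: "ncmp q A \<bullet>\<^bsub>Y\<^esub> ncmp z A = Ident Y (fobj (ntgt q) A)" if "A \<in> Ob X" for A
    using arg_cong[OF D(5), of "\<lambda>x. ncmp x A"] that by simp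
  have qs: "ncmp q A \<bullet>\<^bsub>Y\<^esub> ncmp s A = ncmp q A \<bullet>\<^bsub>Y\<^esub> ncmp a A" if "A \<in> Ob X" for A
    using arg_cong[OF D(9), of "\<lambda>x. ncmp x A"] that by simp
  have e2: "ncmp q A \<bullet>\<^bsub>Y\<^esub> ncmp (Ident H (nsrc q)) A = ncmp q A \<bullet>\<^bsub>Y\<^esub> ncmp (z \<bullet>\<^bsub>H\<^esub> q) A" if "A \<in> Ob X" for A
    using that by (simp add: qz[THEN Y.Cmp_eq_extend])
  note p1 = pr[of b a, OF _ _ _ _ _ _ qa[symmetric], simplified]
  note p2 = pr[of "Ident H (nsrc q)" "z \<bullet>\<^bsub>H\<^esub> q", OF _ _ _ _ _ _ e2, simplified]
  show ?thesis
    unfolding additive_bundle_def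
  proof (intro conjI ballI impI)
    show "ncmp s A \<bullet>\<^bsub>Y\<^esub> pair_into Y (ncmp a A) (ncmp b A) (ncmp b A) (ncmp a A) = ncmp s A"
      using at[OF D(10)] p1(4)[OF A] A by simp
    show "ncmp s A \<bullet>\<^bsub>Y\<^esub> pair_into Y (ncmp a A) (ncmp b A) (Ident Y (Dom Y (ncmp q A))) (ncmp z A \<bullet>\<^bsub>Y\<^esub> ncmp q A) =
      Ident Y (Dom Y (ncmp q A))"
      using at[OF D(11)] p2(4)[OF A] A by simp
    fix W u v w
    assume W: "W \<in> Ob Y" "u \<in> hom Y W (Dom Y (ncmp q A))" "v \<in> hom Y W (Dom Y (ncmp q A))" "w \<in> hom Y W (Dom Y (ncmp q A))"
      and e: "ncmp q A \<bullet>\<^bsub>Y\<^esub> u = ncmp q A \<bullet>\<^bsub>Y\<^esub> v \<and> ncmp q A \<bullet>\<^bsub>Y\<^esub> v = ncmp q A \<bullet>\<^bsub>Y\<^esub> w"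
    have qaH: "q \<bullet>\<^bsub>H\<^esub> a \<in> Arr H" "Cod H (q \<bullet>\<^bsub>H\<^esub> a) = (To H ^^ 0) (Cod H q)" by simp_all
    obtain r t where rt: "is_pullback H ((Ta H ^^ 0) q) (q \<bullet>\<^bsub>H\<^esub> a) r t"
      using Hom_displayI[OF d(1) disp] qaH unfolding tangent_display_def by blast
    have rt': "is_pullback H q (q \<bullet>\<^bsub>H\<^esub> a) r t" using rt by simp
    note rd = H.is_pullbackD[OF rt', simplified]
    have rtA: "is_pullback Y (ncmp q A) (ncmp (q \<bullet>\<^bsub>H\<^esub> a) A) (ncmp r A) (ncmp t A)" if "A \<in> Ob X" for A
      using Hom_display_pullbackD[OF d(1) disp rt that] that by simp
    note [simp] = rd(4-8)
    have [simp]: "lax_tangent_morphism X Y (nsrc t)" using tnt_typing(1)[OF rd(5)] .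
    have ty2 [simp]: "ncmp r A \<in> Arr Y" "Dom Y (ncmp r A) = fobj (nsrc t) A" "Cod Y (ncmp r A) = fobj (nsrc q) A"
      "ncmp t A \<in> Arr Y" "Dom Y (ncmp t A) = fobj (nsrc t) A" "Cod Y (ncmp t A) = fobj (nsrc b) A" if "A \<in> Ob X" for A
      using that by simp_all
    \<comment> \<open>the generic triple\<close>
    let ?x = "a \<bullet>\<^bsub>H\<^esub> t" and ?y = "b \<bullet>\<^bsub>H\<^esub> t"
    have xy: "ncmp q A \<bullet>\<^bsub>Y\<^esub> ncmp ?x A = ncmp q A \<bullet>\<^bsub>Y\<^esub> ncmp ?y A" if "A \<in> Ob X" for A
      using that by (simp add: qa[THEN Y.Cmp_eq_extend])
    have yr: "ncmp q A \<bullet>\<^bsub>Y\<^esub> ncmp ?y A = ncmp q A \<bullet>\<^bsub>Y\<^esub> ncmp r A" if "A \<in> Ob X" for A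
      using Y.is_pullbackD(9)[OF rtA[OF that]] that by (simp add: qa[THEN Y.Cmp_eq_extend])
    have eH: "q \<bullet>\<^bsub>H\<^esub> ?x = q \<bullet>\<^bsub>H\<^esub> ?y" "q \<bullet>\<^bsub>H\<^esub> ?y = q \<bullet>\<^bsub>H\<^esub> r"
      by (rule tnt_eqI; use xy yr in simp)+
    let ?xy = "pair_into H a b ?x ?y" and ?yr = "pair_into H a b ?y r"
    have xyp [simp]: "tangent_nat_trans X Y ?xy" "nsrc ?xy = nsrc t" "ntgt ?xy = nsrc b"
      and xyc: "\<And>A. A \<in> Ob X \<Longrightarrow> ncmp ?xy A = pair_into Y (ncmp a A) (ncmp b A) (ncmp ?x A) (ncmp ?y A)"
      and xya: "a \<bullet>\<^bsub>H\<^esub> ?xy = ?x" "b \<bullet>\<^bsub>H\<^esub> ?xy = ?y"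
      using pr[of ?x ?y, OF _ _ _ _ _ _ xy] by simp_all
    have yrp [simp]: "tangent_nat_trans X Y ?yr" "nsrc ?yr = nsrc t" "ntgt ?yr = nsrc b"
      and yrc: "\<And>A. A \<in> Ob X \<Longrightarrow> ncmp ?yr A = pair_into Y (ncmp a A) (ncmp b A) (ncmp ?y A) (ncmp r A)"
      and yra: "a \<bullet>\<^bsub>H\<^esub> ?yr = ?y" "b \<bullet>\<^bsub>H\<^esub> ?yr = r"
      using pr[of ?y r, OF _ _ _ _ _ _ yr] by simp_all
    have ty3 [simp]: "ncmp ?xy A \<in> Arr Y" "Dom Y (ncmp ?xy A) = fobj (nsrc t) A" "Cod Y (ncmp ?xy A) = fobj (nsrc b) A"
      "ncmp ?yr A \<in> Arr Y" "Dom Y (ncmp ?yr A) = fobj (nsrc t) A" "Cod Y (ncmp ?yr A) = fobj (nsrc b) A" if "A \<in> Ob X" for A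
      using that by simp_all
    have axy: "ncmp a A \<bullet>\<^bsub>Y\<^esub> ncmp ?xy A = ncmp ?x A" "ncmp a A \<bullet>\<^bsub>Y\<^esub> ncmp ?yr A = ncmp ?y A" if "A \<in> Ob X" for A
      using arg_cong[OF xya(1), of "\<lambda>x. ncmp x A"] arg_cong[OF yra(1), of "\<lambda>x. ncmp x A"] that by simp_all
    have e3: "ncmp q A \<bullet>\<^bsub>Y\<^esub> ncmp (s \<bullet>\<^bsub>H\<^esub> ?xy) A = ncmp q A \<bullet>\<^bsub>Y\<^esub> ncmp r A" if "A \<in> Ob X" for A
      using that xy[OF that] yr[OF that] axy[OF that] by (simp add: qs[THEN Y.Cmp_eq_extend])
    have e4: "ncmp q A \<bullet>\<^bsub>Y\<^esub> ncmp ?x A = ncmp q A \<bullet>\<^bsub>Y\<^esub> ncmp (s \<bullet>\<^bsub>H\<^esub> ?yr) A" if "A \<in> Ob X" for A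
      using that xy[OF that] axy[OF that] by (simp add: qs[THEN Y.Cmp_eq_extend])
    note p3 = pr[of "s \<bullet>\<^bsub>H\<^esub> ?xy" r, OF _ _ _ _ _ _ e3, simplified]
    note p4 = pr[of ?x "s \<bullet>\<^bsub>H\<^esub> ?yr", OF _ _ _ _ _ _ e4, simplified]
    have "s \<bullet>\<^bsub>H\<^esub> pair_into H a b (s \<bullet>\<^bsub>H\<^esub> ?xy) r = s \<bullet>\<^bsub>H\<^esub> pair_into H a b ?x (s \<bullet>\<^bsub>H\<^esub> ?yr)"
      by (rule additive_bundle_assoc[OF ad _ _ _ _ eH, of "nsrc t"]) simp_all
    from at[OF this]
    have gen: "ncmp s A \<bullet>\<^bsub>Y\<^esub> pair_into Y (ncmp a A) (ncmp b A) (ncmp s A \<bullet>\<^bsub>Y\<^esub> ncmp ?xy A) (ncmp r A) =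
       ncmp s A \<bullet>\<^bsub>Y\<^esub> pair_into Y (ncmp a A) (ncmp b A) (ncmp ?x A) (ncmp s A \<bullet>\<^bsub>Y\<^esub> ncmp ?yr A)"
      using A p3(4) p4(4) by simp
    \<comment> \<open>the given triple factors through the generic one\<close>
    let ?pr = "pair_into Y (ncmp a A) (ncmp b A)"
    have W' [simp]: "u \<in> Arr Y" "Dom Y u = W" "Cod Y u = fobj (nsrc q) A" "v \<in> Arr Y" "Dom Y v = W" "Cod Y v = fobj (nsrc q) A"
      "w \<in> Arr Y" "Dom Y w = W" "Cod Y w = fobj (nsrc q) A" using W A by simp_all
    note lift = Y.is_pullback_lift[OF pA[OF A]]
    have h1 [simp]: "?pr u v \<in> Arr Y" "Dom Y (?pr u v) = W" "Cod Y (?pr u v) = fobj (nsrc b) A"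
      and h1p: "ncmp a A \<bullet>\<^bsub>Y\<^esub> ?pr u v = u" "ncmp b A \<bullet>\<^bsub>Y\<^esub> ?pr u v = v"
      using lift[of u v] A e by simp_all
    have "ncmp q A \<bullet>\<^bsub>Y\<^esub> w = ncmp (q \<bullet>\<^bsub>H\<^esub> a) A \<bullet>\<^bsub>Y\<^esub> ?pr u v" using A e h1p by simp
    note l2 = Y.is_pullback_lift[OF rtA[OF A] _ _ _ _ _ this]
    define h where "h = pair_into Y (ncmp r A) (ncmp t A) w (?pr u v)"
    have h [simp]: "h \<in> Arr Y" "Dom Y h = W" "Cod Y h = fobj (nsrc t) A"
      and hp: "ncmp r A \<bullet>\<^bsub>Y\<^esub> h = w" "ncmp t A \<bullet>\<^bsub>Y\<^esub> h = ?pr u v" unfolding h_def using l2 A by simp_all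
    have xh: "ncmp ?x A \<bullet>\<^bsub>Y\<^esub> h = u" "ncmp ?y A \<bullet>\<^bsub>Y\<^esub> h = v" using A hp h1p by simp_all
    have xyh: "ncmp ?xy A \<bullet>\<^bsub>Y\<^esub> h = ?pr u v"
      unfolding xyc[OF A] using Y.pair_into_Cmp[OF pA[OF A], of "ncmp ?x A" "ncmp ?y A" h] A xy[OF A] xh by simp
    have yrh: "ncmp ?yr A \<bullet>\<^bsub>Y\<^esub> h = ?pr v w"
      unfolding yrc[OF A] using Y.pair_into_Cmp[OF pA[OF A], of "ncmp ?y A" "ncmp r A" h] A yr[OF A] xh hp by simp
    have l3: "?pr (ncmp s A \<bullet>\<^bsub>Y\<^esub> ncmp ?xy A) (ncmp r A) \<in> Arr Y"
      "Cod Y (?pr (ncmp s A \<bullet>\<^bsub>Y\<^esub> ncmp ?xy A) (ncmp r A)) = fobj (nsrc b) A"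
      "Dom Y (?pr (ncmp s A \<bullet>\<^bsub>Y\<^esub> ncmp ?xy A) (ncmp r A)) = fobj (nsrc t) A"
      and l3h: "?pr (ncmp s A \<bullet>\<^bsub>Y\<^esub> ncmp ?xy A) (ncmp r A) \<bullet>\<^bsub>Y\<^esub> h = ?pr (ncmp s A \<bullet>\<^bsub>Y\<^esub> ?pr u v) w"
      using lift[of "ncmp s A \<bullet>\<^bsub>Y\<^esub> ncmp ?xy A" "ncmp r A"]
        Y.pair_into_Cmp[OF pA[OF A], of "ncmp s A \<bullet>\<^bsub>Y\<^esub> ncmp ?xy A" "ncmp r A" h] e3[OF A] A hp xyh by simp_all
    have l4: "?pr (ncmp ?x A) (ncmp s A \<bullet>\<^bsub>Y\<^esub> ncmp ?yr A) \<in> Arr Y"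
      "Cod Y (?pr (ncmp ?x A) (ncmp s A \<bullet>\<^bsub>Y\<^esub> ncmp ?yr A)) = fobj (nsrc b) A"
      "Dom Y (?pr (ncmp ?x A) (ncmp s A \<bullet>\<^bsub>Y\<^esub> ncmp ?yr A)) = fobj (nsrc t) A"
      and l4h: "?pr (ncmp ?x A) (ncmp s A \<bullet>\<^bsub>Y\<^esub> ncmp ?yr A) \<bullet>\<^bsub>Y\<^esub> h = ?pr u (ncmp s A \<bullet>\<^bsub>Y\<^esub> ?pr v w)"
      using lift[of "ncmp ?x A" "ncmp s A \<bullet>\<^bsub>Y\<^esub> ncmp ?yr A"]
        Y.pair_into_Cmp[OF pA[OF A], of "ncmp ?x A" "ncmp s A \<bullet>\<^bsub>Y\<^esub> ncmp ?yr A" h] e4[OF A] A xh yrh by simp_all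
    show "ncmp s A \<bullet>\<^bsub>Y\<^esub> ?pr (ncmp s A \<bullet>\<^bsub>Y\<^esub> ?pr u v) w = ncmp s A \<bullet>\<^bsub>Y\<^esub> ?pr u (ncmp s A \<bullet>\<^bsub>Y\<^esub> ?pr v w)"
      unfolding l3h[symmetric] l4h[symmetric]
      using arg_cong[OF gen, of "\<lambda>x. x \<bullet>\<^bsub>Y\<^esub> h"] l3 l4 A by simp
  qed (use pA[OF A] A qz qs in simp_all)
qed

text \<open>Each axiom is an equation between tangent natural transformations or a pullback along the
  projection or its image under \<open>T\<close>. The hypotheses on the components ensure that the pairings in the
  axioms exist and are pairings in components.\<close>

lemma diff_bundle_iff_components:
  assumes ty: "bundle_typed b" and disp: "\<And>A. A \<in> Ob X \<Longrightarrow> tangent_display Y (ncmp (bq b) A)"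
    and pA: "\<And>A. A \<in> Ob X \<Longrightarrow> is_pullback Y (ncmp (bq b) A) (ncmp (bq b) A) (ncmp (bpi1 b) A) (ncmp (bpi2 b) A)"
    and eq1: "\<And>A. A \<in> Ob X \<Longrightarrow> Ta Y (ncmp (bq b) A) \<bullet>\<^bsub>Y\<^esub> ncmp (bl b) A = tz Y (fobj (ntgt (bq b)) A) \<bullet>\<^bsub>Y\<^esub> ncmp (bq b) A"
    and eq2: "\<And>A. A \<in> Ob X \<Longrightarrow> tp Y (fobj (nsrc (bq b)) A) \<bullet>\<^bsub>Y\<^esub> ncmp (bl b) A = ncmp (bz b) A \<bullet>\<^bsub>Y\<^esub> ncmp (bq b) A"
  shows "diff_bundle H b \<longleftrightarrow> (\<forall>A\<in>Ob X. diff_bundle Y (bundle_at b A))"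
proof -
  let ?d = "\<lambda>A. bundle_at b A"
  have t [simp]: "tangent_nat_trans X Y (bq b)" "tangent_nat_trans X Y (bpi1 b)" "tangent_nat_trans X Y (bpi2 b)"
     "tangent_nat_trans X Y (bz b)" "tangent_nat_trans X Y (bs b)" "tangent_nat_trans X Y (bl b)"
    and st [simp]: "nsrc (bpi1 b) = nsrc (bpi2 b)" "ntgt (bpi1 b) = nsrc (bq b)" "ntgt (bpi2 b) = nsrc (bq b)"
     "nsrc (bz b) = ntgt (bq b)" "ntgt (bz b) = nsrc (bq b)"
     "nsrc (bs b) = nsrc (bpi2 b)" "ntgt (bs b) = nsrc (bq b)"
     "nsrc (bl b) = nsrc (bq b)" "ntgt (bl b) = Tbar X Y (nsrc (bq b))"
    using ty unfolding bundle_typed_def by blast+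
  have [simp]: "lax_tangent_morphism X Y (nsrc (bq b))" "lax_tangent_morphism X Y (ntgt (bq b))"
    "lax_tangent_morphism X Y (nsrc (bpi2 b))"
    using tnt_typing(1,2)[OF t(1)] tnt_typing(1)[OF t(3)] by auto
  have c [simp]: "ncmp (bq b) A \<in> Arr Y" "Dom Y (ncmp (bq b) A) = fobj (nsrc (bq b)) A" "Cod Y (ncmp (bq b) A) = fobj (ntgt (bq b)) A"
    "ncmp (bpi1 b) A \<in> Arr Y" "Dom Y (ncmp (bpi1 b) A) = fobj (nsrc (bpi2 b)) A" "Cod Y (ncmp (bpi1 b) A) = fobj (nsrc (bq b)) A"
    "ncmp (bpi2 b) A \<in> Arr Y" "Dom Y (ncmp (bpi2 b) A) = fobj (nsrc (bpi2 b)) A" "Cod Y (ncmp (bpi2 b) A) = fobj (nsrc (bq b)) A"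
    "ncmp (bz b) A \<in> Arr Y" "Dom Y (ncmp (bz b) A) = fobj (ntgt (bq b)) A" "Cod Y (ncmp (bz b) A) = fobj (nsrc (bq b)) A"
    "ncmp (bs b) A \<in> Arr Y" "Dom Y (ncmp (bs b) A) = fobj (nsrc (bpi2 b)) A" "Cod Y (ncmp (bs b) A) = fobj (nsrc (bq b)) A"
    "ncmp (bl b) A \<in> Arr Y" "Dom Y (ncmp (bl b) A) = fobj (nsrc (bq b)) A" "Cod Y (ncmp (bl b) A) = To Y (fobj (nsrc (bq b)) A)"
    if "A \<in> Ob X" for A
    using that by simp_all
  have pTA: "is_pullback Y (ncmp (Ta H (bq b)) A) (ncmp (Ta H (bq b)) A) (ncmp (Ta H (bpi1 b)) A) (ncmp (Ta H (bpi2 b)) A)"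
    and pTTA: "is_pullback Y (Ta Y (ncmp (Ta H (bq b)) A)) (Ta Y (ncmp (Ta H (bq b)) A))
        (Ta Y (ncmp (Ta H (bpi1 b)) A)) (Ta Y (ncmp (Ta H (bpi2 b)) A))" if "A \<in> Ob X" for A
    using Y.tangent_display_pullback[OF disp[OF that] pA[OF that]] that by simp_all
  have p: "is_pullback H (bq b) (bq b) (bpi1 b) (bpi2 b)"
  proof (rule Hom_pullbackI)
    fix A assume A: "A \<in> Ob X"
    show "jointly_monic Y {..<2::nat} (To Y (fobj (nsrc (bpi1 b)) A)) (\<lambda>j. two_legs (Ta Y (ncmp (bpi1 b) A)) (Ta Y (ncmp (bpi2 b) A)) j)"
      using jointly_monic_pair[OF pTA[OF A]] A by (simp cong: if_cong)
  qed (use pA in simp_all)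
  have pT: "is_pullback H (Ta H (bq b)) (Ta H (bq b)) (Ta H (bpi1 b)) (Ta H (bpi2 b))"
  proof (rule Hom_pullbackI)
    fix A assume A: "A \<in> Ob X"
    show "jointly_monic Y {..<2::nat} (To Y (fobj (nsrc (Ta H (bpi1 b))) A)) (\<lambda>j. two_legs (Ta Y (ncmp (Ta H (bpi1 b)) A)) (Ta Y (ncmp (Ta H (bpi2 b)) A)) j)"
      using jointly_monic_pair[OF pTTA[OF A]] A by (simp cong: if_cong)
  qed (use pTA in simp_all)
  have wf: "Ta Y (ncmp (bq b) A) \<bullet>\<^bsub>Y\<^esub> (ncmp (bl b) A \<bullet>\<^bsub>Y\<^esub> ncmp (bpi1 b) A) = Ta Y (ncmp (bq b) A) \<bullet>\<^bsub>Y\<^esub> (ncmp (bl b) A \<bullet>\<^bsub>Y\<^esub> ncmp (bpi2 b) A)"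
    "tp Y (fobj (nsrc (bq b)) A) \<bullet>\<^bsub>Y\<^esub> (ncmp (bl b) A \<bullet>\<^bsub>Y\<^esub> ncmp (bpi1 b) A) = tp Y (fobj (nsrc (bq b)) A) \<bullet>\<^bsub>Y\<^esub> (ncmp (bl b) A \<bullet>\<^bsub>Y\<^esub> ncmp (bpi2 b) A)"
    "Ta Y (ncmp (bq b) A) \<bullet>\<^bsub>Y\<^esub> (ncmp (bl b) A \<bullet>\<^bsub>Y\<^esub> ncmp (bpi1 b) A) = Ta Y (ncmp (bq b) A) \<bullet>\<^bsub>Y\<^esub> (tz Y (fobj (nsrc (bq b)) A) \<bullet>\<^bsub>Y\<^esub> ncmp (bpi2 b) A)"
    if "A \<in> Ob X" for A
    using Y.bundle_pairs_wf[OF pA[OF that], of "ncmp (bl b) A" "ncmp (bz b) A"] eq1[OF that] eq2[OF that] that by simp_all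
  have w1: "ncmp (Ta H (bq b)) A \<bullet>\<^bsub>Y\<^esub> ncmp (bl b \<bullet>\<^bsub>H\<^esub> bpi1 b) A = ncmp (Ta H (bq b)) A \<bullet>\<^bsub>Y\<^esub> ncmp (bl b \<bullet>\<^bsub>H\<^esub> bpi2 b) A"
    and w2: "ncmp (tp H (nsrc (bq b))) A \<bullet>\<^bsub>Y\<^esub> ncmp (bl b \<bullet>\<^bsub>H\<^esub> bpi1 b) A = ncmp (tp H (nsrc (bq b))) A \<bullet>\<^bsub>Y\<^esub> ncmp (bl b \<bullet>\<^bsub>H\<^esub> bpi2 b) A"
    and w3: "ncmp (Ta H (bq b)) A \<bullet>\<^bsub>Y\<^esub> ncmp (bl b \<bullet>\<^bsub>H\<^esub> bpi1 b) A = ncmp (Ta H (bq b)) A \<bullet>\<^bsub>Y\<^esub> ncmp (tz H (nsrc (bq b)) \<bullet>\<^bsub>H\<^esub> bpi2 b) A"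
    if "A \<in> Ob X" for A using wf[OF that] that by simp_all
  have ptp: "is_pullback Y (ncmp (tp H (nsrc (bq b))) A) (ncmp (tp H (nsrc (bq b))) A) (ncmp (tpi1 H (nsrc (bq b))) A) (ncmp (tpi2 H (nsrc (bq b))) A)"
    if "A \<in> Ob X" for A using that by (simp add: Y.tpi_pullback)
  note q1 = Hom_pair_into[OF pT pTA _ _ _ _ _ w1, simplified]
  note q2 = Hom_pair_into[OF Hom_tpi_pullback(1) ptp _ _ _ _ _ w2, simplified]
  note q3 = Hom_pair_into[OF pT pTA _ _ _ _ _ w3, simplified]
  have i1: "tangent_display H (bq b) \<longleftrightarrow> (\<forall>A\<in>Ob X. tangent_display Y (bq (?d A)))"
    using Hom_displayI[OF t(1) disp] disp by simp
  have i2: "additive_bundle H (bq b) (bpi1 b) (bpi2 b) (bz b) (bs b) \<longleftrightarrow>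
    (\<forall>A\<in>Ob X. additive_bundle Y (bq (?d A)) (bpi1 (?d A)) (bpi2 (?d A)) (bz (?d A)) (bs (?d A)))"
    using Hom_additive[OF p] Hom_additiveD[OF _ disp] by auto
  have i3: "bl b \<in> hom H (tot H b) (To H (tot H b)) \<longleftrightarrow> (\<forall>A\<in>Ob X. bl (?d A) \<in> hom Y (tot Y (?d A)) (To Y (tot Y (?d A))))"
    by simp
  have i4: "Ta H (bq b) \<bullet>\<^bsub>H\<^esub> bl b = tz H (base H b) \<bullet>\<^bsub>H\<^esub> bq b \<longleftrightarrow>
     (\<forall>A\<in>Ob X. Ta Y (bq (?d A)) \<bullet>\<^bsub>Y\<^esub> bl (?d A) = tz Y (base Y (?d A)) \<bullet>\<^bsub>Y\<^esub> bq (?d A))"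
    by (subst tnt_eq_iff) simp_all
  have i5: "bl b \<bullet>\<^bsub>H\<^esub> bz b = Ta H (bz b) \<bullet>\<^bsub>H\<^esub> tz H (base H b) \<longleftrightarrow>
     (\<forall>A\<in>Ob X. bl (?d A) \<bullet>\<^bsub>Y\<^esub> bz (?d A) = Ta Y (bz (?d A)) \<bullet>\<^bsub>Y\<^esub> tz Y (base Y (?d A)))"
    by (subst tnt_eq_iff) simp_all
  have i6: "bl b \<bullet>\<^bsub>H\<^esub> bs b = Ta H (bs b) \<bullet>\<^bsub>H\<^esub> pair_into H (Ta H (bpi1 b)) (Ta H (bpi2 b)) (bl b \<bullet>\<^bsub>H\<^esub> bpi1 b) (bl b \<bullet>\<^bsub>H\<^esub> bpi2 b) \<longleftrightarrow>
     (\<forall>A\<in>Ob X. bl (?d A) \<bullet>\<^bsub>Y\<^esub> bs (?d A) = Ta Y (bs (?d A)) \<bullet>\<^bsub>Y\<^esub>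
       pair_into Y (Ta Y (bpi1 (?d A))) (Ta Y (bpi2 (?d A))) (bl (?d A) \<bullet>\<^bsub>Y\<^esub> bpi1 (?d A)) (bl (?d A) \<bullet>\<^bsub>Y\<^esub> bpi2 (?d A)))"
    by (subst tnt_eq_iff) (use q1 in simp_all)
  have i7: "tp H (tot H b) \<bullet>\<^bsub>H\<^esub> bl b = bz b \<bullet>\<^bsub>H\<^esub> bq b \<longleftrightarrow>
     (\<forall>A\<in>Ob X. tp Y (tot Y (?d A)) \<bullet>\<^bsub>Y\<^esub> bl (?d A) = bz (?d A) \<bullet>\<^bsub>Y\<^esub> bq (?d A))"
    by (subst tnt_eq_iff) simp_all
  have i8: "bl b \<bullet>\<^bsub>H\<^esub> bz b = tz H (tot H b) \<bullet>\<^bsub>H\<^esub> bz b \<longleftrightarrow>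
     (\<forall>A\<in>Ob X. bl (?d A) \<bullet>\<^bsub>Y\<^esub> bz (?d A) = tz Y (tot Y (?d A)) \<bullet>\<^bsub>Y\<^esub> bz (?d A))"
    by (subst tnt_eq_iff) simp_all
  have i9: "bl b \<bullet>\<^bsub>H\<^esub> bs b = ts H (tot H b) \<bullet>\<^bsub>H\<^esub> pair_into H (tpi1 H (tot H b)) (tpi2 H (tot H b)) (bl b \<bullet>\<^bsub>H\<^esub> bpi1 b) (bl b \<bullet>\<^bsub>H\<^esub> bpi2 b) \<longleftrightarrow>
     (\<forall>A\<in>Ob X. bl (?d A) \<bullet>\<^bsub>Y\<^esub> bs (?d A) = ts Y (tot Y (?d A)) \<bullet>\<^bsub>Y\<^esub>
       pair_into Y (tpi1 Y (tot Y (?d A))) (tpi2 Y (tot Y (?d A))) (bl (?d A) \<bullet>\<^bsub>Y\<^esub> bpi1 (?d A)) (bl (?d A) \<bullet>\<^bsub>Y\<^esub> bpi2 (?d A)))"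
    by (subst tnt_eq_iff) (use q2 in simp_all)
  have i10: "Ta H (bl b) \<bullet>\<^bsub>H\<^esub> bl b = tl H (tot H b) \<bullet>\<^bsub>H\<^esub> bl b \<longleftrightarrow>
     (\<forall>A\<in>Ob X. Ta Y (bl (?d A)) \<bullet>\<^bsub>Y\<^esub> bl (?d A) = tl Y (tot Y (?d A)) \<bullet>\<^bsub>Y\<^esub> bl (?d A))"
    by (subst tnt_eq_iff) simp_all
  let ?x = "Ta H (bs b) \<bullet>\<^bsub>H\<^esub> pair_into H (Ta H (bpi1 b)) (Ta H (bpi2 b)) (bl b \<bullet>\<^bsub>H\<^esub> bpi1 b) (tz H (tot H b) \<bullet>\<^bsub>H\<^esub> bpi2 b)"
  let ?xA = "\<lambda>A. Ta Y (bs (?d A)) \<bullet>\<^bsub>Y\<^esub> pair_into Y (Ta Y (bpi1 (?d A))) (Ta Y (bpi2 (?d A)))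
     (bl (?d A) \<bullet>\<^bsub>Y\<^esub> bpi1 (?d A)) (tz Y (tot Y (?d A)) \<bullet>\<^bsub>Y\<^esub> bpi2 (?d A))"
  have xt: "tangent_nat_trans X Y ?x" "nsrc ?x = nsrc (bpi2 b)" "ntgt ?x = Tbar X Y (nsrc (bq b))"
    using q3 by simp_all
  have xA: "ncmp ?x A = ?xA A" if "A \<in> Ob X" for A using q3(4)[OF that] that by simp
  have i11: "is_pullback H (tz H (base H b)) (Ta H (bq b)) (bq b \<bullet>\<^bsub>H\<^esub> bpi1 b) ?x \<longleftrightarrow>
     (\<forall>A\<in>Ob X. is_pullback Y (tz Y (base Y (?d A))) (Ta Y (bq (?d A))) (bq (?d A) \<bullet>\<^bsub>Y\<^esub> bpi1 (?d A)) (?xA A))"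
  proof (intro iffI ballI)
    fix A assume A: "A \<in> Ob X" and P: "is_pullback H (tz H (base H b)) (Ta H (bq b)) (bq b \<bullet>\<^bsub>H\<^esub> bpi1 b) ?x"
    have "is_pullback H ((Ta H ^^ 1) (bq b)) (tz H (base H b)) ?x (bq b \<bullet>\<^bsub>H\<^esub> bpi1 b)"
      using H.is_pullback_sym[OF P] by simp
    from Y.is_pullback_sym[OF Hom_display_pullbackD[OF t(1) disp this A]]
    show "is_pullback Y (tz Y (base Y (?d A))) (Ta Y (bq (?d A))) (bq (?d A) \<bullet>\<^bsub>Y\<^esub> bpi1 (?d A)) (?xA A)"
      using xA[OF A] A by simp
  next
    assume P: "\<forall>A\<in>Ob X. is_pullback Y (tz Y (base Y (?d A))) (Ta Y (bq (?d A))) (bq (?d A) \<bullet>\<^bsub>Y\<^esub> bpi1 (?d A)) (?xA A)"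
    show "is_pullback H (tz H (base H b)) (Ta H (bq b)) (bq b \<bullet>\<^bsub>H\<^esub> bpi1 b) ?x"
    proof (rule Hom_pullbackI)
      fix A assume A: "A \<in> Ob X"
      have PA: "is_pullback Y (tz Y (fobj (ntgt (bq b)) A)) (Ta Y (ncmp (bq b) A)) (ncmp (bq b \<bullet>\<^bsub>H\<^esub> bpi1 b) A) (ncmp ?x A)"
        using P[THEN bspec, OF A] xA[OF A] A by simp
      have st: "T_stable Y {..<2::nat} (two_legs ((Ta Y ^^ 1) (ncmp (bq b) A)) (tz Y (fobj (ntgt (bq b)) A)))"
        by (rule Y.tangent_display_T_stable[OF disp[OF A]]) (use A in simp_all)
      have "is_pullback Y (Ta Y (Ta Y (ncmp (bq b) A))) (Ta Y (tz Y (fobj (ntgt (bq b)) A)))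
          (Ta Y (ncmp ?x A)) (Ta Y (ncmp (bq b \<bullet>\<^bsub>H\<^esub> bpi1 b) A))"
        using Y.T_stable_pullback(1)[OF st] Y.is_pullback_sym[OF PA] by simp
      from jointly_monic_pair[OF Y.is_pullback_sym[OF this]]
      show "jointly_monic Y {..<2::nat} (To Y (fobj (nsrc (bq b \<bullet>\<^bsub>H\<^esub> bpi1 b)) A))
        (\<lambda>j. two_legs (Ta Y (ncmp (bq b \<bullet>\<^bsub>H\<^esub> bpi1 b) A)) (Ta Y (ncmp ?x A)) j)"
        using A by simp
      show "is_pullback Y (ncmp (tz H (base H b)) A) (ncmp (Ta H (bq b)) A) (ncmp (bq b \<bullet>\<^bsub>H\<^esub> bpi1 b) A) (ncmp ?x A)"
        using PA A by simp
    qed (use xt in simp_all)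
  qed
  show ?thesis
    unfolding diff_bundle_def ball_conj_distrib
    by (intro arg_cong2[of _ _ _ _ "(\<and>)"] i1 i2 i3 i4 i5 i6 i7 i8 i9 i10 i11)
qed

text \<open>This is what makes such a bundle a family of bundles of \<open>Y\<close> indexed by the objects of \<open>X\<close>.\<close>

theorem DBpt_Ob_iff:
  "b \<in> Ob (DBpt U X Y) \<longleftrightarrow> bundle_typed b \<and> (\<forall>A\<in>Ob X. diff_bundle Y (bundle_at b A))"
proof -
  have ob: "b \<in> Ob (DBpt U X Y) \<longleftrightarrow> diff_bundle H b \<and> pointwise_display U X Y (bq b)"
    by (simp add: DBpt_def)
  show ?thesis
  proof
    assume "b \<in> Ob (DBpt U X Y)"
    then have d: "diff_bundle H b" and q: "tangent_nat_trans X Y (bq b)" "\<And>A. A \<in> Ob X \<Longrightarrow> tangent_display Y (ncmp (bq b) A)"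
      unfolding ob pointwise_display_iff by auto
    note D = diff_bundleD[OF d]
    note a = additive_bundleD[OF D(2)]
    note pd = H.is_pullbackD[OF a(1), simplified]
    have ty: "bundle_typed b"
      unfolding bundle_typed_def using D(3-5) a(2-4,6-8) pd by simp
    have "diff_bundle H b \<longleftrightarrow> (\<forall>A\<in>Ob X. diff_bundle Y (bundle_at b A))"
    proof (rule diff_bundle_iff_components[OF ty q(2)])
      fix A assume A: "A \<in> Ob X"
      show "is_pullback Y (ncmp (bq b) A) (ncmp (bq b) A) (ncmp (bpi1 b) A) (ncmp (bpi2 b) A)"
        using Hom_display_pullbackD[OF q, of 0] a(1) A by simp
      show "Ta Y (ncmp (bq b) A) \<bullet>\<^bsub>Y\<^esub> ncmp (bl b) A = tz Y (fobj (ntgt (bq b)) A) \<bullet>\<^bsub>Y\<^esub> ncmp (bq b) A"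
        using arg_cong[OF D(6), of "\<lambda>x. ncmp x A"] A by simp
      show "tp Y (fobj (nsrc (bq b)) A) \<bullet>\<^bsub>Y\<^esub> ncmp (bl b) A = ncmp (bz b) A \<bullet>\<^bsub>Y\<^esub> ncmp (bq b) A"
        using arg_cong[OF D(9), of "\<lambda>x. ncmp x A"] A by simp
    qed
    then show "bundle_typed b \<and> (\<forall>A\<in>Ob X. diff_bundle Y (bundle_at b A))" using ty d by blast
  next
    assume r: "bundle_typed b \<and> (\<forall>A\<in>Ob X. diff_bundle Y (bundle_at b A))"
    then have q: "tangent_nat_trans X Y (bq b)" unfolding bundle_typed_def by blast
    note D = diff_bundleD[of Y "bundle_at b A" for A, simplified]
    have dA: "diff_bundle Y (bundle_at b A)" if "A \<in> Ob X" for A using r that by blast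
    have "diff_bundle H b \<longleftrightarrow> (\<forall>A\<in>Ob X. diff_bundle Y (bundle_at b A))"
    proof (rule diff_bundle_iff_components)
      show "bundle_typed b" using r by blast
      fix A assume A: "A \<in> Ob X"
      note D = diff_bundleD[OF dA[OF A], simplified]
      show "tangent_display Y (ncmp (bq b) A)" by (rule D(1))
      show "is_pullback Y (ncmp (bq b) A) (ncmp (bq b) A) (ncmp (bpi1 b) A) (ncmp (bpi2 b) A)"
        by (rule additive_bundleD(1)[OF D(2)])
      show "Ta Y (ncmp (bq b) A) \<bullet>\<^bsub>Y\<^esub> ncmp (bl b) A = tz Y (fobj (ntgt (bq b)) A) \<bullet>\<^bsub>Y\<^esub> ncmp (bq b) A"
        using D(6) q A by simp
      show "tp Y (fobj (nsrc (bq b)) A) \<bullet>\<^bsub>Y\<^esub> ncmp (bl b) A = ncmp (bz b) A \<bullet>\<^bsub>Y\<^esub> ncmp (bq b) A"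
        using D(9) q A by simp
    qed
    then show "b \<in> Ob (DBpt U X Y)"
      unfolding ob pointwise_display_iff using r q diff_bundleD(1)[OF dA, simplified] by blast
  qed
qed

end

section \<open>Linear morphisms\<close>

context tangent_on
begin

lemma bundle_typing [simp]:
  assumes "diff_bundle X b"
  shows "bq b \<in> Arr X" "bpi1 b \<in> Arr X" "bpi2 b \<in> Arr X" "bz b \<in> Arr X" "bs b \<in> Arr X" "bl b \<in> Arr X"
    "Dom X (bpi2 b) = Dom X (bpi1 b)" "Cod X (bpi1 b) = Dom X (bq b)" "Cod X (bpi2 b) = Dom X (bq b)"
    "Dom X (bz b) = Cod X (bq b)" "Cod X (bz b) = Dom X (bq b)"
    "Dom X (bs b) = Dom X (bpi1 b)" "Cod X (bs b) = Dom X (bq b)"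
    "Dom X (bl b) = Dom X (bq b)" "Cod X (bl b) = To X (Dom X (bq b))"
proof -
  note D = diff_bundleD[OF assms]
  note A = additive_bundleD[OF D(2)]
  note P = is_pullbackD[OF A(1)]
  show "bq b \<in> Arr X" "bpi1 b \<in> Arr X" "bpi2 b \<in> Arr X" "bz b \<in> Arr X" "bs b \<in> Arr X" "bl b \<in> Arr X"
    "Dom X (bpi2 b) = Dom X (bpi1 b)" "Cod X (bpi1 b) = Dom X (bq b)" "Cod X (bpi2 b) = Dom X (bq b)"
    "Dom X (bz b) = Cod X (bq b)" "Cod X (bz b) = Dom X (bq b)"
    "Dom X (bs b) = Dom X (bpi1 b)" "Cod X (bs b) = Dom X (bq b)"
    "Dom X (bl b) = Dom X (bq b)" "Cod X (bl b) = To X (Dom X (bq b))"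
    using D A P by simp_all
qed

lemma bundle_pullback:
  assumes "diff_bundle X b"
  shows "is_pullback X (bq b) (bq b) (bpi1 b) (bpi2 b)"
    "is_pullback X (Ta X (bq b)) (Ta X (bq b)) (Ta X (bpi1 b)) (Ta X (bpi2 b))"
    "is_pullback X (Ta X (Ta X (bq b))) (Ta X (Ta X (bq b))) (Ta X (Ta X (bpi1 b))) (Ta X (Ta X (bpi2 b)))"
  using additive_bundleD(1)[OF diff_bundleD(2)[OF assms]] tangent_display_pullback[OF diff_bundleD(1)[OF assms]]
  by simp_all

lemma linear_morphismD [simp]:
  assumes "linear_morphism X \<phi>"
  shows "diff_bundle X (msrc \<phi>)" "diff_bundle X (mtgt \<phi>)" "mbase \<phi> \<in> Arr X" "mtot \<phi> \<in> Arr X"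
    "Dom X (mbase \<phi>) = Cod X (bq (msrc \<phi>))" "Cod X (mbase \<phi>) = Cod X (bq (mtgt \<phi>))"
    "Dom X (mtot \<phi>) = Dom X (bq (msrc \<phi>))" "Cod X (mtot \<phi>) = Dom X (bq (mtgt \<phi>))"
  using assms unfolding linear_morphism_def by auto

lemma linear_eqs:
  assumes "linear_morphism X \<phi>"
  shows "bq (mtgt \<phi>) \<bullet>\<^bsub>X\<^esub> mtot \<phi> = mbase \<phi> \<bullet>\<^bsub>X\<^esub> bq (msrc \<phi>)"
    "bl (mtgt \<phi>) \<bullet>\<^bsub>X\<^esub> mtot \<phi> = Ta X (mtot \<phi>) \<bullet>\<^bsub>X\<^esub> bl (msrc \<phi>)"
  using assms unfolding linear_morphism_def by auto

text \<open>The zero is recovered from the lift: \<open>z q = p l\<close>, and \<open>q\<close> is split by \<open>z\<close>.\<close>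

lemma linear_zero:
  assumes f: "linear_morphism X \<phi>"
  shows "mtot \<phi> \<bullet>\<^bsub>X\<^esub> bz (msrc \<phi>) = bz (mtgt \<phi>) \<bullet>\<^bsub>X\<^esub> mbase \<phi>"
proof -
  let ?b = "msrc \<phi>" and ?c = "mtgt \<phi>"
  note [simp] = linear_morphismD[OF f] bundle_typing
  note D = diff_bundleD[OF linear_morphismD(1)[OF f]] and D' = diff_bundleD[OF linear_morphismD(2)[OF f]]
  have "mtot \<phi> \<bullet>\<^bsub>X\<^esub> (bz ?b \<bullet>\<^bsub>X\<^esub> bq ?b) = tp X (tot X ?c) \<bullet>\<^bsub>X\<^esub> (Ta X (mtot \<phi>) \<bullet>\<^bsub>X\<^esub> bl ?b)"
    by (simp add: tp_nat[THEN Cmp_eq_extend] D(9))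
  also have "\<dots> = bz ?c \<bullet>\<^bsub>X\<^esub> (mbase \<phi> \<bullet>\<^bsub>X\<^esub> bq ?b)"
    by (simp add: linear_eqs(2)[OF f, symmetric] D'(9)[THEN Cmp_eq_extend] linear_eqs(1)[OF f])
  finally have "(mtot \<phi> \<bullet>\<^bsub>X\<^esub> (bz ?b \<bullet>\<^bsub>X\<^esub> bq ?b)) \<bullet>\<^bsub>X\<^esub> bz ?b = (bz ?c \<bullet>\<^bsub>X\<^esub> (mbase \<phi> \<bullet>\<^bsub>X\<^esub> bq ?b)) \<bullet>\<^bsub>X\<^esub> bz ?b"
    by simp
  then show ?thesis by (simp add: additive_bundleD(5)[OF D(2)])
qed

text \<open>The lift is the universal map restricted along \<open>\<langle>1, z q\<rangle>\<close>, hence monic.\<close>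

lemma lift_monic:
  assumes b: "diff_bundle X b" and x: "x \<in> Arr X" "y \<in> Arr X" "Dom X x = Dom X y" "Cod X x = tot X b" "Cod X y = tot X b"
    and e: "bl b \<bullet>\<^bsub>X\<^esub> x = bl b \<bullet>\<^bsub>X\<^esub> y"
  shows "x = y"
proof -
  note [simp] = bundle_typing[OF b] x
  note D = diff_bundleD[OF b]
  note A = additive_bundleD[OF D(2)]
  note p = bundle_pullback[OF b]
  let ?q = "bq b" and ?z = "bz b" and ?l = "bl b" and ?E = "tot X b" and ?M = "base X b"
  \<comment> \<open>\<open>i = \<langle>1, z q\<rangle>\<close>; the tuple \<open>m\<close> below is the one in the universal map \<open>\<xi> = T s m\<close>\<close>
  define i where "i = pair_into X (bpi1 b) (bpi2 b) (Ident X ?E) (?z \<bullet>\<^bsub>X\<^esub> ?q)"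
  have "?q \<bullet>\<^bsub>X\<^esub> Ident X ?E = ?q \<bullet>\<^bsub>X\<^esub> (?z \<bullet>\<^bsub>X\<^esub> ?q)" by (simp add: A(5)[THEN Cmp_eq_extend])
  note l = is_pullback_lift[OF p(1) _ _ _ _ _ this]
  have i [simp]: "i \<in> Arr X" "Dom X i = ?E" "Cod X i = Dom X (bpi1 b)"
    and ip: "bpi1 b \<bullet>\<^bsub>X\<^esub> i = Ident X ?E" "bpi2 b \<bullet>\<^bsub>X\<^esub> i = ?z \<bullet>\<^bsub>X\<^esub> ?q"
    unfolding i_def using l by simp_all
  have si: "bs b \<bullet>\<^bsub>X\<^esub> i = Ident X ?E" unfolding i_def by (rule A(11))
  define m where "m = pair_into X (Ta X (bpi1 b)) (Ta X (bpi2 b)) (?l \<bullet>\<^bsub>X\<^esub> bpi1 b) (tz X ?E \<bullet>\<^bsub>X\<^esub> bpi2 b)"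
  have "Ta X ?q \<bullet>\<^bsub>X\<^esub> (?l \<bullet>\<^bsub>X\<^esub> bpi1 b) = Ta X ?q \<bullet>\<^bsub>X\<^esub> (tz X ?E \<bullet>\<^bsub>X\<^esub> bpi2 b)"
    by (rule bundle_pairs_wf(3)[OF p(1)]) (use D in simp_all)
  note l = is_pullback_lift[OF p(2) _ _ _ _ _ this]
  have m [simp]: "m \<in> Arr X" "Dom X m = Dom X (bpi1 b)" "Cod X m = To X (Dom X (bpi1 b))"
    and mp: "Ta X (bpi1 b) \<bullet>\<^bsub>X\<^esub> m = ?l \<bullet>\<^bsub>X\<^esub> bpi1 b" "Ta X (bpi2 b) \<bullet>\<^bsub>X\<^esub> m = tz X ?E \<bullet>\<^bsub>X\<^esub> bpi2 b"
    unfolding m_def using l by simp_all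
  have mi: "m \<bullet>\<^bsub>X\<^esub> i = Ta X i \<bullet>\<^bsub>X\<^esub> ?l"
  proof (rule is_pullback_monic[OF p(2)])
    show "Ta X (bpi1 b) \<bullet>\<^bsub>X\<^esub> (m \<bullet>\<^bsub>X\<^esub> i) = Ta X (bpi1 b) \<bullet>\<^bsub>X\<^esub> (Ta X i \<bullet>\<^bsub>X\<^esub> ?l)"
      by (simp add: mp[THEN Cmp_eq_extend] ip ip(1)[THEN Ta_eq, THEN Cmp_eq_extend])
    show "Ta X (bpi2 b) \<bullet>\<^bsub>X\<^esub> (m \<bullet>\<^bsub>X\<^esub> i) = Ta X (bpi2 b) \<bullet>\<^bsub>X\<^esub> (Ta X i \<bullet>\<^bsub>X\<^esub> ?l)"
      by (simp add: mp[THEN Cmp_eq_extend] ip ip(2)[THEN Ta_eq, THEN Cmp_eq_extend] D(6) tz_nat[THEN Cmp_eq_extend])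
  qed simp_all
  let ?xi = "Ta X (bs b) \<bullet>\<^bsub>X\<^esub> m"
  have xi: "?xi \<bullet>\<^bsub>X\<^esub> (i \<bullet>\<^bsub>X\<^esub> w) = ?l \<bullet>\<^bsub>X\<^esub> w" if "w \<in> Arr X" "Cod X w = ?E" for w
    using that by (simp add: mi[THEN Cmp_eq_extend] si[THEN Ta_eq, THEN Cmp_eq_extend])
  have q: "?q \<bullet>\<^bsub>X\<^esub> (tp X ?E \<bullet>\<^bsub>X\<^esub> (?l \<bullet>\<^bsub>X\<^esub> w)) = ?q \<bullet>\<^bsub>X\<^esub> w" if "w \<in> Arr X" "Cod X w = ?E" for w
    using that by (simp add: D(9)[THEN Cmp_eq_extend] A(5)[THEN Cmp_eq_extend])
  have "i \<bullet>\<^bsub>X\<^esub> x = i \<bullet>\<^bsub>X\<^esub> y"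
  proof (rule is_pullback_monic[OF D(13)[folded m_def]])
    show "(?q \<bullet>\<^bsub>X\<^esub> bpi1 b) \<bullet>\<^bsub>X\<^esub> (i \<bullet>\<^bsub>X\<^esub> x) = (?q \<bullet>\<^bsub>X\<^esub> bpi1 b) \<bullet>\<^bsub>X\<^esub> (i \<bullet>\<^bsub>X\<^esub> y)"
      using q[of x] q[of y] e by (simp add: ip(1)[THEN Cmp_eq_extend])
    show "?xi \<bullet>\<^bsub>X\<^esub> (i \<bullet>\<^bsub>X\<^esub> x) = ?xi \<bullet>\<^bsub>X\<^esub> (i \<bullet>\<^bsub>X\<^esub> y)"
      unfolding xi[OF x(1,4)] xi[OF x(2,5)] by (rule e)
  qed simp_all
  then have "bpi1 b \<bullet>\<^bsub>X\<^esub> (i \<bullet>\<^bsub>X\<^esub> x) = bpi1 b \<bullet>\<^bsub>X\<^esub> (i \<bullet>\<^bsub>X\<^esub> y)" by simp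
  then show ?thesis by (simp add: ip(1)[THEN Cmp_eq_extend])
qed

text \<open>Both sides agree after the monic lift, because the lift turns sums in the fibre into sums of tangent
  vectors, which are natural.\<close>

lemma linear_sum:
  assumes f: "linear_morphism X \<phi>"
    and k [simp]: "k \<in> Arr X" "Dom X k = Dom X (bpi1 (msrc \<phi>))" "Cod X k = Dom X (bpi1 (mtgt \<phi>))"
    and kp: "bpi1 (mtgt \<phi>) \<bullet>\<^bsub>X\<^esub> k = mtot \<phi> \<bullet>\<^bsub>X\<^esub> bpi1 (msrc \<phi>)" "bpi2 (mtgt \<phi>) \<bullet>\<^bsub>X\<^esub> k = mtot \<phi> \<bullet>\<^bsub>X\<^esub> bpi2 (msrc \<phi>)"
  shows "mtot \<phi> \<bullet>\<^bsub>X\<^esub> bs (msrc \<phi>) = bs (mtgt \<phi>) \<bullet>\<^bsub>X\<^esub> k"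
proof -
  note [simp] = linear_morphismD[OF f] bundle_typing
  define m where "m b = pair_into X (tpi1 X (tot X b)) (tpi2 X (tot X b)) (bl b \<bullet>\<^bsub>X\<^esub> bpi1 b) (bl b \<bullet>\<^bsub>X\<^esub> bpi2 b)" for b
  have m [simp]: "m b \<in> Arr X" "Dom X (m b) = Dom X (bpi1 b)" "Cod X (m b) = T2o X (tot X b)"
    and mp: "tpi1 X (tot X b) \<bullet>\<^bsub>X\<^esub> m b = bl b \<bullet>\<^bsub>X\<^esub> bpi1 b" "tpi2 X (tot X b) \<bullet>\<^bsub>X\<^esub> m b = bl b \<bullet>\<^bsub>X\<^esub> bpi2 b"
    and ms: "bl b \<bullet>\<^bsub>X\<^esub> bs b = ts X (tot X b) \<bullet>\<^bsub>X\<^esub> m b" if b: "diff_bundle X b" for b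
  proof -
    note D = diff_bundleD[OF b]
    have "tp X (tot X b) \<bullet>\<^bsub>X\<^esub> (bl b \<bullet>\<^bsub>X\<^esub> bpi1 b) = tp X (tot X b) \<bullet>\<^bsub>X\<^esub> (bl b \<bullet>\<^bsub>X\<^esub> bpi2 b)"
      by (rule bundle_pairs_wf(2)[OF bundle_pullback(1)[OF b]]) (use D b in simp_all)
    note l = is_pullback_lift[OF tpi_pullback[of "tot X b"] _ _ _ _ _ this]
    show "m b \<in> Arr X" "Dom X (m b) = Dom X (bpi1 b)" "Cod X (m b) = T2o X (tot X b)"
      "tpi1 X (tot X b) \<bullet>\<^bsub>X\<^esub> m b = bl b \<bullet>\<^bsub>X\<^esub> bpi1 b" "tpi2 X (tot X b) \<bullet>\<^bsub>X\<^esub> m b = bl b \<bullet>\<^bsub>X\<^esub> bpi2 b"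
      unfolding m_def using l b by simp_all
    show "bl b \<bullet>\<^bsub>X\<^esub> bs b = ts X (tot X b) \<bullet>\<^bsub>X\<^esub> m b" unfolding m_def by (rule D(11))
  qed
  let ?b = "msrc \<phi>" and ?c = "mtgt \<phi>"
  have mk: "m ?c \<bullet>\<^bsub>X\<^esub> k = T2a X (mtot \<phi>) \<bullet>\<^bsub>X\<^esub> m ?b"
    by (rule tpi_monic[of _ _ "tot X ?c"])
      (simp_all add: mp mp[THEN Cmp_eq_extend] kp tpi_nat[THEN Cmp_eq_extend] linear_eqs(2)[OF f, THEN Cmp_eq_extend])
  show ?thesis
  proof (rule lift_monic[of ?c])
    have "bl ?c \<bullet>\<^bsub>X\<^esub> (mtot \<phi> \<bullet>\<^bsub>X\<^esub> bs ?b) = Ta X (mtot \<phi>) \<bullet>\<^bsub>X\<^esub> (ts X (tot X ?b) \<bullet>\<^bsub>X\<^esub> m ?b)"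
      by (simp add: linear_eqs(2)[OF f, THEN Cmp_eq_extend] ms)
    also have "\<dots> = ts X (tot X ?c) \<bullet>\<^bsub>X\<^esub> (T2a X (mtot \<phi>) \<bullet>\<^bsub>X\<^esub> m ?b)"
      by (simp add: ts_nat[THEN Cmp_eq_extend])
    also have "\<dots> = bl ?c \<bullet>\<^bsub>X\<^esub> (bs ?c \<bullet>\<^bsub>X\<^esub> k)"
      by (simp add: mk[symmetric] ms[THEN Cmp_eq_extend])
    finally show "bl ?c \<bullet>\<^bsub>X\<^esub> (mtot \<phi> \<bullet>\<^bsub>X\<^esub> bs ?b) = bl ?c \<bullet>\<^bsub>X\<^esub> (bs ?c \<bullet>\<^bsub>X\<^esub> k)" .
  qed simp_all
qed

end

subsection \<open>The tangent category of display differential bundles\<close>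

lemma linmor_eqI:
  "\<lbrakk>msrc \<phi> = msrc \<psi>; mtgt \<phi> = mtgt \<psi>; mbase \<phi> = mbase \<psi>; mtot \<phi> = mtot \<psi>\<rbrakk> \<Longrightarrow> \<phi> = (\<psi> :: 'a linmor)"
  by (cases \<phi>; cases \<psi>) simp

locale db_on = tangent_on +
  assumes tangent_DB: "tangent_category (DB X)"

sublocale db_on \<subseteq> DB: tangent_on "DB X"
  using tangent_DB by unfold_locales

lemma DB_simps [simp]:
  "Ob (DB X) = {b. diff_bundle X b}" "Arr (DB X) = {\<phi>. linear_morphism X \<phi>}"
  "Dom (DB X) = msrc" "Cod (DB X) = mtgt" "To (DB X) = T_bundle X" "T2o (DB X) b = T2_bundle X b"
  by (simp_all add: DB_def T2o_def)

lemma DB_projections [simp]: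
  "msrc (g \<bullet>\<^bsub>DB X\<^esub> f) = msrc f" "mtgt (g \<bullet>\<^bsub>DB X\<^esub> f) = mtgt g"
  "mbase (g \<bullet>\<^bsub>DB X\<^esub> f) = mbase g \<bullet>\<^bsub>X\<^esub> mbase f" "mtot (g \<bullet>\<^bsub>DB X\<^esub> f) = mtot g \<bullet>\<^bsub>X\<^esub> mtot f"
  "msrc (Ident (DB X) b) = b" "mtgt (Ident (DB X) b) = b"
  "mbase (Ident (DB X) b) = Ident X (base X b)" "mtot (Ident (DB X) b) = Ident X (tot X b)"
  "msrc (Ta (DB X) f) = T_bundle X (msrc f)" "mtgt (Ta (DB X) f) = T_bundle X (mtgt f)"
  "mbase (Ta (DB X) f) = Ta X (mbase f)" "mtot (Ta (DB X) f) = Ta X (mtot f)"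
  "msrc (tp (DB X) b) = T_bundle X b" "mtgt (tp (DB X) b) = b"
  "mbase (tp (DB X) b) = tp X (base X b)" "mtot (tp (DB X) b) = tp X (tot X b)"
  "msrc (tpi1 (DB X) b) = T2_bundle X b" "mtgt (tpi1 (DB X) b) = T_bundle X b"
  "mbase (tpi1 (DB X) b) = tpi1 X (base X b)" "mtot (tpi1 (DB X) b) = tpi1 X (tot X b)"
  "msrc (tpi2 (DB X) b) = T2_bundle X b" "mtgt (tpi2 (DB X) b) = T_bundle X b"
  "mbase (tpi2 (DB X) b) = tpi2 X (base X b)" "mtot (tpi2 (DB X) b) = tpi2 X (tot X b)"
  "msrc (tz (DB X) b) = b" "mtgt (tz (DB X) b) = T_bundle X b"
  "mbase (tz (DB X) b) = tz X (base X b)" "mtot (tz (DB X) b) = tz X (tot X b)"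
  "msrc (ts (DB X) b) = T2_bundle X b" "mtgt (ts (DB X) b) = T_bundle X b"
  "mbase (ts (DB X) b) = ts X (base X b)" "mtot (ts (DB X) b) = ts X (tot X b)"
  "msrc (tl (DB X) b) = T_bundle X b" "mtgt (tl (DB X) b) = T_bundle X (T_bundle X b)"
  "mbase (tl (DB X) b) = tl X (base X b)" "mtot (tl (DB X) b) = tl X (tot X b)"
  "msrc (tc (DB X) b) = T_bundle X (T_bundle X b)" "mtgt (tc (DB X) b) = T_bundle X (T_bundle X b)"
  "mbase (tc (DB X) b) = tc X (base X b)" "mtot (tc (DB X) b) = tc X (tot X b)"
  by (simp_all add: DB_def)

lemma T_bundle_simps [simp]:
  "bq (T_bundle X b) = Ta X (bq b)" "bpi1 (T_bundle X b) = Ta X (bpi1 b)" "bpi2 (T_bundle X b) = Ta X (bpi2 b)"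
  "bz (T_bundle X b) = Ta X (bz b)" "bs (T_bundle X b) = Ta X (bs b)"
  "bl (T_bundle X b) = tc X (tot X b) \<bullet>\<^bsub>X\<^esub> Ta X (bl b)"
  by (simp_all add: T_bundle_def)

lemma T2_bundle_simps [simp]:
  "bq (T2_bundle X b) = T2a X (bq b)" "bpi1 (T2_bundle X b) = T2a X (bpi1 b)" "bpi2 (T2_bundle X b) = T2a X (bpi2 b)"
  "bz (T2_bundle X b) = T2a X (bz b)" "bs (T2_bundle X b) = T2a X (bs b)"
  by (simp_all add: T2_bundle_def)

context db_on
begin

lemma diff_bundle_T [simp]: "diff_bundle X b \<Longrightarrow> diff_bundle X (T_bundle X b)"
  using DB.To_Ob[of b] by simp

lemma diff_bundle_T2 [simp]: "diff_bundle X b \<Longrightarrow> diff_bundle X (T2_bundle X b)"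
  using DB.T2o_Ob[of b] by simp

end

sublocale db_on \<subseteq> DBX: tangent_pair "DB X" X by unfold_locales

context db_on
begin

lemma strict_Base: "strict_tangent_morphism (DB X) X (Base X)"
  by (rule DBX.strict_tangent_morphismI) (use DB.Ta_Arr DB.structure_Arr(1,4,7,10,13,16,19) DB.Cmp_Arr DB.Ident_Arr in \<open>simp_all add: Base_def\<close>)

lemma strict_Tot: "strict_tangent_morphism (DB X) X (Tot X)"
  by (rule DBX.strict_tangent_morphismI) (use DB.Ta_Arr DB.structure_Arr(1,4,7,10,13,16,19) DB.Cmp_Arr DB.Ident_Arr in \<open>simp_all add: Tot_def\<close>)

lemma lax_Base [simp]: "lax_tangent_morphism (DB X) X (Base X)"
  and lax_Tot [simp]: "lax_tangent_morphism (DB X) X (Tot X)"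
  using strict_Base strict_Tot unfolding strict_tangent_morphism_def by auto

lemma Base_Tot_simps [simp]:
  "diff_bundle X b \<Longrightarrow> fobj (Base X) b = base X b" "diff_bundle X b \<Longrightarrow> fobj (Tot X) b = tot X b"
  "linear_morphism X f \<Longrightarrow> farr (Base X) f = mbase f" "linear_morphism X f \<Longrightarrow> farr (Tot X) f = mtot f"
  "diff_bundle X b \<Longrightarrow> lstr (Base X) b = Ident X (To X (base X b))"
  "diff_bundle X b \<Longrightarrow> lstr (Tot X) b = Ident X (To X (tot X b))"
  by (simp_all add: Base_def Tot_def)

lemma Tot2_simps [simp]:
  "diff_bundle X b \<Longrightarrow> fobj (Tot2 X) b = Dom X (bpi1 b)"
  "diff_bundle X b \<Longrightarrow> lstr (Tot2 X) b = Ident X (To X (Dom X (bpi1 b)))"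
  by (simp_all add: Tot2_def)

lemma Tot2_arr:
  assumes f [simp]: "linear_morphism X f"
  shows "farr (Tot2 X) f \<in> Arr X" "Dom X (farr (Tot2 X) f) = Dom X (bpi1 (msrc f))"
    "Cod X (farr (Tot2 X) f) = Dom X (bpi1 (mtgt f))"
    "bpi1 (mtgt f) \<bullet>\<^bsub>X\<^esub> farr (Tot2 X) f = mtot f \<bullet>\<^bsub>X\<^esub> bpi1 (msrc f)"
    "bpi2 (mtgt f) \<bullet>\<^bsub>X\<^esub> farr (Tot2 X) f = mtot f \<bullet>\<^bsub>X\<^esub> bpi2 (msrc f)"
proof -
  have "bq (mtgt f) \<bullet>\<^bsub>X\<^esub> (mtot f \<bullet>\<^bsub>X\<^esub> bpi1 (msrc f)) = bq (mtgt f) \<bullet>\<^bsub>X\<^esub> (mtot f \<bullet>\<^bsub>X\<^esub> bpi2 (msrc f))"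
    using is_pullbackD(9)[OF bundle_pullback(1)[of "msrc f"]] by (simp add: linear_eqs(1)[OF f, THEN Cmp_eq_extend])
  note l = is_pullback_lift[OF bundle_pullback(1)[of "mtgt f"] _ _ _ _ _ this]
  show "farr (Tot2 X) f \<in> Arr X" "Dom X (farr (Tot2 X) f) = Dom X (bpi1 (msrc f))"
    "Cod X (farr (Tot2 X) f) = Dom X (bpi1 (mtgt f))"
    "bpi1 (mtgt f) \<bullet>\<^bsub>X\<^esub> farr (Tot2 X) f = mtot f \<bullet>\<^bsub>X\<^esub> bpi1 (msrc f)"
    "bpi2 (mtgt f) \<bullet>\<^bsub>X\<^esub> farr (Tot2 X) f = mtot f \<bullet>\<^bsub>X\<^esub> bpi2 (msrc f)"
    using l by (simp_all add: Tot2_def)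
qed

text \<open>The recorded pullbacks are preserved by \<open>T\<close> and \<open>T T\<close>, so their projections to \<open>Tot\<close> stay jointly
  monic.\<close>

lemma lax_Tot2 [simp]: "lax_tangent_morphism (DB X) X (Tot2 X)"
proof (rule DBX.lax_by_cone[where J = "{..<2::nat}" and F = "\<lambda>_. Tot X" and e = "\<lambda>j b. two_legs (bpi1 b) (bpi2 b) j"])
  fix b assume "b \<in> Ob (DB X)"
  then have b: "diff_bundle X b" by simp
  show "jointly_monic X {..<2::nat} (fobj (Tot2 X) b) (\<lambda>j. two_legs (bpi1 b) (bpi2 b) j)"
    by (rule DBX.jointly_monic_pair[OF bundle_pullback(1)[OF b]]) (use b in simp)
  show "jointly_monic X {..<2::nat} (To X (fobj (Tot2 X) b)) (\<lambda>j. Ta X (two_legs (bpi1 b) (bpi2 b) j))"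
    unfolding if_distrib by (rule DBX.jointly_monic_pair[OF bundle_pullback(2)[OF b]]) (use b in simp)
  show "jointly_monic X {..<2::nat} (To X (To X (fobj (Tot2 X) b))) (\<lambda>j. Ta X (Ta X (two_legs (bpi1 b) (bpi2 b) j)))"
    unfolding if_distrib by (rule DBX.jointly_monic_pair[OF bundle_pullback(3)[OF b]]) (use b in simp)
qed (auto simp: Tot2_arr, auto simp: Tot2_def)

lemma univ_bundle_simps [simp]:
  "bq (univ_bundle X) = \<lparr>nsrc = Tot X, ntgt = Base X, ncmp = (\<lambda>b\<in>Ob (DB X). bq b)\<rparr>"
  "bpi1 (univ_bundle X) = \<lparr>nsrc = Tot2 X, ntgt = Tot X, ncmp = (\<lambda>b\<in>Ob (DB X). bpi1 b)\<rparr>"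
  "bpi2 (univ_bundle X) = \<lparr>nsrc = Tot2 X, ntgt = Tot X, ncmp = (\<lambda>b\<in>Ob (DB X). bpi2 b)\<rparr>"
  "bz (univ_bundle X) = \<lparr>nsrc = Base X, ntgt = Tot X, ncmp = (\<lambda>b\<in>Ob (DB X). bz b)\<rparr>"
  "bs (univ_bundle X) = \<lparr>nsrc = Tot2 X, ntgt = Tot X, ncmp = (\<lambda>b\<in>Ob (DB X). bs b)\<rparr>"
  "bl (univ_bundle X) = \<lparr>nsrc = Tot X, ntgt = Tbar (DB X) X (Tot X), ncmp = (\<lambda>b\<in>Ob (DB X). bl b)\<rparr>"
  by (simp_all add: univ_bundle_def)

lemma univ_bundle_at: "diff_bundle X b \<Longrightarrow> bundle_at (univ_bundle X) b = b"
  by (cases b) (simp add: bundle_at_def)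

text \<open>For the projection and the lift, naturality is the definition of a linear morphism. For zero and
  sum it is the preservation of zeros and sums by linear morphisms.\<close>

lemma univ_bundle_typed: "DBX.bundle_typed (univ_bundle X)"
  unfolding DBX.bundle_typed_def
proof (intro conjI)
  show "tangent_nat_trans (DB X) X (bq (univ_bundle X))"
    by (rule DBX.tangent_nat_transI) (auto simp: linear_eqs)
  show "tangent_nat_trans (DB X) X (bpi1 (univ_bundle X))" "tangent_nat_trans (DB X) X (bpi2 (univ_bundle X))"
    by (rule DBX.tangent_nat_transI; auto simp: Tot2_arr)+
  show "tangent_nat_trans (DB X) X (bz (univ_bundle X))"
    by (rule DBX.tangent_nat_transI) (auto simp: linear_zero)
  show "tangent_nat_trans (DB X) X (bs (univ_bundle X))"
    by (rule DBX.tangent_nat_transI) (auto simp: linear_sum[OF _ Tot2_arr])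
  show "tangent_nat_trans (DB X) X (bl (univ_bundle X))"
    by (rule DBX.tangent_nat_transI) (auto simp: linear_eqs tc_tc)
qed simp_all

theorem univ_bundle_Ob: "univ_bundle X \<in> Ob (DBpt U (DB X) X)"
  unfolding DBX.DBpt_Ob_iff by (auto simp: univ_bundle_at univ_bundle_typed)

end

section \<open>Transport of tangent structure along an isomorphism\<close>

text \<open>Only \<open>C\<close> is assumed to be a tangent category; the bijections carry its axioms to \<open>D\<close>.\<close>

locale tcat_iso = C: tangent_on C for C :: "('o, 'a) tcat" +
  fixes D :: "('o2, 'a2) tcat" and fo :: "'o \<Rightarrow> 'o2" and fa :: "'a \<Rightarrow> 'a2"
  assumes bij_Ob: "bij_betw fo (Ob C) (Ob D)" and bij_Arr: "bij_betw fa (Arr C) (Arr D)"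
    and fa_Dom [simp]: "f \<in> Arr C \<Longrightarrow> Dom D (fa f) = fo (Dom C f)"
    and fa_Cod [simp]: "f \<in> Arr C \<Longrightarrow> Cod D (fa f) = fo (Cod C f)"
    and fa_Ident [simp]: "A \<in> Ob C \<Longrightarrow> Ident D (fo A) = fa (Ident C A)"
    and fa_Cmp [simp]: "\<lbrakk>f \<in> Arr C; g \<in> Arr C; Cod C f = Dom C g\<rbrakk> \<Longrightarrow> fa g \<bullet>\<^bsub>D\<^esub> fa f = fa (g \<bullet>\<^bsub>C\<^esub> f)"
    and fo_To [simp]: "A \<in> Ob C \<Longrightarrow> To D (fo A) = fo (To C A)"
    and fa_Ta [simp]: "f \<in> Arr C \<Longrightarrow> Ta D (fa f) = fa (Ta C f)"
    and fa_structure [simp]: "A \<in> Ob C \<Longrightarrow> tp D (fo A) = fa (tp C A)"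
      "A \<in> Ob C \<Longrightarrow> tpi1 D (fo A) = fa (tpi1 C A)" "A \<in> Ob C \<Longrightarrow> tpi2 D (fo A) = fa (tpi2 C A)"
      "A \<in> Ob C \<Longrightarrow> tz D (fo A) = fa (tz C A)" "A \<in> Ob C \<Longrightarrow> ts D (fo A) = fa (ts C A)"
      "A \<in> Ob C \<Longrightarrow> tl D (fo A) = fa (tl C A)" "A \<in> Ob C \<Longrightarrow> tc D (fo A) = fa (tc C A)"
begin

lemma Ob_D: "Ob D = fo ` Ob C" and Arr_D: "Arr D = fa ` Arr C"
  using bij_Ob bij_Arr by (simp_all add: bij_betw_def)

lemma fo_Ob [simp]: "A \<in> Ob C \<Longrightarrow> fo A \<in> Ob D" and fa_Arr [simp]: "f \<in> Arr C \<Longrightarrow> fa f \<in> Arr D"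
  by (simp_all add: Ob_D Arr_D)

lemma fo_inj [simp]: "\<lbrakk>A \<in> Ob C; B \<in> Ob C\<rbrakk> \<Longrightarrow> fo A = fo B \<longleftrightarrow> A = B"
  and fa_inj [simp]: "\<lbrakk>f \<in> Arr C; g \<in> Arr C\<rbrakk> \<Longrightarrow> fa f = fa g \<longleftrightarrow> f = g"
  using bij_Ob bij_Arr by (auto simp: bij_betw_def inj_on_def)

lemma Ob_DE: "\<lbrakk>A' \<in> Ob D; \<And>A. \<lbrakk>A \<in> Ob C; A' = fo A\<rbrakk> \<Longrightarrow> thesis\<rbrakk> \<Longrightarrow> thesis"
  and Arr_DE: "\<lbrakk>f' \<in> Arr D; \<And>f. \<lbrakk>f \<in> Arr C; f' = fa f\<rbrakk> \<Longrightarrow> thesis\<rbrakk> \<Longrightarrow> thesis"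
  unfolding Ob_D Arr_D by blast+

lemma category_D: "category D"
  unfolding category_def by (auto elim!: Ob_DE Arr_DE)

end

sublocale tcat_iso \<subseteq> D: category_on D
  using category_D by unfold_locales

context tcat_iso
begin

definition ga :: "'a2 \<Rightarrow> 'a" where "ga = the_inv_into (Arr C) fa"
definition go :: "'o2 \<Rightarrow> 'o" where "go = the_inv_into (Ob C) fo"

lemma ga [simp]: "f' \<in> Arr D \<Longrightarrow> ga f' \<in> Arr C" "f' \<in> Arr D \<Longrightarrow> fa (ga f') = f'" "f \<in> Arr C \<Longrightarrow> ga (fa f) = f"
  unfolding ga_def using bij_Arr by (auto simp: bij_betw_def the_inv_into_into f_the_inv_into_f the_inv_into_f_f)

lemma go [simp]: "A' \<in> Ob D \<Longrightarrow> go A' \<in> Ob C" "A' \<in> Ob D \<Longrightarrow> fo (go A') = A'" "A \<in> Ob C \<Longrightarrow> go (fo A) = A"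
  unfolding go_def using bij_Ob by (auto simp: bij_betw_def the_inv_into_into f_the_inv_into_f the_inv_into_f_f)

lemma wide_pullback_D:
  assumes w: "wide_pullback C J f L e" and L: "L \<in> Ob C"
    and f': "\<And>j. j \<in> J \<Longrightarrow> f' j = fa (f j)" and e': "\<And>j. j \<in> J \<Longrightarrow> e' j = fa (e j)"
  shows "wide_pullback D J f' (fo L) e'"
proof (rule wide_pullbackI)
  note d = wide_pullbackD[OF w]
  show "f' j \<in> Arr D" if "j \<in> J" for j using d[OF that] f'[OF that] by simp
  show "e' j \<in> Arr D \<and> Dom D (e' j) = fo L \<and> Cod D (e' j) = Dom D (f' j)" if "j \<in> J" for j
    using d[OF that] f'[OF that] e'[OF that] by simp
  show "Cod D (f' j) = Cod D (f' k) \<and> f' j \<bullet>\<^bsub>D\<^esub> e' j = f' k \<bullet>\<^bsub>D\<^esub> e' k" if "j \<in> J" "k \<in> J" for j k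
    using d[OF that(1)] d[OF that(2)] wide_pullback_cone[OF w that] that by (simp add: f' e')
  show "jointly_monic D J (fo L) e'"
    unfolding jointly_monic_def
  proof (intro ballI impI)
    fix x y assume xy: "x \<in> Arr D" "y \<in> Arr D" "Dom D x = Dom D y" "Cod D x = fo L" "Cod D y = fo L"
      and eq: "\<forall>j\<in>J. e' j \<bullet>\<^bsub>D\<^esub> x = e' j \<bullet>\<^bsub>D\<^esub> y"
    have t: "Dom C (ga x) = Dom C (ga y)" "Cod C (ga x) = L" "Cod C (ga y) = L"
      using xy fa_Dom[of "ga x"] fa_Dom[of "ga y"] fa_Cod[of "ga x"] fa_Cod[of "ga y"] L by simp_all
    have "ga x = ga y"
    proof (rule jointly_monicD[OF C.jointly_monic_wide[OF w]])
      fix j assume j: "j \<in> J"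
      have "fa (e j) \<bullet>\<^bsub>D\<^esub> fa (ga x) = fa (e j) \<bullet>\<^bsub>D\<^esub> fa (ga y)" using eq j e' xy by simp
      then show "e j \<bullet>\<^bsub>C\<^esub> ga x = e j \<bullet>\<^bsub>C\<^esub> ga y" using d[OF j] xy t by (simp del: ga(2))
    qed (use xy t in simp_all)
    then have "fa (ga x) = fa (ga y)" by simp
    then show "x = y" using xy by simp
  qed
  fix W' u' assume W': "W' \<in> Ob D" and u': "\<And>j. j \<in> J \<Longrightarrow> u' j \<in> Arr D \<and> Dom D (u' j) = W' \<and> Cod D (u' j) = Dom D (f' j)"
    and c': "\<And>j k. j \<in> J \<Longrightarrow> k \<in> J \<Longrightarrow> f' j \<bullet>\<^bsub>D\<^esub> u' j = f' k \<bullet>\<^bsub>D\<^esub> u' k"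
  have u: "ga (u' j) \<in> Arr C \<and> Dom C (ga (u' j)) = go W' \<and> Cod C (ga (u' j)) = Dom C (f j)" if j: "j \<in> J" for j
    using u'[OF j] fa_Dom[of "ga (u' j)"] fa_Cod[of "ga (u' j)"] d[OF j] f'[OF j] by (metis C.Cod_Ob C.Dom_Ob fa_Dom ga(1,2) go(3) fo_inj)
  have c: "f j \<bullet>\<^bsub>C\<^esub> ga (u' j) = f k \<bullet>\<^bsub>C\<^esub> ga (u' k)" if jk: "j \<in> J" "k \<in> J" for j k
  proof -
    have "fa (f j) \<bullet>\<^bsub>D\<^esub> fa (ga (u' j)) = fa (f k) \<bullet>\<^bsub>D\<^esub> fa (ga (u' k))"
      using c'[OF jk] u'[OF jk(1)] u'[OF jk(2)] f' jk by simp
    then show ?thesis using u[OF jk(1)] u[OF jk(2)] d[OF jk(1)] d[OF jk(2)] by (simp del: ga(2))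
  qed
  have gW: "go W' \<in> Ob C" using W' by simp
  obtain h where h: "h \<in> Arr C" "Dom C h = go W'" "Cod C h = L" "\<forall>j\<in>J. e j \<bullet>\<^bsub>C\<^esub> h = ga (u' j)"
    using wide_pullback_lift[OF w gW u c] by blast
  have "fa h \<in> hom D W' (fo L)" using h W' by simp
  moreover have "e' j \<bullet>\<^bsub>D\<^esub> fa h = u' j" if j: "j \<in> J" for j
    using h d[OF j] e'[OF j] j u'[OF j] by simp
  ultimately show "\<exists>h. h \<in> hom D W' (fo L) \<and> (\<forall>j\<in>J. e' j \<bullet>\<^bsub>D\<^esub> h = u' j)" by blast
qed

lemma wide_pullback_C:
  assumes w: "wide_pullback D J f' (fo L) e'" and L: "L \<in> Ob C"
    and f: "\<And>j. j \<in> J \<Longrightarrow> f j \<in> Arr C" "\<And>j. j \<in> J \<Longrightarrow> f' j = fa (f j)"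
    and e: "\<And>j. j \<in> J \<Longrightarrow> e j \<in> Arr C" "\<And>j. j \<in> J \<Longrightarrow> e' j = fa (e j)"
  shows "wide_pullback C J f L e"
proof (rule wide_pullbackI)
  note d = wide_pullbackD[OF w]
  show fj: "f j \<in> Arr C" if "j \<in> J" for j using f that by simp
  show ej: "e j \<in> Arr C \<and> Dom C (e j) = L \<and> Cod C (e j) = Dom C (f j)" if "j \<in> J" for j
    using d(3,4)[OF that] f[OF that] e[OF that] L by simp
  show "Cod C (f j) = Cod C (f k) \<and> f j \<bullet>\<^bsub>C\<^esub> e j = f k \<bullet>\<^bsub>C\<^esub> e k" if "j \<in> J" "k \<in> J" for j k
    using wide_pullback_cone[OF w that] f[OF that(1)] f[OF that(2)] ej[OF that(1)] ej[OF that(2)] e(2)[OF that(1)] e(2)[OF that(2)]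
    by simp
  show "jointly_monic C J L e"
    unfolding jointly_monic_def
  proof (intro ballI impI)
    fix x y assume xy: "x \<in> Arr C" "y \<in> Arr C" "Dom C x = Dom C y" "Cod C x = L" "Cod C y = L"
      and eq: "\<forall>j\<in>J. e j \<bullet>\<^bsub>C\<^esub> x = e j \<bullet>\<^bsub>C\<^esub> y"
    have "fa x = fa y"
      by (rule jointly_monicD[OF D.jointly_monic_wide[OF w]]) (use xy eq ej e(2) in simp_all)
    then show "x = y" using xy by simp
  qed
  fix W u assume W: "W \<in> Ob C" and u: "\<And>j. j \<in> J \<Longrightarrow> u j \<in> Arr C \<and> Dom C (u j) = W \<and> Cod C (u j) = Dom C (f j)"
    and c: "\<And>j k. j \<in> J \<Longrightarrow> k \<in> J \<Longrightarrow> f j \<bullet>\<^bsub>C\<^esub> u j = f k \<bullet>\<^bsub>C\<^esub> u k"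
  have "\<exists>h. h \<in> Arr D \<and> Dom D h = fo W \<and> Cod D h = fo L \<and> (\<forall>j\<in>J. e' j \<bullet>\<^bsub>D\<^esub> h = fa (u j))"
  proof (rule wide_pullback_lift[OF w])
    show "f' j \<bullet>\<^bsub>D\<^esub> fa (u j) = f' k \<bullet>\<^bsub>D\<^esub> fa (u k)" if "j \<in> J" "k \<in> J" for j k
      using c[OF that] u[OF that(1)] u[OF that(2)] f[OF that(1)] f[OF that(2)] by simp
  qed (use W u f in simp_all)
  then obtain h where h: "h \<in> Arr D" "Dom D h = fo W" "Cod D h = fo L" "\<forall>j\<in>J. e' j \<bullet>\<^bsub>D\<^esub> h = fa (u j)" by blast
  have t: "ga h \<in> Arr C" "Dom C (ga h) = W" "Cod C (ga h) = L"
    using h fa_Dom[of "ga h"] fa_Cod[of "ga h"] L W by simp_all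
  have "e j \<bullet>\<^bsub>C\<^esub> ga h = u j" if j: "j \<in> J" for j
  proof -
    have "fa (e j) \<bullet>\<^bsub>D\<^esub> fa (ga h) = fa (u j)" using h j e by simp
    then show ?thesis using ej[OF j] t u[OF j] by (simp del: ga(2))
  qed
  then show "\<exists>h. h \<in> hom C W L \<and> (\<forall>j\<in>J. e j \<bullet>\<^bsub>C\<^esub> h = u j)" using t by auto
qed

lemma is_pullback_D:
  assumes "is_pullback C f g a b"
  shows "is_pullback D (fa f) (fa g) (fa a) (fa b)"
proof -
  note d = C.is_pullbackD[OF assms]
  have "wide_pullback D {..<2::nat} (two_legs (fa f) (fa g)) (fo (Dom C a)) (two_legs (fa a) (fa b))"
    by (rule wide_pullback_D[OF assms[unfolded C.is_pullback_iff_wide]]) (use d in simp_all)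
  then show ?thesis unfolding D.is_pullback_iff_wide using d by simp
qed

lemma pair_into_D:
  assumes "is_pullback C f g a b" "u \<in> Arr C" "v \<in> Arr C" "Dom C u = Dom C v"
    "Cod C u = Dom C f" "Cod C v = Dom C g" "f \<bullet>\<^bsub>C\<^esub> u = g \<bullet>\<^bsub>C\<^esub> v"
  shows "pair_into D (fa a) (fa b) (fa u) (fa v) = fa (pair_into C a b u v)"
  by (rule D.pair_into_eqI[OF is_pullback_D[OF assms(1)]])
    (use C.is_pullback_lift[OF assms] C.is_pullbackD(4-8)[OF assms(1)] in simp_all)

lemma additive_bundle_D:
  assumes ad: "additive_bundle C q a b z s"
  shows "additive_bundle D (fa q) (fa a) (fa b) (fa z) (fa s)"
proof -
  note A = additive_bundleD[OF ad]
  note d = C.is_pullbackD[OF A(1)]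
  note l = C.is_pullback_lift[OF A(1)] and pD = pair_into_D[OF A(1)]
  note [simp] = d(1,4-8) A(2,3,4,6,7,8)
  have w1: "q \<bullet>\<^bsub>C\<^esub> b = q \<bullet>\<^bsub>C\<^esub> a" using d(9) by simp
  have w2: "q \<bullet>\<^bsub>C\<^esub> Ident C (Dom C q) = q \<bullet>\<^bsub>C\<^esub> (z \<bullet>\<^bsub>C\<^esub> q)" by (simp add: A(5)[THEN C.Cmp_eq_extend])
  show ?thesis
    unfolding additive_bundle_def
  proof (intro conjI ballI impI)
    show "is_pullback D (fa q) (fa q) (fa a) (fa b)" by (rule is_pullback_D[OF A(1)])
    show "fa s \<bullet>\<^bsub>D\<^esub> pair_into D (fa a) (fa b) (fa b) (fa a) = fa s"
      using pD[of b a, OF _ _ _ _ _ w1] l[of b a, OF _ _ _ _ _ w1] A(10) by simp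
    show "fa s \<bullet>\<^bsub>D\<^esub> pair_into D (fa a) (fa b) (Ident D (Dom D (fa q))) (fa z \<bullet>\<^bsub>D\<^esub> fa q) = Ident D (Dom D (fa q))"
      using pD[of "Ident C (Dom C q)" "z \<bullet>\<^bsub>C\<^esub> q", OF _ _ _ _ _ w2] l[of "Ident C (Dom C q)" "z \<bullet>\<^bsub>C\<^esub> q", OF _ _ _ _ _ w2] A(11) by simp
    fix W' u' v' w' assume "W' \<in> Ob D" "u' \<in> hom D W' (Dom D (fa q))" "v' \<in> hom D W' (Dom D (fa q))"
      "w' \<in> hom D W' (Dom D (fa q))" and eq: "fa q \<bullet>\<^bsub>D\<^esub> u' = fa q \<bullet>\<^bsub>D\<^esub> v' \<and> fa q \<bullet>\<^bsub>D\<^esub> v' = fa q \<bullet>\<^bsub>D\<^esub> w'"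
    then have m: "u' \<in> Arr D" "v' \<in> Arr D" "w' \<in> Arr D"
      and m': "Dom D u' = W'" "Dom D v' = W'" "Dom D w' = W'"
        "Cod D u' = fo (Dom C q)" "Cod D v' = fo (Dom C q)" "Cod D w' = fo (Dom C q)" by simp_all
    obtain u v w where uvw [simp]: "u \<in> Arr C" "v \<in> Arr C" "w \<in> Arr C" "u' = fa u" "v' = fa v" "w' = fa w"
      using m by (elim Arr_DE) blast
    have t: "fo (Dom C u) = W'" "fo (Dom C v) = W'" "fo (Dom C w) = W'"
        "fo (Cod C u) = fo (Dom C q)" "fo (Cod C v) = fo (Dom C q)" "fo (Cod C w) = fo (Dom C q)"
      using m' by simp_all
    have t' [simp]: "Dom C v = Dom C u" "Dom C w = Dom C u" "Cod C u = Dom C q" "Cod C v = Dom C q" "Cod C w = Dom C q"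
    proof -
      have "fo (Dom C v) = fo (Dom C u)" "fo (Dom C w) = fo (Dom C u)" using t by simp_all
      then show "Dom C v = Dom C u" "Dom C w = Dom C u" by simp_all
      show "Cod C u = Dom C q" "Cod C v = Dom C q" "Cod C w = Dom C q" using t(4-6) by simp_all
    qed
    have e: "q \<bullet>\<^bsub>C\<^esub> u = q \<bullet>\<^bsub>C\<^esub> v" "q \<bullet>\<^bsub>C\<^esub> v = q \<bullet>\<^bsub>C\<^esub> w" using eq by simp_all
    note l1 = l[OF uvw(1,2) _ _ _ e(1), simplified] and l2 = l[OF uvw(2,3) _ _ _ e(2), simplified]
    note p1 = pD[OF uvw(1,2) _ _ _ e(1), simplified] and p2 = pD[OF uvw(2,3) _ _ _ e(2), simplified]
    let ?uv = "pair_into C a b u v" and ?vw = "pair_into C a b v w"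
    have e3: "q \<bullet>\<^bsub>C\<^esub> (s \<bullet>\<^bsub>C\<^esub> ?uv) = q \<bullet>\<^bsub>C\<^esub> w" using l1 e by (simp add: A(9)[THEN C.Cmp_eq_extend])
    have e4: "q \<bullet>\<^bsub>C\<^esub> u = q \<bullet>\<^bsub>C\<^esub> (s \<bullet>\<^bsub>C\<^esub> ?vw)" using l2 e by (simp add: A(9)[THEN C.Cmp_eq_extend])
    have "s \<bullet>\<^bsub>C\<^esub> pair_into C a b (s \<bullet>\<^bsub>C\<^esub> ?uv) w = s \<bullet>\<^bsub>C\<^esub> pair_into C a b u (s \<bullet>\<^bsub>C\<^esub> ?vw)"
      by (rule additive_bundle_assoc[OF ad, of "Dom C u"]) (use e in simp_all)
    then show "fa s \<bullet>\<^bsub>D\<^esub> pair_into D (fa a) (fa b) (fa s \<bullet>\<^bsub>D\<^esub> pair_into D (fa a) (fa b) u' v') w' =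
        fa s \<bullet>\<^bsub>D\<^esub> pair_into D (fa a) (fa b) u' (fa s \<bullet>\<^bsub>D\<^esub> pair_into D (fa a) (fa b) v' w')"
      using l[of "s \<bullet>\<^bsub>C\<^esub> ?uv" w, OF _ _ _ _ _ e3] l[of u "s \<bullet>\<^bsub>C\<^esub> ?vw", OF _ _ _ _ _ e4]
        pD[of "s \<bullet>\<^bsub>C\<^esub> ?uv" w, OF _ _ _ _ _ e3] pD[of u "s \<bullet>\<^bsub>C\<^esub> ?vw", OF _ _ _ _ _ e4] l1 l2 p1 p2 by simp
  qed (use A(5,9) in simp_all)
qed

lemma Ta_pow_D [simp]: "f \<in> Arr C \<Longrightarrow> (Ta D ^^ m) (fa f) = fa ((Ta C ^^ m) f)"
  by (induction m) simp_all

lemma is_fold_pullback_D: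
  assumes q: "q \<in> Arr C" and f: "is_fold_pullback C n q b pr" and pr': "\<And>i. i < n \<Longrightarrow> pr' i = fa (pr i)"
  shows "is_fold_pullback D n (fa q) (fa b) pr'"
proof -
  have b: "b \<in> Arr C" using f unfolding is_fold_pullback_def by blast
  have w: "wide_pullback C {..n} (fold_legs n (Ident C (Cod C q)) (\<lambda>_. q)) (Dom C b) (fold_legs n b pr)"
    using f C.is_fold_pullback_iff_wide[OF q] by blast
  have "wide_pullback D {..n} (fold_legs n (Ident D (Cod D (fa q))) (\<lambda>_. fa q)) (fo (Dom C b)) (fold_legs n (fa b) pr')"
    by (rule wide_pullback_D[OF w]) (use b q pr' in auto)
  then show ?thesis using D.is_fold_pullback_iff_wide[of "fa q"] q b by simp
qed

lemma is_fold_pullback_C: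
  assumes q: "q \<in> Arr C" and f: "is_fold_pullback D n (fa q) b' pr'"
  shows "is_fold_pullback C n q (ga b') (\<lambda>i. ga (pr' i))" "b' \<in> Arr D" "i < n \<Longrightarrow> pr' i \<in> Arr D"
proof -
  show b: "b' \<in> Arr D" and p: "i < n \<Longrightarrow> pr' i \<in> Arr D" for i using f unfolding is_fold_pullback_def by auto
  have D: "Dom D b' = fo (Dom C (ga b'))" using b fa_Dom[of "ga b'"] by simp
  have w: "wide_pullback D {..n} (fold_legs n (Ident D (Cod D (fa q))) (\<lambda>_. fa q)) (fo (Dom C (ga b'))) (fold_legs n b' pr')"
    using f D.is_fold_pullback_iff_wide[of "fa q"] q unfolding D[symmetric] by simp
  have "wide_pullback C {..n} (fold_legs n (Ident C (Cod C q)) (\<lambda>_. q)) (Dom C (ga b')) (fold_legs n (ga b') (\<lambda>i. ga (pr' i)))"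
    by (rule wide_pullback_C[OF w]) (use b p q in auto)
  then show "is_fold_pullback C n q (ga b') (\<lambda>i. ga (pr' i))" using C.is_fold_pullback_iff_wide[OF q] by blast
qed

theorem tangent_category_D: "tangent_category D"
  unfolding tangent_category_def
proof (intro conjI ballI allI impI)
  have T2o [simp]: "T2o D (fo A) = fo (T2o C A)" if "A \<in> Ob C" for A
    using that by (simp add: T2o_def[of D])
  have T2a [simp]: "T2a D (fa f) = fa (T2a C f)" if "f \<in> Arr C" for f
    using pair_into_D[OF C.tpi_pullback[of "Cod C f"] _ _ _ _ _ C.T2a_wf[OF that]] that
    unfolding T2a_def by simp
  show "category D" by (rule category_D)
  show "functorial D D (To D) (Ta D)"
    unfolding functorial_def by (auto elim!: Ob_DE Arr_DE)
  show "natural D D (To D) (Ta D) (\<lambda>A. A) (\<lambda>f. f) (tp D)"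
    "natural D D (\<lambda>A. A) (\<lambda>f. f) (To D) (Ta D) (tz D)"
    "natural D D (T2o D) (T2a D) (To D) (Ta D) (ts D)"
    "natural D D (To D) (Ta D) (\<lambda>A. To D (To D A)) (\<lambda>f. Ta D (Ta D f)) (tl D)"
    "natural D D (\<lambda>A. To D (To D A)) (\<lambda>f. Ta D (Ta D f)) (\<lambda>A. To D (To D A)) (\<lambda>f. Ta D (Ta D f)) (tc D)"
    unfolding natural_def
    by (auto simp: C.tp_nat C.tz_nat C.ts_nat C.tl_nat C.tc_nat elim!: Ob_DE Arr_DE)
next
  fix A' assume "A' \<in> Ob D"
  then obtain A where A [simp]: "A \<in> Ob C" and A': "A' = fo A" unfolding Ob_D by auto
  note [simp] = A'
  show "is_pullback D (tp D A') (tp D A') (tpi1 D A') (tpi2 D A')"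
    using is_pullback_D[OF C.tpi_pullback[OF A]] by simp
  show "\<exists>b pr. is_fold_pullback D n (tp D A') b pr" for n
  proof -
    obtain b pr where "is_fold_pullback C n (tp C A) b pr" using C.tangent_unfolded(4)[OF A] by blast
    from is_fold_pullback_D[OF _ this, of "\<lambda>i. fa (pr i)"] show ?thesis by auto
  qed
  fix n b pr m assume f: "is_fold_pullback D n (tp D A') b pr"
  have f': "is_fold_pullback C n (tp C A) (ga b) (\<lambda>i. ga (pr i))" "b \<in> Arr D" "\<And>i. i < n \<Longrightarrow> pr i \<in> Arr D"
    using is_fold_pullback_C[of "tp C A" n b pr] f by simp_all
  have "is_fold_pullback D n (fa ((Ta C ^^ m) (tp C A))) (fa ((Ta C ^^ m) (ga b))) (\<lambda>i. (Ta D ^^ m) (pr i))"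
  proof (rule is_fold_pullback_D[OF _ C.tangent_unfolded(5)[OF A f'(1)]])
    fix i assume "i < n"
    then show "(Ta D ^^ m) (pr i) = fa ((Ta C ^^ m) (ga (pr i)))"
      using Ta_pow_D[of "ga (pr i)" m] f'(3) by simp
  qed simp
  then show "is_fold_pullback D n ((Ta D ^^ m) (tp D A')) ((Ta D ^^ m) b) (\<lambda>i. (Ta D ^^ m) (pr i))"
    using Ta_pow_D[of "ga b" m] f'(2) by simp
next
  fix A' assume "A' \<in> Ob D"
  then obtain A where A [simp]: "A \<in> Ob C" and A': "A' = fo A" unfolding Ob_D by auto
  note [simp] = A'
  note eqs = C.tangent_equations[OF A]
  show "additive_bundle D (tp D A') (tpi1 D A') (tpi2 D A') (tz D A') (ts D A')"
    using additive_bundle_D[OF eqs(1)] by simp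
  show "Ta D (tp D A') \<bullet>\<^bsub>D\<^esub> tl D A' = tz D A' \<bullet>\<^bsub>D\<^esub> tp D A'" using eqs by simp
  show "tl D A' \<bullet>\<^bsub>D\<^esub> tz D A' = Ta D (tz D A') \<bullet>\<^bsub>D\<^esub> tz D A'" using eqs by simp
  show "tp D (To D A') \<bullet>\<^bsub>D\<^esub> tc D A' = Ta D (tp D A')" using eqs by simp
  show "tc D A' \<bullet>\<^bsub>D\<^esub> Ta D (tz D A') = tz D (To D A')" using eqs by simp
  show "Ta D (tl D A') \<bullet>\<^bsub>D\<^esub> tl D A' = tl D (To D A') \<bullet>\<^bsub>D\<^esub> tl D A'" using eqs(8) by simp
  show "tc D A' \<bullet>\<^bsub>D\<^esub> tl D A' = tl D A'" using eqs(9) by simp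
  show "tc D (To D A') \<bullet>\<^bsub>D\<^esub> (Ta D (tc D A') \<bullet>\<^bsub>D\<^esub> tl D (To D A')) = Ta D (tl D A') \<bullet>\<^bsub>D\<^esub> tc D A'" using eqs(10) by simp
  show "tc D A' \<bullet>\<^bsub>D\<^esub> tc D A' = Ident D (To D (To D A'))" using eqs(11) by simp
  show "Ta D (tc D A') \<bullet>\<^bsub>D\<^esub> (tc D (To D A') \<bullet>\<^bsub>D\<^esub> Ta D (tc D A')) =
          tc D (To D A') \<bullet>\<^bsub>D\<^esub> (Ta D (tc D A') \<bullet>\<^bsub>D\<^esub> tc D (To D A'))" using eqs(12) by simp
  have w1: "Ta C (tp C A) \<bullet>\<^bsub>C\<^esub> (tl C A \<bullet>\<^bsub>C\<^esub> tpi1 C A) = Ta C (tp C A) \<bullet>\<^bsub>C\<^esub> (tl C A \<bullet>\<^bsub>C\<^esub> tpi2 C A)"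
    by (simp add: C.tangent_equations(2)[THEN C.Cmp_eq_extend] C.tp_tpi)
  note l1 = C.is_pullback_lift[OF C.tpi_pullback_Ta(1)[OF A] _ _ _ _ _ w1, simplified]
    and p1 = pair_into_D[OF C.tpi_pullback_Ta(1)[OF A] _ _ _ _ _ w1, simplified]
  show "tl D A' \<bullet>\<^bsub>D\<^esub> ts D A' =
          Ta D (ts D A') \<bullet>\<^bsub>D\<^esub> pair_into D (Ta D (tpi1 D A')) (Ta D (tpi2 D A'))
                                (tl D A' \<bullet>\<^bsub>D\<^esub> tpi1 D A') (tl D A' \<bullet>\<^bsub>D\<^esub> tpi2 D A')"
    using eqs(4) l1 p1 by simp
  have w2: "tp C (To C A) \<bullet>\<^bsub>C\<^esub> (tc C A \<bullet>\<^bsub>C\<^esub> Ta C (tpi1 C A)) = tp C (To C A) \<bullet>\<^bsub>C\<^esub> (tc C A \<bullet>\<^bsub>C\<^esub> Ta C (tpi2 C A))"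
    using C.is_pullbackD(9)[OF C.tpi_pullback_Ta(1)[OF A]]
    by (simp add: C.tangent_equations(5)[THEN C.Cmp_eq_extend])
  note l2 = C.is_pullback_lift[OF C.tpi_pullback[OF C.To_Ob[OF A]] _ _ _ _ _ w2, simplified]
    and p2 = pair_into_D[OF C.tpi_pullback[OF C.To_Ob[OF A]] _ _ _ _ _ w2, simplified]
  show "tc D A' \<bullet>\<^bsub>D\<^esub> Ta D (ts D A') =
          ts D (To D A') \<bullet>\<^bsub>D\<^esub> pair_into D (tpi1 D (To D A')) (tpi2 D (To D A'))
                                (tc D A' \<bullet>\<^bsub>D\<^esub> Ta D (tpi1 D A')) (tc D A' \<bullet>\<^bsub>D\<^esub> Ta D (tpi2 D A'))"
    using eqs(7) l2 p2 by simp
  have "Ta C (tp C A) \<bullet>\<^bsub>C\<^esub> (Ta C (tpi1 C A) \<bullet>\<^bsub>C\<^esub> C.lift_pair A) = Ta C (tp C A) \<bullet>\<^bsub>C\<^esub> (Ta C (tpi2 C A) \<bullet>\<^bsub>C\<^esub> C.lift_pair A)"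
    using C.lift_pair(1-3)[OF A] by (simp add: C.is_pullbackD(9)[OF C.tpi_pullback_Ta(1), THEN C.Cmp_eq_extend])
  then have w3: "Ta C (tp C A) \<bullet>\<^bsub>C\<^esub> (tz C (To C A) \<bullet>\<^bsub>C\<^esub> tpi1 C A) = Ta C (tp C A) \<bullet>\<^bsub>C\<^esub> (tl C A \<bullet>\<^bsub>C\<^esub> tpi2 C A)"
    by (simp add: C.lift_pair(4,5))
  note p3 = pair_into_D[OF C.tpi_pullback_Ta(1)[OF A] _ _ _ _ _ w3, simplified, folded C.lift_pair_def]
  show "is_pullback D (tz D A') (Ta D (tp D A')) (tp D A' \<bullet>\<^bsub>D\<^esub> tpi1 D A')
          (Ta D (ts D A') \<bullet>\<^bsub>D\<^esub> pair_into D (Ta D (tpi1 D A')) (Ta D (tpi2 D A'))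
             (tz D (To D A') \<bullet>\<^bsub>D\<^esub> tpi1 D A') (tl D A' \<bullet>\<^bsub>D\<^esub> tpi2 D A'))"
    using is_pullback_D[OF eqs(13)[folded C.lift_pair_def]] p3 C.lift_pair(1-3)[OF A] by simp
qed

end

sublocale tcat_iso \<subseteq> D: tangent_on D
  using tangent_category_D by unfold_locales

sublocale tcat_iso \<subseteq> CD: tangent_pair C D by unfold_locales
sublocale tcat_iso \<subseteq> DC: tangent_pair D C by unfold_locales

context tcat_iso
begin

definition iso_lmor :: "('o, 'a, 'o2, 'a2) lmor" where
  "iso_lmor = \<lparr>fobj = restrict fo (Ob C), farr = restrict fa (Arr C), lstr = \<lambda>A\<in>Ob C. Ident D (fo (To C A))\<rparr>"

definition inv_lmor :: "('o2, 'a2, 'o, 'a) lmor" where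
  "inv_lmor = \<lparr>fobj = restrict go (Ob D), farr = restrict ga (Arr D), lstr = \<lambda>A\<in>Ob D. Ident C (go (To D A))\<rparr>"

lemma strict_iso_lmor: "strict_tangent_morphism C D iso_lmor"
  by (rule CD.strict_tangent_morphismI) (simp_all add: iso_lmor_def)

lemma strict_inv_lmor: "strict_tangent_morphism D C inv_lmor"
  by (rule DC.strict_tangent_morphismI) (auto simp: inv_lmor_def elim!: Ob_DE Arr_DE)

lemma inv_iso: "tng_comp C C inv_lmor iso_lmor = tng_ident C"
  by (auto simp: tng_comp_def tng_ident_def iso_lmor_def inv_lmor_def fun_eq_iff restrict_def)

lemma iso_inv: "tng_comp D D iso_lmor inv_lmor = tng_ident D"
  by (auto simp: tng_comp_def tng_ident_def iso_lmor_def inv_lmor_def fun_eq_iff restrict_def elim!: Ob_DE Arr_DE)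

lemma tng_invertible_iso: "tng_invertible C D iso_lmor"
  unfolding tng_invertible_def
  using strict_iso_lmor strict_inv_lmor inv_iso iso_inv unfolding strict_tangent_morphism_def by blast

end

section \<open>Pointwise display differential bundles in components\<close>

definition linmor_at :: "('f, 'o, 'a) nt linmor \<Rightarrow> 'o \<Rightarrow> 'a linmor" where
  "linmor_at \<phi> A = \<lparr>msrc = bundle_at (msrc \<phi>) A, mtgt = bundle_at (mtgt \<phi>) A,
     mbase = ncmp (mbase \<phi>) A, mtot = ncmp (mtot \<phi>) A\<rparr>"

lemma linmor_at_simps [simp]:
  "msrc (linmor_at \<phi> A) = bundle_at (msrc \<phi>) A" "mtgt (linmor_at \<phi> A) = bundle_at (mtgt \<phi>) A"
  "mbase (linmor_at \<phi> A) = ncmp (mbase \<phi>) A" "mtot (linmor_at \<phi> A) = ncmp (mtot \<phi>) A"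
  by (simp_all add: linmor_at_def)

context tangent_pair
begin

lemma bundle_typedD [simp]:
  assumes "bundle_typed b"
  shows "tangent_nat_trans X Y (bq b)" "tangent_nat_trans X Y (bpi1 b)" "tangent_nat_trans X Y (bpi2 b)"
     "tangent_nat_trans X Y (bz b)" "tangent_nat_trans X Y (bs b)" "tangent_nat_trans X Y (bl b)"
     "nsrc (bpi1 b) = nsrc (bpi2 b)" "ntgt (bpi1 b) = nsrc (bq b)" "ntgt (bpi2 b) = nsrc (bq b)"
     "nsrc (bz b) = ntgt (bq b)" "ntgt (bz b) = nsrc (bq b)"
     "nsrc (bs b) = nsrc (bpi2 b)" "ntgt (bs b) = nsrc (bq b)"
     "nsrc (bl b) = nsrc (bq b)" "ntgt (bl b) = Tbar X Y (nsrc (bq b))"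
     "lax_tangent_morphism X Y (nsrc (bq b))" "lax_tangent_morphism X Y (ntgt (bq b))"
     "lax_tangent_morphism X Y (nsrc (bpi2 b))"
  using assms tnt_typing(1)[of "bq b"] tnt_typing(2)[of "bq b"] tnt_typing(1)[of "bpi2 b"]
  unfolding bundle_typed_def by blast+

lemma DBpt_sel [simp]:
  "Dom (DBpt U X Y) = msrc" "Cod (DBpt U X Y) = mtgt" "Ident (DBpt U X Y) = Ident (DB H)"
  "Cmp (DBpt U X Y) = Cmp (DB H)" "To (DBpt U X Y) = T_bundle H" "Ta (DBpt U X Y) = Ta (DB H)"
  "tp (DBpt U X Y) = tp (DB H)" "tpi1 (DBpt U X Y) = tpi1 (DB H)" "tpi2 (DBpt U X Y) = tpi2 (DB H)"
  "tz (DBpt U X Y) = tz (DB H)" "ts (DBpt U X Y) = ts (DB H)" "tl (DBpt U X Y) = tl (DB H)"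
  "tc (DBpt U X Y) = tc (DB H)"
  by (simp_all add: DBpt_def DB_def)

lemma DBpt_Arr_iff:
  "\<phi> \<in> Arr (DBpt U X Y) \<longleftrightarrow> msrc \<phi> \<in> Ob (DBpt U X Y) \<and> mtgt \<phi> \<in> Ob (DBpt U X Y) \<and>
     tangent_nat_trans X Y (mbase \<phi>) \<and> nsrc (mbase \<phi>) = ntgt (bq (msrc \<phi>)) \<and> ntgt (mbase \<phi>) = ntgt (bq (mtgt \<phi>)) \<and>
     tangent_nat_trans X Y (mtot \<phi>) \<and> nsrc (mtot \<phi>) = nsrc (bq (msrc \<phi>)) \<and> ntgt (mtot \<phi>) = nsrc (bq (mtgt \<phi>)) \<and>
     (\<forall>A\<in>Ob X. linear_morphism Y (linmor_at \<phi> A))" (is "?L \<longleftrightarrow> ?R")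
proof -
  have ob: "b \<in> Ob (DBpt U X Y) \<longleftrightarrow> diff_bundle H b \<and> pointwise_display U X Y (bq b)" for b
    by (simp add: DBpt_def)
  have ar: "?L \<longleftrightarrow> msrc \<phi> \<in> Ob (DBpt U X Y) \<and> mtgt \<phi> \<in> Ob (DBpt U X Y) \<and> linear_morphism H \<phi>"
  proof -
    have "?L \<longleftrightarrow> linear_morphism H \<phi> \<and> pointwise_display U X Y (bq (msrc \<phi>)) \<and> pointwise_display U X Y (bq (mtgt \<phi>))"
      by (simp add: DBpt_def)
    moreover have "linear_morphism H \<phi> \<Longrightarrow> diff_bundle H (msrc \<phi>) \<and> diff_bundle H (mtgt \<phi>)"
      unfolding linear_morphism_def by blast
    ultimately show ?thesis unfolding ob by blast
  qed
  show ?thesis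
  proof (cases "msrc \<phi> \<in> Ob (DBpt U X Y) \<and> mtgt \<phi> \<in> Ob (DBpt U X Y) \<and>
     tangent_nat_trans X Y (mbase \<phi>) \<and> nsrc (mbase \<phi>) = ntgt (bq (msrc \<phi>)) \<and> ntgt (mbase \<phi>) = ntgt (bq (mtgt \<phi>)) \<and>
     tangent_nat_trans X Y (mtot \<phi>) \<and> nsrc (mtot \<phi>) = nsrc (bq (msrc \<phi>)) \<and> ntgt (mtot \<phi>) = nsrc (bq (mtgt \<phi>))")
    case False
    then show ?thesis unfolding ar linear_morphism_def by auto
  next
    case True
    then have o: "msrc \<phi> \<in> Ob (DBpt U X Y)" "mtgt \<phi> \<in> Ob (DBpt U X Y)"
      and t [simp]: "tangent_nat_trans X Y (mbase \<phi>)" "nsrc (mbase \<phi>) = ntgt (bq (msrc \<phi>))" "ntgt (mbase \<phi>) = ntgt (bq (mtgt \<phi>))"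
       "tangent_nat_trans X Y (mtot \<phi>)" "nsrc (mtot \<phi>) = nsrc (bq (msrc \<phi>))" "ntgt (mtot \<phi>) = nsrc (bq (mtgt \<phi>))"
      by blast+
    have b [simp]: "bundle_typed (msrc \<phi>)" "bundle_typed (mtgt \<phi>)" using o unfolding DBpt_Ob_iff by auto
    have d: "diff_bundle Y (bundle_at (msrc \<phi>) A)" "diff_bundle Y (bundle_at (mtgt \<phi>) A)" if "A \<in> Ob X" for A
      using o that unfolding DBpt_Ob_iff by auto
    have e1: "bq (mtgt \<phi>) \<bullet>\<^bsub>H\<^esub> mtot \<phi> = mbase \<phi> \<bullet>\<^bsub>H\<^esub> bq (msrc \<phi>) \<longleftrightarrow>
       (\<forall>A\<in>Ob X. ncmp (bq (mtgt \<phi>)) A \<bullet>\<^bsub>Y\<^esub> ncmp (mtot \<phi>) A = ncmp (mbase \<phi>) A \<bullet>\<^bsub>Y\<^esub> ncmp (bq (msrc \<phi>)) A)"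
      by (subst tnt_eq_iff) simp_all
    have e2: "Ta H (mtot \<phi>) \<bullet>\<^bsub>H\<^esub> bl (msrc \<phi>) = bl (mtgt \<phi>) \<bullet>\<^bsub>H\<^esub> mtot \<phi> \<longleftrightarrow>
       (\<forall>A\<in>Ob X. Ta Y (ncmp (mtot \<phi>) A) \<bullet>\<^bsub>Y\<^esub> ncmp (bl (msrc \<phi>)) A = ncmp (bl (mtgt \<phi>)) A \<bullet>\<^bsub>Y\<^esub> ncmp (mtot \<phi>) A)"
      by (subst tnt_eq_iff) simp_all
    have "linear_morphism H \<phi> \<longleftrightarrow> (\<forall>A\<in>Ob X. linear_morphism Y (linmor_at \<phi> A))"
      using o d unfolding linear_morphism_def e1 e2 ob by auto
    then show ?thesis unfolding ar using True by blast
  qed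
qed

text \<open>The components and the ends of the projection leave open only the apex of the recorded fibre
  product, as a lax tangent morphism. Its arrow part and its structure are determined by the jointly
  monic projections.\<close>

lemma bundle_eqI:
  assumes b: "b \<in> Ob (DBpt U X Y)" and b': "b' \<in> Ob (DBpt U X Y)"
    and e: "nsrc (bq b) = nsrc (bq b')" "ntgt (bq b) = ntgt (bq b')"
    and at: "\<And>A. A \<in> Ob X \<Longrightarrow> bundle_at b A = bundle_at b' A"
  shows "b = b'"
proof -
  have t [simp]: "bundle_typed b" "bundle_typed b'" using b b' unfolding DBpt_Ob_iff by auto
  have d: "diff_bundle Y (bundle_at b A)" if "A \<in> Ob X" for A using b that unfolding DBpt_Ob_iff by auto
  have c: "ncmp (bq b) A = ncmp (bq b') A" "ncmp (bpi1 b) A = ncmp (bpi1 b') A" "ncmp (bpi2 b) A = ncmp (bpi2 b') A"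
    "ncmp (bz b) A = ncmp (bz b') A" "ncmp (bs b) A = ncmp (bs b') A" "ncmp (bl b) A = ncmp (bl b') A" if "A \<in> Ob X" for A
    using at[OF that] by (simp_all add: bundle_at_def)
  have ob: "fobj (nsrc (bpi2 b)) A = fobj (nsrc (bpi2 b')) A" if "A \<in> Ob X" for A
    using tnt_typing(4)[of "bpi2 b" A] tnt_typing(4)[of "bpi2 b'" A] c(3)[OF that] that by simp
  note p = Y.bundle_pullback[OF d, simplified]
  have P: "nsrc (bpi2 b) = nsrc (bpi2 b')"
  proof (rule lmor_eqI)
    fix f assume f: "f \<in> Arr X"
    note n = tnt_nat[of "bpi1 b" f, OF _ f refl] tnt_nat[of "bpi2 b" f, OF _ f refl]
      tnt_nat[of "bpi1 b'" f, OF _ f refl] tnt_nat[of "bpi2 b'" f, OF _ f refl]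
    show "farr (nsrc (bpi2 b)) f = farr (nsrc (bpi2 b')) f"
      by (rule Y.is_pullback_monic[OF p(1)[of "Cod X f"]]) (use f n e in \<open>simp_all add: ob c\<close>)
  next
    fix A assume A: "A \<in> Ob X"
    note n = tnt_tan[of "bpi1 b" A, OF _ A] tnt_tan[of "bpi2 b" A, OF _ A]
      tnt_tan[of "bpi1 b'" A, OF _ A] tnt_tan[of "bpi2 b'" A, OF _ A]
    show "lstr (nsrc (bpi2 b)) A = lstr (nsrc (bpi2 b')) A"
      by (rule Y.is_pullback_monic[OF p(2)[of A]]) (use A n e in \<open>simp_all add: ob c\<close>)
  qed (use ob in simp_all)
  have "bq b = bq b'" "bpi1 b = bpi1 b'" "bpi2 b = bpi2 b'" "bz b = bz b'" "bs b = bs b'" "bl b = bl b'"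
    by (rule tnt_eqI; use c e P in simp)+
  then show ?thesis by (cases b; cases b') simp
qed

lemma linmor_nt_eqI:
  assumes "\<phi> \<in> Arr (DBpt U X Y)" "\<psi> \<in> Arr (DBpt U X Y)" "msrc \<phi> = msrc \<psi>" "mtgt \<phi> = mtgt \<psi>"
    and "\<And>A. A \<in> Ob X \<Longrightarrow> linmor_at \<phi> A = linmor_at \<psi> A"
  shows "\<phi> = \<psi>"
proof (rule linmor_eqI)
  have c: "ncmp (mbase \<phi>) A = ncmp (mbase \<psi>) A" "ncmp (mtot \<phi>) A = ncmp (mtot \<psi>) A" if "A \<in> Ob X" for A
    using assms(5)[OF that] by (simp_all add: linmor_at_def)
  show "mbase \<phi> = mbase \<psi>" "mtot \<phi> = mtot \<psi>"
    by (rule tnt_eqI; use assms(1-4) c in \<open>simp add: DBpt_Arr_iff\<close>)+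
qed (use assms in simp_all)

end

subsection \<open>Precomposition\<close>

lemma bundle_pre_simps [simp]:
  "bq (bundle_pre X'' X b K) = nt_whisker_right X'' X (bq b) K"
  "bpi1 (bundle_pre X'' X b K) = nt_whisker_right X'' X (bpi1 b) K"
  "bpi2 (bundle_pre X'' X b K) = nt_whisker_right X'' X (bpi2 b) K"
  "bz (bundle_pre X'' X b K) = nt_whisker_right X'' X (bz b) K"
  "bs (bundle_pre X'' X b K) = nt_whisker_right X'' X (bs b) K"
  "bl (bundle_pre X'' X b K) = nt_whisker_right X'' X (bl b) K"
  by (simp_all add: bundle_pre_def)

lemma bundle_at_pre [simp]: "A \<in> Ob X'' \<Longrightarrow> bundle_at (bundle_pre X'' X b K) A = bundle_at b (fobj K A)"
  by (simp add: bundle_at_def)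

context tangent_triple
begin

lemma Tbar_comp:
  assumes [simp]: "lax_tangent_morphism X Y F" "lax_tangent_morphism Y Z G"
  shows "tng_comp X Z (Tbar Y Z G) F = Tbar X Z (tng_comp X Z G F)"
  by (rule XZ.lmor_eqI) (simp_all add: lax_comp)

lemma T2bar_comp:
  assumes F [simp]: "lax_tangent_morphism X Y F" and G [simp]: "lax_tangent_morphism Y Z G"
  shows "tng_comp X Z (T2bar Y Z G) F = T2bar X Z (tng_comp X Z G F)"
proof (rule XZ.lmor_eqI)
  have [simp]: "lax_tangent_morphism X Z (tng_comp X Z G F)" by (rule lax_comp[OF F G])
  fix A assume A [simp]: "A \<in> Ob X"
  have FA [simp]: "fobj F A \<in> Ob Y" by simp
  note l = XZ.T2bar_lstr[OF lax_comp[OF F G] A] and m = YZ.T2bar_lstr[OF G FA]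
  show "lstr (tng_comp X Z (T2bar Y Z G) F) A = lstr (T2bar X Z (tng_comp X Z G F)) A"
    by (rule YZ.Y.tpi_Ta_monic[of _ _ "fobj G (fobj F A)"])
      (use l m in \<open>simp_all add: m(4,5)[THEN YZ.Y.Cmp_eq_extend] YZ.Y.tpi_nat\<close>)
qed (simp_all add: lax_comp)

lemma bundle_pre_Ob:
  assumes b: "b \<in> Ob (DBpt U Y Z)" and K [simp]: "lax_tangent_morphism X Y K"
  shows "bundle_pre X Z b K \<in> Ob (DBpt U X Z)"
proof -
  have t [simp]: "YZ.bundle_typed b" using b unfolding YZ.DBpt_Ob_iff by blast
  have "XZ.bundle_typed (bundle_pre X Z b K)"
    unfolding XZ.bundle_typed_def by (simp add: tnt_whisker_right Tbar_comp)
  then show ?thesis using b unfolding XZ.DBpt_Ob_iff YZ.DBpt_Ob_iff by simp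
qed

end

section \<open>The universal property\<close>

context db_on
begin

lemma linear_simps [simp]:
  "\<lbrakk>linear_morphism X f; linear_morphism X g; mtgt f = msrc g\<rbrakk> \<Longrightarrow> linear_morphism X (g \<bullet>\<^bsub>DB X\<^esub> f)"
  "linear_morphism X f \<Longrightarrow> linear_morphism X (Ta (DB X) f)"
  "diff_bundle X b \<Longrightarrow> linear_morphism X (Ident (DB X) b)" "diff_bundle X b \<Longrightarrow> linear_morphism X (tp (DB X) b)"
  "diff_bundle X b \<Longrightarrow> linear_morphism X (tpi1 (DB X) b)" "diff_bundle X b \<Longrightarrow> linear_morphism X (tpi2 (DB X) b)"
  "diff_bundle X b \<Longrightarrow> linear_morphism X (tz (DB X) b)" "diff_bundle X b \<Longrightarrow> linear_morphism X (ts (DB X) b)"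
  "diff_bundle X b \<Longrightarrow> linear_morphism X (tl (DB X) b)" "diff_bundle X b \<Longrightarrow> linear_morphism X (tc (DB X) b)"
  "linear_morphism X f \<Longrightarrow> linear_morphism X (T2a (DB X) f)"
  using DB.Cmp_Arr[of f g] DB.Ta_Arr[of f] DB.Ident_Arr[of b] DB.structure_Arr[of b] DB.T2a_Arr(1)[of f] by simp_all

end

locale db_pair = tangent_pair X Y + B: db_on Y
  for X :: "('o, 'a) tcat" and Y :: "('o2, 'a2) tcat"

sublocale db_pair \<subseteq> K: tangent_triple X "DB Y" Y by unfold_locales

context db_pair
begin

lemmas lax_DB_typing [simp] = K.XY.lax_typing[simplified]
lemmas tnt_DB_typing [simp] = K.XY.tnt_typing(3-5)[simplified]

lemma T_bundle_Ob:
  assumes b: "b \<in> Ob (DBpt U X Y)"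
  shows "T_bundle H b \<in> Ob (DBpt U X Y)"
    and "A \<in> Ob X \<Longrightarrow> bundle_at (T_bundle H b) A = T_bundle Y (bundle_at b A)"
proof -
  have t [simp]: "bundle_typed b" using b unfolding DBpt_Ob_iff by blast
  show at: "bundle_at (T_bundle H b) A = T_bundle Y (bundle_at b A)" if "A \<in> Ob X" for A
    using that by (simp add: bundle_at_def T_bundle_def)
  have "bundle_typed (T_bundle H b)" unfolding bundle_typed_def by simp
  moreover have "diff_bundle Y (bundle_at (T_bundle H b) A)" if "A \<in> Ob X" for A
    unfolding at[OF that] using b that unfolding DBpt_Ob_iff by simp
  ultimately show "T_bundle H b \<in> Ob (DBpt U X Y)" unfolding DBpt_Ob_iff by blast
qed

lemma T2_bundle_Ob:
  assumes b: "b \<in> Ob (DBpt U X Y)"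
  shows "T2_bundle H b \<in> Ob (DBpt U X Y)"
    and "A \<in> Ob X \<Longrightarrow> bundle_at (T2_bundle H b) A = T2_bundle Y (bundle_at b A)"
proof -
  have t [simp]: "bundle_typed b" using b unfolding DBpt_Ob_iff by blast
  let ?E = "nsrc (bq b)"
  have pA: "is_pullback Y (ncmp (Ta H (tp H ?E)) A) (ncmp (Ta H (tp H ?E)) A) (ncmp (Ta H (tpi1 H ?E)) A) (ncmp (Ta H (tpi2 H ?E)) A)"
    if "A \<in> Ob X" for A using that by (simp add: Y.tpi_pullback_Ta)
  have e: "ncmp (Ta H (tp H ?E)) A \<bullet>\<^bsub>Y\<^esub> ncmp (bl (T_bundle H b) \<bullet>\<^bsub>H\<^esub> tpi1 H ?E) A =
      ncmp (Ta H (tp H ?E)) A \<bullet>\<^bsub>Y\<^esub> ncmp (bl (T_bundle H b) \<bullet>\<^bsub>H\<^esub> tpi2 H ?E) A" if "A \<in> Ob X" for A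
    using that by (simp add: Y.Ta_tp_tc[THEN Y.Cmp_eq_extend] Y.tp_nat[THEN Y.Cmp_eq_extend] Y.tp_tpi)
  note pr = Hom_pair_into[OF Hom_tpi_pullback(2)[of ?E] pA _ _ _ _ _ e, simplified]
  have bl: "bl (T2_bundle H b) = pair_into H (Ta H (tpi1 H ?E)) (Ta H (tpi2 H ?E))
     (tc H ?E \<bullet>\<^bsub>H\<^esub> Ta H (bl b) \<bullet>\<^bsub>H\<^esub> tpi1 H ?E) (tc H ?E \<bullet>\<^bsub>H\<^esub> Ta H (bl b) \<bullet>\<^bsub>H\<^esub> tpi2 H ?E)"
    by (simp add: T2_bundle_def)
  show at: "bundle_at (T2_bundle H b) A = T2_bundle Y (bundle_at b A)" if A: "A \<in> Ob X" for A
    using A pr(4)[OF A] by (simp add: bundle_at_def T2_bundle_def)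
  have "bundle_typed (T2_bundle H b)" unfolding bundle_typed_def using pr by (simp add: bl)
  then show "T2_bundle H b \<in> Ob (DBpt U X Y)" using b at unfolding DBpt_Ob_iff by simp
qed

text \<open>\<open>Base\<close> and \<open>Tot\<close> preserve the tangent structure and the chosen pullbacks, so they commute with the
  tangent functors of the two hom-categories on the nose.\<close>

lemma Base_Tot_comp:
  assumes F [simp]: "lax_tangent_morphism X (DB Y) F"
  shows "tng_comp X Y (Base Y) (Tbar X (DB Y) F) = Tbar X Y (tng_comp X Y (Base Y) F)"
    "tng_comp X Y (Tot Y) (Tbar X (DB Y) F) = Tbar X Y (tng_comp X Y (Tot Y) F)"
    "tng_comp X Y (Base Y) (T2bar X (DB Y) F) = T2bar X Y (tng_comp X Y (Base Y) F)"
    "tng_comp X Y (Tot Y) (T2bar X (DB Y) F) = T2bar X Y (tng_comp X Y (Tot Y) F)"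
proof -
  have [simp]: "lax_tangent_morphism X Y (tng_comp X Y (Base Y) F)" "lax_tangent_morphism X Y (tng_comp X Y (Tot Y) F)"
    by (simp_all add: K.lax_comp)
  show "tng_comp X Y (Base Y) (Tbar X (DB Y) F) = Tbar X Y (tng_comp X Y (Base Y) F)"
    "tng_comp X Y (Tot Y) (Tbar X (DB Y) F) = Tbar X Y (tng_comp X Y (Tot Y) F)"
    by (rule lmor_eqI; simp add: K.lax_comp)+
  have T2: "mbase (T2a (DB Y) f) = T2a Y (mbase f)" "mtot (T2a (DB Y) f) = T2a Y (mtot f)" if f [simp]: "linear_morphism Y f" for f
  proof -
    have [simp]: "msrc (T2a (DB Y) f) = T2_bundle Y (msrc f)" "mtgt (T2a (DB Y) f) = T2_bundle Y (mtgt f)"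
      using B.DB.T2a_Arr[of f] by simp_all
    note n = B.DB.tpi_nat[of f "mtgt f", simplified]
    note nb = n[THEN arg_cong[of _ _ mbase], simplified] and nt = n[THEN arg_cong[of _ _ mtot], simplified]
    show "mbase (T2a (DB Y) f) = T2a Y (mbase f)"
      by (rule Y.tpi_monic[of _ _ "base Y (mtgt f)"]) (use nb in \<open>simp_all add: Y.tpi_nat\<close>)
    show "mtot (T2a (DB Y) f) = T2a Y (mtot f)"
      by (rule Y.tpi_monic[of _ _ "tot Y (mtgt f)"]) (use nt in \<open>simp_all add: Y.tpi_nat\<close>)
  qed
  have L: "linear_morphism Y (lstr (T2bar X (DB Y) F) A)" "msrc (lstr (T2bar X (DB Y) F) A) = T2_bundle Y (fobj F (To X A))"
    "mtgt (lstr (T2bar X (DB Y) F) A) = T_bundle Y (T2_bundle Y (fobj F A))"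
    "Ta (DB Y) (tpi1 (DB Y) (fobj F A)) \<bullet>\<^bsub>DB Y\<^esub> lstr (T2bar X (DB Y) F) A = lstr (Tbar X (DB Y) F) A \<bullet>\<^bsub>DB Y\<^esub> tpi1 (DB Y) (fobj F (To X A))"
    "Ta (DB Y) (tpi2 (DB Y) (fobj F A)) \<bullet>\<^bsub>DB Y\<^esub> lstr (T2bar X (DB Y) F) A = lstr (Tbar X (DB Y) F) A \<bullet>\<^bsub>DB Y\<^esub> tpi2 (DB Y) (fobj F (To X A))"
    if "A \<in> Ob X" for A
    using K.XY.T2bar_lstr[OF F that] by simp_all
  show "tng_comp X Y (Base Y) (T2bar X (DB Y) F) = T2bar X Y (tng_comp X Y (Base Y) F)"
  proof (rule lmor_eqI)
    fix A assume A [simp]: "A \<in> Ob X"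
    note [simp] = L(1-3)[OF A]
    note l = T2bar_lstr[of "tng_comp X Y (Base Y) F", OF _ A, simplified]
    note m = L(4,5)[OF A, THEN arg_cong[of _ _ mbase], simplified]
    show "lstr (tng_comp X Y (Base Y) (T2bar X (DB Y) F)) A = lstr (T2bar X Y (tng_comp X Y (Base Y) F)) A"
      by (rule Y.tpi_Ta_monic[of _ _ "base Y (fobj F A)"]) (use l m in simp_all)
  qed (simp_all add: K.lax_comp T2)
  show "tng_comp X Y (Tot Y) (T2bar X (DB Y) F) = T2bar X Y (tng_comp X Y (Tot Y) F)"
  proof (rule lmor_eqI)
    fix A assume A [simp]: "A \<in> Ob X"
    note [simp] = L(1-3)[OF A]
    note l = T2bar_lstr[of "tng_comp X Y (Tot Y) F", OF _ A, simplified]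
    note m = L(4,5)[OF A, THEN arg_cong[of _ _ mtot], simplified]
    show "lstr (tng_comp X Y (Tot Y) (T2bar X (DB Y) F)) A = lstr (T2bar X Y (tng_comp X Y (Tot Y) F)) A"
      by (rule Y.tpi_Ta_monic[of _ _ "tot Y (fobj F A)"]) (use l m in simp_all)
  qed (simp_all add: K.lax_comp T2)
qed

abbreviation (input) Q_pre :: "('o, 'a, 'a2 dbundle, 'a2 linmor) lmor \<Rightarrow> (('o, 'a, 'o2, 'a2) lmor, 'o, 'a2) nt dbundle" where
  "Q_pre F \<equiv> bundle_pre X Y (univ_bundle Y) F"

definition Q_arr :: "(('o, 'a, 'a2 dbundle, 'a2 linmor) lmor, 'o, 'a2 linmor) nt \<Rightarrow>
    (('o, 'a, 'o2, 'a2) lmor, 'o, 'a2) nt linmor" where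
  "Q_arr \<theta> = \<lparr>msrc = Q_pre (nsrc \<theta>), mtgt = Q_pre (ntgt \<theta>),
         mbase = nt_whisker_left X Y (Base Y) \<theta>, mtot = nt_whisker_left X Y (Tot Y) \<theta>\<rparr>"

text \<open>The lax tangent morphism into \<open>DB Y\<close> that classifies \<open>b\<close>: its objects are the components of
  \<open>b\<close>, its arrows and its structure those of the ends of the projection.\<close>

definition classify :: "(('o, 'a, 'o2, 'a2) lmor, 'o, 'a2) nt dbundle \<Rightarrow> ('o, 'a, 'a2 dbundle, 'a2 linmor) lmor" where
  "classify b = \<lparr>fobj = (\<lambda>A\<in>Ob X. bundle_at b A),
     farr = (\<lambda>f\<in>Arr X. \<lparr>msrc = bundle_at b (Dom X f), mtgt = bundle_at b (Cod X f),
       mbase = farr (ntgt (bq b)) f, mtot = farr (nsrc (bq b)) f\<rparr>),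
     lstr = (\<lambda>A\<in>Ob X. \<lparr>msrc = bundle_at b (To X A), mtgt = T_bundle Y (bundle_at b A),
       mbase = lstr (ntgt (bq b)) A, mtot = lstr (nsrc (bq b)) A\<rparr>)\<rparr>"

definition classify_arr :: "(('o, 'a, 'o2, 'a2) lmor, 'o, 'a2) nt linmor \<Rightarrow>
    (('o, 'a, 'a2 dbundle, 'a2 linmor) lmor, 'o, 'a2 linmor) nt" where
  "classify_arr \<phi> = \<lparr>nsrc = classify (msrc \<phi>), ntgt = classify (mtgt \<phi>), ncmp = (\<lambda>A\<in>Ob X. linmor_at \<phi> A)\<rparr>"

lemma classify_simps [simp]:
  "A \<in> Ob X \<Longrightarrow> fobj (classify b) A = bundle_at b A"
  "f \<in> Arr X \<Longrightarrow> farr (classify b) f = \<lparr>msrc = bundle_at b (Dom X f), mtgt = bundle_at b (Cod X f),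
       mbase = farr (ntgt (bq b)) f, mtot = farr (nsrc (bq b)) f\<rparr>"
  "A \<in> Ob X \<Longrightarrow> lstr (classify b) A = \<lparr>msrc = bundle_at b (To X A), mtgt = T_bundle Y (bundle_at b A),
       mbase = lstr (ntgt (bq b)) A, mtot = lstr (nsrc (bq b)) A\<rparr>"
  "fobj (classify b) \<in> extensional (Ob X)" "farr (classify b) \<in> extensional (Arr X)"
  "lstr (classify b) \<in> extensional (Ob X)"
  by (simp_all add: classify_def)

text \<open>Arrows and structure are linear because the projection and the lift of \<open>b\<close> are tangent natural
  transformations. The axioms are equations of linear morphisms, whose base and total parts are axioms
  of the ends of the projection.\<close>

lemma lax_classify:
  assumes b: "b \<in> Ob (DBpt U X Y)"
  shows "lax_tangent_morphism X (DB Y) (classify b)"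
proof (rule K.XY.lax_tangent_morphismI)
  have t [simp]: "bundle_typed b" using b unfolding DBpt_Ob_iff by blast
  have d [simp]: "diff_bundle Y (bundle_at b A)" if "A \<in> Ob X" for A using b that unfolding DBpt_Ob_iff by auto
  let ?E = "nsrc (bq b)" and ?M = "ntgt (bq b)"
  show lf: "farr (classify b) f \<in> Arr (DB Y) \<and> Dom (DB Y) (farr (classify b) f) = fobj (classify b) (Dom X f) \<and>
      Cod (DB Y) (farr (classify b) f) = fobj (classify b) (Cod X f)" if f: "f \<in> Arr X" for f
  proof -
    have "linear_morphism Y (farr (classify b) f)"
      unfolding linear_morphism_def classify_simps(2)[OF f]
      using f tnt_nat[of "bq b" f, OF _ f refl] tnt_nat[of "bl b" f, OF _ f refl] by simp
    then show ?thesis using f by simp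
  qed
  show ll: "lstr (classify b) A \<in> Arr (DB Y) \<and> Dom (DB Y) (lstr (classify b) A) = fobj (classify b) (To X A) \<and>
      Cod (DB Y) (lstr (classify b) A) = To (DB Y) (fobj (classify b) A)" if A: "A \<in> Ob X" for A
  proof -
    have "linear_morphism Y (lstr (classify b) A)"
      unfolding linear_morphism_def classify_simps(3)[OF A]
      using A tnt_tan[of "bq b" A, OF _ A] tnt_tan[of "bl b" A, OF _ A] by (simp add: Y.tc_tc)
    then show ?thesis using A by simp
  qed
  show "fobj (classify b) A \<in> Ob (DB Y)" if "A \<in> Ob X" for A using that by simp
  show "farr (classify b) (Ident X A) = Ident (DB Y) (fobj (classify b) A)" if "A \<in> Ob X" for A
    by (rule linmor_eqI) (use that in simp_all)
  show "farr (classify b) (g \<bullet>\<^bsub>X\<^esub> f) = farr (classify b) g \<bullet>\<^bsub>DB Y\<^esub> farr (classify b) f"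
    if "f \<in> Arr X" "g \<in> Arr X" "Cod X f = Dom X g" for f g
    by (rule linmor_eqI) (use that in simp_all)
  show "lstr (classify b) (Cod X f) \<bullet>\<^bsub>DB Y\<^esub> farr (classify b) (Ta X f) =
      Ta (DB Y) (farr (classify b) f) \<bullet>\<^bsub>DB Y\<^esub> lstr (classify b) (Dom X f)" if f: "f \<in> Arr X" for f
    by (rule linmor_eqI) (use f lstr_nat[OF _ f refl] in simp_all)
  fix A assume A: "A \<in> Ob X"
  show "tp (DB Y) (fobj (classify b) A) \<bullet>\<^bsub>DB Y\<^esub> lstr (classify b) A = farr (classify b) (tp X A)"
    by (rule linmor_eqI) (use A in \<open>simp_all add: lax_equations(1)\<close>)
  show "lstr (classify b) A \<bullet>\<^bsub>DB Y\<^esub> farr (classify b) (tz X A) = tz (DB Y) (fobj (classify b) A)"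
    by (rule linmor_eqI) (use A in \<open>simp_all add: lax_equations(2)\<close>)
  show "tl (DB Y) (fobj (classify b) A) \<bullet>\<^bsub>DB Y\<^esub> lstr (classify b) A =
      Ta (DB Y) (lstr (classify b) A) \<bullet>\<^bsub>DB Y\<^esub> (lstr (classify b) (To X A) \<bullet>\<^bsub>DB Y\<^esub> farr (classify b) (tl X A))"
    by (rule linmor_eqI) (use A in \<open>simp_all add: lax_equations(4)\<close>)
  show "tc (DB Y) (fobj (classify b) A) \<bullet>\<^bsub>DB Y\<^esub> (Ta (DB Y) (lstr (classify b) A) \<bullet>\<^bsub>DB Y\<^esub> lstr (classify b) (To X A)) =
      Ta (DB Y) (lstr (classify b) A) \<bullet>\<^bsub>DB Y\<^esub> (lstr (classify b) (To X A) \<bullet>\<^bsub>DB Y\<^esub> farr (classify b) (tc X A))"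
    by (rule linmor_eqI) (use A in \<open>simp_all add: lax_equations(5)\<close>)
  fix k assume k: "k \<in> Arr (DB Y)" "Dom (DB Y) k = fobj (classify b) (T2o X A)" "Cod (DB Y) k = T2o (DB Y) (fobj (classify b) A)"
     "tpi1 (DB Y) (fobj (classify b) A) \<bullet>\<^bsub>DB Y\<^esub> k = lstr (classify b) A \<bullet>\<^bsub>DB Y\<^esub> farr (classify b) (tpi1 X A)"
     "tpi2 (DB Y) (fobj (classify b) A) \<bullet>\<^bsub>DB Y\<^esub> k = lstr (classify b) A \<bullet>\<^bsub>DB Y\<^esub> farr (classify b) (tpi2 X A)"
  have kt [simp]: "linear_morphism Y k" "msrc k = bundle_at b (T2o X A)" "mtgt k = T2_bundle Y (bundle_at b A)"
    using k(1-3) A by simp_all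
  note kb = k(4,5)[THEN arg_cong[of _ _ mbase]] and kt' = k(4,5)[THEN arg_cong[of _ _ mtot]]
  have M: "lax_tangent_morphism X Y ?M" and E: "lax_tangent_morphism X Y ?E" by simp_all
  obtain hM where hM: "hM \<in> Arr Y" "Dom Y hM = fobj ?M (T2o X A)" "Cod Y hM = T2o Y (fobj ?M A)"
    "tpi1 Y (fobj ?M A) \<bullet>\<^bsub>Y\<^esub> hM = lstr ?M A \<bullet>\<^bsub>Y\<^esub> farr ?M (tpi1 X A)"
    "tpi2 Y (fobj ?M A) \<bullet>\<^bsub>Y\<^esub> hM = lstr ?M A \<bullet>\<^bsub>Y\<^esub> farr ?M (tpi2 X A)"
    "lstr ?M A \<bullet>\<^bsub>Y\<^esub> farr ?M (ts X A) = ts Y (fobj ?M A) \<bullet>\<^bsub>Y\<^esub> hM" by (rule lax_ts[OF M A])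
  obtain hE where hE: "hE \<in> Arr Y" "Dom Y hE = fobj ?E (T2o X A)" "Cod Y hE = T2o Y (fobj ?E A)"
    "tpi1 Y (fobj ?E A) \<bullet>\<^bsub>Y\<^esub> hE = lstr ?E A \<bullet>\<^bsub>Y\<^esub> farr ?E (tpi1 X A)"
    "tpi2 Y (fobj ?E A) \<bullet>\<^bsub>Y\<^esub> hE = lstr ?E A \<bullet>\<^bsub>Y\<^esub> farr ?E (tpi2 X A)"
    "lstr ?E A \<bullet>\<^bsub>Y\<^esub> farr ?E (ts X A) = ts Y (fobj ?E A) \<bullet>\<^bsub>Y\<^esub> hE" by (rule lax_ts[OF E A])
  have ty: "mbase k \<in> Arr Y" "Dom Y (mbase k) = fobj ?M (T2o X A)" "Cod Y (mbase k) = T2o Y (fobj ?M A)"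
    "mtot k \<in> Arr Y" "Dom Y (mtot k) = fobj ?E (T2o X A)" "Cod Y (mtot k) = T2o Y (fobj ?E A)"
    using Y.linear_morphismD[OF kt(1)] A by simp_all
  have "mbase k = hM" by (rule Y.tpi_monic[of _ _ "fobj ?M A"]) (use A kb hM ty in simp_all)
  moreover have "mtot k = hE" by (rule Y.tpi_monic[of _ _ "fobj ?E A"]) (use A kt' hE ty in simp_all)
  ultimately show "lstr (classify b) A \<bullet>\<^bsub>DB Y\<^esub> farr (classify b) (ts X A) = ts (DB Y) (fobj (classify b) A) \<bullet>\<^bsub>DB Y\<^esub> k"
    by (intro linmor_eqI) (use A hM(6) hE(6) in simp_all)
qed simp_all

lemma Q_pre_Ob: "lax_tangent_morphism X (DB Y) F \<Longrightarrow> Q_pre F \<in> Ob (DBpt U X Y)"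
  using K.bundle_pre_Ob[OF B.univ_bundle_Ob] by blast

lemma Q_pre_at [simp]: "\<lbrakk>lax_tangent_morphism X (DB Y) F; A \<in> Ob X\<rbrakk> \<Longrightarrow> bundle_at (Q_pre F) A = fobj F A"
  by (simp add: B.univ_bundle_at)

lemma Q_arr_at [simp]:
  assumes [simp]: "tangent_nat_trans X (DB Y) \<theta>" "A \<in> Ob X"
  shows "linmor_at (Q_arr \<theta>) A = ncmp \<theta> A"
proof -
  have [simp]: "lax_tangent_morphism X (DB Y) (nsrc \<theta>)" "lax_tangent_morphism X (DB Y) (ntgt \<theta>)"
    using K.XY.tnt_typing(1,2)[OF assms(1)] by auto
  show ?thesis by (rule linmor_eqI) (simp_all add: Q_arr_def B.univ_bundle_at)
qed

lemma Q_arr_Arr: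
  assumes t [simp]: "tangent_nat_trans X (DB Y) \<theta>"
  shows "Q_arr \<theta> \<in> Arr (DBpt U X Y)"
proof -
  have [simp]: "lax_tangent_morphism X (DB Y) (nsrc \<theta>)" "lax_tangent_morphism X (DB Y) (ntgt \<theta>)"
    using K.XY.tnt_typing(1,2)[OF assms(1)] by auto
  show ?thesis
    unfolding DBpt_Arr_iff using Q_pre_Ob[of _ U] by (simp add: Q_arr_at) (simp add: Q_arr_def K.tnt_whisker_left)
qed

lemma Q_classify:
  assumes b: "b \<in> Ob (DBpt U X Y)"
  shows "Q_pre (classify b) = b"
proof (rule bundle_eqI[OF Q_pre_Ob[OF lax_classify[OF b]] b])
  have t [simp]: "bundle_typed b" using b unfolding DBpt_Ob_iff by blast
  have d [simp]: "diff_bundle Y (bundle_at b A)" if "A \<in> Ob X" for A using b that unfolding DBpt_Ob_iff by auto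
  note c [simp] = lax_classify[OF b]
  have ar [simp]: "linear_morphism Y (farr (classify b) f)" if "f \<in> Arr X" for f using that by (rule lax_DB_typing(2)[OF c])
  have ls [simp]: "linear_morphism Y (lstr (classify b) A)" if "A \<in> Ob X" for A using that by (rule lax_DB_typing(7)[OF c])
  show "nsrc (bq (Q_pre (classify b))) = nsrc (bq b)"
    by (rule lmor_eqI) (use ar ls in \<open>simp_all add: K.lax_comp\<close>)
  show "ntgt (bq (Q_pre (classify b))) = ntgt (bq b)"
    by (rule lmor_eqI) (use ar ls in \<open>simp_all add: K.lax_comp\<close>)
  show "bundle_at (Q_pre (classify b)) A = bundle_at b A" if "A \<in> Ob X" for A
    unfolding Q_pre_at[OF c that] using that by simp
qed

lemma classify_Q:
  assumes F [simp]: "lax_tangent_morphism X (DB Y) F"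
  shows "classify (Q_pre F) = F"
proof (rule K.XY.lmor_eqI[OF lax_classify[OF Q_pre_Ob[OF F]] F])
  show "fobj (classify (Q_pre F)) A = fobj F A" if "A \<in> Ob X" for A using that by (simp del: bundle_at_pre)
  show "farr (classify (Q_pre F)) f = farr F f" if "f \<in> Arr X" for f
    by (rule linmor_eqI) (use that in \<open>simp_all del: bundle_at_pre\<close>)
  show "lstr (classify (Q_pre F)) A = lstr F A" if "A \<in> Ob X" for A
    by (rule linmor_eqI) (use that in \<open>simp_all del: bundle_at_pre\<close>)
qed

lemma tnt_classify_arr:
  assumes f: "\<phi> \<in> Arr (DBpt U X Y)"
  shows "tangent_nat_trans X (DB Y) (classify_arr \<phi>)"
proof (rule K.XY.tangent_nat_transI)
  note F = f[unfolded DBpt_Arr_iff]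
  have o: "msrc \<phi> \<in> Ob (DBpt U X Y)" "mtgt \<phi> \<in> Ob (DBpt U X Y)" using F by auto
  have t [simp]: "bundle_typed (msrc \<phi>)" "bundle_typed (mtgt \<phi>)" using o unfolding DBpt_Ob_iff by auto
  have l [simp]: "linear_morphism Y (linmor_at \<phi> A)" if "A \<in> Ob X" for A using F that by blast
  have n [simp]: "tangent_nat_trans X Y (mbase \<phi>)" "nsrc (mbase \<phi>) = ntgt (bq (msrc \<phi>))" "ntgt (mbase \<phi>) = ntgt (bq (mtgt \<phi>))"
     "tangent_nat_trans X Y (mtot \<phi>)" "nsrc (mtot \<phi>) = nsrc (bq (msrc \<phi>))" "ntgt (mtot \<phi>) = nsrc (bq (mtgt \<phi>))"
    using F by auto
  show "lax_tangent_morphism X (DB Y) (nsrc (classify_arr \<phi>))" "lax_tangent_morphism X (DB Y) (ntgt (classify_arr \<phi>))"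
    using lax_classify[OF o(1)] lax_classify[OF o(2)] by (simp_all add: classify_arr_def)
  show "ncmp (classify_arr \<phi>) \<in> extensional (Ob X)" by (simp add: classify_arr_def)
  show "ncmp (classify_arr \<phi>) A \<in> Arr (DB Y) \<and> Dom (DB Y) (ncmp (classify_arr \<phi>) A) = fobj (nsrc (classify_arr \<phi>)) A \<and>
    Cod (DB Y) (ncmp (classify_arr \<phi>) A) = fobj (ntgt (classify_arr \<phi>)) A" if "A \<in> Ob X" for A
    using that by (simp add: classify_arr_def)
  show "ncmp (classify_arr \<phi>) (Cod X f) \<bullet>\<^bsub>DB Y\<^esub> farr (nsrc (classify_arr \<phi>)) f =
    farr (ntgt (classify_arr \<phi>)) f \<bullet>\<^bsub>DB Y\<^esub> ncmp (classify_arr \<phi>) (Dom X f)" if f: "f \<in> Arr X" for f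
    by (rule linmor_eqI)
      (use f tnt_nat[OF n(1) f refl] tnt_nat[OF n(4) f refl] in \<open>simp_all add: classify_arr_def\<close>)
  show "Ta (DB Y) (ncmp (classify_arr \<phi>) A) \<bullet>\<^bsub>DB Y\<^esub> lstr (nsrc (classify_arr \<phi>)) A =
    lstr (ntgt (classify_arr \<phi>)) A \<bullet>\<^bsub>DB Y\<^esub> ncmp (classify_arr \<phi>) (To X A)" if A: "A \<in> Ob X" for A
    by (rule linmor_eqI)
      (use A tnt_tan[OF n(1) A] tnt_tan[OF n(4) A] in \<open>simp_all add: classify_arr_def\<close>)
qed

lemma Q_classify_arr:
  assumes f: "\<phi> \<in> Arr (DBpt U X Y)"
  shows "Q_arr (classify_arr \<phi>) = \<phi>"
proof (rule linmor_nt_eqI[OF Q_arr_Arr[OF tnt_classify_arr[OF f]] f])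
  have o: "msrc \<phi> \<in> Ob (DBpt U X Y)" "mtgt \<phi> \<in> Ob (DBpt U X Y)" using f unfolding DBpt_Arr_iff by auto
  show "msrc (Q_arr (classify_arr \<phi>)) = msrc \<phi>" "mtgt (Q_arr (classify_arr \<phi>)) = mtgt \<phi>"
    using Q_classify[OF o(1)] Q_classify[OF o(2)] by (simp_all add: Q_arr_def classify_arr_def)
  show "linmor_at (Q_arr (classify_arr \<phi>)) A = linmor_at \<phi> A" if "A \<in> Ob X" for A
    using Q_arr_at[OF tnt_classify_arr[OF f] that] that by (simp add: classify_arr_def)
qed

lemma classify_arr_Q:
  assumes t [simp]: "tangent_nat_trans X (DB Y) \<theta>"
  shows "classify_arr (Q_arr \<theta>) = \<theta>"
proof (rule K.XY.tnt_eqI[OF tnt_classify_arr[OF Q_arr_Arr[OF t]] t])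
  have [simp]: "lax_tangent_morphism X (DB Y) (nsrc \<theta>)" "lax_tangent_morphism X (DB Y) (ntgt \<theta>)"
    using K.XY.tnt_typing(1,2)[OF assms(1)] by auto
  show "nsrc (classify_arr (Q_arr \<theta>)) = nsrc \<theta>" "ntgt (classify_arr (Q_arr \<theta>)) = ntgt \<theta>"
    by (simp_all add: classify_arr_def Q_arr_def classify_Q)
  show "ncmp (classify_arr (Q_arr \<theta>)) A = ncmp \<theta> A" if "A \<in> Ob X" for A
    using that Q_arr_at[OF t that] by (simp add: classify_arr_def)
qed

lemma Q_pre_To:
  assumes F [simp]: "lax_tangent_morphism X (DB Y) F"
  shows "T_bundle H (Q_pre F) = Q_pre (Tbar X (DB Y) F)" "T2_bundle H (Q_pre F) = Q_pre (T2bar X (DB Y) F)"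
proof -
  have T [simp]: "lax_tangent_morphism X (DB Y) (Tbar X (DB Y) F)" "lax_tangent_morphism X (DB Y) (T2bar X (DB Y) F)"
    by (rule K.XY.lax_Tbar[OF F], rule K.XY.lax_T2bar[OF F])
  note o = Q_pre_Ob[OF F]
  have tq: "tangent_nat_trans X Y (bq (Q_pre F))" using bundle_typedD(1) o unfolding DBpt_Ob_iff by blast
  show "T_bundle H (Q_pre F) = Q_pre (Tbar X (DB Y) F)"
    by (rule bundle_eqI[OF T_bundle_Ob(1)[OF o] Q_pre_Ob[OF T(1)]])
      (use T_bundle_Ob(2)[OF o] in \<open>simp_all add: Base_Tot_comp del: bundle_at_pre\<close>)
  show "T2_bundle H (Q_pre F) = Q_pre (T2bar X (DB Y) F)"
    by (rule bundle_eqI[OF T2_bundle_Ob(1)[OF o] Q_pre_Ob[OF T(2)]])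
      (use T2_bundle_Ob(2)[OF o] Hom_T2a(2,3)[OF tq] in \<open>simp_all add: Base_Tot_comp del: bundle_at_pre\<close>)
qed

text \<open>The inverse is classification. The structure maps agree because \<open>Base\<close> and \<open>Tot\<close> are strict.\<close>

theorem tcat_iso_Q: "tcat_iso (Hom X (DB Y)) (DBpt U X Y) (bundle_pre X Y (univ_bundle Y)) Q_arr"
proof (unfold_locales)
  let ?C = "Hom X (DB Y)"
  show "bij_betw (bundle_pre X Y (univ_bundle Y)) (Ob ?C) (Ob (DBpt U X Y))"
    by (rule bij_betw_byWitness[where f' = classify])
      (use lax_classify Q_pre_Ob in \<open>auto simp: classify_Q Q_classify\<close>)
  show "bij_betw Q_arr (Arr ?C) (Arr (DBpt U X Y))"
    by (rule bij_betw_byWitness[where f' = classify_arr])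
      (use tnt_classify_arr Q_arr_Arr in \<open>auto simp: classify_arr_Q Q_classify_arr\<close>)
  fix F assume "F \<in> Ob ?C"
  then have F [simp]: "lax_tangent_morphism X (DB Y) F" by simp
  show "Ident (DBpt U X Y) (Q_pre F) = Q_arr (Ident ?C F)"
    by (rule linmor_eqI; (rule nt_eqI)?) (simp_all add: Q_arr_def)
  show "To (DBpt U X Y) (Q_pre F) = Q_pre (To ?C F)" by (simp add: Q_pre_To)
  show "tp (DBpt U X Y) (Q_pre F) = Q_arr (tp ?C F)" "tpi1 (DBpt U X Y) (Q_pre F) = Q_arr (tpi1 ?C F)"
    "tpi2 (DBpt U X Y) (Q_pre F) = Q_arr (tpi2 ?C F)" "tz (DBpt U X Y) (Q_pre F) = Q_arr (tz ?C F)"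
    "ts (DBpt U X Y) (Q_pre F) = Q_arr (ts ?C F)"
    by (rule linmor_eqI; (rule nt_eqI)?; simp add: Q_arr_def Q_pre_To Base_Tot_comp)+
  show "tl (DBpt U X Y) (Q_pre F) = Q_arr (tl ?C F)" "tc (DBpt U X Y) (Q_pre F) = Q_arr (tc ?C F)"
    by (rule linmor_eqI; (rule nt_eqI)?; simp add: Q_arr_def Q_pre_To Base_Tot_comp K.XY.lax_Tbar)+
next
  let ?C = "Hom X (DB Y)"
  fix f assume "f \<in> Arr ?C"
  then have f [simp]: "tangent_nat_trans X (DB Y) f" by simp
  have [simp]: "lax_tangent_morphism X (DB Y) (nsrc f)" "lax_tangent_morphism X (DB Y) (ntgt f)"
    using K.XY.tnt_typing(1,2)[OF f] by auto
  show "Dom (DBpt U X Y) (Q_arr f) = Q_pre (Dom ?C f)" "Cod (DBpt U X Y) (Q_arr f) = Q_pre (Cod ?C f)"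
    by (simp_all add: Q_arr_def)
  show "Ta (DBpt U X Y) (Q_arr f) = Q_arr (Ta ?C f)"
    by (rule linmor_eqI; (rule nt_eqI)?) (simp_all add: Q_arr_def Q_pre_To Base_Tot_comp)
  fix g assume "g \<in> Arr ?C" "Cod ?C f = Dom ?C g"
  then have g [simp]: "tangent_nat_trans X (DB Y) g" and e: "ntgt f = nsrc g" by simp_all
  show "Q_arr g \<bullet>\<^bsub>DBpt U X Y\<^esub> Q_arr f = Q_arr (g \<bullet>\<^bsub>?C\<^esub> f)"
    by (rule linmor_eqI; (rule nt_eqI)?) (simp_all add: Q_arr_def e)
qed

end

section \<open>Functoriality of precomposition\<close>

lemma whisker_left_right:
  fixes W :: "('o0, 'a0) tcat" and X :: "('o1, 'a1) tcat" and V :: "('o2, 'a2) tcat" and Y :: "('o3, 'a3) tcat"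
  assumes "lax_tangent_morphism W X K" "tangent_nat_trans X V \<theta>" "lax_tangent_morphism V Y G"
  shows "nt_whisker_right W Y (nt_whisker_left X Y G \<theta>) K = nt_whisker_left W Y G (nt_whisker_right W V \<theta> K)"
proof -
  interpret K: tangent_pair W X by (rule lax_tangent_pair[OF assms(1)])
  have l: "lax_tangent_morphism X V (nsrc \<theta>)" "lax_tangent_morphism X V (ntgt \<theta>)"
    using assms(2) unfolding tangent_nat_trans_def by blast+
  show ?thesis
    by (rule nt_ext[where S = "Ob W"])
      (use assms(1) in \<open>simp_all add: tng_comp_assoc[OF assms(1) l(1) assms(3)] tng_comp_assoc[OF assms(1) l(2) assms(3)]\<close>)
qed

lemma whisker_left_comp:
  fixes W :: "('o0, 'a0) tcat" and X :: "('o1, 'a1) tcat" and V :: "('o2, 'a2) tcat" and Y :: "('o3, 'a3) tcat"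
  assumes "tangent_nat_trans W X \<kappa>" "lax_tangent_morphism X V F" "lax_tangent_morphism V Y G"
  shows "nt_whisker_left W Y G (nt_whisker_left W V F \<kappa>) = nt_whisker_left W Y (tng_comp X Y G F) \<kappa>"
proof -
  have l: "lax_tangent_morphism W X (nsrc \<kappa>)" "lax_tangent_morphism W X (ntgt \<kappa>)"
    using assms(1) unfolding tangent_nat_trans_def by blast+
  interpret K: tangent_pair W X by (rule lax_tangent_pair[OF l(1)])
  show ?thesis
    by (rule nt_ext[where S = "Ob W"])
      (use assms(1) in \<open>simp_all add: tng_comp_assoc[OF l(1) assms(2,3)] tng_comp_assoc[OF l(2) assms(2,3)]\<close>)
qed

lemma whisker_right_ident:
  fixes X :: "('o1, 'a1) tcat" and Y :: "('o2, 'a2) tcat"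
  assumes "tangent_nat_trans X Y \<psi>"
  shows "nt_whisker_right X Y \<psi> (tng_ident X) = \<psi>"
proof -
  have l: "lax_tangent_morphism X Y (nsrc \<psi>)" "lax_tangent_morphism X Y (ntgt \<psi>)"
    using assms unfolding tangent_nat_trans_def by blast+
  interpret tangent_pair X Y by (rule lax_tangent_pair[OF l(1)])
  show ?thesis
    by (rule nt_ext[where S = "Ob X"])
      (use tnt_extensional[OF assms] in \<open>simp_all add: tng_comp_ident_right l, simp add: tng_ident_def\<close>)
qed

lemma bundle_pre_comp:
  fixes W :: "('o0, 'a0) tcat" and X :: "('o1, 'a1) tcat" and V :: "('o2, 'a2) tcat" and Y :: "('o3, 'a3) tcat"
  assumes "lax_tangent_morphism W X K" "lax_tangent_morphism X V F" "tangent_pair V Y" "tangent_pair.bundle_typed V Y b"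
  shows "bundle_pre W Y (bundle_pre X Y b F) K = bundle_pre W Y b (tng_comp W V F K)"
proof -
  interpret tangent_pair V Y by (rule assms(3))
  note t = bundle_typedD(1-6)[OF assms(4)]
  show ?thesis
    unfolding bundle_pre_def by (simp add: t[THEN whisker_right_comp[OF assms(1,2)]])
qed

lemma bundle_pre_ident:
  fixes X :: "('o1, 'a1) tcat" and Y :: "('o2, 'a2) tcat"
  assumes "tangent_pair X Y" "tangent_pair.bundle_typed X Y b"
  shows "bundle_pre X Y b (tng_ident X) = b"
proof -
  interpret tangent_pair X Y by (rule assms(1))
  note t = bundle_typedD(1-6)[OF assms(2)]
  show ?thesis unfolding bundle_pre_def by (simp add: t[THEN whisker_right_ident])
qed

context tangent_pair
begin

lemma strictD:
  assumes "strict_tangent_morphism X Y F"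
  shows "lax_tangent_morphism X Y F" "A \<in> Ob X \<Longrightarrow> lstr F A = Ident Y (fobj F (To X A))"
    "A \<in> Ob X \<Longrightarrow> fobj F (To X A) = To Y (fobj F A)"
proof -
  show l: "lax_tangent_morphism X Y F" and i: "A \<in> Ob X \<Longrightarrow> lstr F A = Ident Y (fobj F (To X A))"
    using assms unfolding strict_tangent_morphism_def by auto
  assume A: "A \<in> Ob X"
  then have "Cod Y (lstr F A) = fobj F (To X A)" using l i by simp
  then show "fobj F (To X A) = To Y (fobj F A)" using l A by simp
qed

lemma strict_eqI:
  assumes "strict_tangent_morphism X Y F" "strict_tangent_morphism X Y G"
    "\<And>A. A \<in> Ob X \<Longrightarrow> fobj F A = fobj G A" "\<And>f. f \<in> Arr X \<Longrightarrow> farr F f = farr G f"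
  shows "F = G"
  by (rule lmor_eqI) (use assms strictD in simp_all)

end

context tangent_triple
begin

lemma strict_comp:
  assumes F: "strict_tangent_morphism X Y F" and G: "strict_tangent_morphism Y Z G"
  shows "strict_tangent_morphism X Z (tng_comp X Z G F)"
  unfolding strict_tangent_morphism_def
proof (intro conjI ballI)
  note f = XY.strictD[OF F] and g = YZ.strictD[OF G]
  show "lax_tangent_morphism X Z (tng_comp X Z G F)" by (rule lax_comp[OF f(1) g(1)])
  fix A assume "A \<in> Ob X"
  then show "lstr (tng_comp X Z G F) A = Ident Z (fobj (tng_comp X Z G F) (To X A))"
    using f g by simp
qed

lemma functorial_whisker_left:
  assumes G [simp]: "lax_tangent_morphism Y Z G"
  shows "functorial (Hom X Y) (Hom X Z) (\<lambda>F. tng_comp X Z G F) (nt_whisker_left X Z G)"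
  unfolding functorial_def
proof (intro conjI ballI impI)
  fix F assume "F \<in> Ob (Hom X Y)"
  then have F [simp]: "lax_tangent_morphism X Y F" by simp
  show "tng_comp X Z G F \<in> Ob (Hom X Z)" by (simp add: lax_comp)
  show "nt_whisker_left X Z G (Ident (Hom X Y) F) = Ident (Hom X Z) (tng_comp X Z G F)"
    by (rule nt_ext[where S = "Ob X"]) simp_all
next
  fix f assume "f \<in> Arr (Hom X Y)"
  then have f [simp]: "tangent_nat_trans X Y f" by simp
  show "nt_whisker_left X Z G f \<in> hom (Hom X Z) (tng_comp X Z G (Dom (Hom X Y) f)) (tng_comp X Z G (Cod (Hom X Y) f))"
    by (simp add: tnt_whisker_left)
  fix g assume "g \<in> Arr (Hom X Y)" "Cod (Hom X Y) f = Dom (Hom X Y) g"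
  then have g [simp]: "tangent_nat_trans X Y g" and e: "ntgt f = nsrc g" by simp_all
  show "nt_whisker_left X Z G (g \<bullet>\<^bsub>Hom X Y\<^esub> f) = nt_whisker_left X Z G g \<bullet>\<^bsub>Hom X Z\<^esub> nt_whisker_left X Z G f"
    by (rule nt_ext[where S = "Ob X"]) (simp_all add: e)
qed

lemma functorial_whisker_right:
  assumes F [simp]: "lax_tangent_morphism X Y F"
  shows "functorial (Hom Y Z) (Hom X Z) (\<lambda>G. tng_comp X Z G F) (\<lambda>\<psi>. nt_whisker_right X Z \<psi> F)"
  unfolding functorial_def
proof (intro conjI ballI impI)
  fix G assume "G \<in> Ob (Hom Y Z)"
  then have G [simp]: "lax_tangent_morphism Y Z G" by simp
  show "tng_comp X Z G F \<in> Ob (Hom X Z)" by (simp add: lax_comp)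
  show "nt_whisker_right X Z (Ident (Hom Y Z) G) F = Ident (Hom X Z) (tng_comp X Z G F)"
    by (rule nt_ext[where S = "Ob X"]) simp_all
next
  fix f assume "f \<in> Arr (Hom Y Z)"
  then have f [simp]: "tangent_nat_trans Y Z f" by simp
  show "nt_whisker_right X Z f F \<in> hom (Hom X Z) (tng_comp X Z (Dom (Hom Y Z) f) F) (tng_comp X Z (Cod (Hom Y Z) f) F)"
    by (simp add: tnt_whisker_right)
  fix g assume "g \<in> Arr (Hom Y Z)" "Cod (Hom Y Z) f = Dom (Hom Y Z) g"
  then have g [simp]: "tangent_nat_trans Y Z g" and e: "ntgt f = nsrc g" by simp_all
  show "nt_whisker_right X Z (g \<bullet>\<^bsub>Hom Y Z\<^esub> f) F = nt_whisker_right X Z g F \<bullet>\<^bsub>Hom X Z\<^esub> nt_whisker_right X Z f F"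
    by (rule nt_ext[where S = "Ob X"]) (simp_all add: e)
qed

lemma hom_pre_simps [simp]:
  "lax_tangent_morphism Y Z F \<Longrightarrow> fobj (hom_pre X Y Z K) F = tng_comp X Z F K"
  "tangent_nat_trans Y Z \<theta> \<Longrightarrow> farr (hom_pre X Y Z K) \<theta> = nt_whisker_right X Z \<theta> K"
  "lax_tangent_morphism Y Z F \<Longrightarrow> lstr (hom_pre X Y Z K) F = Ident (Hom X Z) (tng_comp X Z (Tbar Y Z F) K)"
  "nsrc (hom_pre2 X Y Z \<kappa>) = hom_pre X Y Z (nsrc \<kappa>)" "ntgt (hom_pre2 X Y Z \<kappa>) = hom_pre X Y Z (ntgt \<kappa>)"
  "lax_tangent_morphism Y Z F \<Longrightarrow> ncmp (hom_pre2 X Y Z \<kappa>) F = nt_whisker_left X Z F \<kappa>"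
  "fobj (hom_pre X Y Z K) \<in> extensional {F. lax_tangent_morphism Y Z F}"
  "farr (hom_pre X Y Z K) \<in> extensional {\<theta>. tangent_nat_trans Y Z \<theta>}"
  "lstr (hom_pre X Y Z K) \<in> extensional {F. lax_tangent_morphism Y Z F}"
  "ncmp (hom_pre2 X Y Z \<kappa>) \<in> extensional {F. lax_tangent_morphism Y Z F}"
  by (simp_all add: hom_pre_def hom_pre2_def)

lemma strict_hom_pre:
  assumes K [simp]: "lax_tangent_morphism X Y K"
  shows "strict_tangent_morphism (Hom Y Z) (Hom X Z) (hom_pre X Y Z K)"
proof -
  interpret P: tangent_pair "Hom Y Z" "Hom X Z" by unfold_locales
  note fn = functorial_whisker_right[OF K, unfolded functorial_def]
  show ?thesis
  proof (rule P.strict_tangent_morphismI)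
    fix G assume "G \<in> Ob (Hom Y Z)"
    then have G [simp]: "lax_tangent_morphism Y Z G" by simp
    show "fobj (hom_pre X Y Z K) G \<in> Ob (Hom X Z)" by (simp add: lax_comp)
    show "farr (hom_pre X Y Z K) (Ident (Hom Y Z) G) = Ident (Hom X Z) (fobj (hom_pre X Y Z K) G)"
      using fn by simp
    show "lstr (hom_pre X Y Z K) G = Ident (Hom X Z) (fobj (hom_pre X Y Z K) (To (Hom Y Z) G))" by simp
    show "fobj (hom_pre X Y Z K) (To (Hom Y Z) G) = To (Hom X Z) (fobj (hom_pre X Y Z K) G)"
      by (simp add: Tbar_comp)
    show "farr (hom_pre X Y Z K) (tp (Hom Y Z) G) = tp (Hom X Z) (fobj (hom_pre X Y Z K) G)"
      "farr (hom_pre X Y Z K) (tpi1 (Hom Y Z) G) = tpi1 (Hom X Z) (fobj (hom_pre X Y Z K) G)"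
      "farr (hom_pre X Y Z K) (tpi2 (Hom Y Z) G) = tpi2 (Hom X Z) (fobj (hom_pre X Y Z K) G)"
      "farr (hom_pre X Y Z K) (tz (Hom Y Z) G) = tz (Hom X Z) (fobj (hom_pre X Y Z K) G)"
      "farr (hom_pre X Y Z K) (ts (Hom Y Z) G) = ts (Hom X Z) (fobj (hom_pre X Y Z K) G)"
      "farr (hom_pre X Y Z K) (tl (Hom Y Z) G) = tl (Hom X Z) (fobj (hom_pre X Y Z K) G)"
      "farr (hom_pre X Y Z K) (tc (Hom Y Z) G) = tc (Hom X Z) (fobj (hom_pre X Y Z K) G)"
      by (rule nt_ext[where S = "Ob X"]; simp add: Tbar_comp T2bar_comp)+
  next
    fix f assume "f \<in> Arr (Hom Y Z)"
    then have f [simp]: "tangent_nat_trans Y Z f" by simp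
    show "farr (hom_pre X Y Z K) f \<in> Arr (Hom X Z) \<and> Dom (Hom X Z) (farr (hom_pre X Y Z K) f) = fobj (hom_pre X Y Z K) (Dom (Hom Y Z) f) \<and>
      Cod (Hom X Z) (farr (hom_pre X Y Z K) f) = fobj (hom_pre X Y Z K) (Cod (Hom Y Z) f)"
      by (simp add: tnt_whisker_right)
    show "farr (hom_pre X Y Z K) (Ta (Hom Y Z) f) = Ta (Hom X Z) (farr (hom_pre X Y Z K) f)"
      by (rule nt_ext[where S = "Ob X"]) (simp_all add: Tbar_comp)
    fix g assume "g \<in> Arr (Hom Y Z)" "Cod (Hom Y Z) f = Dom (Hom Y Z) g"
    then show "farr (hom_pre X Y Z K) (g \<bullet>\<^bsub>Hom Y Z\<^esub> f) = farr (hom_pre X Y Z K) g \<bullet>\<^bsub>Hom X Z\<^esub> farr (hom_pre X Y Z K) f"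
      using fn by simp
  qed simp_all
qed

lemma functorial_hom_pre:
  "functorial (Hom X Y) (Hom (Hom Y Z) (Hom X Z)) (hom_pre X Y Z) (hom_pre2 X Y Z)"
proof -
  interpret P: tangent_pair "Hom Y Z" "Hom X Z" by unfold_locales
  note l = strict_hom_pre[THEN P.strictD(1)]
  have t: "tangent_nat_trans (Hom Y Z) (Hom X Z) (hom_pre2 X Y Z \<kappa>)" if k [simp]: "tangent_nat_trans X Y \<kappa>" for \<kappa>
  proof (rule P.tangent_nat_transI)
    have s [simp]: "lax_tangent_morphism X Y (nsrc \<kappa>)" "lax_tangent_morphism X Y (ntgt \<kappa>)" using XY.tnt_typing(1,2)[OF k] by auto
    show "lax_tangent_morphism (Hom Y Z) (Hom X Z) (nsrc (hom_pre2 X Y Z \<kappa>))"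
      "lax_tangent_morphism (Hom Y Z) (Hom X Z) (ntgt (hom_pre2 X Y Z \<kappa>))" using l[OF s(1)] l[OF s(2)] by simp_all
    fix G assume "G \<in> Ob (Hom Y Z)"
    then have G [simp]: "lax_tangent_morphism Y Z G" by simp
    show "ncmp (hom_pre2 X Y Z \<kappa>) G \<in> Arr (Hom X Z) \<and> Dom (Hom X Z) (ncmp (hom_pre2 X Y Z \<kappa>) G) = fobj (nsrc (hom_pre2 X Y Z \<kappa>)) G \<and>
      Cod (Hom X Z) (ncmp (hom_pre2 X Y Z \<kappa>) G) = fobj (ntgt (hom_pre2 X Y Z \<kappa>)) G" by (simp add: tnt_whisker_left)
    show "Ta (Hom X Z) (ncmp (hom_pre2 X Y Z \<kappa>) G) \<bullet>\<^bsub>Hom X Z\<^esub> lstr (nsrc (hom_pre2 X Y Z \<kappa>)) G =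
      lstr (ntgt (hom_pre2 X Y Z \<kappa>)) G \<bullet>\<^bsub>Hom X Z\<^esub> ncmp (hom_pre2 X Y Z \<kappa>) (To (Hom Y Z) G)"
      by (rule nt_ext[where S = "Ob X"]) (simp_all add: Tbar_comp lax_comp)
  next
    fix f assume "f \<in> Arr (Hom Y Z)"
    then have f [simp]: "tangent_nat_trans Y Z f" by simp
    show "ncmp (hom_pre2 X Y Z \<kappa>) (Cod (Hom Y Z) f) \<bullet>\<^bsub>Hom X Z\<^esub> farr (nsrc (hom_pre2 X Y Z \<kappa>)) f =
      farr (ntgt (hom_pre2 X Y Z \<kappa>)) f \<bullet>\<^bsub>Hom X Z\<^esub> ncmp (hom_pre2 X Y Z \<kappa>) (Dom (Hom Y Z) f)"
      by (rule nt_ext[where S = "Ob X"]) (simp_all add: YZ.tnt_nat)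
  qed simp_all
  show ?thesis
    unfolding functorial_def
  proof (intro conjI ballI impI)
    fix K assume "K \<in> Ob (Hom X Y)"
    then have K [simp]: "lax_tangent_morphism X Y K" by simp
    show "hom_pre X Y Z K \<in> Ob (Hom (Hom Y Z) (Hom X Z))" using l[OF K] by simp
    show "hom_pre2 X Y Z (Ident (Hom X Y) K) = Ident (Hom (Hom Y Z) (Hom X Z)) (hom_pre X Y Z K)"
    proof (rule nt_ext[where S = "Ob (Hom Y Z)"])
      fix G assume G: "G \<in> Ob (Hom Y Z)"
      then show "ncmp (hom_pre2 X Y Z (Ident (Hom X Y) K)) G = ncmp (Ident (Hom (Hom Y Z) (Hom X Z)) (hom_pre X Y Z K)) G"
        using functorial_whisker_left[of G] P.Hom_Cmp_simps(6)[OF G] unfolding functorial_def by simp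
    qed (use P.Hom_extensional(2) in simp_all)
  next
    fix f assume "f \<in> Arr (Hom X Y)"
    then have f [simp]: "tangent_nat_trans X Y f" by simp
    show "hom_pre2 X Y Z f \<in> hom (Hom (Hom Y Z) (Hom X Z)) (hom_pre X Y Z (Dom (Hom X Y) f)) (hom_pre X Y Z (Cod (Hom X Y) f))"
      using t[OF f] by simp
    fix g assume g: "g \<in> Arr (Hom X Y)" "Cod (Hom X Y) f = Dom (Hom X Y) g"
    show "hom_pre2 X Y Z (g \<bullet>\<^bsub>Hom X Y\<^esub> f) = hom_pre2 X Y Z g \<bullet>\<^bsub>Hom (Hom Y Z) (Hom X Z)\<^esub> hom_pre2 X Y Z f"
    proof (rule nt_ext[where S = "Ob (Hom Y Z)"])
      fix G assume G: "G \<in> Ob (Hom Y Z)"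
      then show "ncmp (hom_pre2 X Y Z (g \<bullet>\<^bsub>Hom X Y\<^esub> f)) G = ncmp (hom_pre2 X Y Z g \<bullet>\<^bsub>Hom (Hom Y Z) (Hom X Z)\<^esub> hom_pre2 X Y Z f) G"
        using functorial_whisker_left[of G] P.Hom_Cmp_simps(3)[OF G] g unfolding functorial_def by simp
    qed (use P.Hom_extensional(1) in simp_all)
  qed
qed

end

section \<open>Representability\<close>

lemma tnt_lax:
  assumes "tangent_nat_trans X Y \<phi>"
  shows "lax_tangent_morphism X Y (nsrc \<phi>)" "lax_tangent_morphism X Y (ntgt \<phi>)"
  using assms unfolding tangent_nat_trans_def by blast+

lemma functorial_compose:
  assumes "functorial A B Fo Fa" "functorial B C Go Ga"
  shows "functorial A C (\<lambda>x. Go (Fo x)) (\<lambda>f. Ga (Fa f))"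
proof -
  have F: "Fo x \<in> Ob B" if "x \<in> Ob A" for x using assms(1) that unfolding functorial_def by blast
  have Fa: "Fa f \<in> Arr B" "Dom B (Fa f) = Fo (Dom A f)" "Cod B (Fa f) = Fo (Cod A f)" if "f \<in> Arr A" for f
    using assms(1) that unfolding functorial_def by auto
  have Fi: "Fa (Ident A x) = Ident B (Fo x)" if "x \<in> Ob A" for x using assms(1) that unfolding functorial_def by blast
  have Fc: "Fa (g \<bullet>\<^bsub>A\<^esub> f) = Fa g \<bullet>\<^bsub>B\<^esub> Fa f" if "f \<in> Arr A" "g \<in> Arr A" "Cod A f = Dom A g" for f g
    using assms(1) that unfolding functorial_def by blast
  have G: "Go x \<in> Ob C" if "x \<in> Ob B" for x using assms(2) that unfolding functorial_def by blast
  have Ga: "Ga f \<in> Arr C" "Dom C (Ga f) = Go (Dom B f)" "Cod C (Ga f) = Go (Cod B f)" if "f \<in> Arr B" for f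
    using assms(2) that unfolding functorial_def by auto
  have Gi: "Ga (Ident B x) = Ident C (Go x)" if "x \<in> Ob B" for x using assms(2) that unfolding functorial_def by blast
  have Gc: "Ga (g \<bullet>\<^bsub>B\<^esub> f) = Ga g \<bullet>\<^bsub>C\<^esub> Ga f" if "f \<in> Arr B" "g \<in> Arr B" "Cod B f = Dom B g" for f g
    using assms(2) that unfolding functorial_def by blast
  show ?thesis unfolding functorial_def
    by (intro conjI ballI impI) (simp_all add: F Fa Fi Fc G Ga Gi Gc)
qed

lemma functorial_cong:
  assumes "functorial A B Fo Fa" "category A" "\<And>x. x \<in> Ob A \<Longrightarrow> Go x = Fo x" "\<And>f. f \<in> Arr A \<Longrightarrow> Ga f = Fa f"
  shows "functorial A B Go Ga"
proof -
  interpret category_on A using assms(2) by unfold_locales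
  show ?thesis using assms(1,3,4) unfolding functorial_def by simp
qed

context db_pair
begin

lemma GamQ_iso: "GamQ U X Y = tcat_iso.iso_lmor (Hom X (DB Y)) (DBpt U X Y) (bundle_pre X Y (univ_bundle Y)) Q_arr"
  unfolding tcat_iso.iso_lmor_def[OF tcat_iso_Q] Gam_def by (simp add: Q_arr_def[abs_def])

end

locale db_change = tangent_triple W X Y + B: db_on Y
  for W :: "('o1, 'a1) tcat" and X :: "('o2, 'a2) tcat" and Y :: "('o, 'a) tcat" +
  fixes U :: "('ou \<times> 'au) itself"

sublocale db_change \<subseteq> P1: db_pair X Y by unfold_locales
sublocale db_change \<subseteq> P2: db_pair W Y by unfold_locales
sublocale db_change \<subseteq> TD: tangent_triple W X "DB Y" by unfold_locales

context db_change
begin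

lemma iso1: "tcat_iso (Hom X (DB Y)) (DBpt U X Y) (bundle_pre X Y (univ_bundle Y)) P1.Q_arr" by (rule P1.tcat_iso_Q)
lemma iso2: "tcat_iso (Hom W (DB Y)) (DBpt U W Y) (bundle_pre W Y (univ_bundle Y)) P2.Q_arr" by (rule P2.tcat_iso_Q)

end

sublocale db_change \<subseteq> I1: tcat_iso "Hom X (DB Y)" "DBpt U X Y" "bundle_pre X Y (univ_bundle Y)" P1.Q_arr by (rule iso1)
sublocale db_change \<subseteq> I2: tcat_iso "Hom W (DB Y)" "DBpt U W Y" "bundle_pre W Y (univ_bundle Y)" P2.Q_arr by (rule iso2)
sublocale db_change \<subseteq> D12: tangent_pair "DBpt U X Y" "DBpt U W Y" by unfold_locales
sublocale db_change \<subseteq> T1: tangent_triple "Hom X (DB Y)" "Hom W (DB Y)" "DBpt U W Y" by unfold_locales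
sublocale db_change \<subseteq> T2: tangent_triple "DBpt U X Y" "Hom X (DB Y)" "DBpt U W Y" by unfold_locales

context db_change
begin

text \<open>Precomposition on classifying morphisms, conjugated with \<open>\<Gamma>\<close>. Being a composite of functorial
  constructions, it is the form from which strictness and functoriality are read off.\<close>

abbreviation (input) "via \<equiv> (\<lambda>K. tng_comp (DBpt U X Y) (DBpt U W Y)
   (tng_comp (Hom X (DB Y)) (DBpt U W Y) I2.iso_lmor (hom_pre W X (DB Y) K)) I1.inv_lmor)"

abbreviation (input) "via2 \<equiv> (\<lambda>\<kappa>. nt_whisker_right (DBpt U X Y) (DBpt U W Y)
   (nt_whisker_left (Hom X (DB Y)) (DBpt U W Y) I2.iso_lmor (hom_pre2 W X (DB Y) \<kappa>)) I1.inv_lmor)"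

lemma strict_via: "lax_tangent_morphism W X K \<Longrightarrow> strict_tangent_morphism (DBpt U X Y) (DBpt U W Y) (via K)"
  by (intro T2.strict_comp T1.strict_comp I1.strict_inv_lmor I2.strict_iso_lmor TD.strict_hom_pre)

lemma I_simps:
  "b \<in> Ob (DBpt U X Y) \<Longrightarrow> fobj I1.inv_lmor b = I1.go b" "\<phi> \<in> Arr (DBpt U X Y) \<Longrightarrow> farr I1.inv_lmor \<phi> = I1.ga \<phi>"
  "lax_tangent_morphism W (DB Y) F \<Longrightarrow> fobj I2.iso_lmor F = bundle_pre W Y (univ_bundle Y) F"
  "tangent_nat_trans W (DB Y) \<theta> \<Longrightarrow> farr I2.iso_lmor \<theta> = P2.Q_arr \<theta>"
  by (simp_all add: I1.inv_lmor_def I2.iso_lmor_def)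

lemma go1:
  assumes "b \<in> Ob (DBpt U X Y)"
  shows "lax_tangent_morphism X (DB Y) (I1.go b)" "bundle_pre X Y (univ_bundle Y) (I1.go b) = b"
  using I1.go(1,2)[OF assms] by simp_all

lemma ga1:
  assumes "\<phi> \<in> Arr (DBpt U X Y)"
  shows "tangent_nat_trans X (DB Y) (I1.ga \<phi>)" "P1.Q_arr (I1.ga \<phi>) = \<phi>"
  using I1.ga(1,2)[OF assms] by simp_all

lemma univ_pre_comp:
  assumes "lax_tangent_morphism W X K" "lax_tangent_morphism X (DB Y) F"
  shows "bundle_pre W Y (bundle_pre X Y (univ_bundle Y) F) K = bundle_pre W Y (univ_bundle Y) (tng_comp W (DB Y) F K)"
  by (rule bundle_pre_comp[OF assms B.DBX.tangent_pair_axioms B.univ_bundle_typed])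

text \<open>A bundle is \<open>Q\<^sub>F\<close> for its classifying morphism \<open>F\<close>, and \<open>(Q\<^sub>F)\<^sub>K = Q\<^bsub>F K\<^esub>\<close>.\<close>

lemma DBpt_pre_eq:
  assumes K: "lax_tangent_morphism W X K"
  shows "DBpt_pre U W X Y K = via K"
proof -
  have ob: "bundle_pre W Y b K = fobj (via K) b" if b: "b \<in> Ob (DBpt U X Y)" for b
    using univ_pre_comp[OF K go1(1)[OF b]] b go1[OF b] K by (simp add: I_simps TD.lax_comp)
  show ?thesis
  proof (rule lmor_ext[where S = "Ob (DBpt U X Y)" and T = "Arr (DBpt U X Y)"])
    fix b assume b: "b \<in> Ob (DBpt U X Y)"
    then show "fobj (DBpt_pre U W X Y K) b = fobj (via K) b" using ob by (simp add: DBpt_pre_def)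
    have "T_bundle (Hom X Y) b \<in> Ob (DBpt U X Y)" by (rule P1.T_bundle_Ob(1)[OF b])
    then show "lstr (DBpt_pre U W X Y K) b = lstr (via K) b"
      using D12.strictD(2)[OF strict_via[OF K] b] ob[of "T_bundle (Hom X Y) b"] b by (simp add: DBpt_pre_def del: tng_comp_simps)
  next
    fix \<phi> assume f: "\<phi> \<in> Arr (DBpt U X Y)"
    note t [simp] = ga1(1)[OF f] K
    have l [simp]: "lax_tangent_morphism X (DB Y) (nsrc (I1.ga \<phi>))" "lax_tangent_morphism X (DB Y) (ntgt (I1.ga \<phi>))"
      using tnt_lax[OF t(1)] by auto
    have \<phi>: "\<phi> = P1.Q_arr (I1.ga \<phi>)" using ga1(2)[OF f] by simp
    have "farr (via K) \<phi> = P2.Q_arr (nt_whisker_right W (DB Y) (I1.ga \<phi>) K)"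
      using f by (simp add: I_simps TD.tnt_whisker_right)
    also have "\<dots> = \<lparr>msrc = bundle_pre W Y (msrc (P1.Q_arr (I1.ga \<phi>))) K, mtgt = bundle_pre W Y (mtgt (P1.Q_arr (I1.ga \<phi>))) K,
         mbase = nt_whisker_right W Y (mbase (P1.Q_arr (I1.ga \<phi>))) K, mtot = nt_whisker_right W Y (mtot (P1.Q_arr (I1.ga \<phi>))) K\<rparr>"
      by (simp add: P1.Q_arr_def P2.Q_arr_def univ_pre_comp whisker_left_right[OF K t(1)])
    finally show "farr (DBpt_pre U W X Y K) \<phi> = farr (via K) \<phi>"
      using f \<phi> by (simp add: DBpt_pre_def)
  qed (simp_all add: DBpt_pre_def)
qed

lemma strict_DBpt_pre: "lax_tangent_morphism W X K \<Longrightarrow> strict_tangent_morphism (DBpt U X Y) (DBpt U W Y) (DBpt_pre U W X Y K)"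
  unfolding DBpt_pre_eq by (rule strict_via)

lemma DBpt_pre2_eq:
  assumes k [simp]: "tangent_nat_trans W X \<kappa>"
  shows "DBpt_pre2 U W X Y \<kappa> = via2 \<kappa>"
proof (rule nt_ext[where S = "Ob (DBpt U X Y)"])
  have l [simp]: "lax_tangent_morphism W X (nsrc \<kappa>)" "lax_tangent_morphism W X (ntgt \<kappa>)"
    using tnt_lax[OF k] by auto
  show "nsrc (DBpt_pre2 U W X Y \<kappa>) = nsrc (via2 \<kappa>)" "ntgt (DBpt_pre2 U W X Y \<kappa>) = ntgt (via2 \<kappa>)"
    by (simp_all add: DBpt_pre2_def DBpt_pre_eq)
  fix b assume b: "b \<in> Ob (DBpt U X Y)"
  note g [simp] = go1(1)[OF b]
  have "ncmp (via2 \<kappa>) b = P2.Q_arr (nt_whisker_left W (DB Y) (I1.go b) \<kappa>)"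
    using b by (simp add: I_simps TD.tnt_whisker_left)
  also have "\<dots> = \<lparr>msrc = bundle_pre W Y (bundle_pre X Y (univ_bundle Y) (I1.go b)) (nsrc \<kappa>),
      mtgt = bundle_pre W Y (bundle_pre X Y (univ_bundle Y) (I1.go b)) (ntgt \<kappa>),
      mbase = nt_whisker_left W Y (base (Hom X Y) (bundle_pre X Y (univ_bundle Y) (I1.go b))) \<kappa>,
      mtot = nt_whisker_left W Y (tot (Hom X Y) (bundle_pre X Y (univ_bundle Y) (I1.go b))) \<kappa>\<rparr>"
    by (simp add: P2.Q_arr_def univ_pre_comp whisker_left_comp[OF k g])
  finally show "ncmp (DBpt_pre2 U W X Y \<kappa>) b = ncmp (via2 \<kappa>) b"
    using b go1(2)[OF b] by (simp add: DBpt_pre2_def)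
qed (simp_all add: DBpt_pre2_def)

lemma functorial_DBpt_pre:
  "functorial (Hom W X) (Hom (DBpt U X Y) (DBpt U W Y)) (DBpt_pre U W X Y) (DBpt_pre2 U W X Y)"
proof (rule functorial_cong)
  show "functorial (Hom W X) (Hom (DBpt U X Y) (DBpt U W Y)) via via2"
    by (rule functorial_compose[OF functorial_compose[OF TD.functorial_hom_pre
          T1.functorial_whisker_left[OF strict_lax[OF I2.strict_iso_lmor]]]
        T2.functorial_whisker_right[OF strict_lax[OF I1.strict_inv_lmor]]])
qed (simp_all add: DBpt_pre_eq DBpt_pre2_eq XY.category_Hom)

text \<open>By \<open>DBpt_pre_eq\<close> and \<open>DBpt_pre2_eq\<close> the two sides of the naturality equations differ by
  \<open>\<Gamma>\<^sup>-\<^sup>1 \<Gamma>\<close>.\<close>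

lemma Gam_natural:
  assumes K: "lax_tangent_morphism W X K"
  shows "tng_comp (Hom X (DB Y)) (DBpt U W Y) (GamQ U W Y) (hom_pre W X (DB Y) K) =
        tng_comp (Hom X (DB Y)) (DBpt U W Y) (DBpt_pre U W X Y K) (GamQ U X Y)"
proof -
  let ?H1 = "Hom X (DB Y)" and ?D2 = "DBpt U W Y"
  let ?L = "tng_comp ?H1 ?D2 I2.iso_lmor (hom_pre W X (DB Y) K)"
  have L: "lax_tangent_morphism ?H1 ?D2 ?L"
    by (rule strict_lax[OF T1.strict_comp[OF TD.strict_hom_pre[OF K] I2.strict_iso_lmor]])
  have a: "lax_tangent_morphism ?H1 (DBpt U X Y) I1.iso_lmor" by (rule strict_lax[OF I1.strict_iso_lmor])
  have b: "lax_tangent_morphism (DBpt U X Y) ?H1 I1.inv_lmor" by (rule strict_lax[OF I1.strict_inv_lmor])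
  show ?thesis
    unfolding P1.GamQ_iso P2.GamQ_iso DBpt_pre_eq[OF K]
    using tng_comp_assoc[OF a b L] by (simp add: I1.inv_iso tng_comp_ident_right[OF L])
qed

lemma Gam_natural2:
  assumes k: "tangent_nat_trans W X \<kappa>"
  shows "nt_whisker_left (Hom X (DB Y)) (DBpt U W Y) (GamQ U W Y) (hom_pre2 W X (DB Y) \<kappa>) =
        nt_whisker_right (Hom X (DB Y)) (DBpt U W Y) (DBpt_pre2 U W X Y \<kappa>) (GamQ U X Y)"
proof -
  let ?H1 = "Hom X (DB Y)" and ?D2 = "DBpt U W Y"
  interpret P: tangent_pair ?H1 "Hom W (DB Y)" by unfold_locales
  have h: "tangent_nat_trans ?H1 (Hom W (DB Y)) (hom_pre2 W X (DB Y) \<kappa>)"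
    using TD.functorial_hom_pre k unfolding functorial_def by simp
  have L: "tangent_nat_trans ?H1 ?D2 (nt_whisker_left ?H1 ?D2 I2.iso_lmor (hom_pre2 W X (DB Y) \<kappa>))"
    by (rule T1.tnt_whisker_left[OF h strict_lax[OF I2.strict_iso_lmor]])
  have a: "lax_tangent_morphism ?H1 (DBpt U X Y) I1.iso_lmor" by (rule strict_lax[OF I1.strict_iso_lmor])
  have b: "lax_tangent_morphism (DBpt U X Y) ?H1 I1.inv_lmor" by (rule strict_lax[OF I1.strict_inv_lmor])
  show ?thesis
    unfolding P1.GamQ_iso P2.GamQ_iso DBpt_pre2_eq[OF k]
    using whisker_right_comp[OF a b L] by (simp add: I1.inv_iso whisker_right_ident[OF L])
qed

end

lemma DBpt_pre_ident:
  fixes X :: "('o1, 'a1) tcat" and Y :: "('o, 'a) tcat" and U :: "('ou \<times> 'au) itself"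
  assumes "tangent_category X" "tangent_category Y" "tangent_category (DB Y)"
  shows "DBpt_pre U X X Y (tng_ident X) = tng_ident (DBpt U X Y)"
proof -
  interpret db_change X X Y U using assms by unfold_locales
  note i = strict_ident[OF I1.tangent_category_D]
  show ?thesis
  proof (rule D12.strict_eqI[OF strict_DBpt_pre[OF lax_ident[OF assms(1)]] i])
    have id: "bundle_pre X Y b (tng_ident X) = b" if "b \<in> Ob (DBpt U X Y)" for b
      by (rule bundle_pre_ident[OF YZ.tangent_pair_axioms]) (use that in \<open>simp add: YZ.DBpt_Ob_iff\<close>)
    show "fobj (DBpt_pre U X X Y (tng_ident X)) b = fobj (tng_ident (DBpt U X Y)) b" if "b \<in> Ob (DBpt U X Y)" for b
      using that id by (simp add: DBpt_pre_def tng_ident_def[of "DBpt U X Y"])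
    fix \<phi> assume f: "\<phi> \<in> Arr (DBpt U X Y)"
    note F = f[unfolded YZ.DBpt_Arr_iff]
    have "tangent_nat_trans X Y (mbase \<phi>)" "tangent_nat_trans X Y (mtot \<phi>)" "msrc \<phi> \<in> Ob (DBpt U X Y)" "mtgt \<phi> \<in> Ob (DBpt U X Y)"
      using F by blast+
    then show "farr (DBpt_pre U X X Y (tng_ident X)) \<phi> = farr (tng_ident (DBpt U X Y)) \<phi>"
      using f by (simp add: DBpt_pre_def tng_ident_def[of "DBpt U X Y"] id whisker_right_ident)
  qed
qed

lemma DBpt_pre_comp:
  fixes V :: "('o3, 'a3) tcat" and W :: "('o1, 'a1) tcat" and X :: "('o2, 'a2) tcat" and Y :: "('o, 'a) tcat"
    and U :: "('ou \<times> 'au) itself"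
  assumes "tangent_category V" "tangent_category W" "tangent_category X" "tangent_category Y" "tangent_category (DB Y)"
    and K [simp]: "lax_tangent_morphism W X K" and J [simp]: "lax_tangent_morphism V W J"
  shows "DBpt_pre U V X Y (tng_comp V X K J) =
    tng_comp (DBpt U X Y) (DBpt U V Y) (DBpt_pre U V W Y J) (DBpt_pre U W X Y K)"
proof -
  interpret A: db_change W X Y U using assms by unfold_locales
  interpret B: db_change V W Y U using assms by unfold_locales
  interpret C: db_change V X Y U using assms by unfold_locales
  interpret T: tangent_triple V W X by unfold_locales
  interpret DT: tangent_triple "DBpt U X Y" "DBpt U W Y" "DBpt U V Y" by unfold_locales
  have KJ: "lax_tangent_morphism V X (tng_comp V X K J)" by (rule T.lax_comp[OF J K])
  have pre: "bundle_pre V Y (bundle_pre W Y b K) J = bundle_pre V Y b (tng_comp V X K J)" if "b \<in> Ob (DBpt U X Y)" for b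
    by (rule bundle_pre_comp[OF J K A.YZ.tangent_pair_axioms]) (use that in \<open>simp add: A.YZ.DBpt_Ob_iff\<close>)
  show ?thesis
  proof (rule C.D12.strict_eqI[OF C.strict_DBpt_pre[OF KJ] DT.strict_comp[OF A.strict_DBpt_pre[OF K] B.strict_DBpt_pre[OF J]]])
    fix b assume b: "b \<in> Ob (DBpt U X Y)"
    have "bundle_pre W Y b K \<in> Ob (DBpt U W Y)" by (rule A.bundle_pre_Ob[OF b K])
    then show "fobj (DBpt_pre U V X Y (tng_comp V X K J)) b =
      fobj (tng_comp (DBpt U X Y) (DBpt U V Y) (DBpt_pre U V W Y J) (DBpt_pre U W X Y K)) b"
      using b pre[OF b] by (simp add: DBpt_pre_def)
  next
    fix \<phi> assume f: "\<phi> \<in> Arr (DBpt U X Y)"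
    note F = f[unfolded A.YZ.DBpt_Arr_iff]
    have t: "tangent_nat_trans X Y (mbase \<phi>)" "tangent_nat_trans X Y (mtot \<phi>)"
      and o: "msrc \<phi> \<in> Ob (DBpt U X Y)" "mtgt \<phi> \<in> Ob (DBpt U X Y)"
      using F by blast+
    have "farr (DBpt_pre U W X Y K) \<phi> \<in> Arr (DBpt U W Y)"
      using A.D12.lax_typing(2)[OF strict_lax[OF A.strict_DBpt_pre[OF K]] f] .
    then show "farr (DBpt_pre U V X Y (tng_comp V X K J)) \<phi> =
      farr (tng_comp (DBpt U X Y) (DBpt U V Y) (DBpt_pre U V W Y J) (DBpt_pre U W X Y K)) \<phi>"
      using f pre[OF o(1)] pre[OF o(2)]
      by (simp add: DBpt_pre_def whisker_right_comp[OF J K t(1)] whisker_right_comp[OF J K t(2)])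
  qed
qed

text \<open>Both sides are whiskerings of the ends of the projection of \<open>b\<close>; they agree by naturality of \<open>\<kappa>\<close>
  along the components of \<open>\<iota>\<close>.\<close>

lemma DBpt_pre2_hcomp:
  fixes V :: "('o3, 'a3) tcat" and W :: "('o1, 'a1) tcat" and X :: "('o2, 'a2) tcat" and Y :: "('o, 'a) tcat"
    and U :: "('ou \<times> 'au) itself"
  assumes "tangent_category V" "tangent_category W" "tangent_category X" "tangent_category Y" "tangent_category (DB Y)"
    and k: "tangent_nat_trans W X \<kappa>" and i: "tangent_nat_trans V W \<iota>"
  shows "DBpt_pre2 U V X Y (nt_hcomp V X \<kappa> \<iota>) =
    nt_hcomp (DBpt U X Y) (DBpt U V Y) (DBpt_pre2 U V W Y \<iota>) (DBpt_pre2 U W X Y \<kappa>)"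
proof -
  interpret A: db_change W X Y U using assms by unfold_locales
  interpret B: db_change V W Y U using assms by unfold_locales
  interpret C: db_change V X Y U using assms by unfold_locales
  interpret T: tangent_triple V W X by unfold_locales
  have l [simp]: "lax_tangent_morphism W X (nsrc \<kappa>)" "lax_tangent_morphism W X (ntgt \<kappa>)"
    "lax_tangent_morphism V W (nsrc \<iota>)" "lax_tangent_morphism V W (ntgt \<iota>)"
    using tnt_lax[OF k] tnt_lax[OF i] by auto
  have src: "nsrc (nt_hcomp V X \<kappa> \<iota>) = tng_comp V X (nsrc \<kappa>) (nsrc \<iota>)" "ntgt (nt_hcomp V X \<kappa> \<iota>) = tng_comp V X (ntgt \<kappa>) (ntgt \<iota>)"
    by (simp_all add: nt_hcomp_def nt_comp_def)
  note comp = DBpt_pre_comp[OF assms(1-5)]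
  show ?thesis
  proof (rule nt_ext[where S = "Ob (DBpt U X Y)"])
    show "nsrc (DBpt_pre2 U V X Y (nt_hcomp V X \<kappa> \<iota>)) =
      nsrc (nt_hcomp (DBpt U X Y) (DBpt U V Y) (DBpt_pre2 U V W Y \<iota>) (DBpt_pre2 U W X Y \<kappa>))"
      "ntgt (DBpt_pre2 U V X Y (nt_hcomp V X \<kappa> \<iota>)) =
      ntgt (nt_hcomp (DBpt U X Y) (DBpt U V Y) (DBpt_pre2 U V W Y \<iota>) (DBpt_pre2 U W X Y \<kappa>))"
      by (simp_all add: DBpt_pre2_def src comp, simp_all add: nt_hcomp_def nt_comp_def)
    show "ncmp (DBpt_pre2 U V X Y (nt_hcomp V X \<kappa> \<iota>)) \<in> extensional (Ob (DBpt U X Y))"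
      "ncmp (nt_hcomp (DBpt U X Y) (DBpt U V Y) (DBpt_pre2 U V W Y \<iota>) (DBpt_pre2 U W X Y \<kappa>)) \<in> extensional (Ob (DBpt U X Y))"
      by (simp_all add: DBpt_pre2_def nt_hcomp_def nt_comp_def)
    fix b assume b: "b \<in> Ob (DBpt U X Y)"
    have t: "A.YZ.bundle_typed b" using b unfolding A.YZ.DBpt_Ob_iff by blast
    note bt = A.YZ.bundle_typedD[OF t]
    let ?kb = "ncmp (DBpt_pre2 U W X Y \<kappa>) b"
    have kb: "?kb = \<lparr>msrc = bundle_pre W Y b (nsrc \<kappa>), mtgt = bundle_pre W Y b (ntgt \<kappa>),
         mbase = nt_whisker_left W Y (ntgt (bq b)) \<kappa>, mtot = nt_whisker_left W Y (nsrc (bq b)) \<kappa>\<rparr>"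
      using b by (simp add: DBpt_pre2_def)
    have o: "bundle_pre W Y b (nsrc \<kappa>) \<in> Ob (DBpt U W Y)" "bundle_pre W Y b (ntgt \<kappa>) \<in> Ob (DBpt U W Y)"
      by (rule A.bundle_pre_Ob[OF b]; simp)+
    have "tangent_nat_trans (DBpt U X Y) (DBpt U W Y) (DBpt_pre2 U W X Y \<kappa>)"
      using A.functorial_DBpt_pre k unfolding functorial_def by simp
    from A.D12.tnt_typing(3)[OF this b] have ka: "?kb \<in> Arr (DBpt U W Y)" .
    have pre: "bundle_pre V Y (bundle_pre W Y b K) J = bundle_pre V Y b (tng_comp V X K J)"
      if "lax_tangent_morphism W X K" "lax_tangent_morphism V W J" for K J
      by (rule bundle_pre_comp[OF that(2,1) A.YZ.tangent_pair_axioms t])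
    have h: "nt_whisker_left V Y F (nt_hcomp V X \<kappa> \<iota>) =
      nt_whisker_left V Y (tng_comp W Y F (ntgt \<kappa>)) \<iota> \<bullet>\<^bsub>Hom V Y\<^esub> nt_whisker_right V Y (nt_whisker_left W Y F \<kappa>) (nsrc \<iota>)"
      if F: "lax_tangent_morphism X Y F" for F
    proof (rule nt_ext[where S = "Ob V"])
      fix A assume A: "A \<in> Ob V"
      have "ncmp \<kappa> (fobj (ntgt \<iota>) A) \<bullet>\<^bsub>X\<^esub> farr (nsrc \<kappa>) (ncmp \<iota> A) = farr (ntgt \<kappa>) (ncmp \<iota> A) \<bullet>\<^bsub>X\<^esub> ncmp \<kappa> (fobj (nsrc \<iota>) A)"
        using A.XY.tnt_nat[OF k, of "ncmp \<iota> A" "fobj (ntgt \<iota>) A"] A i by simp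
      then show "ncmp (nt_whisker_left V Y F (nt_hcomp V X \<kappa> \<iota>)) A =
        ncmp (nt_whisker_left V Y (tng_comp W Y F (ntgt \<kappa>)) \<iota> \<bullet>\<^bsub>Hom V Y\<^esub> nt_whisker_right V Y (nt_whisker_left W Y F \<kappa>) (nsrc \<iota>)) A"
        using A F k i A.XY.tnt_typing(3-5)[OF k] by (simp add: nt_hcomp_def nt_comp_def)
    qed (use F l in \<open>simp_all add: src tng_comp_assoc[OF l(3) l(1) F] tng_comp_assoc[OF l(4) l(2) F]\<close>)
    show "ncmp (DBpt_pre2 U V X Y (nt_hcomp V X \<kappa> \<iota>)) b =
      ncmp (nt_hcomp (DBpt U X Y) (DBpt U V Y) (DBpt_pre2 U V W Y \<iota>) (DBpt_pre2 U W X Y \<kappa>)) b"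
    proof (rule linmor_eqI)
      have R: "ncmp (nt_hcomp (DBpt U X Y) (DBpt U V Y) (DBpt_pre2 U V W Y \<iota>) (DBpt_pre2 U W X Y \<kappa>)) b =
        ncmp (DBpt_pre2 U V W Y \<iota>) (bundle_pre W Y b (ntgt \<kappa>)) \<bullet>\<^bsub>DB (Hom V Y)\<^esub> farr (DBpt_pre U V W Y (nsrc \<iota>)) ?kb"
        using b by (simp add: nt_hcomp_def nt_comp_def) (simp add: DBpt_pre2_def DBpt_pre_def)
      have L: "ncmp (DBpt_pre2 U V X Y (nt_hcomp V X \<kappa> \<iota>)) b = \<lparr>msrc = bundle_pre V Y b (tng_comp V X (nsrc \<kappa>) (nsrc \<iota>)),
        mtgt = bundle_pre V Y b (tng_comp V X (ntgt \<kappa>) (ntgt \<iota>)),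
        mbase = nt_whisker_left V Y (ntgt (bq b)) (nt_hcomp V X \<kappa> \<iota>), mtot = nt_whisker_left V Y (nsrc (bq b)) (nt_hcomp V X \<kappa> \<iota>)\<rparr>"
        using b by (simp add: DBpt_pre2_def src)
      have R1: "ncmp (DBpt_pre2 U V W Y \<iota>) (bundle_pre W Y b (ntgt \<kappa>)) =
        \<lparr>msrc = bundle_pre V Y (bundle_pre W Y b (ntgt \<kappa>)) (nsrc \<iota>), mtgt = bundle_pre V Y (bundle_pre W Y b (ntgt \<kappa>)) (ntgt \<iota>),
         mbase = nt_whisker_left V Y (tng_comp W Y (ntgt (bq b)) (ntgt \<kappa>)) \<iota>,
         mtot = nt_whisker_left V Y (tng_comp W Y (nsrc (bq b)) (ntgt \<kappa>)) \<iota>\<rparr>"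
        using o(2) by (simp add: DBpt_pre2_def)
      have R2: "farr (DBpt_pre U V W Y (nsrc \<iota>)) ?kb =
        \<lparr>msrc = bundle_pre V Y (msrc ?kb) (nsrc \<iota>), mtgt = bundle_pre V Y (mtgt ?kb) (nsrc \<iota>),
         mbase = nt_whisker_right V Y (mbase ?kb) (nsrc \<iota>), mtot = nt_whisker_right V Y (mtot ?kb) (nsrc \<iota>)\<rparr>"
        using ka by (simp add: DBpt_pre_def)
      show "msrc (ncmp (DBpt_pre2 U V X Y (nt_hcomp V X \<kappa> \<iota>)) b) =
         msrc (ncmp (nt_hcomp (DBpt U X Y) (DBpt U V Y) (DBpt_pre2 U V W Y \<iota>) (DBpt_pre2 U W X Y \<kappa>)) b)"
        "mtgt (ncmp (DBpt_pre2 U V X Y (nt_hcomp V X \<kappa> \<iota>)) b) =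
         mtgt (ncmp (nt_hcomp (DBpt U X Y) (DBpt U V Y) (DBpt_pre2 U V W Y \<iota>) (DBpt_pre2 U W X Y \<kappa>)) b)"
        unfolding L R R1 R2 by (simp_all add: kb pre)
      show "mbase (ncmp (DBpt_pre2 U V X Y (nt_hcomp V X \<kappa> \<iota>)) b) =
         mbase (ncmp (nt_hcomp (DBpt U X Y) (DBpt U V Y) (DBpt_pre2 U V W Y \<iota>) (DBpt_pre2 U W X Y \<kappa>)) b)"
        "mtot (ncmp (DBpt_pre2 U V X Y (nt_hcomp V X \<kappa> \<iota>)) b) =
         mtot (ncmp (nt_hcomp (DBpt U X Y) (DBpt U V Y) (DBpt_pre2 U V W Y \<iota>) (DBpt_pre2 U W X Y \<kappa>)) b)"
        unfolding L R R1 R2 by (simp_all add: kb h[OF bt(16)] h[OF bt(17)])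
    qed
  qed
qed

theorem theorem4p11:
  fixes X :: "('o, 'a) tcat"
    and X1 :: "('o1, 'a1) tcat" and X2 :: "('o2, 'a2) tcat" and X3 :: "('o3, 'a3) tcat"
    and U :: "('ou \<times> 'au) itself"
  assumes "tangent_category X" and "tangent_category (DB X)"
    and "tangent_category X1" and "tangent_category X2" and "tangent_category X3"
  shows
    "strict_tangent_morphism (DB X) X (Base X) \<and> strict_tangent_morphism (DB X) X (Tot X) \<and>
     univ_bundle X \<in> Ob (DBpt U (DB X) X) \<and>
     \<comment> \<open>the contravariant functor\<close>
     tangent_category (DBpt U X1 X) \<and>
     (\<forall>K\<in>Ob (Hom X2 X1).
        strict_tangent_morphism (DBpt U X1 X) (DBpt U X2 X) (DBpt_pre U X2 X1 X K)) \<and>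
     functorial (Hom X2 X1) (Hom (DBpt U X1 X) (DBpt U X2 X))
       (DBpt_pre U X2 X1 X) (DBpt_pre2 U X2 X1 X) \<and>
     DBpt_pre U X1 X1 X (tng_ident X1) = tng_ident (DBpt U X1 X) \<and>
     (\<forall>K\<in>Ob (Hom X2 X1). \<forall>J\<in>Ob (Hom X3 X2).
        DBpt_pre U X3 X1 X (tng_comp X3 X1 K J) =
        tng_comp (DBpt U X1 X) (DBpt U X3 X) (DBpt_pre U X3 X2 X J) (DBpt_pre U X2 X1 X K)) \<and>
     (\<forall>\<kappa>\<in>Arr (Hom X2 X1). \<forall>\<iota>\<in>Arr (Hom X3 X2).
        DBpt_pre2 U X3 X1 X (nt_hcomp X3 X1 \<kappa> \<iota>) =
        nt_hcomp (DBpt U X1 X) (DBpt U X3 X) (DBpt_pre2 U X3 X2 X \<iota>) (DBpt_pre2 U X2 X1 X \<kappa>)) \<and>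
     \<comment> \<open>the induced morphisms are strict, invertible and natural in \<open>X1\<close>\<close>
     strict_tangent_morphism (Hom X1 (DB X)) (DBpt U X1 X) (GamQ U X1 X) \<and>
     tng_invertible (Hom X1 (DB X)) (DBpt U X1 X) (GamQ U X1 X) \<and>
     (\<forall>K\<in>Ob (Hom X2 X1).
        tng_comp (Hom X1 (DB X)) (DBpt U X2 X) (GamQ U X2 X) (hom_pre X2 X1 (DB X) K) =
        tng_comp (Hom X1 (DB X)) (DBpt U X2 X) (DBpt_pre U X2 X1 X K) (GamQ U X1 X)) \<and>
     (\<forall>\<kappa>\<in>Arr (Hom X2 X1).
        nt_whisker_left (Hom X1 (DB X)) (DBpt U X2 X) (GamQ U X2 X) (hom_pre2 X2 X1 (DB X) \<kappa>) =
        nt_whisker_right (Hom X1 (DB X)) (DBpt U X2 X) (DBpt_pre2 U X2 X1 X \<kappa>) (GamQ U X1 X))"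
proof -
  interpret db_change X2 X1 X U using assms by unfold_locales
  interpret T: tangent_pair X3 X2 using assms by unfold_locales
  show ?thesis
  proof (intro conjI ballI)
    show "strict_tangent_morphism (DB X) X (Base X)" "strict_tangent_morphism (DB X) X (Tot X)"
      by (rule B.strict_Base B.strict_Tot)+
    show "univ_bundle X \<in> Ob (DBpt U (DB X) X)" by (rule B.univ_bundle_Ob)
    show "tangent_category (DBpt U X1 X)" by (rule I1.tangent_category_D)
    show "functorial (Hom X2 X1) (Hom (DBpt U X1 X) (DBpt U X2 X)) (DBpt_pre U X2 X1 X) (DBpt_pre2 U X2 X1 X)"
      by (rule functorial_DBpt_pre)
    show "DBpt_pre U X1 X1 X (tng_ident X1) = tng_ident (DBpt U X1 X)"
      by (rule DBpt_pre_ident[OF assms(3,1,2)])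
    show "strict_tangent_morphism (Hom X1 (DB X)) (DBpt U X1 X) (GamQ U X1 X)"
      "tng_invertible (Hom X1 (DB X)) (DBpt U X1 X) (GamQ U X1 X)"
      unfolding P1.GamQ_iso by (rule I1.strict_iso_lmor I1.tng_invertible_iso)+
  next
    fix K assume "K \<in> Ob (Hom X2 X1)"
    then have K: "lax_tangent_morphism X2 X1 K" by simp
    show "strict_tangent_morphism (DBpt U X1 X) (DBpt U X2 X) (DBpt_pre U X2 X1 X K)"
      by (rule strict_DBpt_pre[OF K])
    show "tng_comp (Hom X1 (DB X)) (DBpt U X2 X) (GamQ U X2 X) (hom_pre X2 X1 (DB X) K) =
        tng_comp (Hom X1 (DB X)) (DBpt U X2 X) (DBpt_pre U X2 X1 X K) (GamQ U X1 X)"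
      by (rule Gam_natural[OF K])
    fix J assume "J \<in> Ob (Hom X3 X2)"
    then show "DBpt_pre U X3 X1 X (tng_comp X3 X1 K J) =
        tng_comp (DBpt U X1 X) (DBpt U X3 X) (DBpt_pre U X3 X2 X J) (DBpt_pre U X2 X1 X K)"
      by (intro DBpt_pre_comp[OF assms(5,4,3,1,2) K]) simp
  next
    fix \<kappa> assume "\<kappa> \<in> Arr (Hom X2 X1)"
    then have k: "tangent_nat_trans X2 X1 \<kappa>" by simp
    show "nt_whisker_left (Hom X1 (DB X)) (DBpt U X2 X) (GamQ U X2 X) (hom_pre2 X2 X1 (DB X) \<kappa>) =
        nt_whisker_right (Hom X1 (DB X)) (DBpt U X2 X) (DBpt_pre2 U X2 X1 X \<kappa>) (GamQ U X1 X)"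
      by (rule Gam_natural2[OF k])
    fix \<iota> assume "\<iota> \<in> Arr (Hom X3 X2)"
    then show "DBpt_pre2 U X3 X1 X (nt_hcomp X3 X1 \<kappa> \<iota>) =
        nt_hcomp (DBpt U X1 X) (DBpt U X3 X) (DBpt_pre2 U X3 X2 X \<iota>) (DBpt_pre2 U X2 X1 X \<kappa>)"
      by (intro DBpt_pre2_hcomp[OF assms(5,4,3,1,2) k]) simp
  qed
qed

end
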